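(* Let $(V_a)$ be a definable family of differential varieties and let $p$ be a numerical polynomial. Then the sets $$\{a : \omega_{V_a}\geq p\}\qquad\text{and}\qquad \{a : \omega_{V_a}=p\}$$ are definable in the structure $(K,\Delta)$. Here $\geq$ is the ordering of numerical polynomials by eventual domination.
   Context: Setting: $(K,\Delta)$ is a differentially closed field of characteristic zero with commuting derivations $\Delta=\{\delta_1,\dots,\delta_m\}$, assumed to be a saturated (universal) model of the theory $\mathrm{DCF}_{0,m}$; $k$ is a (small) differential subfield of $K$, so that $K$ is universal over $k$. Definability is in the language of differential rings. For $\xi=(u_1,\dots,u_m)\in\mathbb N^m$, $\operatorname{ord}\xi=u_1+\cdots+u_m$ and $\delta^\xi=\delta_1^{u_1}\cdots\delta_m^{u_m}$. A numerical polynomial is $p\in\mathbb Q[t]$ with $p(s)\in\mathbb Z$ for all integers $s$. For numerical polynomials, $p\le q$ (eventual domination) means $p(s)\le q(s)$ for all sufficiently large $s\in\mathbb N$; this is a total order. Kolchin polynomial: for a small differential subfield $L$ of $K$ and a tuple $b=(b_1,\dots,b_n)$ from $K$, $\omega_{b/L}$ is the numerical polynomial (it exists by a theorem of Kolchin) with $\omega_{b/L}(s)=\operatorname{trdeg}_L L(\delta^\xi b_i:\operatorname{ord}\xi\le s,\ 1\le i\le n)$ for all sufficiently large $s\in\mathbb N$. A differential variety $V\subseteq K^n$ over $L$ is the zero set in $K^n$ of a collection of differential polynomials over $L$ in $n$ differential indeterminates. If $V$ is an irreducible differential variety over $L$, then $\omega_V:=\omega_{b/L}$, where $b$ is a generic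 point of the prime differential ideal of differential polynomials over $L$ vanishing on $V$ (that is, the differential polynomials over $L$ vanishing at $b$ are exactly those in this ideal). For an arbitrary differential variety $V$ over $L$, $\omega_V:=\max\{\omega_W: W \text{ is an irreducible component of } V\}$, the maximum with respect to eventual domination. Definable family: given a collection $F(x,y)$ of differential polynomials over $k$ in tuples of differential indeterminates $x=(x_1,\dots,x_n)$ and $y$, for each $a\in K^{|y|}$ the system $F(x,a)=0$ defines a differential variety $V_a\subseteq K^n$ over $k\langle a\rangle$, the differential field generated by $a$ over $k$; such a collection $(V_a)$ is called a definable family of differential varieties. *)

theory Defs
  imports
    "HOL-Library.Poly_Mapping"
    "HOL-Library.Equipollence"
    "HOL-Algebra.Algebraic_Closure_Type"
    "HOL-Computational_Algebra.Polynomial"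
begin

text \<open>
  The differential field \<open>K\<close> is a whole type \<open>'a\<close> of class \<open>field_char_0\<close>, with
  \<open>m\<close> derivations \<open>\<delta> 0, \<dots>, \<delta> (m - 1)\<close>; the values \<open>\<delta> j\<close> for \<open>j \<ge> m\<close> are never used.
  A point of \<open>K\<^sup>n\<close> is a list of length \<open>n\<close>, a multi-index \<open>\<xi> \<in> \<nat>\<^sup>m\<close> is a list of
  length \<open>m\<close>, and \<open>ord \<xi>\<close> is \<open>sum_list \<xi>\<close>.
\<close>

section \<open>Differential fields\<close>

definition differential_field :: "nat \<Rightarrow> (nat \<Rightarrow> 'a::field_char_0 \<Rightarrow> 'a) \<Rightarrow> bool" where
  "differential_field m \<delta> \<longleftrightarrow>
     (\<forall>j<m. \<forall>x y. \<delta> j (x + y) = \<delta> j x + \<delta> j y) \<and>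
     (\<forall>j<m. \<forall>x y. \<delta> j (x * y) = \<delta> j x * y + x * \<delta> j y) \<and>
     (\<forall>i<m. \<forall>j<m. \<forall>x. \<delta> i (\<delta> j x) = \<delta> j (\<delta> i x))"

definition is_subfield :: "'a::field_char_0 set \<Rightarrow> bool" where
  "is_subfield L \<longleftrightarrow>
     0 \<in> L \<and> 1 \<in> L \<and> (\<forall>x\<in>L. \<forall>y\<in>L. x + y \<in> L \<and> x * y \<in> L) \<and>
     (\<forall>x\<in>L. - x \<in> L \<and> inverse x \<in> L)"

definition is_diff_subfield :: "nat \<Rightarrow> (nat \<Rightarrow> 'a::field_char_0 \<Rightarrow> 'a) \<Rightarrow> 'a set \<Rightarrow> bool" where
  "is_diff_subfield m \<delta> L \<longleftrightarrow> is_subfield L \<and> (\<forall>j<m. \<forall>x\<in>L. \<delta> j x \<in> L)"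

definition gen_field :: "'a::field_char_0 set \<Rightarrow> 'a set \<Rightarrow> 'a set" where
  "gen_field L S = is_subfield hull (L \<union> S)"

definition gen_diff_field ::
    "nat \<Rightarrow> (nat \<Rightarrow> 'a::field_char_0 \<Rightarrow> 'a) \<Rightarrow> 'a set \<Rightarrow> 'a set \<Rightarrow> 'a set" where
  "gen_diff_field m \<delta> L S = is_diff_subfield m \<delta> hull (L \<union> S)"

definition dpow :: "(nat \<Rightarrow> 'a \<Rightarrow> 'a) \<Rightarrow> nat list \<Rightarrow> 'a \<Rightarrow> 'a" where
  "dpow \<delta> \<xi> x = foldr (\<lambda>j. \<delta> j ^^ (\<xi> ! j)) [0..<length \<xi>] x"

section \<open>Polynomials and differential polynomials\<close>

type_synonym ('v, 'a) mpoly = "('v \<Rightarrow>\<^sub>0 nat) \<Rightarrow>\<^sub>0 'a"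

definition mpolys_over :: "'a::zero set \<Rightarrow> 'v set \<Rightarrow> ('v, 'a) mpoly set" where
  "mpolys_over L Y =
     {f. (\<forall>u. Poly_Mapping.lookup f u \<in> L) \<and> (\<forall>u\<in>Poly_Mapping.keys f. Poly_Mapping.keys u \<subseteq> Y)}"

definition mpoly_eval :: "('v \<Rightarrow> 'a::comm_semiring_1) \<Rightarrow> ('v, 'a) mpoly \<Rightarrow> 'a" where
  "mpoly_eval c f =
     (\<Sum>u\<in>Poly_Mapping.keys f. Poly_Mapping.lookup f u *
        (\<Prod>v\<in>Poly_Mapping.keys u. c v ^ Poly_Mapping.lookup u v))"

text \<open>The variable \<open>(i, \<xi>)\<close> stands for \<open>\<delta>\<^sup>\<xi> x\<^sub>i\<close>, where \<open>x\<^sub>0, \<dots>, x\<^bsub>n-1\<^esub>\<close> are the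
  differential indeterminates.\<close>

type_synonym 'a dpoly = "(nat \<times> nat list, 'a) mpoly"

definition dpolys :: "nat \<Rightarrow> 'a::zero set \<Rightarrow> nat \<Rightarrow> 'a dpoly set" where
  "dpolys m L n = mpolys_over L ({..<n} \<times> {\<xi>. length \<xi> = m})"

definition dpoly_eval :: "(nat \<Rightarrow> 'a::comm_semiring_1 \<Rightarrow> 'a) \<Rightarrow> 'a dpoly \<Rightarrow> 'a list \<Rightarrow> 'a" where
  "dpoly_eval \<delta> f b = mpoly_eval (\<lambda>(i, \<xi>). dpow \<delta> \<xi> (b ! i)) f"

section \<open>Differentially closed fields\<close>

definition differential_extension ::
    "nat \<Rightarrow> (nat \<Rightarrow> 'a::field_char_0 \<Rightarrow> 'a) \<Rightarrow> 'b ring \<Rightarrow> (nat \<Rightarrow> 'b \<Rightarrow> 'b) \<Rightarrow> ('a \<Rightarrow> 'b) \<Rightarrow> bool" where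
  "differential_extension m \<delta> E \<epsilon> h \<longleftrightarrow>
     field E \<and>
     (\<forall>j<m. \<forall>x\<in>carrier E. \<epsilon> j x \<in> carrier E) \<and>
     (\<forall>j<m. \<forall>x\<in>carrier E. \<forall>y\<in>carrier E. \<epsilon> j (x \<oplus>\<^bsub>E\<^esub> y) = \<epsilon> j x \<oplus>\<^bsub>E\<^esub> \<epsilon> j y) \<and>
     (\<forall>j<m. \<forall>x\<in>carrier E. \<forall>y\<in>carrier E.
        \<epsilon> j (x \<otimes>\<^bsub>E\<^esub> y) = \<epsilon> j x \<otimes>\<^bsub>E\<^esub> y \<oplus>\<^bsub>E\<^esub> x \<otimes>\<^bsub>E\<^esub> \<epsilon> j y) \<and>
     (\<forall>i<m. \<forall>j<m. \<forall>x\<in>carrier E. \<epsilon> i (\<epsilon> j x) = \<epsilon> j (\<epsilon> i x)) \<and>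
     h \<in> ring_hom ring_of_type_algebra E \<and>
     (\<forall>j<m. \<forall>x. h (\<delta> j x) = \<epsilon> j (h x))"

definition dpoly_eval_ext ::
    "'b ring \<Rightarrow> (nat \<Rightarrow> 'b \<Rightarrow> 'b) \<Rightarrow> ('a::zero \<Rightarrow> 'b) \<Rightarrow> 'a dpoly \<Rightarrow> 'b list \<Rightarrow> 'b" where
  "dpoly_eval_ext E \<epsilon> h f c =
     (\<Oplus>\<^bsub>E\<^esub>u\<in>Poly_Mapping.keys f. h (Poly_Mapping.lookup f u) \<otimes>\<^bsub>E\<^esub>
        (\<Otimes>\<^bsub>E\<^esub>v\<in>Poly_Mapping.keys u.
           dpow \<epsilon> (snd v) (c ! fst v) [^]\<^bsub>E\<^esub> Poly_Mapping.lookup u v))"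

text \<open>
  Every finite system of differential polynomial equations and inequations over \<open>K\<close> that has a
  solution in some differential field extension of \<open>K\<close> has a solution in \<open>K\<close>.  A solution \<open>c\<close>
  already lies in the subextension \<open>K\<langle>c\<rangle>\<close>, which has the same cardinality as the infinite
  field \<open>K\<close>; hence quantifying over extensions whose carrier lies in the type \<open>'a\<close> is no
  restriction.
\<close>

definition differentially_closed :: "nat \<Rightarrow> (nat \<Rightarrow> 'a::field_char_0 \<Rightarrow> 'a) \<Rightarrow> bool" where
  "differentially_closed m \<delta> \<longleftrightarrow>
     differential_field m \<delta> \<and>
     (\<forall>(E :: 'a ring) \<epsilon> h n S T c.
        differential_extension m \<delta> E \<epsilon> h \<longrightarrow>
        finite S \<longrightarrow> S \<subseteq> dpolys m UNIV n \<longrightarrow> finite T \<longrightarrow> T \<subseteq> dpolys m UNIV n \<longrightarrow>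
        length c = n \<longrightarrow> set c \<subseteq> carrier E \<longrightarrow>
        (\<forall>f\<in>S. dpoly_eval_ext E \<epsilon> h f c = \<zero>\<^bsub>E\<^esub>) \<longrightarrow>
        (\<forall>g\<in>T. dpoly_eval_ext E \<epsilon> h g c \<noteq> \<zero>\<^bsub>E\<^esub>) \<longrightarrow>
        (\<exists>b. length b = n \<and> (\<forall>f\<in>S. dpoly_eval \<delta> f b = 0) \<and> (\<forall>g\<in>T. dpoly_eval \<delta> g b \<noteq> 0)))"

section \<open>First-order formulas in the language of differential rings\<close>

text \<open>Elements of \<open>'a\<close> serve as names for parameters, elements of \<open>'d\<close> as derivation symbols.\<close>

datatype (tm_params: 'a, tm_ders: 'd) dterm =
    TVar nat
  | TParam 'a
  | TZero
  | TOne
  | TAdd "('a, 'd) dterm" "('a, 'd) dterm"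
  | TUminus "('a, 'd) dterm"
  | TMult "('a, 'd) dterm" "('a, 'd) dterm"
  | TDer 'd "('a, 'd) dterm"

datatype (fm_params: 'a, fm_ders: 'd) dform =
    FEq "('a, 'd) dterm" "('a, 'd) dterm"
  | FNot "('a, 'd) dform"
  | FAnd "('a, 'd) dform" "('a, 'd) dform"
  | FEx nat "('a, 'd) dform"

primrec tm_vars :: "('a, 'd) dterm \<Rightarrow> nat set" where
  "tm_vars (TVar i) = {i}"
| "tm_vars (TParam c) = {}"
| "tm_vars TZero = {}"
| "tm_vars TOne = {}"
| "tm_vars (TAdd s t) = tm_vars s \<union> tm_vars t"
| "tm_vars (TUminus t) = tm_vars t"
| "tm_vars (TMult s t) = tm_vars s \<union> tm_vars t"
| "tm_vars (TDer j t) = tm_vars t"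

primrec fm_free :: "('a, 'd) dform \<Rightarrow> nat set" where
  "fm_free (FEq s t) = tm_vars s \<union> tm_vars t"
| "fm_free (FNot \<phi>) = fm_free \<phi>"
| "fm_free (FAnd \<phi> \<psi>) = fm_free \<phi> \<union> fm_free \<psi>"
| "fm_free (FEx i \<phi>) = fm_free \<phi> - {i}"

primrec tm_val :: "('d \<Rightarrow> 'a \<Rightarrow> 'a) \<Rightarrow> (nat \<Rightarrow> 'a) \<Rightarrow> ('a::comm_ring_1, 'd) dterm \<Rightarrow> 'a" where
  "tm_val \<delta> e (TVar i) = e i"
| "tm_val \<delta> e (TParam c) = c"
| "tm_val \<delta> e TZero = 0"
| "tm_val \<delta> e TOne = 1"
| "tm_val \<delta> e (TAdd s t) = tm_val \<delta> e s + tm_val \<delta> e t"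
| "tm_val \<delta> e (TUminus t) = - tm_val \<delta> e t"
| "tm_val \<delta> e (TMult s t) = tm_val \<delta> e s * tm_val \<delta> e t"
| "tm_val \<delta> e (TDer j t) = \<delta> j (tm_val \<delta> e t)"

primrec sat :: "('d \<Rightarrow> 'a \<Rightarrow> 'a) \<Rightarrow> (nat \<Rightarrow> 'a) \<Rightarrow> ('a::comm_ring_1, 'd) dform \<Rightarrow> bool" where
  "sat \<delta> e (FEq s t) \<longleftrightarrow> tm_val \<delta> e s = tm_val \<delta> e t"
| "sat \<delta> e (FNot \<phi>) \<longleftrightarrow> \<not> sat \<delta> e \<phi>"
| "sat \<delta> e (FAnd \<phi> \<psi>) \<longleftrightarrow> sat \<delta> e \<phi> \<and> sat \<delta> e \<psi>"
| "sat \<delta> e (FEx i \<phi>) \<longleftrightarrow> (\<exists>x. sat \<delta> (e(i := x)) \<phi>)"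

text \<open>Formulas with \<open>m\<close> derivation symbols, parameters from \<open>A\<close> and free variables among the
  first \<open>n\<close>.\<close>

definition formulas :: "nat \<Rightarrow> 'a set \<Rightarrow> nat \<Rightarrow> ('a, nat) dform set" where
  "formulas m A n = {\<phi>. fm_ders \<phi> \<subseteq> {..<m} \<and> fm_params \<phi> \<subseteq> A \<and> fm_free \<phi> \<subseteq> {..<n}}"

text \<open>As usual, a definable set may be defined with arbitrary parameters from the structure.\<close>

definition definable ::
    "nat \<Rightarrow> (nat \<Rightarrow> 'a::field_char_0 \<Rightarrow> 'a) \<Rightarrow> nat \<Rightarrow> 'a list set \<Rightarrow> bool" where
  "definable m \<delta> r Y \<longleftrightarrow>
     (\<exists>\<phi>\<in>formulas m UNIV r. Y = {a. length a = r \<and> sat \<delta> (\<lambda>i. a ! i) \<phi>})"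

text \<open>Saturation in the cardinality of the model.\<close>

definition saturated :: "nat \<Rightarrow> (nat \<Rightarrow> 'a::field_char_0 \<Rightarrow> 'a) \<Rightarrow> bool" where
  "saturated m \<delta> \<longleftrightarrow>
     (\<forall>A n \<Gamma>. A \<prec> (UNIV :: 'a set) \<longrightarrow> \<Gamma> \<subseteq> formulas m A n \<longrightarrow>
        (\<forall>\<Gamma>\<^sub>0\<subseteq>\<Gamma>. finite \<Gamma>\<^sub>0 \<longrightarrow> (\<exists>b. length b = n \<and> (\<forall>\<phi>\<in>\<Gamma>\<^sub>0. sat \<delta> (\<lambda>i. b ! i) \<phi>))) \<longrightarrow>
        (\<exists>b. length b = n \<and> (\<forall>\<phi>\<in>\<Gamma>. sat \<delta> (\<lambda>i. b ! i) \<phi>)))"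

section \<open>Transcendence degree\<close>

definition alg_independent :: "'a::field_char_0 set \<Rightarrow> 'a set \<Rightarrow> bool" where
  "alg_independent L B \<longleftrightarrow> (\<forall>f\<in>mpolys_over L B. mpoly_eval (\<lambda>x. x) f = 0 \<longrightarrow> f = 0)"

definition algebraic_over :: "'a::field_char_0 set \<Rightarrow> 'a \<Rightarrow> bool" where
  "algebraic_over L x \<longleftrightarrow>
     (\<exists>q :: 'a Polynomial.poly. q \<noteq> 0 \<and> (\<forall>i. Polynomial.coeff q i \<in> L) \<and> Polynomial.poly q x = 0)"

definition transcendence_basis :: "'a::field_char_0 set \<Rightarrow> 'a set \<Rightarrow> 'a set \<Rightarrow> bool" where
  "transcendence_basis L M B \<longleftrightarrow>
     B \<subseteq> M \<and> alg_independent L B \<and> (\<forall>x\<in>M. algebraic_over (gen_field L B) x)"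

text \<open>Meaningful for finite transcendence degree only; it is used below for finitely generated
  field extensions.\<close>

definition trdeg :: "'a::field_char_0 set \<Rightarrow> 'a set \<Rightarrow> nat" where
  "trdeg L M = card (SOME B. transcendence_basis L M B)"

section \<open>Kolchin polynomials\<close>

definition numerical_poly :: "rat Polynomial.poly \<Rightarrow> bool" where
  "numerical_poly p \<longleftrightarrow> (\<forall>s::int. Polynomial.poly p (of_int s) \<in> \<int>)"

definition dominated :: "rat Polynomial.poly \<Rightarrow> rat Polynomial.poly \<Rightarrow> bool" where
  "dominated p q \<longleftrightarrow>
     (\<forall>\<^sub>F s in sequentially. Polynomial.poly p (of_nat s) \<le> Polynomial.poly q (of_nat s))"

definition kolchin_poly ::
    "nat \<Rightarrow> (nat \<Rightarrow> 'a::field_char_0 \<Rightarrow> 'a) \<Rightarrow> 'a set \<Rightarrow> 'a list \<Rightarrow> rat Polynomial.poly" where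
  "kolchin_poly m \<delta> L b =
     (THE q. numerical_poly q \<and>
        (\<forall>\<^sub>F s in sequentially. Polynomial.poly q (of_nat s) =
           of_nat (trdeg L (gen_field L
             {dpow \<delta> \<xi> (b ! i) | \<xi> i. length \<xi> = m \<and> sum_list \<xi> \<le> s \<and> i < length b}))))"

definition diff_variety ::
    "nat \<Rightarrow> (nat \<Rightarrow> 'a::field_char_0 \<Rightarrow> 'a) \<Rightarrow> 'a set \<Rightarrow> nat \<Rightarrow> 'a list set \<Rightarrow> bool" where
  "diff_variety m \<delta> L n V \<longleftrightarrow>
     (\<exists>S \<subseteq> dpolys m L n. V = {b. length b = n \<and> (\<forall>f\<in>S. dpoly_eval \<delta> f b = 0)})"

definition irreducible_variety ::
    "nat \<Rightarrow> (nat \<Rightarrow> 'a::field_char_0 \<Rightarrow> 'a) \<Rightarrow> 'a set \<Rightarrow> nat \<Rightarrow> 'a list set \<Rightarrow> bool" where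
  "irreducible_variety m \<delta> L n V \<longleftrightarrow>
     diff_variety m \<delta> L n V \<and> V \<noteq> {} \<and>
     (\<forall>V1 V2. diff_variety m \<delta> L n V1 \<longrightarrow> diff_variety m \<delta> L n V2 \<longrightarrow> V = V1 \<union> V2 \<longrightarrow>
        V = V1 \<or> V = V2)"

definition irreducible_component ::
    "nat \<Rightarrow> (nat \<Rightarrow> 'a::field_char_0 \<Rightarrow> 'a) \<Rightarrow> 'a set \<Rightarrow> nat \<Rightarrow> 'a list set \<Rightarrow> 'a list set \<Rightarrow> bool" where
  "irreducible_component m \<delta> L n V W \<longleftrightarrow>
     irreducible_variety m \<delta> L n W \<and> W \<subseteq> V \<and>
     (\<forall>W'. irreducible_variety m \<delta> L n W' \<longrightarrow> W \<subseteq> W' \<longrightarrow> W' \<subseteq> V \<longrightarrow> W' = W)"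

definition generic_point ::
    "nat \<Rightarrow> (nat \<Rightarrow> 'a::field_char_0 \<Rightarrow> 'a) \<Rightarrow> 'a set \<Rightarrow> nat \<Rightarrow> 'a list set \<Rightarrow> 'a list \<Rightarrow> bool" where
  "generic_point m \<delta> L n W b \<longleftrightarrow>
     length b = n \<and>
     (\<forall>f\<in>dpolys m L n. dpoly_eval \<delta> f b = 0 \<longleftrightarrow> (\<forall>v\<in>W. dpoly_eval \<delta> f v = 0))"

definition kolchin_poly_irreducible ::
    "nat \<Rightarrow> (nat \<Rightarrow> 'a::field_char_0 \<Rightarrow> 'a) \<Rightarrow> 'a set \<Rightarrow> nat \<Rightarrow> 'a list set \<Rightarrow> rat Polynomial.poly" where
  "kolchin_poly_irreducible m \<delta> L n W = kolchin_poly m \<delta> L (SOME b. generic_point m \<delta> L n W b)"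

text \<open>The maximum over the irreducible components with respect to eventual domination.  It is
  unspecified for \<open>V = {}\<close>, which has no components.\<close>

definition kolchin_poly_variety ::
    "nat \<Rightarrow> (nat \<Rightarrow> 'a::field_char_0 \<Rightarrow> 'a) \<Rightarrow> 'a set \<Rightarrow> nat \<Rightarrow> 'a list set \<Rightarrow> rat Polynomial.poly" where
  "kolchin_poly_variety m \<delta> L n V =
     (THE q. q \<in> kolchin_poly_irreducible m \<delta> L n ` {W. irreducible_component m \<delta> L n V W} \<and>
        (\<forall>q' \<in> kolchin_poly_irreducible m \<delta> L n ` {W. irreducible_component m \<delta> L n V W}.
           dominated q' q))"

section \<open>Definable families\<close>

text \<open>\<open>F\<close> is a set of differential polynomials in \<open>n + length a\<close> indeterminates, of which the
  first \<open>n\<close> are \<open>x\<close> and the others are \<open>y\<close>.\<close>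

definition family_member ::
    "(nat \<Rightarrow> 'a::field_char_0 \<Rightarrow> 'a) \<Rightarrow> nat \<Rightarrow> 'a dpoly set \<Rightarrow> 'a list \<Rightarrow> 'a list set" where
  "family_member \<delta> n F a = {b. length b = n \<and> (\<forall>f\<in>F. dpoly_eval \<delta> f (b @ a) = 0)}"

definition family_kolchin_poly ::
    "nat \<Rightarrow> (nat \<Rightarrow> 'a::field_char_0 \<Rightarrow> 'a) \<Rightarrow> 'a set \<Rightarrow> nat \<Rightarrow> 'a dpoly set \<Rightarrow> 'a list
      \<Rightarrow> rat Polynomial.poly" where
  "family_kolchin_poly m \<delta> k n F a =
     kolchin_poly_variety m \<delta> (gen_diff_field m \<delta> k (set a)) n (family_member \<delta> n F a)"

end

theory Submission
  imports Defs "HOL-Algebra.Weak_Morphisms" "HOL-Library.Countable"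
begin

text \<open>
  Rank the jets \<open>\<delta>\<^sup>\<xi> x\<^sub>i\<close> by order first.  The Kolchin polynomial of \<open>b\<close> over \<open>k\<langle>a\<rangle>\<close> counts the
  jets of \<open>b\<close> that are not leaders, a leader being a jet algebraic over \<open>k\<langle>a\<rangle>\<close> and the lower jets;
  by Dickson's lemma finitely many leaders generate all of them by differentiation.  Hence the
  minimal polynomials of these leaders, together with the non-vanishing of their initials, their
  separants and some auxiliary polynomials, define a chart around \<open>(b, a)\<close> with two properties.
  Every point of the chart is a specialisation of \<open>(b, a)\<close> and has at least the leaders of \<open>(b, a)\<close>.
  Conversely, over every \<open>a'\<close> below the chart, the characteristic set has a generic solution in
  a differential field extension, where the jets that are not leaders are independent, so that by
  differential closedness and saturation the fibre contains a point with exactly the leaders of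
  \<open>(b, a)\<close>.  By saturation finitely many charts cover the space.  Therefore the Kolchin polynomial of \<open>V\<^sub>a\<close> is the maximum of
  the finitely many polynomials attached to those charts inside the family that lie over \<open>a\<close>, and
  the projections of the charts are definable.
\<close>

section \<open>Numerical polynomials and eventual domination\<close>

text \<open>The generic solution over \<open>a'\<close> must keep initials and separants nonzero.
  These involve its own jets, whereas only conditions on \<open>a'\<close> are at hand while it is
  being built. So each of them is traded for a polynomial in the jets of the parameters alone,
  nonzero at \<open>a\<close>; these are the auxiliary polynomials of a chart. Coherence of the
  characteristic set is never computed. Its members are minimal relations of an actual point, so
  different prolongations with the same leader all hold at that point; specialisation carries them
  to the generic solution, and there they make the prescribed derivations shift jets. Transcendence
  degrees are handled through derivations: in characteristic 0, x is algebraic over a field iff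
  every derivation that kills the field kills x, and this closure operator has exchange by linear
  algebra. The same extension theorem for derivations supplies the derivations of the generic
  solution.\<close>

lemma poly_eventually_sign:
  fixes p :: "rat Polynomial.poly"
  assumes "p \<noteq> 0"
  shows "(\<exists>e>0. \<forall>\<^sub>F s in sequentially. e \<le> Polynomial.poly p (of_nat s)) \<or>
         (\<exists>e>0. \<forall>\<^sub>F s in sequentially. Polynomial.poly p (of_nat s) \<le> - e)"
  using assms
proof (induction p)
  case 0
  then show ?case by simp
next
  case (pCons a p)
  show ?case
  proof (cases "p = 0")
    case True
    then have "a \<noteq> 0" using pCons by auto
    then have "a > 0 \<or> - a > 0" by auto
    then show ?thesis
    proof
      assume "a > 0"
      then show ?thesis using True by (intro disjI1 exI[of _ a]) auto
    next
      assume "- a > 0"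
      then show ?thesis using True by (intro disjI2 exI[of _ "-a"]) auto
    qed
  next
    case False
    from pCons.IH[OF this] show ?thesis
    proof
      assume "\<exists>e>0. \<forall>\<^sub>F s in sequentially. e \<le> Polynomial.poly p (of_nat s)"
      then obtain e N where e: "e > 0" and N: "\<And>s. s \<ge> N \<Longrightarrow> e \<le> Polynomial.poly p (of_nat s)"
        unfolding eventually_sequentially by blast
      \<comment> \<open>The value at s is a + s * p(s) \<ge> a + s * e, so the gap e absorbs the
        constant coefficient a once s * e \<ge> 1 - a. A mere sign in the induction hypothesis would
        not give this.\<close>
      obtain M :: nat where M: "of_nat M \<ge> (1 - a) / e"
        using real_arch_simple by blast
      have "1 \<le> Polynomial.poly (pCons a p) (of_nat s)" if "s \<ge> max N M" for s
      proof -
        have "(1 - a) / e \<le> of_nat s" using M that by (meson max.bounded_iff of_nat_le_iff order.trans)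
        then have "1 - a \<le> of_nat s * e" using e by (simp add: field_simps)
        also have "\<dots> \<le> of_nat s * Polynomial.poly p (of_nat s)"
          using N[of s] that by (intro mult_left_mono) auto
        finally show ?thesis by simp
      qed
      then show ?thesis unfolding eventually_sequentially by (intro disjI1 exI[of _ 1] conjI exI[of _ "max N M"]) auto
    next
      assume "\<exists>e>0. \<forall>\<^sub>F s in sequentially. Polynomial.poly p (of_nat s) \<le> - e"
      then obtain e N where e: "e > 0" and N: "\<And>s. s \<ge> N \<Longrightarrow> Polynomial.poly p (of_nat s) \<le> - e"
        unfolding eventually_sequentially by blast
      obtain M :: nat where M: "of_nat M \<ge> (1 + a) / e"
        using real_arch_simple by blast
      have "Polynomial.poly (pCons a p) (of_nat s) \<le> - 1" if "s \<ge> max N M" for s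
      proof -
        have "(1 + a) / e \<le> of_nat s" using M that by (meson max.bounded_iff of_nat_le_iff order.trans)
        then have *: "1 + a \<le> of_nat s * e" using e by (simp add: field_simps)
        have "of_nat s * Polynomial.poly p (of_nat s) \<le> of_nat s * (- e)"
          using N[of s] that by (intro mult_left_mono) auto
        then show ?thesis using * by simp
      qed
      then show ?thesis unfolding eventually_sequentially by (intro disjI2 exI[of _ 1] conjI exI[of _ "max N M"]) auto
    qed
  qed
qed

section \<open>Eventual domination as a total order\<close>

lemma dominated_refl: "dominated p p"
  by (simp add: dominated_def)

lemma dominated_trans: "dominated p q \<Longrightarrow> dominated q u \<Longrightarrow> dominated p u"
  unfolding dominated_def by (erule (1) eventually_elim2) (rule order.trans)

lemma dominated_total: "dominated p q \<or> dominated q p"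
proof (cases "q - p = 0")
  case True
  then show ?thesis by (simp add: dominated_refl)
next
  case False
  from poly_eventually_sign[OF this] show ?thesis
  proof
    assume "\<exists>e>0. \<forall>\<^sub>F s in sequentially. e \<le> Polynomial.poly (q - p) (of_nat s)"
    then show ?thesis by (auto simp: dominated_def intro!: disjI1 elim: eventually_mono)
  next
    assume "\<exists>e>0. \<forall>\<^sub>F s in sequentially. Polynomial.poly (q - p) (of_nat s) \<le> - e"
    then show ?thesis by (auto simp: dominated_def intro!: disjI2 elim: eventually_mono)
  qed
qed

text \<open>A nonzero difference would eventually stay away from 0. This makes
  \<open>count_poly\<close>, and with it every Kolchin polynomial, well defined.\<close>

lemma eventually_equal_polys:
  fixes p q :: "rat Polynomial.poly"
  assumes "\<forall>\<^sub>F s in sequentially. Polynomial.poly p (of_nat s) = Polynomial.poly q (of_nat s)"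
  shows "p = q"
proof (rule ccontr)
  assume "p \<noteq> q"
  then have "p - q \<noteq> 0" by simp
  have "\<forall>\<^sub>F s in sequentially. False" if "e > 0"
    "(\<forall>\<^sub>F s in sequentially. e \<le> Polynomial.poly (p - q) (of_nat s)) \<or>
     (\<forall>\<^sub>F s in sequentially. Polynomial.poly (p - q) (of_nat s) \<le> - e)" for e
    using that(2)
  proof
    assume "\<forall>\<^sub>F s in sequentially. e \<le> Polynomial.poly (p - q) (of_nat s)"
    with assms show ?thesis by eventually_elim (use that in auto)
  next
    assume "\<forall>\<^sub>F s in sequentially. Polynomial.poly (p - q) (of_nat s) \<le> - e"
    with assms show ?thesis by eventually_elim (use that in auto)
  qed
  with poly_eventually_sign[OF \<open>p - q \<noteq> 0\<close>] show False by (auto simp: eventually_False)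
qed

lemma dominated_antisym:
  assumes "dominated p q" "dominated q p" shows "p = q"
proof (rule eventually_equal_polys)
  show "\<forall>\<^sub>F s in sequentially. Polynomial.poly p (of_nat s) = Polynomial.poly q (of_nat s)"
    using assms unfolding dominated_def by eventually_elim simp
qed

lemma finite_dominated_max:
  assumes "finite A" "A \<noteq> {}"
  shows "\<exists>q\<in>A. \<forall>p\<in>A. dominated p q"
  using assms
proof (induction A rule: finite_ne_induct)
  case (singleton x)
  then show ?case by (simp add: dominated_refl)
next
  case (insert x A)
  then obtain q where q: "q \<in> A" "\<forall>p\<in>A. dominated p q" by blast
  from dominated_total[of x q] show ?case
    using q by (auto intro: dominated_trans dominated_refl)
qed

lemma degree_diff_less_same_lead_coeff:
  assumes "Polynomial.degree p = Polynomial.degree q" "lead_coeff p = lead_coeff q" "Polynomial.degree q \<noteq> 0"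
  shows "Polynomial.degree (p - q :: 'a::ab_group_add Polynomial.poly) < Polynomial.degree q"
proof (cases "p - q = 0")
  case False
  then show ?thesis using assms by (intro degree_less_if_less_eqI degree_diff_le) auto
qed (use assms in simp)

text \<open>Counting determines a Kolchin polynomial only at large arguments, whereas integrality is
  required at all integers. The forward difference has smaller degree and inherits the assumption,
  so integrality spreads from a large N by steps in both directions.\<close>

lemma numerical_polyI:
  fixes q :: "rat Polynomial.poly"
  assumes "\<forall>\<^sub>F s in sequentially. Polynomial.poly q (of_nat s) \<in> \<int>"
  shows "numerical_poly q"
  using assms
proof (induction "Polynomial.degree q" arbitrary: q rule: less_induct)
  case less
  define d where "d = pcompose q [:1, 1:] - q"
  have d: "Polynomial.poly d x = Polynomial.poly q (x + 1) - Polynomial.poly q x" for x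
    by (simp add: d_def poly_pcompose add.commute)
  obtain N where N: "\<And>s. s \<ge> N \<Longrightarrow> Polynomial.poly q (of_nat s) \<in> \<int>"
    using less.prems by (auto simp: eventually_sequentially)
  have step: "Polynomial.poly d (of_int s) \<in> \<int>" for s :: int
  proof (cases "Polynomial.degree q = 0")
    case True
    then obtain c where "q = [:c:]" by (metis degree_eq_zeroE)
    then show ?thesis by (simp add: d_def)
  next
    case False
    have "Polynomial.degree (pcompose q [:1, 1:]) = Polynomial.degree q"
      by (simp add: degree_pcompose)
    moreover have "lead_coeff (pcompose q [:1, 1:]) = lead_coeff q"
      by (subst lead_coeff_comp) auto
    ultimately have "Polynomial.degree d < Polynomial.degree q"
      unfolding d_def using False by (intro degree_diff_less_same_lead_coeff)
    moreover have "\<forall>\<^sub>F s in sequentially. Polynomial.poly d (of_nat s) \<in> \<int>"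
      unfolding eventually_sequentially
    proof (intro exI[of _ N] allI impI)
      fix s assume "N \<le> s"
      then show "Polynomial.poly d (of_nat s) \<in> \<int>"
        using N[of s] N[of "Suc s"] by (simp add: d add.commute)
    qed
    ultimately have "numerical_poly d" using less.hyps by blast
    then show ?thesis by (simp add: numerical_poly_def)
  qed
  show ?case
    unfolding numerical_poly_def
  proof
    fix s :: int
    show "Polynomial.poly q (of_int s) \<in> \<int>"
    proof (induction s rule: int_induct[where k = "int N"])
      case base
      then show ?case using N[of N] by simp
    next
      case (step1 i)
      then show ?case using step[of i] Ints_add by (fastforce simp: d)
    next
      case (step2 i)
      then show ?case using step[of "i - 1"] Ints_diff by (fastforce simp: d)
    qed
  qed
qed

section \<open>Hilbert functions of monomial ideals\<close>

text \<open>The falling factorials \<open>b n\<close> = x (x - 1) ... (x - n + 1) satisfy \<Delta>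
  b(n+1) = (n+1) b(n). Subtracting the leading multiple of \<open>b n\<close> from q lowers the
  degree, and c times b(n+1) is an antidifference of that multiple.\<close>

lemma ex_antidifference:
  fixes q :: "rat Polynomial.poly"
  shows "\<exists>Q. \<forall>x. Polynomial.poly Q (x + 1) - Polynomial.poly Q x = Polynomial.poly q x"
proof (induction "Polynomial.degree q" arbitrary: q rule: less_induct)
  case less
  define b :: "nat \<Rightarrow> rat Polynomial.poly" where "b n = (\<Prod>i<n. [:- of_nat i, 1:])" for n
  have b_Suc: "b (Suc n) = b n * [:- of_nat n, 1:]" for n by (simp add: b_def)
  have b_deg: "Polynomial.degree (b n) = n \<and> lead_coeff (b n) = 1" for n
  proof (induction n)
    case 0
    then show ?case by (simp add: b_def)
  next
    case (Suc n)
    then have "b n \<noteq> 0" by auto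
    then have "Polynomial.degree (b n * [:- of_nat n, 1:]) = Polynomial.degree (b n) + 1"
      by (subst degree_mult_eq) auto
    moreover have "lead_coeff (b n * [:- of_nat n, 1:]) = lead_coeff (b n)"
      by (subst lead_coeff_mult) simp
    ultimately show ?case unfolding b_Suc using Suc by (metis Suc_eq_plus1)
  qed
  have b_shift: "Polynomial.poly (b (Suc n)) (x + 1) = (x + 1) * Polynomial.poly (b n) x" for n x
  proof (induction n)
    case 0
    then show ?case by (simp add: b_def)
  next
    case (Suc n)
    have "Polynomial.poly (b (Suc (Suc n))) (x + 1)
        = Polynomial.poly (b (Suc n)) (x + 1) * (x - of_nat n)"
      by (subst b_Suc) (simp add: algebra_simps)
    also have "\<dots> = (x + 1) * Polynomial.poly (b (Suc n)) x"
      unfolding Suc by (simp add: b_Suc algebra_simps)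
    finally show ?case .
  qed
  have b_diff: "Polynomial.poly (b (Suc n)) (x + 1) - Polynomial.poly (b (Suc n)) x
      = of_nat (Suc n) * Polynomial.poly (b n) x" for n x
    unfolding b_shift by (simp add: b_Suc algebra_simps)
  define n where "n = Polynomial.degree q"
  define c where "c = lead_coeff q / of_nat (Suc n)"
  define r where "r = q - Polynomial.smult (lead_coeff q) (b n)"
  have c: "c * of_nat (Suc n) = lead_coeff q" by (simp add: c_def)
  have "\<exists>R. \<forall>x. Polynomial.poly R (x + 1) - Polynomial.poly R x = Polynomial.poly r x"
  proof (cases "n = 0")
    case True
    then obtain a where "q = [:a:]" unfolding n_def by (metis degree_eq_zeroE)
    then have "r = 0" by (simp add: r_def n_def b_def)
    then show ?thesis by (intro exI[of _ 0]) simp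
  next
    case False
    have "Polynomial.degree r < n"
    proof (cases "q = 0")
      case True
      then show ?thesis using False n_def by simp
    next
      case q: False
      have b1: "Polynomial.degree (b n) = n" "Polynomial.coeff (b n) n = 1"
        using b_deg[of n] by auto
      have "Polynomial.degree (Polynomial.smult (lead_coeff q) (b n) - q) < Polynomial.degree q"
      proof (rule degree_diff_less_same_lead_coeff)
        show "Polynomial.degree (Polynomial.smult (lead_coeff q) (b n)) = Polynomial.degree q"
          using b1 q by (simp add: n_def)
        show "lead_coeff (Polynomial.smult (lead_coeff q) (b n)) = lead_coeff q"
          using b1 q by (simp add: n_def)
      qed (use False n_def in simp)
      moreover have "Polynomial.degree r = Polynomial.degree (Polynomial.smult (lead_coeff q) (b n) - q)"
        unfolding r_def by (metis degree_minus minus_diff_eq)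
      ultimately show ?thesis by (simp add: n_def)
    qed
    then show ?thesis using less.hyps unfolding n_def by blast
  qed
  then obtain R where R: "\<And>x. Polynomial.poly R (x + 1) - Polynomial.poly R x = Polynomial.poly r x"
    by blast
  show ?case
  proof (intro exI[of _ "R + Polynomial.smult c (b (Suc n))"] allI)
    fix x
    have "c * (Polynomial.poly (b (Suc n)) (x + 1) - Polynomial.poly (b (Suc n)) x)
        = lead_coeff q * Polynomial.poly (b n) x"
      unfolding b_diff c[symmetric] by (simp add: algebra_simps)
    then show "Polynomial.poly (R + Polynomial.smult c (b (Suc n))) (x + 1)
        - Polynomial.poly (R + Polynomial.smult c (b (Suc n))) x = Polynomial.poly q x"
      using R[of x] by (simp add: r_def algebra_simps)
  qed
qed

text \<open>Agreement at large arguments only; \<open>numerical_polyI\<close> supplies integrality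
  afterwards.\<close>

definition eventually_poly :: "(nat \<Rightarrow> nat) \<Rightarrow> bool" where
  "eventually_poly f \<longleftrightarrow>
     (\<exists>q :: rat Polynomial.poly. \<forall>\<^sub>F s in sequentially. Polynomial.poly q (of_nat s) = of_nat (f s))"

lemma eventually_poly_sum:
  assumes "finite A" "\<And>j. j \<in> A \<Longrightarrow> eventually_poly (f j)"
  shows "eventually_poly (\<lambda>s. \<Sum>j\<in>A. f j s)"
  using assms
proof (induction A rule: finite_induct)
  case empty
  then show ?case by (auto simp: eventually_poly_def intro: exI[of _ 0])
next
  case (insert a A)
  then obtain p q :: "rat Polynomial.poly" where
    "\<forall>\<^sub>F s in sequentially. Polynomial.poly p (of_nat s) = of_nat (f a s)"
    "\<forall>\<^sub>F s in sequentially. Polynomial.poly q (of_nat s) = of_nat (\<Sum>j\<in>A. f j s)"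
    unfolding eventually_poly_def by force
  then have "\<forall>\<^sub>F s in sequentially. Polynomial.poly (p + q) (of_nat s) = of_nat (\<Sum>j\<in>insert a A. f j s)"
    by eventually_elim (use insert in simp)
  then show ?case unfolding eventually_poly_def by blast
qed

lemma eventually_poly_shift:
  assumes "eventually_poly f"
  shows "eventually_poly (\<lambda>s. f (s - j))"
proof -
  obtain q :: "rat Polynomial.poly" and N
    where N: "\<And>s. s \<ge> N \<Longrightarrow> Polynomial.poly q (of_nat s) = of_nat (f s)"
    using assms unfolding eventually_poly_def eventually_sequentially by blast
  have "\<forall>\<^sub>F s in sequentially. Polynomial.poly (pcompose q [:- of_nat j, 1:]) (of_nat s) = of_nat (f (s - j))"
    unfolding eventually_sequentially
  proof (intro exI[of _ "N + j"] allI impI)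
    fix s assume s: "N + j \<le> s"
    then have "(of_nat (s - j) :: rat) = of_nat s - of_nat j" by (simp add: of_nat_diff)
    then show "Polynomial.poly (pcompose q [:- of_nat j, 1:]) (of_nat s) = of_nat (f (s - j))"
      using N[of "s - j"] s by (simp add: poly_pcompose)
  qed
  then show ?thesis unfolding eventually_poly_def by blast
qed

lemma eventually_poly_partial_sums:
  assumes "eventually_poly f"
  shows "eventually_poly (\<lambda>s. \<Sum>i\<le>s. f i)"
proof -
  obtain q :: "rat Polynomial.poly" and N
    where N: "\<And>s. s \<ge> N \<Longrightarrow> Polynomial.poly q (of_nat s) = of_nat (f s)"
    using assms unfolding eventually_poly_def eventually_sequentially by blast
  obtain Q where Q: "\<And>x. Polynomial.poly Q (x + 1) - Polynomial.poly Q x = Polynomial.poly q x"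
    using ex_antidifference by blast
  define c where "c = of_nat (\<Sum>i\<le>N. f i) - Polynomial.poly Q (of_nat N + 1)"
  have "of_nat (\<Sum>i\<le>s. f i) = Polynomial.poly Q (of_nat s + 1) + c" if "s \<ge> N" for s
    using that
  proof (induction s rule: dec_induct)
    case base
    then show ?case by (simp add: c_def)
  next
    case (step s)
    have "Polynomial.poly Q (of_nat (Suc s) + 1) - Polynomial.poly Q (of_nat s + 1) = of_nat (f (Suc s))"
      using Q[of "of_nat s + 1"] N[of "Suc s"] step by (simp add: algebra_simps)
    then show ?case using step by (simp add: algebra_simps)
  qed
  then have "\<forall>\<^sub>F s in sequentially. Polynomial.poly (pcompose Q [:1, 1:] + [:c:]) (of_nat s) = of_nat (\<Sum>i\<le>s. f i)"
    unfolding eventually_sequentially by (intro exI[of _ N]) (simp add: poly_pcompose add.commute)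
  then show ?thesis unfolding eventually_poly_def by blast
qed

section \<open>Exponent sets of monomial ideals and Dickson's lemma\<close>

definition shift_closed :: "nat \<Rightarrow> nat list set \<Rightarrow> bool" where
  "shift_closed m U \<longleftrightarrow> (\<forall>\<xi>\<in>U. length \<xi> = m \<longrightarrow> (\<forall>l<m. \<xi>[l := Suc (\<xi> ! l)] \<in> U))"

lemma shift_closed_le:
  assumes "shift_closed m U" "g \<in> U" "list_all2 (\<le>) g \<xi>" "length g = m"
  shows "\<xi> \<in> U"
  using assms(2-4)
proof (induction "sum_list \<xi> - sum_list g" arbitrary: g rule: less_induct)
  case less
  have len: "length \<xi> = m" using less by (simp add: list_all2_lengthD)
  show ?case
  proof (cases "g = \<xi>")
    case True
    then show ?thesis using less by simp
  next
    case False
    then obtain l where l: "l < m" "g ! l \<noteq> \<xi> ! l"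
      using less len by (metis nth_equalityI)
    define g' where "g' = g[l := Suc (g ! l)]"
    have g': "g' \<in> U" using assms(1) less l by (auto simp: shift_closed_def g'_def)
    have le: "list_all2 (\<le>) g' \<xi>"
      using less.prems(2) l less.prems(3)
      by (auto simp: g'_def list_all2_conv_all_nth nth_list_update le_neq_implies_less Suc_leI)
    have "sum_list g' = Suc (sum_list g)"
      using l less.prems(3) by (simp add: g'_def sum_list_update)
    moreover have "sum_list g' \<le> sum_list \<xi>"
      using le by (auto simp: list_all2_conv_all_nth sum_list_sum_nth intro!: sum_mono)
    ultimately have "sum_list \<xi> - sum_list g' < sum_list \<xi> - sum_list g" by linarith
    from less.hyps[OF this g' le] show ?thesis by (simp add: g'_def less.prems)
  qed
qed

lemma shift_closed_slice:
  assumes "shift_closed (Suc m) U"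
  shows "shift_closed m {\<xi>. j # \<xi> \<in> U}"
  unfolding shift_closed_def
proof (intro ballI impI allI)
  fix \<xi> l assume "\<xi> \<in> {\<xi>. j # \<xi> \<in> U}" "length \<xi> = m" "l < m"
  then have "(j # \<xi>)[Suc l := Suc ((j # \<xi>) ! Suc l)] \<in> U"
    using assms unfolding shift_closed_def by (metis Suc_less_eq length_Cons mem_Collect_eq)
  then show "\<xi>[l := Suc (\<xi> ! l)] \<in> {\<xi>. j # \<xi> \<in> U}" by simp
qed

lemma shift_closed_slice_mono:
  assumes "shift_closed (Suc m) U" "j \<le> j'" "length \<xi> = m" "j # \<xi> \<in> U"
  shows "j' # \<xi> \<in> U"
  by (rule shift_closed_le[OF assms(1) assms(4)]) (use assms in \<open>auto simp: list_all2_refl\<close>)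

text \<open>Dickson's lemma by induction on the number of variables: slicing by the first exponent j
  gives an increasing sequence of ideals \<open>S j\<close>. Generators of their union already lie
  in one slice \<open>S J\<close>, so the slices from J on coincide and the generators of the slices
  up to J suffice.\<close>

lemma shift_closed_finite_basis:
  assumes "shift_closed m U" "\<And>\<xi>. \<xi> \<in> U \<Longrightarrow> length \<xi> = m"
  shows "\<exists>G\<subseteq>U. finite G \<and> (\<forall>\<xi>\<in>U. \<exists>g\<in>G. list_all2 (\<le>) g \<xi>)"
  using assms
proof (induction m arbitrary: U)
  case 0
  then have "U \<subseteq> {[]}" by auto
  then show ?case by (intro exI[of _ U]) (auto intro: finite_subset)
next
  case (Suc m)
  define S where "S j = {\<xi>. j # \<xi> \<in> U}" for j
  have S: "shift_closed m (S j)" "\<And>\<xi>. \<xi> \<in> S j \<Longrightarrow> length \<xi> = m" for j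
    using shift_closed_slice[OF Suc.prems(1)] Suc.prems(2) unfolding S_def by fastforce+
  have "\<exists>G\<subseteq>S j. finite G \<and> (\<forall>\<xi>\<in>S j. \<exists>g\<in>G. list_all2 (\<le>) g \<xi>)" for j
    by (rule Suc.IH[OF S(1) S(2)])
  then obtain B where B: "\<And>j. B j \<subseteq> S j" "\<And>j. finite (B j)"
    "\<And>j \<xi>. \<xi> \<in> S j \<Longrightarrow> \<exists>g\<in>B j. list_all2 (\<le>) g \<xi>" by metis
  have "shift_closed m (\<Union>j. S j)" using S(1) unfolding shift_closed_def by blast
  moreover have "length \<xi> = m" if "\<xi> \<in> (\<Union>j. S j)" for \<xi> using S(2) that by blast
  ultimately have "\<exists>G\<subseteq>(\<Union>j. S j). finite G \<and> (\<forall>\<xi>\<in>(\<Union>j. S j). \<exists>g\<in>G. list_all2 (\<le>) g \<xi>)"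
    by (rule Suc.IH)
  then obtain G' where G': "G' \<subseteq> (\<Union>j. S j)" "finite G'"
    "\<forall>\<xi>\<in>(\<Union>j. S j). \<exists>g\<in>G'. list_all2 (\<le>) g \<xi>" by (elim exE conjE)
  have mono: "j \<le> j' \<Longrightarrow> S j \<subseteq> S j'" for j j'
    using shift_closed_slice_mono[OF Suc.prems(1)] Suc.prems(2) unfolding S_def by fastforce
  obtain J where J: "G' \<subseteq> S J"
  proof -
    have "\<forall>g\<in>G'. \<exists>j. g \<in> S j" using G'(1) by blast
    then obtain w where w: "\<And>g. g \<in> G' \<Longrightarrow> g \<in> S (w g)" by metis
    have "G' \<subseteq> S (Max (w ` G'))"
    proof
      fix g assume "g \<in> G'"
      then have "w g \<le> Max (w ` G')" using G'(2) by auto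
      then show "g \<in> S (Max (w ` G'))" using mono w[OF \<open>g \<in> G'\<close>] by blast
    qed
    then show thesis using that by blast
  qed
  show ?case
  proof (intro exI[of _ "\<Union>j\<le>J. (#) j ` B j"] conjI ballI)
    show "(\<Union>j\<le>J. (#) j ` B j) \<subseteq> U" using B(1) by (auto simp: S_def)
    show "finite (\<Union>j\<le>J. (#) j ` B j)" using B(2) by blast
    fix \<xi> assume \<xi>: "\<xi> \<in> U"
    then obtain j \<xi>' where eq: "\<xi> = j # \<xi>'" using Suc.prems(2) by (metis Suc_length_conv)
    then have in_S: "\<xi>' \<in> S j" using \<xi> by (simp add: S_def)
    show "\<exists>g\<in>\<Union>j\<le>J. (#) j ` B j. list_all2 (\<le>) g \<xi>"
    proof (cases "j \<le> J")
      case True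
      then show ?thesis using B(3)[OF in_S] eq by fastforce
    next
      case False
      have "\<xi>' \<in> (\<Union>j. S j)" using in_S by blast
      then obtain g where g: "g \<in> G'" "list_all2 (\<le>) g \<xi>'" using G'(3) by blast
      then have "length g = m" using J S(2) by blast
      then have "\<xi>' \<in> S J" using shift_closed_le[OF S(1) _ g(2)] g(1) J by blast
      then obtain h where "h \<in> B J" "list_all2 (\<le>) h \<xi>'" using B(3) by blast
      then show ?thesis using eq False by (intro bexI[of _ "J # h"]) auto
    qed
  qed
qed

section \<open>The Hilbert function is eventually polynomial\<close>

definition hilbert_fun :: "nat \<Rightarrow> nat list set \<Rightarrow> nat \<Rightarrow> nat" where
  "hilbert_fun m U s = card {\<xi>. length \<xi> = m \<and> sum_list \<xi> \<le> s \<and> \<xi> \<notin> U}"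

lemma finite_bounded_multi_indices: "finite {\<xi> :: nat list. length \<xi> = m \<and> sum_list \<xi> \<le> s}"
proof (rule finite_subset)
  show "{\<xi> :: nat list. length \<xi> = m \<and> sum_list \<xi> \<le> s} \<subseteq> {\<xi>. set \<xi> \<subseteq> {..s} \<and> length \<xi> = m}"
    using member_le_sum_list by fastforce
qed (simp add: finite_lists_length_eq)

lemma hilbert_fun_Suc:
  fixes U :: "nat list set"
  shows "hilbert_fun (Suc m) U s = (\<Sum>j\<le>s. hilbert_fun m {\<xi>. j # \<xi> \<in> U} (s - j))"
proof -
  have "{\<xi>. length \<xi> = Suc m \<and> sum_list \<xi> \<le> s \<and> \<xi> \<notin> U}
      = (\<Union>j\<le>s. (#) j ` {\<xi>. length \<xi> = m \<and> sum_list \<xi> \<le> s - j \<and> \<xi> \<notin> {\<xi>. j # \<xi> \<in> U}})"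
    by (force simp: length_Suc_conv image_iff)
  moreover have "card (\<Union>j\<le>s. (#) j ` {\<xi>. length \<xi> = m \<and> sum_list \<xi> \<le> s - j \<and> \<xi> \<notin> {\<xi>. j # \<xi> \<in> U}})
      = (\<Sum>j\<le>s. card ((#) j ` {\<xi>. length \<xi> = m \<and> sum_list \<xi> \<le> s - j \<and> \<xi> \<notin> {\<xi>. j # \<xi> \<in> U}}))"
  proof (rule card_UN_disjoint)
    show "\<forall>j\<in>{..s}. finite ((#) j ` {\<xi>. length \<xi> = m \<and> sum_list \<xi> \<le> s - j \<and> \<xi> \<notin> {\<xi>. j # \<xi> \<in> U}})"
      by (intro ballI finite_imageI finite_subset[OF _ finite_bounded_multi_indices[of m s]]) auto
  qed auto
  moreover have "card (Cons j ` A) = card A" for j :: nat and A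
    by (simp add: card_image)
  ultimately show ?thesis unfolding hilbert_fun_def by presburger
qed

text \<open>Sum the Hilbert functions of the slices over the first exponent. The finitely many
  slices before the stable one contribute shifted functions; all the others together contribute
  partial sums of a single Hilbert function, which an antidifference makes polynomial.\<close>

lemma hilbert_fun_eventually_poly:
  assumes "shift_closed m U"
  shows "eventually_poly (hilbert_fun m U)"
  using assms
proof (induction m arbitrary: U)
  case 0
  have "eventually_poly (\<lambda>s. c)" for c
    unfolding eventually_poly_def by (intro exI[of _ "[:of_nat c:]"]) simp
  moreover have "{\<xi>::nat list. \<xi> = [] \<and> sum_list \<xi> \<le> s \<and> \<xi> \<notin> U} = {\<xi>. \<xi> = [] \<and> \<xi> \<notin> U}" for s by auto
  ultimately show ?case by (simp add: hilbert_fun_def)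
next
  case (Suc m)
  \<comment> \<open>The length is built in because \<open>U\<close> may contain lists of other
    lengths, which the Hilbert function ignores.\<close>
  define S where "S j = {\<xi>. length \<xi> = m \<and> j # \<xi> \<in> U}" for j
  have HS: "hilbert_fun m {\<xi>. j # \<xi> \<in> U} = hilbert_fun m (S j)" for j
    unfolding hilbert_fun_def S_def by (rule ext, rule arg_cong[where f = card]) auto
  have S: "eventually_poly (hilbert_fun m (S j))" for j
    unfolding HS[symmetric] using Suc.IH[OF shift_closed_slice[OF Suc.prems]] .
  have mono: "j \<le> j' \<Longrightarrow> S j \<subseteq> S j'" for j j'
    using shift_closed_slice_mono[OF Suc.prems] unfolding S_def by fastforce
  have sc: "shift_closed m (\<Union>j. S j)"
    using shift_closed_slice[OF Suc.prems] unfolding shift_closed_def S_def by auto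
  then obtain G where G: "G \<subseteq> (\<Union>j. S j)" "finite G" "\<And>\<xi>. \<xi> \<in> (\<Union>j. S j) \<Longrightarrow> \<exists>g\<in>G. list_all2 (\<le>) g \<xi>"
    using shift_closed_finite_basis[OF sc] by (auto simp: S_def)
  obtain J where J: "\<And>j. j \<ge> J \<Longrightarrow> S j = S J"
  proof -
    have "\<forall>g\<in>G. \<exists>j. g \<in> S j" using G(1) by blast
    then obtain w where w: "\<And>g. g \<in> G \<Longrightarrow> g \<in> S (w g)" by metis
    define J where "J = Max (w ` G)"
    have "S j \<subseteq> S J" for j
    proof
      fix \<xi> assume "\<xi> \<in> S j"
      then obtain g where g: "g \<in> G" "list_all2 (\<le>) g \<xi>" using G(3) by blast
      have "w g \<le> J" using g(1) G(2) by (auto simp: J_def)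
      then have gJ: "g \<in> S J" using mono w[OF g(1)] by blast
      then have len: "length g = m" by (simp add: S_def)
      have "list_all2 (\<le>) (J # g) (J # \<xi>)" using g(2) by simp
      from shift_closed_le[OF Suc.prems _ this] have "J # \<xi> \<in> U" using gJ by (simp add: S_def)
      then show "\<xi> \<in> S J" using list_all2_lengthD[OF g(2)] len by (simp add: S_def)
    qed
    then have "S j = S J" if "j \<ge> J" for j using mono[OF that] by blast
    then show thesis using that by blast
  qed
  have "hilbert_fun (Suc m) U s = (\<Sum>j<J. hilbert_fun m (S j) (s - j)) + (\<Sum>i\<le>s - J. hilbert_fun m (S J) i)"
    if "s \<ge> J" for s
  proof -
    have "hilbert_fun (Suc m) U s = (\<Sum>j\<le>s. hilbert_fun m (S j) (s - j))"
      by (simp add: hilbert_fun_Suc HS)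
    also have "\<dots> = (\<Sum>j<J. hilbert_fun m (S j) (s - j)) + (\<Sum>j\<in>{J..s}. hilbert_fun m (S j) (s - j))"
    proof -
      have "{..s} = {..<J} \<union> {J..s}" "{..<J} \<inter> {J..s} = {}" using that by auto
      then show ?thesis by (simp add: sum.union_disjoint)
    qed
    also have "(\<Sum>j\<in>{J..s}. hilbert_fun m (S j) (s - j)) = (\<Sum>j\<in>{J..s}. hilbert_fun m (S J) (s - j))"
    proof (rule sum.cong)
      fix j assume "j \<in> {J..s}"
      then have "S j = S J" by (intro J) simp
      then show "hilbert_fun m (S j) (s - j) = hilbert_fun m (S J) (s - j)" by simp
    qed simp
    also have "\<dots> = (\<Sum>i\<le>s - J. hilbert_fun m (S J) i)"
      by (rule sum.reindex_bij_witness[where i = "\<lambda>i. s - i" and j = "\<lambda>j. s - j"]) (use that in auto)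
    finally show ?thesis .
  qed
  moreover have "eventually_poly (\<lambda>s. (\<Sum>j<J. hilbert_fun m (S j) (s - j)) + (\<Sum>i\<le>s - J. hilbert_fun m (S J) i))"
  proof -
    have 1: "eventually_poly (\<lambda>s. \<Sum>j<J. hilbert_fun m (S j) (s - j))"
      by (intro eventually_poly_sum eventually_poly_shift S) auto
    have 2: "eventually_poly (\<lambda>s. \<Sum>i\<le>s - J. hilbert_fun m (S J) i)"
      using eventually_poly_shift[OF eventually_poly_partial_sums[OF S]] .
    \<comment> \<open>The two summands are indexed by a truth value so that closure under finite
      sums applies.\<close>
    have "eventually_poly (\<lambda>s. \<Sum>b\<in>(UNIV::bool set). (if b then (\<Sum>j<J. hilbert_fun m (S j) (s - j))
        else (\<Sum>i\<le>s - J. hilbert_fun m (S J) i)))"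
      proof (rule eventually_poly_sum)
      fix c :: bool
      show "eventually_poly (\<lambda>s. if c then \<Sum>j<J. hilbert_fun m (S j) (s - j)
        else \<Sum>i\<le>s - J. hilbert_fun m (S J) i)"
        using 1 2 by (cases c) simp_all
    qed simp
    then show ?thesis by (simp add: UNIV_bool add.commute)
  qed
  ultimately show ?case
    unfolding eventually_poly_def eventually_sequentially
    by (metis (no_types, lifting) max.bounded_iff)
qed

section \<open>Subrings, fractions and algebraic elements\<close>

definition is_subring :: "'a::comm_ring_1 set \<Rightarrow> bool" where
  "is_subring B \<longleftrightarrow>
     0 \<in> B \<and> 1 \<in> B \<and> (\<forall>x\<in>B. \<forall>y\<in>B. x + y \<in> B \<and> x * y \<in> B) \<and> (\<forall>x\<in>B. - x \<in> B)"

lemma is_subringD: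
  assumes "is_subring B"
  shows "0 \<in> B" "1 \<in> B" "x \<in> B \<Longrightarrow> y \<in> B \<Longrightarrow> x + y \<in> B" "x \<in> B \<Longrightarrow> y \<in> B \<Longrightarrow> x * y \<in> B"
    "x \<in> B \<Longrightarrow> - x \<in> B"
  using assms by (auto simp: is_subring_def)

lemma is_subfieldD:
  assumes "is_subfield B"
  shows "0 \<in> B" "1 \<in> B" "x \<in> B \<Longrightarrow> y \<in> B \<Longrightarrow> x + y \<in> B" "x \<in> B \<Longrightarrow> y \<in> B \<Longrightarrow> x * y \<in> B"
    "x \<in> B \<Longrightarrow> - x \<in> B" "x \<in> B \<Longrightarrow> inverse x \<in> B"
  using assms by (auto simp: is_subfield_def)

lemma is_subfield_imp_is_subring: "is_subfield B \<Longrightarrow> is_subring B"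
  by (auto simp: is_subfield_def is_subring_def)

lemma is_subring_sum: "is_subring B \<Longrightarrow> (\<And>i. i \<in> A \<Longrightarrow> f i \<in> B) \<Longrightarrow> sum f A \<in> B"
  by (induction A rule: infinite_finite_induct) (auto simp: is_subringD)

lemma is_subring_prod: "is_subring B \<Longrightarrow> (\<And>i. i \<in> A \<Longrightarrow> f i \<in> B) \<Longrightarrow> prod f A \<in> B"
  by (induction A rule: infinite_finite_induct) (auto simp: is_subringD)

lemma is_subring_power: "is_subring B \<Longrightarrow> x \<in> B \<Longrightarrow> x ^ n \<in> B"
  by (induction n) (auto simp: is_subringD)

lemma is_subring_of_nat: "is_subring B \<Longrightarrow> of_nat n \<in> B"
  by (induction n) (auto simp: is_subringD)

lemma is_subring_poly:
  assumes "is_subring B" "\<And>i. Polynomial.coeff P i \<in> B" "x \<in> B"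
  shows "Polynomial.poly P x \<in> B"
  unfolding poly_altdef using assms by (intro is_subring_sum is_subringD(4) is_subring_power) auto

lemma is_subfield_Inter: "(\<And>B. B \<in> T \<Longrightarrow> is_subfield B) \<Longrightarrow> is_subfield (\<Inter>T)"
  by (auto simp: is_subfield_def)

lemma is_subfield_hull: "is_subfield (is_subfield hull W)"
  by (rule hull_in) (auto intro: is_subfield_Inter)

lemma is_subfield_gen_field: "is_subfield (gen_field L S)"
  unfolding gen_field_def by (rule is_subfield_hull)

lemma gen_field_superset: "L \<union> S \<subseteq> gen_field L S"
  unfolding gen_field_def by (rule hull_subset)

lemma gen_field_minimal: "is_subfield B \<Longrightarrow> L \<union> S \<subseteq> B \<Longrightarrow> gen_field L S \<subseteq> B"
  unfolding gen_field_def by (rule hull_minimal)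

lemma gen_field_mono: "L \<subseteq> L' \<Longrightarrow> S \<subseteq> S' \<Longrightarrow> gen_field L S \<subseteq> gen_field L' S'"
  unfolding gen_field_def by (rule hull_mono) blast

lemma algebraic_over_mono: "B \<subseteq> B' \<Longrightarrow> algebraic_over B x \<Longrightarrow> algebraic_over B' x"
  unfolding algebraic_over_def by blast

text \<open>Denominator 0 is allowed: a / 0 = 0 lies in every subring, and \<open>fractionsE\<close>
  trades it for 0 / 1.\<close>

definition fractions :: "'a::field set \<Rightarrow> 'a set" where
  "fractions B = {a / b | a b. a \<in> B \<and> b \<in> B}"

lemma fractionsE:
  assumes "is_subring B" "x \<in> fractions B"
  obtains a b where "x = a / b" "a \<in> B" "b \<in> B" "b \<noteq> 0"
proof -
  obtain a b where ab: "x = a / b" "a \<in> B" "b \<in> B" using assms by (auto simp: fractions_def)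
  show thesis
  proof (cases "b = 0")
    case True
    then show ?thesis using that[of 0 1] ab is_subringD[OF assms(1)] by simp
  next
    case False
    then show ?thesis using that ab by blast
  qed
qed

lemma subset_fractions: "is_subring B \<Longrightarrow> B \<subseteq> fractions B"
proof
  fix a assume "is_subring B" "a \<in> B"
  then have "a = a / 1 \<and> a \<in> B \<and> 1 \<in> B" by (simp add: is_subringD(2))
  then show "a \<in> fractions B" unfolding fractions_def by blast
qed

lemma is_subfield_fractions:
  fixes B :: "'a::field_char_0 set"
  assumes B: "is_subring B"
  shows "is_subfield (fractions B)"
proof -
  note D = is_subringD[OF B]
  have "x + y \<in> fractions B \<and> x * y \<in> fractions B" if xy: "x \<in> fractions B" "y \<in> fractions B" for x y
  proof -
    obtain a b where ab: "x = a / b" "a \<in> B" "b \<in> B" "b \<noteq> 0" using fractionsE[OF B xy(1)] .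
    obtain c d where cd: "y = c / d" "c \<in> B" "d \<in> B" "d \<noteq> 0" using fractionsE[OF B xy(2)] .
    have "x + y = (a * d + c * b) / (b * d)" "x * y = (a * c) / (b * d)"
      unfolding ab(1) cd(1) by (rule add_frac_eq[OF ab(4) cd(4)], rule times_divide_times_eq)
    then show ?thesis unfolding fractions_def using ab cd D by blast
  qed
  moreover have "- x \<in> fractions B \<and> inverse x \<in> fractions B" if x: "x \<in> fractions B" for x
  proof -
    obtain a b where ab: "x = a / b" "a \<in> B" "b \<in> B" "b \<noteq> 0" using fractionsE[OF B x] .
    have "- x = (- a) / b" "inverse x = b / a" using ab by simp_all
    then show ?thesis unfolding fractions_def using ab D by blast
  qed
  ultimately show ?thesis
    unfolding is_subfield_def using subset_fractions[OF B] D by blast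
qed

text \<open>Multiply by the product \<open>d\<close> of the denominators of all coefficients. Hence
  algebraicity can be tested over a ring of values of polynomial expressions instead of the field
  that it generates.\<close>

lemma algebraic_over_fractions:
  fixes B :: "'a::field_char_0 set"
  assumes B: "is_subring B" and alg: "algebraic_over (fractions B) x"
  shows "algebraic_over B x"
proof -
  obtain q where q: "q \<noteq> 0" "\<And>i. Polynomial.coeff q i \<in> fractions B" "Polynomial.poly q x = 0"
    using alg unfolding algebraic_over_def by blast
  have "\<exists>a b. Polynomial.coeff q i = a / b \<and> a \<in> B \<and> b \<in> B \<and> b \<noteq> 0" for i
    using fractionsE[OF B q(2)[of i]] by metis
  then obtain a b where ab: "\<And>i. Polynomial.coeff q i = a i / b i" "\<And>i. a i \<in> B" "\<And>i. b i \<in> B"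
    "\<And>i. b i \<noteq> 0" by metis
  define d where "d = (\<Prod>i\<le>Polynomial.degree q. b i)"
  have d: "d \<noteq> 0" using ab by (simp add: d_def)
  have "Polynomial.coeff (Polynomial.smult d q) i \<in> B" for i
  proof (cases "i \<le> Polynomial.degree q")
    case True
    have "d = b i * prod b ({..Polynomial.degree q} - {i})"
      unfolding d_def using True by (subst prod.remove[of _ i]) auto
    then have "Polynomial.coeff (Polynomial.smult d q) i = prod b ({..Polynomial.degree q} - {i}) * a i"
      using ab[of i] by simp
    then show ?thesis using is_subring_prod[OF B, of _ b] ab is_subringD[OF B] by auto
  next
    case False
    then show ?thesis using is_subringD(1)[OF B] by (simp add: coeff_eq_0)
  qed
  then show ?thesis unfolding algebraic_over_def
    using q d by (intro exI[of _ "Polynomial.smult d q"]) auto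
qed

section \<open>Extension of derivations\<close>

definition derivation :: "('a::field_char_0 \<Rightarrow> 'a) \<Rightarrow> bool" where
  "derivation D \<longleftrightarrow> (\<forall>x y. D (x + y) = D x + D y) \<and> (\<forall>x y. D (x * y) = D x * y + x * D y)"

lemma derivationD:
  assumes "derivation D"
  shows "D (x + y) = D x + D y" "D (x * y) = D x * y + x * D y"
  using assms by (auto simp: derivation_def)

lemma derivation_0: assumes "derivation D" shows "D 0 = 0"
  using derivationD(1)[OF assms, of 0 0] by simp

lemma derivation_1: assumes "derivation D" shows "D 1 = 0"
  using derivationD(2)[OF assms, of 1 1] by simp

lemma derivation_minus: assumes "derivation D" shows "D (- x) = - D x"
  using derivationD(1)[OF assms, of x "- x"] derivation_0[OF assms] by (simp add: eq_neg_iff_add_eq_0 add.commute)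

text \<open>The formula also covers x = 0 because \<open>inverse 0 = 0\<close>, so kernels of
  derivations are subfields in the sense of \<open>is_subfield\<close>.\<close>

lemma derivation_inverse: assumes "derivation D" shows "D (inverse x) = - D x * inverse x * inverse x"
proof (cases "x = 0")
  case True
  then show ?thesis by (simp add: derivation_0[OF assms])
next
  case False
  have "0 = D (x * inverse x)" using False by (simp add: derivation_1[OF assms])
  also have "\<dots> = D x * inverse x + x * D (inverse x)" by (rule derivationD(2)[OF assms])
  finally have "x * D (inverse x) = - D x * inverse x" by (simp add: eq_neg_iff_add_eq_0 add.commute)
  then have "inverse x * (x * D (inverse x)) = inverse x * (- D x * inverse x)" by (rule arg_cong)
  moreover have "inverse x * (x * D (inverse x)) = D (inverse x)" using False by (simp add: mult.assoc[symmetric])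
  ultimately show ?thesis by (simp add: mult.commute)
qed

lemma derivation_kernel_subfield: assumes "derivation D" shows "is_subfield {x. D x = 0}"
  using assms by (auto simp: is_subfield_def derivation_0 derivation_1 derivationD derivation_minus derivation_inverse)

lemma derivation_poly:
  assumes "derivation D"
  shows "D (Polynomial.poly P x) = Polynomial.poly (map_poly D P) x + Polynomial.poly (pderiv P) x * D x"
proof (induction P)
  case 0
  then show ?case by (simp add: derivation_0[OF assms])
next
  case (pCons a P)
  have "map_poly D (pCons a P) = pCons (D a) (map_poly D P)"
    by (rule poly_eqI) (simp add: coeff_map_poly derivation_0[OF assms] coeff_pCons split: nat.split)
  then show ?case using pCons.IH by (simp add: derivationD[OF assms] pderiv_pCons algebra_simps)
qed

text \<open>Spreads commutation from generators to a field: the places where two derivations commute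
  form the kernel of a derivation.\<close>

lemma derivation_commutator:
  assumes "derivation D" "derivation D'"
  shows "derivation (\<lambda>x. D (D' x) - D' (D x))"
  unfolding derivation_def by (simp add: derivationD[OF assms(1)] derivationD[OF assms(2)] algebra_simps)

text \<open>Differentiating an equation q(x) = 0 of least degree over the constants of D leaves
  q'(x) D x = 0, and q'(x) is nonzero by minimality in characteristic 0.\<close>

lemma derivation_algebraic_eq_0:
  assumes D: "derivation D" "\<And>b. b \<in> B \<Longrightarrow> D b = 0" and alg: "algebraic_over B x"
  shows "D x = 0"
proof -
  have B: "algebraic_over {x. D x = 0} x" by (rule algebraic_over_mono[OF _ alg]) (auto simp: D(2))
  define Q where "Q n \<longleftrightarrow> (\<exists>q. q \<noteq> 0 \<and> (\<forall>i. D (Polynomial.coeff q i) = 0) \<and> Polynomial.poly q x = 0 \<and> Polynomial.degree q = n)" for n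
  have "\<exists>n. Q n" using B unfolding algebraic_over_def Q_def by auto
  then have Qn: "Q (Least Q)" by (metis LeastI)
  then obtain q where q: "q \<noteq> 0" "\<And>i. D (Polynomial.coeff q i) = 0" "Polynomial.poly q x = 0" "Polynomial.degree q = Least Q"
    unfolding Q_def by blast
  have "map_poly D q = 0" by (rule poly_eqI) (simp add: coeff_map_poly derivation_0[OF D(1)] q)
  then have *: "Polynomial.poly (pderiv q) x * D x = 0"
    using derivation_poly[OF D(1), of q x] q(3) derivation_0[OF D(1)] by simp
  have "Polynomial.poly (pderiv q) x \<noteq> 0"
  proof
    assume 0: "Polynomial.poly (pderiv q) x = 0"
    have deg: "Polynomial.degree q \<noteq> 0" using q(1,3) by (metis degree_eq_zeroE pCons_0_0 poly_const_conv)
    then have nz: "pderiv q \<noteq> 0" by (simp add: pderiv_eq_0_iff)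
    have "D (of_nat n) = 0" for n
      by (induction n) (simp_all add: derivation_0[OF D(1)] derivation_1[OF D(1)] derivationD[OF D(1)])
    then have "D (Polynomial.coeff (pderiv q) i) = 0" for i
      by (simp add: coeff_pderiv derivationD[OF D(1)] q(2) derivation_1[OF D(1)])
    then have "Q (Polynomial.degree (pderiv q))" unfolding Q_def using nz 0 by blast
    then have "Least Q \<le> Polynomial.degree (pderiv q)" by (rule Least_le)
    then show False using q(4) deg by (simp add: degree_pderiv)
  qed
  with * show ?thesis by simp
qed

text \<open>A pair \<open>(x, w)\<close> stands for the dual number \<open>x + w \<epsilon>\<close>: a functional subring of the ring of
  dual numbers is the graph of a derivation on a subring.\<close>

definition dual_ring :: "('a::field_char_0 \<times> 'a) set \<Rightarrow> bool" where
  "dual_ring \<Gamma> \<longleftrightarrow> (0, 0) \<in> \<Gamma> \<and> (1, 0) \<in> \<Gamma> \<and>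
     (\<forall>a w b v. (a, w) \<in> \<Gamma> \<longrightarrow> (b, v) \<in> \<Gamma> \<longrightarrow> (a + b, w + v) \<in> \<Gamma> \<and> (a * b, a * v + w * b) \<in> \<Gamma>) \<and>
     (\<forall>a w. (a, w) \<in> \<Gamma> \<longrightarrow> (- a, - w) \<in> \<Gamma>)"

definition functional_dual :: "('a::field_char_0 \<times> 'a) set \<Rightarrow> bool" where
  "functional_dual \<Gamma> \<longleftrightarrow> (\<forall>w. (0, w) \<in> \<Gamma> \<longrightarrow> w = 0)"

definition poly_pairs :: "('a::field_char_0 \<times> 'a) set \<Rightarrow> ('a Polynomial.poly \<times> 'a Polynomial.poly) set" where
  "poly_pairs \<Gamma> = {(P, Q). \<forall>i. (Polynomial.coeff P i, Polynomial.coeff Q i) \<in> \<Gamma>}"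

text \<open>All values at x + g \<epsilon> of the polynomials P + Q \<epsilon> with coefficients in
  \<open>\<Gamma>\<close>; Taylor expansion modulo \<epsilon>^2 gives the second component. As a
  graph this extends the derivation to the ring generated by x, with derivative g at x.\<close>

definition dual_adjoin :: "('a::field_char_0 \<times> 'a) set \<Rightarrow> 'a \<Rightarrow> 'a \<Rightarrow> ('a \<times> 'a) set" where
  "dual_adjoin \<Gamma> x g = (\<lambda>(P, Q). (Polynomial.poly P x, Polynomial.poly Q x + Polynomial.poly (pderiv P) x * g)) ` poly_pairs \<Gamma>"

lemma dual_ringD:
  assumes "dual_ring \<Gamma>"
  shows "(0, 0) \<in> \<Gamma>" "(1, 0) \<in> \<Gamma>" "(a, w) \<in> \<Gamma> \<Longrightarrow> (b, v) \<in> \<Gamma> \<Longrightarrow> (a + b, w + v) \<in> \<Gamma>"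
    "(a, w) \<in> \<Gamma> \<Longrightarrow> (b, v) \<in> \<Gamma> \<Longrightarrow> (a * b, a * v + w * b) \<in> \<Gamma>" "(a, w) \<in> \<Gamma> \<Longrightarrow> (- a, - w) \<in> \<Gamma>"
  using assms unfolding dual_ring_def by blast+

lemma functional_dualD:
  assumes "dual_ring \<Gamma>" "functional_dual \<Gamma>" "(a, w) \<in> \<Gamma>" "(a, v) \<in> \<Gamma>"
  shows "w = v"
proof -
  have "(a + - a, w + - v) \<in> \<Gamma>"
    by (rule dual_ringD(3)[OF assms(1,3) dual_ringD(5)[OF assms(1,4)]])
  then have "w + - v = 0"
    using assms(2)[unfolded functional_dual_def, rule_format, of "w + - v"] by simp
  then show ?thesis by simp
qed

lemma dual_ring_sum:
  assumes "dual_ring \<Gamma>" "\<And>i. i \<in> A \<Longrightarrow> (f i, g i) \<in> \<Gamma>"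
  shows "(sum f A, sum g A) \<in> \<Gamma>"
  using assms(2) by (induction A rule: infinite_finite_induct) (auto simp: dual_ringD[OF assms(1)])

lemma poly_pairs_add:
  assumes "dual_ring \<Gamma>" "(P, Q) \<in> poly_pairs \<Gamma>" "(P', Q') \<in> poly_pairs \<Gamma>"
  shows "(P + P', Q + Q') \<in> poly_pairs \<Gamma>"
  using assms by (auto simp: poly_pairs_def intro: dual_ringD)

lemma poly_pairs_minus:
  assumes "dual_ring \<Gamma>" "(P, Q) \<in> poly_pairs \<Gamma>"
  shows "(- P, - Q) \<in> poly_pairs \<Gamma>"
  using assms by (auto simp: poly_pairs_def intro: dual_ringD)

lemma poly_pairs_mult:
  assumes "dual_ring \<Gamma>" "(P, Q) \<in> poly_pairs \<Gamma>" "(P', Q') \<in> poly_pairs \<Gamma>"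
  shows "(P * P', P * Q' + Q * P') \<in> poly_pairs \<Gamma>"
proof -
  have "(\<Sum>i\<le>n. Polynomial.coeff P i * Polynomial.coeff P' (n - i),
         \<Sum>i\<le>n. Polynomial.coeff P i * Polynomial.coeff Q' (n - i) + Polynomial.coeff Q i * Polynomial.coeff P' (n - i)) \<in> \<Gamma>" for n
    by (rule dual_ring_sum[OF assms(1)], rule dual_ringD(4)[OF assms(1)])
       (use assms in \<open>auto simp: poly_pairs_def\<close>)
  then show ?thesis by (simp add: poly_pairs_def coeff_mult sum.distrib)
qed

lemma poly_pairs_monom:
  assumes "dual_ring \<Gamma>" "(a, w) \<in> \<Gamma>"
  shows "(Polynomial.monom a n, Polynomial.monom w n) \<in> poly_pairs \<Gamma>"
  using assms by (auto simp: poly_pairs_def intro: dual_ringD)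

lemma poly_pairs_exists:
  assumes "dual_ring \<Gamma>" "\<And>i. Polynomial.coeff P i \<in> fst ` \<Gamma>"
  shows "\<exists>Q. (P, Q) \<in> poly_pairs \<Gamma>"
proof -
  have "\<exists>w. (Polynomial.coeff P i, w) \<in> \<Gamma>" for i using assms(2)[of i] by force
  then obtain w where w: "\<And>i. (Polynomial.coeff P i, w i) \<in> \<Gamma>" by metis
  define Q where "Q = (\<Sum>i\<le>Polynomial.degree P. Polynomial.monom (w i) i)"
  have "(Polynomial.coeff P i, Polynomial.coeff Q i) \<in> \<Gamma>" for i
    using w[of i] dual_ringD(1)[OF assms(1)]
    by (cases "i \<le> Polynomial.degree P") (auto simp: Q_def coeff_sum coeff_eq_0)
  then show ?thesis by (auto simp: poly_pairs_def)
qed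

lemma dual_adjoinI:
  assumes "(P, Q) \<in> poly_pairs \<Gamma>" "a = Polynomial.poly P x"
    "w = Polynomial.poly Q x + Polynomial.poly (pderiv P) x * g"
  shows "(a, w) \<in> dual_adjoin \<Gamma> x g"
  unfolding dual_adjoin_def by (rule image_eqI[OF _ assms(1)]) (simp add: assms)

lemma dual_adjoinE:
  assumes "(a, w) \<in> dual_adjoin \<Gamma> x g"
  obtains P Q where "(P, Q) \<in> poly_pairs \<Gamma>" "a = Polynomial.poly P x"
    "w = Polynomial.poly Q x + Polynomial.poly (pderiv P) x * g"
  using assms unfolding dual_adjoin_def by (elim imageE) (auto split: prod.splits)

lemma fst_dual_ring_subring:
  assumes "dual_ring \<Gamma>"
  shows "is_subring (fst ` \<Gamma>)"
  unfolding is_subring_def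
proof (intro conjI ballI)
  show "0 \<in> fst ` \<Gamma>" "1 \<in> fst ` \<Gamma>" using dual_ringD(1,2)[OF assms] by (metis fst_conv imageI)+
  fix a assume "a \<in> fst ` \<Gamma>"
  then obtain w where w: "(a, w) \<in> \<Gamma>" by auto
  show "- a \<in> fst ` \<Gamma>" using dual_ringD(5)[OF assms w] by (metis fst_conv imageI)
  fix b assume "b \<in> fst ` \<Gamma>"
  then obtain v where v: "(b, v) \<in> \<Gamma>" by auto
  show "a + b \<in> fst ` \<Gamma>" using dual_ringD(3)[OF assms w v] by (metis fst_conv imageI)
  show "a * b \<in> fst ` \<Gamma>" using dual_ringD(4)[OF assms w v] by (metis fst_conv imageI)
qed

lemma dual_ring_adjoin:
  assumes "dual_ring \<Gamma>"
  shows "dual_ring (dual_adjoin \<Gamma> x g)"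
proof -
  have "(0, 0) \<in> poly_pairs \<Gamma>" "(1, 0) \<in> poly_pairs \<Gamma>"
    using dual_ringD(1,2)[OF assms] by (auto simp: poly_pairs_def one_pCons coeff_pCons split: nat.split)
  then have "(0, 0) \<in> dual_adjoin \<Gamma> x g" "(1, 0) \<in> dual_adjoin \<Gamma> x g"
    by (auto intro: dual_adjoinI)
  moreover have "(a + b, w + v) \<in> dual_adjoin \<Gamma> x g \<and> (a * b, a * v + w * b) \<in> dual_adjoin \<Gamma> x g"
    if ab: "(a, w) \<in> dual_adjoin \<Gamma> x g" "(b, v) \<in> dual_adjoin \<Gamma> x g" for a w b v
  proof -
    obtain P Q where 1: "(P, Q) \<in> poly_pairs \<Gamma>" "a = Polynomial.poly P x"
      "w = Polynomial.poly Q x + Polynomial.poly (pderiv P) x * g" by (rule dual_adjoinE[OF ab(1)])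
    obtain P' Q' where 2: "(P', Q') \<in> poly_pairs \<Gamma>" "b = Polynomial.poly P' x"
      "v = Polynomial.poly Q' x + Polynomial.poly (pderiv P') x * g" by (rule dual_adjoinE[OF ab(2)])
    have "(a + b, w + v) \<in> dual_adjoin \<Gamma> x g"
      by (rule dual_adjoinI[OF poly_pairs_add[OF assms 1(1) 2(1)]])
         (simp_all add: 1 2 pderiv_add algebra_simps)
    moreover have "(a * b, a * v + w * b) \<in> dual_adjoin \<Gamma> x g"
      by (rule dual_adjoinI[OF poly_pairs_mult[OF assms 1(1) 2(1)]])
         (simp_all add: 1 2 pderiv_mult algebra_simps)
    ultimately show ?thesis ..
  qed
  moreover have "(- a, - w) \<in> dual_adjoin \<Gamma> x g" if a: "(a, w) \<in> dual_adjoin \<Gamma> x g" for a w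
  proof -
    obtain P Q where 1: "(P, Q) \<in> poly_pairs \<Gamma>" "a = Polynomial.poly P x"
      "w = Polynomial.poly Q x + Polynomial.poly (pderiv P) x * g" by (rule dual_adjoinE[OF a])
    show ?thesis
      by (rule dual_adjoinI[OF poly_pairs_minus[OF assms 1(1)]]) (simp_all add: 1 pderiv_minus)
  qed
  ultimately show ?thesis unfolding dual_ring_def by blast
qed

lemma dual_adjoin_superset: assumes "dual_ring \<Gamma>" shows "\<Gamma> \<subseteq> dual_adjoin \<Gamma> x g"
proof safe
  fix a w assume "(a, w) \<in> \<Gamma>"
  from poly_pairs_monom[OF assms this, of 0] show "(a, w) \<in> dual_adjoin \<Gamma> x g"
    by (rule dual_adjoinI) (simp_all add: monom_0)
qed

lemma dual_adjoin_mem: assumes "dual_ring \<Gamma>" shows "(x, g) \<in> dual_adjoin \<Gamma> x g"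
  by (rule dual_adjoinI[OF poly_pairs_monom[OF assms dual_ringD(2)[OF assms], of 1]])
     (simp_all add: monom_Suc monom_0 pderiv_pCons)

text \<open>P(x) = 0 forces P = 0, so no condition on g arises: the derivative of a transcendental
  can be prescribed freely.\<close>

lemma functional_dual_adjoin_transcendental:
  assumes "dual_ring \<Gamma>" "functional_dual \<Gamma>" "\<not> algebraic_over (fst ` \<Gamma>) x"
  shows "functional_dual (dual_adjoin \<Gamma> x g)"
  unfolding functional_dual_def
proof (intro allI impI)
  fix w assume "(0, w) \<in> dual_adjoin \<Gamma> x g"
  then obtain P Q where PQ: "(P, Q) \<in> poly_pairs \<Gamma>" "Polynomial.poly P x = 0"
    "w = Polynomial.poly Q x + Polynomial.poly (pderiv P) x * g" by (elim dual_adjoinE) simp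
  have "Polynomial.coeff P i \<in> fst ` \<Gamma>" for i
    using PQ(1) by (auto simp: poly_pairs_def intro: image_eqI[of _ _ "(Polynomial.coeff P i, Polynomial.coeff Q i)"])
  then have "P = 0" using PQ(2) assms(3) unfolding algebraic_over_def by blast
  moreover from this have "Q = 0" using PQ(1) assms(2) by (auto simp: poly_pairs_def functional_dual_def poly_eq_iff)
  ultimately show "w = 0" using PQ by simp
qed

text \<open>The relation p of least degree prescribes g by q(x) + p'(x) g = 0, where q holds the
  derivatives of the coefficients of p. Every other relation of x reduces to this one by
  pseudo-division.\<close>

lemma functional_dual_adjoin_algebraic:
  assumes \<Gamma>: "dual_ring \<Gamma>" "functional_dual \<Gamma>" and alg: "algebraic_over (fst ` \<Gamma>) x"
  shows "\<exists>g. functional_dual (dual_adjoin \<Gamma> x g)"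
proof -
  have sub: "is_subring (fst ` \<Gamma>)" by (rule fst_dual_ring_subring[OF \<Gamma>(1)])
  define R where "R n \<longleftrightarrow> (\<exists>q. q \<noteq> 0 \<and> (\<forall>i. Polynomial.coeff q i \<in> fst ` \<Gamma>) \<and> Polynomial.poly q x = 0 \<and> Polynomial.degree q = n)" for n
  have "\<exists>n. R n" using alg unfolding algebraic_over_def R_def by blast
  then have "R (Least R)" by (metis LeastI)
  then obtain p where p: "p \<noteq> 0" "\<And>i. Polynomial.coeff p i \<in> fst ` \<Gamma>" "Polynomial.poly p x = 0" "Polynomial.degree p = Least R"
    unfolding R_def by blast
  have min: "P = 0" if "\<And>i. Polynomial.coeff P i \<in> fst ` \<Gamma>" "Polynomial.poly P x = 0" "Polynomial.degree P < Polynomial.degree p" for P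
    using that p(4) not_less_Least[of "Polynomial.degree P" R] unfolding R_def by auto
  obtain q where pq: "(p, q) \<in> poly_pairs \<Gamma>" using poly_pairs_exists[OF \<Gamma>(1) p(2)] by blast
  have sep: "Polynomial.poly (pderiv p) x \<noteq> 0"
  proof
    assume 0: "Polynomial.poly (pderiv p) x = 0"
    have deg: "Polynomial.degree p \<noteq> 0" using p(1,3) by (metis degree_eq_zeroE pCons_0_0 poly_const_conv)
    have "Polynomial.coeff (pderiv p) i \<in> fst ` \<Gamma>" for i
      using p(2)[of "Suc i"] is_subring_of_nat[OF sub, of "Suc i"] is_subringD(4)[OF sub] by (simp add: coeff_pderiv)
    then have "pderiv p = 0" using 0 deg by (intro min) (auto simp: degree_pderiv)
    then show False using deg by (simp add: pderiv_eq_0_iff)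
  qed
  define g where "g = - Polynomial.poly q x / Polynomial.poly (pderiv p) x"
  define ev where "ev P Q = Polynomial.poly Q x + Polynomial.poly (pderiv P) x * g" for P Q
  have ev_p: "ev p q = 0" using sep by (simp add: ev_def g_def)
  have main: "ev P Q = 0" if "(P, Q) \<in> poly_pairs \<Gamma>" "Polynomial.poly P x = 0" for P Q
    using that
  proof (induction "Polynomial.degree P" arbitrary: P Q rule: less_induct)
    case less
    have P_in: "Polynomial.coeff P i \<in> fst ` \<Gamma>" for i
      using less.prems(1) by (auto simp: poly_pairs_def intro: image_eqI[of _ _ "(Polynomial.coeff P i, Polynomial.coeff Q i)"])
    show ?case
    proof (cases "Polynomial.degree P < Polynomial.degree p")
      case True
      then have "P = 0" using min[OF P_in less.prems(2)] by blast
      moreover from this have "Q = 0" using less.prems(1) \<Gamma>(2) by (auto simp: poly_pairs_def functional_dual_def poly_eq_iff)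
      ultimately show ?thesis by (simp add: ev_def)
    next
      case False
      define n where "n = Polynomial.degree P"
      define e where "e = n - Polynomial.degree p"
      have n: "n = Polynomial.degree p + e" using False by (simp add: n_def e_def)
      define c c' where "c = lead_coeff p" and "c' = Polynomial.coeff q (Polynomial.degree p)"
      define a a' where "a = lead_coeff P" and "a' = Polynomial.coeff Q n"
      have c: "(c, c') \<in> \<Gamma>" "(a, a') \<in> \<Gamma>" "c \<noteq> 0"
        using pq less.prems(1) p(1) by (auto simp: c_def c'_def a_def a'_def n_def poly_pairs_def)
      have pos: "Polynomial.degree p \<noteq> 0" using p(1,3) by (metis degree_eq_zeroE pCons_0_0 poly_const_conv)
      \<comment> \<open>One step of pseudo-division by p, carried out over the dual numbers: c P - a
        X^e p, with the second component given by the product rule. The leading terms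
        cancel.\<close>
      define P1 where "P1 = Polynomial.monom c 0 * P + - (Polynomial.monom a e * p)"
      define Q1 where "Q1 = (Polynomial.monom c 0 * Q + Polynomial.monom c' 0 * P) +
         - (Polynomial.monom a e * q + Polynomial.monom a' e * p)"
      have PQ1: "(P1, Q1) \<in> poly_pairs \<Gamma>"
        unfolding P1_def Q1_def
        by (intro poly_pairs_add poly_pairs_minus poly_pairs_mult poly_pairs_monom \<Gamma> c pq less.prems)
      have root: "Polynomial.poly P1 x = 0" using less.prems(2) p(3) by (simp add: P1_def)
      have "Polynomial.degree P1 < n \<or> P1 = 0"
      proof (cases "P1 = 0")
        case nz: False
        have "Polynomial.degree (Polynomial.monom a e * p) \<le> n"
          using degree_mult_le[of "Polynomial.monom a e" p] degree_monom_le[of a e] n by linarith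
        moreover have "Polynomial.degree (Polynomial.monom c 0 * P) \<le> n"
          using degree_mult_le[of "Polynomial.monom c 0" P] by (simp add: degree_monom_eq n_def monom_0)
        ultimately have "Polynomial.degree P1 \<le> n" unfolding P1_def by (intro degree_add_le) simp_all
        moreover have "Polynomial.coeff P1 n = 0"
          proof -
          have "Polynomial.coeff (Polynomial.monom a e * p) n = a * c"
            unfolding coeff_monom_mult using n by (simp add: c_def)
          moreover have "Polynomial.coeff (Polynomial.monom c 0 * P) n = c * a"
            unfolding coeff_monom_mult by (simp add: a_def n_def)
          ultimately show ?thesis unfolding P1_def by simp
        qed
        moreover from calculation nz have "Polynomial.degree P1 \<noteq> n" using leading_coeff_neq_0[OF nz] by auto
        ultimately show ?thesis by simp
      qed simp
      then have "ev P1 Q1 = 0"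
      proof
        assume "Polynomial.degree P1 < n"
        then show ?thesis using less.hyps[OF _ PQ1 root] by (simp add: n_def)
      next
        assume "P1 = 0"
        moreover from this have "Q1 = 0" using PQ1 \<Gamma>(2) by (auto simp: poly_pairs_def functional_dual_def poly_eq_iff)
        ultimately show ?thesis by (simp add: ev_def)
      qed
      moreover have "ev P1 Q1 = c * ev P Q - Polynomial.poly (Polynomial.monom a e) x * ev p q
         + c' * Polynomial.poly P x - Polynomial.poly (Polynomial.monom a' e) x * Polynomial.poly p x
         - Polynomial.poly (pderiv (Polynomial.monom a e)) x * g * Polynomial.poly p x"
        unfolding ev_def P1_def Q1_def
        by (simp add: pderiv_add pderiv_minus pderiv_diff pderiv_mult pderiv_smult monom_0 algebra_simps)
      ultimately have "c * ev P Q = 0" using less.prems(2) p(3) ev_p by simp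
      then show ?thesis using c(3) by simp
    qed
  qed
  then have "functional_dual (dual_adjoin \<Gamma> x g)"
    unfolding functional_dual_def ev_def by (auto elim!: dual_adjoinE)
  then show ?thesis by blast
qed

text \<open>A maximal functional dual ring above \<open>\<Gamma>\<close> is total, since any further
  element can be adjoined. The values may lie anywhere in the field and not only in the domain of
  the given derivation; prescribing derivatives of new variables relies on this.\<close>

theorem derivation_extension:
  assumes \<Gamma>: "dual_ring \<Gamma>" "functional_dual \<Gamma>"
  shows "\<exists>D. derivation D \<and> (\<forall>(x, w)\<in>\<Gamma>. D x = w)"
proof -
  define \<A> where "\<A> = {\<Delta>. \<Gamma> \<subseteq> \<Delta> \<and> dual_ring \<Delta> \<and> functional_dual \<Delta>}"
  have "\<exists>M\<in>\<A>. \<forall>W\<in>\<A>. M \<subseteq> W \<longrightarrow> W = M"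
  proof (rule subset_Zorn_nonempty)
    show "\<A> \<noteq> {}" using \<Gamma> by (auto simp: \<A>_def)
    fix \<C> assume ne: "\<C> \<noteq> {}" and ch: "subset.chain \<A> \<C>"
    have A: "\<And>W. W \<in> \<C> \<Longrightarrow> \<Gamma> \<subseteq> W \<and> dual_ring W \<and> functional_dual W"
      using ch unfolding subset.chain_def \<A>_def by blast
    have two: "\<exists>Z\<in>\<C>. u \<in> Z \<and> v \<in> Z" if "u \<in> \<Union>\<C>" "v \<in> \<Union>\<C>" for u v
      using that ch unfolding subset.chain_def by blast
    obtain X0 where X0: "X0 \<in> \<C>" using ne by blast
    have "dual_ring (\<Union>\<C>)"
      unfolding dual_ring_def
    proof (intro conjI allI impI)
      show "(0, 0) \<in> \<Union>\<C>" "(1, 0) \<in> \<Union>\<C>" using A[OF X0] X0 dual_ringD by blast+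
      fix a w b v assume "(a, w) \<in> \<Union>\<C>" "(b, v) \<in> \<Union>\<C>"
      from two[OF this] obtain Z where Z: "Z \<in> \<C>" "(a, w) \<in> Z" "(b, v) \<in> Z" by blast
      from dual_ringD(3,4)[OF _ Z(2,3)] A[OF Z(1)]
      show "(a + b, w + v) \<in> \<Union>\<C>" "(a * b, a * v + w * b) \<in> \<Union>\<C>" using Z(1) by blast+
    next
      fix a w assume "(a, w) \<in> \<Union>\<C>"
      then show "(- a, - w) \<in> \<Union>\<C>" using A dual_ringD(5) by blast
    qed
    moreover have "functional_dual (\<Union>\<C>)" using A by (auto simp: functional_dual_def)
    ultimately show "\<Union>\<C> \<in> \<A>" using A[OF X0] X0 by (auto simp: \<A>_def)
  qed
  then obtain M where M: "M \<in> \<A>" and max: "\<And>W. W \<in> \<A> \<Longrightarrow> M \<subseteq> W \<Longrightarrow> W = M" by blast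
  have M': "\<Gamma> \<subseteq> M" "dual_ring M" "functional_dual M" using M by (auto simp: \<A>_def)
  have total: "\<exists>w. (x, w) \<in> M" for x
  proof -
    obtain g where "functional_dual (dual_adjoin M x g)"
      using functional_dual_adjoin_transcendental[OF M'(2,3)] functional_dual_adjoin_algebraic[OF M'(2,3)] by blast
    then have "dual_adjoin M x g \<in> \<A>"
      using dual_adjoin_superset[OF M'(2), of x g] dual_ring_adjoin[OF M'(2), of x g] M'(1) by (auto simp: \<A>_def)
    then have "dual_adjoin M x g = M" using max dual_adjoin_superset[OF M'(2)] by blast
    then show ?thesis using dual_adjoin_mem[OF M'(2), of x g] by metis
  qed
  then obtain D where D: "\<And>x. (x, D x) \<in> M" by metis
  have eq: "D x = w" if "(x, w) \<in> M" for x w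
    using functional_dualD[OF M'(2,3) D that] .
  have "derivation D"
    unfolding derivation_def
  proof (intro conjI allI)
    fix x y
    show "D (x + y) = D x + D y" by (rule eq, rule dual_ringD(3)[OF M'(2) D D])
    show "D (x * y) = D x * y + x * D y"
      by (subst add.commute, rule eq, rule dual_ringD(4)[OF M'(2) D D])
  qed
  then show ?thesis using eq M'(1) by blast
qed

section \<open>The closure operator defined by derivations\<close>

text \<open>In characteristic 0 this is the relative algebraic closure of the subfield generated by
  \<open>S\<close>. In terms of derivations, transitivity and exchange become short
  computations.\<close>

definition der_closure :: "'a::field_char_0 set \<Rightarrow> 'a set" where
  "der_closure S = {x. \<forall>D. derivation D \<longrightarrow> (\<forall>s\<in>S. D s = 0) \<longrightarrow> D x = 0}"

lemma der_closureI: "(\<And>D. derivation D \<Longrightarrow> (\<And>s. s \<in> S \<Longrightarrow> D s = 0) \<Longrightarrow> D x = 0) \<Longrightarrow> x \<in> der_closure S"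
  by (simp add: der_closure_def)

lemma der_closureD: "x \<in> der_closure S \<Longrightarrow> derivation D \<Longrightarrow> (\<And>s. s \<in> S \<Longrightarrow> D s = 0) \<Longrightarrow> D x = 0"
  by (simp add: der_closure_def)

lemma der_closure_superset: "S \<subseteq> der_closure S"
  by (auto simp: der_closure_def)

lemma der_closure_least:
  assumes "S \<subseteq> der_closure T"
  shows "der_closure S \<subseteq> der_closure T"
proof
  fix x assume x: "x \<in> der_closure S"
  show "x \<in> der_closure T"
  proof (rule der_closureI)
    fix D assume D: "derivation D" "\<And>s. s \<in> T \<Longrightarrow> D s = 0"
    show "D x = 0"
    proof (rule der_closureD[OF x D(1)])
      fix s assume "s \<in> S"
      then have "s \<in> der_closure T" using assms by blast
      then show "D s = 0" by (rule der_closureD) (use D in auto)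
    qed
  qed
qed

lemma der_closure_mono: "S \<subseteq> T \<Longrightarrow> der_closure S \<subseteq> der_closure T"
  by (auto simp: der_closure_def)

lemma is_subfield_der_closure: "is_subfield (der_closure S)"
proof -
  have "der_closure S = \<Inter>{{x. D x = 0} | D. derivation D \<and> (\<forall>s\<in>S. D s = 0)}"
    by (auto simp: der_closure_def)
  then show ?thesis using is_subfield_Inter derivation_kernel_subfield by (smt (verit) mem_Collect_eq)
qed

lemma gen_field_subset_der_closure: "gen_field L S \<subseteq> der_closure (L \<union> S)"
  by (rule gen_field_minimal[OF is_subfield_der_closure der_closure_superset])

lemma algebraic_imp_der_closure:
  assumes "algebraic_over B x" "B \<subseteq> der_closure S"
  shows "x \<in> der_closure S"
proof (rule der_closureI)
  fix D assume D: "derivation D" "\<And>s. s \<in> S \<Longrightarrow> D s = 0"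
  show "D x = 0"
  proof (rule derivation_algebraic_eq_0[OF D(1) _ assms(1)])
    fix b assume "b \<in> B"
    then have "b \<in> der_closure S" using assms(2) by blast
    then show "D b = 0" by (rule der_closureD) (use D in auto)
  qed
qed

text \<open>For a transcendental x, adjoining x + \<epsilon> yields a derivation that vanishes on M
  and takes the value 1 at x.\<close>

lemma der_closure_imp_algebraic:
  fixes M :: "'a::field_char_0 set"
  assumes M: "is_subring M" and x: "x \<in> der_closure M"
  shows "algebraic_over M x"
proof (rule ccontr)
  assume tr: "\<not> algebraic_over M x"
  define \<Gamma> where "\<Gamma> = (\<lambda>a. (a, 0 :: 'a)) ` M"
  note D = is_subringD[OF M]
  have \<Gamma>: "(a, w) \<in> \<Gamma> \<longleftrightarrow> a \<in> M \<and> w = 0" for a w by (auto simp: \<Gamma>_def)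
  have "dual_ring \<Gamma>" "functional_dual \<Gamma>" using D by (auto simp: dual_ring_def functional_dual_def \<Gamma>)
  moreover have "fst ` \<Gamma> = M" by (force simp: \<Gamma>_def)
  ultimately have "functional_dual (dual_adjoin \<Gamma> x 1)"
    using functional_dual_adjoin_transcendental[of \<Gamma> x 1] tr by simp
  from derivation_extension[OF dual_ring_adjoin[OF \<open>dual_ring \<Gamma>\<close>] this]
  obtain D where D: "derivation D" "\<forall>(x, w)\<in>dual_adjoin \<Gamma> x 1. D x = w" by blast
  have "D x = 1" using bspec[OF D(2) dual_adjoin_mem[OF \<open>dual_ring \<Gamma>\<close>, of x 1]] by simp
  moreover have "D a = 0" if "a \<in> M" for a
  proof -
    have "(a, 0) \<in> dual_adjoin \<Gamma> x 1"
      using dual_adjoin_superset[OF \<open>dual_ring \<Gamma>\<close>, of x 1] that \<Gamma>[of a 0] by blast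
    from bspec[OF D(2) this] show ?thesis by simp
  qed
  then have "D x = 0" by (rule der_closureD[OF x D(1)])
  ultimately show False by simp
qed

lemma der_closure_gen_field: "x \<in> der_closure (L \<union> S) \<Longrightarrow> algebraic_over (gen_field L S) x"
  by (rule der_closure_imp_algebraic[OF is_subfield_imp_is_subring[OF is_subfield_gen_field]])
     (use der_closure_mono[OF gen_field_superset] in blast)

text \<open>If D' kills S but not y, then it does not kill x either. Subtracting from D the multiple
  of D' that agrees with D at x leaves a derivation that kills x and S, hence y.\<close>

lemma der_closure_exchange:
  assumes y: "y \<in> der_closure (insert x S)" and ny: "y \<notin> der_closure S"
  shows "x \<in> der_closure (insert y S)"
proof (rule der_closureI)
  fix D assume D: "derivation D" "\<And>s. s \<in> insert y S \<Longrightarrow> D s = 0"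
  obtain D' where D': "derivation D'" "\<And>s. s \<in> S \<Longrightarrow> D' s = 0" "D' y \<noteq> 0"
    using ny by (auto simp: der_closure_def)
  have nx: "D' x \<noteq> 0" using der_closureD[OF y D'(1)] D'(2,3) by auto
  define E where "E z = D z - (D x / D' x) * D' z" for z
  have "derivation E" unfolding derivation_def E_def
    by (simp add: derivationD[OF D(1)] derivationD[OF D'(1)] algebra_simps add_divide_distrib diff_divide_distrib)
  moreover have "E s = 0" if "s \<in> insert x S" for s using that D(2) D'(2) nx by (auto simp: E_def)
  ultimately have "E y = 0" by (rule der_closureD[OF y])
  then show "D x = 0" using D(2)[of y] D'(3) nx by (simp add: E_def)
qed

section \<open>Independent sets and the exchange inequality\<close>

definition der_independent :: "'a::field_char_0 set \<Rightarrow> 'a set \<Rightarrow> bool" where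
  "der_independent L B \<longleftrightarrow> (\<forall>x\<in>B. x \<notin> der_closure (L \<union> (B - {x})))"

lemma der_independent_subset: "der_independent L B \<Longrightarrow> B' \<subseteq> B \<Longrightarrow> der_independent L B'"
  unfolding der_independent_def using der_closure_mono by (meson Diff_mono Un_mono order_refl subset_iff)

text \<open>Steinitz exchange: an element x of B outside G replaces some g in G outside B. Such a g
  is found in a smallest H between B \<inter> G and G whose closure over L contains x; minimality of
  H lets exchange put g into the closure of the new set.\<close>

lemma der_independent_card_le:
  assumes "finite G" "finite B" "der_independent L B" "B \<subseteq> der_closure (L \<union> G)"
  shows "card B \<le> card G"
  using assms
proof (induction "card (B - G)" arbitrary: G rule: less_induct)
  case less
  show ?case
  proof (cases "B \<subseteq> G")
    case True
    then show ?thesis using less by (simp add: card_mono)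
  next
    case False
    then obtain x where x: "x \<in> B" "x \<notin> G" by blast
    define K where "K = B \<inter> G"
    define P where "P n \<longleftrightarrow> (\<exists>H. K \<subseteq> H \<and> H \<subseteq> G \<and> x \<in> der_closure (L \<union> H) \<and> card H = n)" for n
    have "P (card G)" unfolding P_def K_def using less.prems(4) x by blast
    then have "P (Least P)" by (rule LeastI)
    then obtain H where H: "K \<subseteq> H" "H \<subseteq> G" "x \<in> der_closure (L \<union> H)" "card H = Least P"
      unfolding P_def by blast
    have finH: "finite H" using H(2) less.prems(1) finite_subset by blast
    have "x \<notin> der_closure (L \<union> K)"
    proof -
      have "L \<union> K \<subseteq> L \<union> (B - {x})" using x by (auto simp: K_def)
      then show ?thesis using less.prems(3) x(1) der_closure_mono unfolding der_independent_def by blast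
    qed
    then have "H \<noteq> K" using H(3) by blast
    then obtain g where g: "g \<in> H" "g \<notin> K" using H(1) by blast
    have nx: "x \<notin> der_closure (L \<union> (H - {g}))"
    proof
      assume "x \<in> der_closure (L \<union> (H - {g}))"
      moreover have "K \<subseteq> H - {g}" "H - {g} \<subseteq> G" using H(1,2) g by auto
      ultimately have "P (card (H - {g}))" unfolding P_def by (intro exI[of _ "H - {g}"] conjI refl)
      then have "Least P \<le> card (H - {g})" by (rule Least_le)
      moreover have "card (H - {g}) < card H" using g(1) finH by (rule card_Diff1_less[rotated])
      ultimately show False using H(4) by simp
    qed
    have "insert g (L \<union> (H - {g})) = L \<union> H" using g(1) by auto
    then have "g \<in> der_closure (insert x (L \<union> (H - {g})))"
      using der_closure_exchange[OF _ nx] H(3) by simp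
    moreover have "insert x (L \<union> (H - {g})) \<subseteq> L \<union> insert x (G - {g})" using H(2) by auto
    ultimately have gin: "g \<in> der_closure (L \<union> insert x (G - {g}))"
      using der_closure_mono by blast
    define G' where "G' = insert x (G - {g})"
    have gG: "g \<in> G" using g H(2) by blast
    have cardG': "card G' = card G"
      using card.remove[OF less.prems(1) gG] x less.prems(1) by (simp add: G'_def)
    have "L \<union> G \<subseteq> der_closure (L \<union> G')"
      using gin der_closure_superset[of "L \<union> G'"] by (auto simp: G'_def)
    then have "B \<subseteq> der_closure (L \<union> G')" using less.prems(4) der_closure_least by blast
    moreover have "card (B - G') < card (B - G)"
    proof (rule psubset_card_mono)
      show "finite (B - G)" using less.prems(2) by simp
      show "B - G' \<subset> B - G" using x g gG by (auto simp: G'_def K_def)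
    qed
    moreover have "finite G'" using less.prems(1) by (simp add: G'_def)
    ultimately have "card B \<le> card G'" using less.hyps less.prems by blast
    then show ?thesis using cardG' by simp
  qed
qed

section \<open>Evaluation of multivariate polynomials\<close>

definition is_ring_hom :: "('a::comm_ring_1 \<Rightarrow> 'b::comm_ring_1) \<Rightarrow> bool" where
  "is_ring_hom h \<longleftrightarrow> h 0 = 0 \<and> h 1 = 1 \<and> (\<forall>x y. h (x + y) = h x + h y) \<and> (\<forall>x y. h (x * y) = h x * h y)"

lemma is_ring_homD:
  assumes "is_ring_hom h"
  shows "h 0 = 0" "h 1 = 1" "h (x + y) = h x + h y" "h (x * y) = h x * h y"
  using assms by (auto simp: is_ring_hom_def)

lemma is_ring_hom_minus: assumes "is_ring_hom h" shows "h (- x) = - h x"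
  using is_ring_homD(3)[OF assms, of x "- x"] is_ring_homD(1)[OF assms]
  by (simp add: eq_neg_iff_add_eq_0 add.commute)

lemma is_ring_hom_id: "is_ring_hom (\<lambda>x. x)"
  by (simp add: is_ring_hom_def)

lemma is_ring_hom_eq_0:
  fixes h :: "'a::field \<Rightarrow> 'b::comm_ring_1"
  assumes "is_ring_hom h" "(0::'b) \<noteq> 1"
  shows "h x = 0 \<longleftrightarrow> x = 0"
proof
  assume "h x = 0"
  show "x = 0"
  proof (rule ccontr)
    assume "x \<noteq> 0"
    then have "h x * h (inverse x) = 1" using is_ring_homD(2,4)[OF assms(1)] by (metis right_inverse)
    then show False using \<open>h x = 0\<close> assms(2) by simp
  qed
qed (simp add: is_ring_homD(1)[OF assms(1)])

definition monomial_eval :: "('v \<Rightarrow> 'b::comm_ring_1) \<Rightarrow> ('v \<Rightarrow>\<^sub>0 nat) \<Rightarrow> 'b" where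
  "monomial_eval y u = (\<Prod>v\<in>Poly_Mapping.keys u. y v ^ Poly_Mapping.lookup u v)"

text \<open>The coefficients are mapped by \<open>h\<close> as well, so that one polynomial can be
  compared at points of different fields.\<close>

definition meval :: "('a::comm_ring_1 \<Rightarrow> 'b::comm_ring_1) \<Rightarrow> ('v \<Rightarrow> 'b) \<Rightarrow> ('v, 'a) mpoly \<Rightarrow> 'b" where
  "meval h y f = (\<Sum>u\<in>Poly_Mapping.keys f. h (Poly_Mapping.lookup f u) * monomial_eval y u)"

lemma mpoly_eval_eq_meval: "mpoly_eval y f = meval (\<lambda>x. x) y f"
  by (simp add: mpoly_eval_def meval_def monomial_eval_def)

lemma monomial_eval_superset:
  assumes "finite V" "Poly_Mapping.keys u \<subseteq> V"
  shows "monomial_eval y u = (\<Prod>v\<in>V. y v ^ Poly_Mapping.lookup u v)"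
  unfolding monomial_eval_def
  by (rule prod.mono_neutral_left) (use assms in \<open>auto simp: in_keys_iff\<close>)

lemma monomial_eval_add: "monomial_eval y (u + w) = monomial_eval y u * monomial_eval y w"
proof -
  define V where "V = Poly_Mapping.keys u \<union> Poly_Mapping.keys w"
  have V: "finite V" "Poly_Mapping.keys u \<subseteq> V" "Poly_Mapping.keys w \<subseteq> V" "Poly_Mapping.keys (u + w) \<subseteq> V"
    using Poly_Mapping.keys_add[of u w] by (auto simp: V_def)
  show ?thesis
    by (simp add: monomial_eval_superset[OF V(1,2)] monomial_eval_superset[OF V(1,3)]
        monomial_eval_superset[OF V(1,4)] lookup_add power_add prod.distrib)
qed

lemma monomial_eval_0 [simp]: "monomial_eval y 0 = 1"
  by (simp add: monomial_eval_def)

lemma monomial_eval_single [simp]: "monomial_eval y (Poly_Mapping.single v n) = y v ^ n"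
  by (cases "n = 0") (simp_all add: monomial_eval_def)

lemma meval_0 [simp]: "meval h y 0 = 0"
  by (simp add: meval_def)

lemma meval_superset:
  assumes "h 0 = 0" "finite U" "Poly_Mapping.keys f \<subseteq> U"
  shows "meval h y f = (\<Sum>u\<in>U. h (Poly_Mapping.lookup f u) * monomial_eval y u)"
  unfolding meval_def
  by (rule sum.mono_neutral_left) (use assms in \<open>auto simp: in_keys_iff\<close>)

lemma meval_add:
  assumes "is_ring_hom h"
  shows "meval h y (f + g) = meval h y f + meval h y g"
proof -
  define V where "V = Poly_Mapping.keys f \<union> Poly_Mapping.keys g"
  have V: "finite V" "Poly_Mapping.keys f \<subseteq> V" "Poly_Mapping.keys g \<subseteq> V" "Poly_Mapping.keys (f + g) \<subseteq> V"
    using Poly_Mapping.keys_add[of f g] by (auto simp: V_def)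
  note h0 = is_ring_homD(1)[OF assms]
  show ?thesis
    unfolding meval_superset[where f = f and h = h, OF h0 V(1,2)] meval_superset[where f = g and h = h, OF h0 V(1,3)]
      meval_superset[where f = "f + g" and h = h, OF h0 V(1,4)]
    by (simp add: lookup_add is_ring_homD[OF assms] distrib_right sum.distrib)
qed

lemma meval_sum:
  assumes "is_ring_hom h"
  shows "meval h y (sum f A) = (\<Sum>i\<in>A. meval h y (f i))"
  by (induction A rule: infinite_finite_induct) (simp_all add: meval_add[OF assms])

lemma meval_single:
  assumes "is_ring_hom h"
  shows "meval h y (Poly_Mapping.single u c) = h c * monomial_eval y u"
  by (cases "c = 0") (simp_all add: meval_def is_ring_homD(1)[OF assms])

lemma mpoly_eq_sum_singles:
  "f = (\<Sum>u\<in>Poly_Mapping.keys f. Poly_Mapping.single u (Poly_Mapping.lookup f u))"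
  by (rule poly_mapping_eqI) (simp add: lookup_sum lookup_single when_def in_keys_iff sum.delta)

lemma mpoly_mult_eq_sum_singles:
  "f * g = (\<Sum>u\<in>Poly_Mapping.keys f. \<Sum>w\<in>Poly_Mapping.keys g.
     Poly_Mapping.single (u + w) (Poly_Mapping.lookup f u * Poly_Mapping.lookup g w))"
proof -
  have "f * g = (\<Sum>u\<in>Poly_Mapping.keys f. Poly_Mapping.single u (Poly_Mapping.lookup f u)) *
      (\<Sum>w\<in>Poly_Mapping.keys g. Poly_Mapping.single w (Poly_Mapping.lookup g w))"
    using mpoly_eq_sum_singles[of f] mpoly_eq_sum_singles[of g] by simp
  then show ?thesis by (simp add: sum_product mult_single)
qed

lemma meval_mult:
  assumes "is_ring_hom h"
  shows "meval h y (f * g) = meval h y f * meval h y g"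
  unfolding mpoly_mult_eq_sum_singles[of f g]
  by (simp add: meval_sum[OF assms] meval_single[OF assms] monomial_eval_add is_ring_homD[OF assms])
     (simp add: meval_def sum_product algebra_simps)

section \<open>Polynomials with restricted coefficients and variables\<close>

lemma mpolys_overI:
  assumes "\<And>u. Poly_Mapping.lookup f u \<in> L"
    "\<And>u v. u \<in> Poly_Mapping.keys f \<Longrightarrow> v \<in> Poly_Mapping.keys u \<Longrightarrow> v \<in> Y"
  shows "f \<in> mpolys_over L Y"
  using assms by (auto simp: mpolys_over_def)

lemma mpolys_overD:
  assumes "f \<in> mpolys_over L Y"
  shows "Poly_Mapping.lookup f u \<in> L"
    "u \<in> Poly_Mapping.keys f \<Longrightarrow> v \<in> Poly_Mapping.keys u \<Longrightarrow> v \<in> Y"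
  using assms unfolding mpolys_over_def by blast+

lemma mpolys_over_0: "0 \<in> L \<Longrightarrow> 0 \<in> mpolys_over L Y"
  by (simp add: mpolys_over_def)

lemma mpolys_over_single:
  "0 \<in> L \<Longrightarrow> c \<in> L \<Longrightarrow> Poly_Mapping.keys u \<subseteq> Y \<Longrightarrow> Poly_Mapping.single u c \<in> mpolys_over L Y"
  by (auto simp: mpolys_over_def lookup_single when_def)

lemma mpolys_over_add:
  assumes "is_subring L" "f \<in> mpolys_over L Y" "g \<in> mpolys_over L Y"
  shows "f + g \<in> mpolys_over L Y"
proof (rule mpolys_overI)
  show "Poly_Mapping.lookup (f + g) u \<in> L" for u
    unfolding lookup_add by (rule is_subringD(3)[OF assms(1)]) (rule mpolys_overD(1)[OF assms(2)] mpolys_overD(1)[OF assms(3)])+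
  show "v \<in> Y" if "u \<in> Poly_Mapping.keys (f + g)" "v \<in> Poly_Mapping.keys u" for u v
    using that Poly_Mapping.keys_add[of f g] mpolys_overD(2)[OF assms(2)] mpolys_overD(2)[OF assms(3)] by blast
qed

lemma mpolys_over_sum:
  assumes "is_subring L" "\<And>i. i \<in> A \<Longrightarrow> f i \<in> mpolys_over L Y"
  shows "sum f A \<in> mpolys_over L Y"
  using assms(2)
  by (induction A rule: infinite_finite_induct)
     (auto simp: mpolys_over_0 is_subringD[OF assms(1)] mpolys_over_add[OF assms(1)])

lemma mpolys_over_mult:
  assumes "is_subring L" "f \<in> mpolys_over L Y" "g \<in> mpolys_over L Y"
  shows "f * g \<in> mpolys_over L Y"
  unfolding mpoly_mult_eq_sum_singles[of f g]
proof (intro mpolys_over_sum[OF assms(1)] mpolys_over_single)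
  fix u w assume uw: "u \<in> Poly_Mapping.keys f" "w \<in> Poly_Mapping.keys g"
  show "Poly_Mapping.lookup f u * Poly_Mapping.lookup g w \<in> L"
    using assms is_subringD(4)[OF assms(1)] by (auto simp: mpolys_over_def)
  show "Poly_Mapping.keys (u + w) \<subseteq> Y"
    using uw Poly_Mapping.keys_add[of u w] mpolys_overD(2)[OF assms(2)] mpolys_overD(2)[OF assms(3)] by blast
qed (rule is_subringD(1)[OF assms(1)])

lemma mpolys_over_mono: "L \<subseteq> L' \<Longrightarrow> Y \<subseteq> Y' \<Longrightarrow> mpolys_over L Y \<subseteq> mpolys_over L' Y'"
  unfolding mpolys_over_def by blast

lemma meval_in_subring:
  assumes "is_subring B" "h ` L \<subseteq> B" "y ` Y \<subseteq> B" "f \<in> mpolys_over L Y"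
  shows "meval h y f \<in> B"
  unfolding meval_def monomial_eval_def
proof (intro is_subring_sum[OF assms(1)] is_subringD(4)[OF assms(1)] is_subring_prod[OF assms(1)]
      is_subring_power[OF assms(1)])
  fix u assume u: "u \<in> Poly_Mapping.keys f"
  show "h (Poly_Mapping.lookup f u) \<in> B" using mpolys_overD(1)[OF assms(4)] assms(2) by blast
  fix v assume "v \<in> Poly_Mapping.keys u"
  then show "y v \<in> B" using mpolys_overD(2)[OF assms(4) u] assms(3) by blast
qed

text \<open>Collecting monomials by their exponent of v turns f into a polynomial in v with
  coefficients free of v; adjoining one variable to an independent family rests on this.\<close>

lemma mpolys_over_insert_decomp:
  assumes L: "is_subring L" and f: "f \<in> mpolys_over L (insert v Y)" and v: "v \<notin> Y"
  obtains N g where "\<And>i. g i \<in> mpolys_over L Y"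
    "f = (\<Sum>i\<le>N. g i * Poly_Mapping.single (Poly_Mapping.single v i) 1)"
proof -
  define r where "r u = Poly_Mapping.update v 0 u" for u :: "'b \<Rightarrow>\<^sub>0 nat"
  have r: "r u + Poly_Mapping.single v (Poly_Mapping.lookup u v) = u" for u
    by (rule poly_mapping_eqI) (auto simp: r_def lookup_add lookup_update lookup_single when_def)
  define N where "N = Max (insert 0 ((\<lambda>u. Poly_Mapping.lookup u v) ` Poly_Mapping.keys f))"
  define g where "g i = (\<Sum>u\<in>{u \<in> Poly_Mapping.keys f. Poly_Mapping.lookup u v = i}.
    Poly_Mapping.single (r u) (Poly_Mapping.lookup f u))" for i
  have "g i \<in> mpolys_over L Y" for i
    unfolding g_def
  proof (rule mpolys_over_sum[OF L], rule mpolys_over_single)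
    fix u assume "u \<in> {u \<in> Poly_Mapping.keys f. Poly_Mapping.lookup u v = i}"
    then show "Poly_Mapping.keys (r u) \<subseteq> Y" using f v by (auto simp: r_def keys_update mpolys_over_def)
    show "Poly_Mapping.lookup f u \<in> L" using f by (auto simp: mpolys_over_def)
  qed (rule is_subringD(1)[OF L])
  moreover have "f = (\<Sum>i\<le>N. g i * Poly_Mapping.single (Poly_Mapping.single v i) 1)"
  proof -
    have "g i * Poly_Mapping.single (Poly_Mapping.single v i) 1
        = (\<Sum>u\<in>{u \<in> Poly_Mapping.keys f. Poly_Mapping.lookup u v = i}. Poly_Mapping.single u (Poly_Mapping.lookup f u))" for i
      unfolding g_def sum_distrib_right
      by (rule sum.cong) (use r in \<open>auto simp: mult_single\<close>)
    moreover have "(\<Sum>i\<le>N. \<Sum>u\<in>{u \<in> Poly_Mapping.keys f. Poly_Mapping.lookup u v = i}. Poly_Mapping.single u (Poly_Mapping.lookup f u))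
        = (\<Sum>u\<in>Poly_Mapping.keys f. Poly_Mapping.single u (Poly_Mapping.lookup f u))"
      by (rule sum.group) (auto simp: N_def)
    ultimately show ?thesis using mpoly_eq_sum_singles[of f] by simp
  qed
  ultimately show thesis using that by blast
qed

lemma lookup_mult_single_power:
  fixes g :: "('v, 'a::comm_ring_1) mpoly"
  assumes "\<And>u. u \<in> Poly_Mapping.keys g \<Longrightarrow> Poly_Mapping.lookup u v = 0" "Poly_Mapping.lookup w v = 0"
  shows "Poly_Mapping.lookup (g * Poly_Mapping.single (Poly_Mapping.single v j) 1) (w + Poly_Mapping.single v i)
    = (if i = j then Poly_Mapping.lookup g w else 0)"
proof -
  have eq: "u + Poly_Mapping.single v j = w + Poly_Mapping.single v i \<longleftrightarrow> u = w \<and> i = j"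
    if "u \<in> Poly_Mapping.keys g" for u
  proof
    assume *: "u + Poly_Mapping.single v j = w + Poly_Mapping.single v i"
    have "Poly_Mapping.lookup (u + Poly_Mapping.single v j) v = Poly_Mapping.lookup (w + Poly_Mapping.single v i) v"
      using * by simp
    then have "i = j" using assms that by (simp add: lookup_add)
    with * show "u = w \<and> i = j" by (metis add_right_imp_eq)
  qed simp
  have "g * Poly_Mapping.single (Poly_Mapping.single v j) 1
      = (\<Sum>u\<in>Poly_Mapping.keys g. Poly_Mapping.single (u + Poly_Mapping.single v j) (Poly_Mapping.lookup g u))"
    by (subst mpoly_eq_sum_singles[of g]) (simp add: sum_distrib_right mult_single)
  then have "Poly_Mapping.lookup (g * Poly_Mapping.single (Poly_Mapping.single v j) 1) (w + Poly_Mapping.single v i)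
      = (\<Sum>u\<in>Poly_Mapping.keys g. if u = w \<and> i = j then Poly_Mapping.lookup g u else 0)"
    by (simp add: lookup_sum lookup_single when_def eq cong: sum.cong)
  also have "\<dots> = (if i = j then Poly_Mapping.lookup g w else 0)"
    by (auto simp: sum.delta in_keys_iff)
  finally show ?thesis .
qed

lemma mpolys_over_insert_unique:
  fixes g :: "nat \<Rightarrow> ('v, 'a::comm_ring_1) mpoly"
  assumes "\<And>i. g i \<in> mpolys_over L Y" "v \<notin> Y" "i \<le> N"
    "(\<Sum>i\<le>N. g i * Poly_Mapping.single (Poly_Mapping.single v i) 1) = 0"
  shows "g i = 0"
proof (rule poly_mapping_eqI)
  fix w
  have z: "Poly_Mapping.lookup u v = 0" if "u \<in> Poly_Mapping.keys (g j)" for u j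
  proof -
    have "Poly_Mapping.keys u \<subseteq> Y" using assms(1)[of j] that by (auto simp: mpolys_over_def)
    then show ?thesis using assms(2) by (auto simp: in_keys_iff)
  qed
  show "Poly_Mapping.lookup (g i) w = Poly_Mapping.lookup 0 w"
  proof (cases "Poly_Mapping.lookup w v = 0")
    case True
    have "0 = Poly_Mapping.lookup (\<Sum>j\<le>N. g j * Poly_Mapping.single (Poly_Mapping.single v j) 1) (w + Poly_Mapping.single v i)"
      using assms(4) by simp
    also have "\<dots> = (\<Sum>j\<le>N. if i = j then Poly_Mapping.lookup (g j) w else 0)"
      unfolding lookup_sum by (rule sum.cong) (simp_all add: lookup_mult_single_power[OF z True])
    also have "\<dots> = Poly_Mapping.lookup (g i) w" using assms(3) by simp
    finally show ?thesis by simp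
  next
    case False
    then have "w \<notin> Poly_Mapping.keys (g i)" using z[of w i] by auto
    then show ?thesis by (simp add: in_keys_iff)
  qed
qed

section \<open>Algebraic independence and transcendence degree\<close>

text \<open>Indexed by variables instead of stated for a set of values, because distinct jets may
  have equal values; injectivity then follows from independence.\<close>

definition alg_indep_family :: "'a::field_char_0 set \<Rightarrow> ('v \<Rightarrow> 'a) \<Rightarrow> 'v set \<Rightarrow> bool" where
  "alg_indep_family L x N \<longleftrightarrow> (\<forall>f\<in>mpolys_over L N. mpoly_eval x f = 0 \<longrightarrow> f = 0)"

lemma alg_independent_eq_family: "alg_independent L B = alg_indep_family L (\<lambda>x. x) B"
  by (simp add: alg_independent_def alg_indep_family_def)

lemma alg_indep_family_subset: "alg_indep_family L x N \<Longrightarrow> N' \<subseteq> N \<Longrightarrow> alg_indep_family L x N'"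
  unfolding alg_indep_family_def using mpolys_over_mono[of L L N' N] by blast

lemma alg_indep_family_empty:
  fixes x :: "'v \<Rightarrow> 'a::field_char_0"
  shows "alg_indep_family L x {}"
  unfolding alg_indep_family_def
proof (intro ballI impI)
  fix f :: "('v, 'a) mpoly" assume f: "f \<in> mpolys_over L {}" "mpoly_eval x f = 0"
  then have k: "Poly_Mapping.keys f \<subseteq> {0}" by (auto simp: mpolys_over_def)
  then have "mpoly_eval x f = Poly_Mapping.lookup f 0"
    unfolding mpoly_eval_eq_meval by (subst meval_superset[OF _ _ k]) auto
  then have "Poly_Mapping.lookup f 0 = 0" using f(2) by simp
  then show "f = 0" using k by (metis (no_types, lifting) in_keys_iff keys_eq_empty subset_singletonD singletonI)
qed

lemma poly_sum_monom:
  fixes t :: "'a::comm_ring_1"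
  shows "Polynomial.poly (\<Sum>i\<le>N. Polynomial.monom (e i) i) t = (\<Sum>i\<le>N. e i * t ^ i)"
  by (simp add: Polynomial.poly_sum poly_monom)

text \<open>Read a relation as a polynomial in v: its coefficients take the value 0 because x v is
  transcendental, and then vanish identically because N is independent.\<close>

lemma alg_indep_family_insert:
  assumes L: "is_subring L" and N: "alg_indep_family L x N" "v \<notin> N"
    and tr: "\<not> algebraic_over (gen_field L (x ` N)) (x v)"
  shows "alg_indep_family L x (insert v N)"
  unfolding alg_indep_family_def
proof (intro ballI impI)
  fix f assume f: "f \<in> mpolys_over L (insert v N)" "mpoly_eval x f = 0"
  obtain n g where g: "\<And>i. g i \<in> mpolys_over L N"
    "f = (\<Sum>i\<le>n. g i * Poly_Mapping.single (Poly_Mapping.single v i) 1)"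
    using mpolys_over_insert_decomp[OF L f(1) N(2)] by blast
  define e where "e i = mpoly_eval x (g i)" for i
  define P where "P = (\<Sum>i\<le>n. Polynomial.monom (e i) i)"
  have "e i \<in> gen_field L (x ` N)" for i
    unfolding e_def mpoly_eval_eq_meval
    by (rule meval_in_subring[OF is_subfield_imp_is_subring[OF is_subfield_gen_field] _ _ g(1)])
       (use gen_field_superset[of L "x ` N"] in auto)
  then have "Polynomial.coeff P i \<in> gen_field L (x ` N)" for i
    using is_subfieldD(1)[OF is_subfield_gen_field] by (auto simp: P_def coeff_sum)
  moreover have "Polynomial.poly P (x v) = 0"
    using f(2) unfolding P_def poly_sum_monom g(2) mpoly_eval_eq_meval e_def
    by (simp add: meval_sum meval_mult meval_single is_ring_hom_id)
  ultimately have "P = 0" using tr unfolding algebraic_over_def by blast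
  have "g i = 0" if "i \<le> n" for i
  proof -
    have "Polynomial.coeff P i = e i" using that by (simp add: P_def coeff_sum)
    then have "e i = 0" using \<open>P = 0\<close> by simp
    then show ?thesis using N(1) g(1) unfolding alg_indep_family_def e_def by blast
  qed
  then show "f = 0" unfolding g(2) by simp
qed

lemma is_subring_meval_image:
  assumes L: "is_subring L" and h: "is_ring_hom h"
  shows "is_subring (meval h x ` mpolys_over L N)"
  unfolding is_subring_def
proof (intro conjI ballI)
  note D = is_subringD[OF L] is_ring_homD[OF h]
  show "0 \<in> meval h x ` mpolys_over L N" by (rule image_eqI[of _ _ 0]) (simp_all add: mpolys_over_0 D)
  have one: "(1 :: ('a, 'b) mpoly) = Poly_Mapping.single 0 1" by simp
  show "1 \<in> meval h x ` mpolys_over L N"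
    by (rule image_eqI[of _ _ "Poly_Mapping.single 0 1"])
       (simp_all only: meval_single[OF h] mpolys_over_single D monomial_eval_0 keys_zero empty_subsetI mult_1_right)
  fix a assume "a \<in> meval h x ` mpolys_over L N"
  then obtain f where f: "f \<in> mpolys_over L N" "a = meval h x f" by blast
  have "Poly_Mapping.single 0 (- 1) * f \<in> mpolys_over L N"
    by (intro mpolys_over_mult[OF L] mpolys_over_single f D(5)) (simp_all add: D)
  moreover have "meval h x (Poly_Mapping.single 0 (- 1) * f) = - a"
    unfolding meval_mult[OF h] meval_single[OF h] f(2) is_ring_hom_minus[OF h] by (simp add: D)
  ultimately show "- a \<in> meval h x ` mpolys_over L N" by (metis imageI)
  fix b assume "b \<in> meval h x ` mpolys_over L N"
  then obtain g where g: "g \<in> mpolys_over L N" "b = meval h x g" by blast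
  show "a + b \<in> meval h x ` mpolys_over L N"
    by (rule image_eqI[of _ _ "f + g"]) (simp_all add: f g meval_add[OF h] mpolys_over_add[OF L])
  show "a * b \<in> meval h x ` mpolys_over L N"
    by (rule image_eqI[of _ _ "f * g"]) (simp_all add: f g meval_mult[OF h] mpolys_over_mult[OF L])
qed

text \<open>An equation for x v over the generated field can be cleared of denominators. Its
  coefficients are then values of polynomials in the variables N, and these assemble into a relation
  of the whole family.\<close>

lemma alg_indep_family_not_algebraic:
  assumes L: "is_subring L" and N: "alg_indep_family L x (insert v N)" "v \<notin> N"
  shows "\<not> algebraic_over (gen_field L (x ` N)) (x v)"
proof
  assume alg: "algebraic_over (gen_field L (x ` N)) (x v)"
  define B where "B = mpoly_eval x ` mpolys_over L N"
  have B: "is_subring B" unfolding B_def mpoly_eval_eq_meval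
    by (rule is_subring_meval_image[OF L is_ring_hom_id])
  have "L \<union> x ` N \<subseteq> B"
  proof (intro Un_least subsetI)
    fix c assume "c \<in> L"
    then show "c \<in> B" unfolding B_def
      by (intro image_eqI[of _ _ "Poly_Mapping.single 0 c"])
         (simp_all add: mpoly_eval_eq_meval meval_single is_ring_hom_id mpolys_over_single is_subringD[OF L])
  next
    fix c assume "c \<in> x ` N"
    then obtain w where w: "w \<in> N" "c = x w" by blast
    then show "c \<in> B" unfolding B_def
      by (intro image_eqI[of _ _ "Poly_Mapping.single (Poly_Mapping.single w 1) 1"])
         (simp_all add: mpoly_eval_eq_meval meval_single is_ring_hom_id mpolys_over_single is_subringD[OF L])
  qed
  then have "gen_field L (x ` N) \<subseteq> fractions B"
    using gen_field_minimal[OF is_subfield_fractions[OF B]] subset_fractions[OF B] by blast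
  then have "algebraic_over B (x v)"
    using algebraic_over_fractions[OF B] algebraic_over_mono alg by blast
  then obtain q where q: "q \<noteq> 0" "\<And>i. Polynomial.coeff q i \<in> B" "Polynomial.poly q (x v) = 0"
    unfolding algebraic_over_def by blast
  have "\<exists>g\<in>mpolys_over L N. Polynomial.coeff q i = mpoly_eval x g" for i
    using q(2)[of i] unfolding B_def by blast
  then obtain g where g: "\<And>i. g i \<in> mpolys_over L N" "\<And>i. Polynomial.coeff q i = mpoly_eval x (g i)" by metis
  define n where "n = Polynomial.degree q"
  define f where "f = (\<Sum>i\<le>n. g i * Poly_Mapping.single (Poly_Mapping.single v i) 1)"
  have "f \<in> mpolys_over L (insert v N)"
    unfolding f_def using g(1) mpolys_over_mono[of L L N "insert v N"]
    by (intro mpolys_over_sum[OF L] mpolys_over_mult[OF L] mpolys_over_single) (auto simp: is_subringD[OF L])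
  moreover have "mpoly_eval x f = Polynomial.poly q (x v)"
    unfolding poly_altdef f_def mpoly_eval_eq_meval
    by (simp add: meval_sum meval_mult meval_single is_ring_hom_id g(2) mpoly_eval_eq_meval n_def)
  ultimately have "f = 0" using N(1) q(3) unfolding alg_indep_family_def by simp
  then have "g n = 0" using mpolys_over_insert_unique[of g L N v n n] g(1) N(2) unfolding f_def by blast
  then have "lead_coeff q = 0" using g(2)[of n] by (simp add: n_def mpoly_eval_def)
  then show False using q(1) by simp
qed

lemma alg_indep_family_der_closure:
  assumes L: "is_subring L" and N: "alg_indep_family L x N" and v: "v \<in> N"
  shows "x v \<notin> der_closure (L \<union> x ` (N - {v}))"
  using alg_indep_family_not_algebraic[OF L, of x v "N - {v}"] der_closure_gen_field N v
  by (auto simp: insert_absorb)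

lemma alg_indep_family_inj_on:
  assumes L: "is_subring L" and N: "alg_indep_family L x N"
  shows "inj_on x N"
proof (rule inj_onI, rule ccontr)
  fix u v assume "u \<in> N" "v \<in> N" "x u = x v" "u \<noteq> v"
  then have "x v \<in> L \<union> x ` (N - {v})" by (metis Diff_iff UnI2 imageI singletonD)
  then have "x v \<in> der_closure (L \<union> x ` (N - {v}))" by (rule subsetD[OF der_closure_superset])
  then show False using alg_indep_family_der_closure[OF L N \<open>v \<in> N\<close>] by blast
qed

lemma alg_indep_family_der_independent:
  assumes L: "is_subring L" and N: "alg_indep_family L x N"
  shows "der_independent L (x ` N)"
  unfolding der_independent_def
proof
  fix z assume "z \<in> x ` N"
  then obtain v where v: "v \<in> N" "z = x v" by blast
  then have "x ` N - {z} = x ` (N - {v})"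
    using alg_indep_family_inj_on[OF L N] by (auto simp: inj_on_def)
  then show "z \<notin> der_closure (L \<union> (x ` N - {z}))"
    using alg_indep_family_der_closure[OF L N v(1)] v(2) by simp
qed

lemma alg_indep_family_card_le:
  assumes L: "is_subring L" and N: "alg_indep_family L x N" and "finite N" "finite G"
    and "x ` N \<subseteq> der_closure (L \<union> G)"
  shows "card N \<le> card G"
  using der_independent_card_le[OF assms(4) _ alg_indep_family_der_independent[OF L N] assms(5)]
    card_image[OF alg_indep_family_inj_on[OF L N]] assms(3) by simp

lemma alg_indep_family_image:
  assumes L: "is_subring L" and "finite N" "alg_indep_family L x N"
  shows "alg_independent L (x ` N)"
  using assms(2,3)
proof (induction N rule: finite_induct)
  case empty
  then show ?case by (simp add: alg_independent_eq_family alg_indep_family_empty)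
next
  case (insert v N)
  have tr: "\<not> algebraic_over (gen_field L (x ` N)) (x v)"
    by (rule alg_indep_family_not_algebraic[OF L insert.prems insert.hyps(2)])
  have "x v \<notin> x ` N"
    using alg_indep_family_inj_on[OF L insert.prems] insert.hyps(2) by (auto simp: inj_on_def)
  moreover have "alg_indep_family L (\<lambda>x. x) (x ` N)"
    using insert.IH alg_indep_family_subset[OF insert.prems] by (auto simp: alg_independent_eq_family)
  ultimately show ?case
    using alg_indep_family_insert[OF L, of "\<lambda>x. x" "x ` N" "x v"] tr by (simp add: alg_independent_eq_family)
qed

text \<open>\<open>trdeg\<close> picks an arbitrary transcendence basis, which exists because the
  image of N is one. Exchange bounds every finite part of it by \<open>card N\<close>, so it is
  finite, and the opposite comparison gives equality.\<close>

lemma trdeg_eq_card: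
  assumes L: "is_subfield L" and N: "finite N" "alg_indep_family L x N"
    and "x ` N \<subseteq> gen_field L S" "S \<subseteq> der_closure (L \<union> x ` N)"
  shows "trdeg L (gen_field L S) = card N"
proof -
  have L': "is_subring L" by (rule is_subfield_imp_is_subring[OF L])
  define M where "M = gen_field L S"
  have Mcl: "M \<subseteq> der_closure (L \<union> x ` N)"
    unfolding M_def
    by (rule gen_field_minimal[OF is_subfield_der_closure])
       (use assms(5) der_closure_superset[of "L \<union> x ` N"] in blast)
  have "transcendence_basis L M (x ` N)"
    unfolding transcendence_basis_def
    using alg_indep_family_image[OF L' N] assms(4) der_closure_gen_field[OF subsetD[OF Mcl]] by (simp add: M_def)
  then have "transcendence_basis L M (SOME B. transcendence_basis L M B)" by (rule someI)
  then obtain B where B: "B = (SOME B. transcendence_basis L M B)" "B \<subseteq> M"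
    "alg_indep_family L (\<lambda>x. x) B" "\<And>z. z \<in> M \<Longrightarrow> algebraic_over (gen_field L B) z"
    unfolding transcendence_basis_def alg_independent_eq_family by blast
  have ind: "der_independent L B" using alg_indep_family_der_independent[OF L' B(3)] by simp
  have fin: "finite (x ` N)" using N by simp
  have le: "card B' \<le> card N" if "B' \<subseteq> B" "finite B'" for B'
  proof -
    have "card B' \<le> card (x ` N)"
      by (rule der_independent_card_le[OF fin that(2) der_independent_subset[OF ind that(1)]])
         (use Mcl B(2) that in blast)
    then show ?thesis using card_image_le[OF N(1), of x] by simp
  qed
  have "finite B"
  proof (rule ccontr)
    assume "infinite B"
    then obtain B' where "B' \<subseteq> B" "finite B'" "card B' = Suc (card N)"
      using infinite_arbitrarily_large by blast
    then show False using le[of B'] by simp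
  qed
  moreover have "M \<subseteq> der_closure (L \<union> B)"
    by (rule subsetI, rule algebraic_imp_der_closure[OF B(4) gen_field_subset_der_closure])
  then have "x ` N \<subseteq> der_closure (L \<union> B)" using assms(4) unfolding M_def by blast
  ultimately have "card N \<le> card B" using alg_indep_family_card_le[OF L' N(2,1)] by blast
  then have "card B = card N" using le[of B] \<open>finite B\<close> by simp
  then show ?thesis unfolding trdeg_def M_def[symmetric] B(1)[symmetric] .
qed

section \<open>Polynomial expressions\<close>

text \<open>Expressions make total derivatives, substitutions and the translation into terms
  structural recursions, and one expression can be evaluated in several rings.\<close>

datatype (pvars: 'v, pconsts: 'a) pexpr =
    PConst 'a
  | PVar 'v
  | PAdd "('v, 'a) pexpr" "('v, 'a) pexpr"
  | PMul "('v, 'a) pexpr" "('v, 'a) pexpr"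

primrec peval :: "('a \<Rightarrow> 'b::comm_ring_1) \<Rightarrow> ('v \<Rightarrow> 'b) \<Rightarrow> ('v, 'a) pexpr \<Rightarrow> 'b" where
  "peval h y (PConst c) = h c"
| "peval h y (PVar v) = y v"
| "peval h y (PAdd e f) = peval h y e + peval h y f"
| "peval h y (PMul e f) = peval h y e * peval h y f"

definition pexprs :: "'a set \<Rightarrow> 'v set \<Rightarrow> ('v, 'a) pexpr set" where
  "pexprs k Y = {e. pconsts e \<subseteq> k \<and> pvars e \<subseteq> Y}"

lemma pexprs_simps [simp]:
  "PConst c \<in> pexprs k Y \<longleftrightarrow> c \<in> k"
  "PVar v \<in> pexprs k Y \<longleftrightarrow> v \<in> Y"
  "PAdd e f \<in> pexprs k Y \<longleftrightarrow> e \<in> pexprs k Y \<and> f \<in> pexprs k Y"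
  "PMul e f \<in> pexprs k Y \<longleftrightarrow> e \<in> pexprs k Y \<and> f \<in> pexprs k Y"
  by (auto simp: pexprs_def)

lemma pexprs_mono: "Y \<subseteq> Y' \<Longrightarrow> e \<in> pexprs k Y \<Longrightarrow> e \<in> pexprs k Y'"
  by (auto simp: pexprs_def)

lemma finite_pvars: "finite (pvars e)"
  by (induction e) auto

lemma peval_cong: "(\<And>v. v \<in> pvars e \<Longrightarrow> y v = z v) \<Longrightarrow> peval h y e = peval h z e"
  by (induction e) auto

primrec to_mpoly :: "('v, 'a::comm_ring_1) pexpr \<Rightarrow> ('v, 'a) mpoly" where
  "to_mpoly (PConst c) = Poly_Mapping.single 0 c"
| "to_mpoly (PVar v) = Poly_Mapping.single (Poly_Mapping.single v 1) 1"
| "to_mpoly (PAdd e f) = to_mpoly e + to_mpoly f"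
| "to_mpoly (PMul e f) = to_mpoly e * to_mpoly f"

lemma meval_to_mpoly: "is_ring_hom h \<Longrightarrow> meval h y (to_mpoly e) = peval h y e"
  by (induction e) (simp_all add: meval_add meval_mult meval_single is_ring_homD)

lemma to_mpoly_mpolys_over: "is_subring L \<Longrightarrow> e \<in> pexprs L Y \<Longrightarrow> to_mpoly e \<in> mpolys_over L Y"
  by (induction e) (auto intro: mpolys_over_single mpolys_over_add mpolys_over_mult is_subringD)

lemma monomial_pexpr:
  fixes L :: "'a::comm_ring_1 set" and h :: "'a \<Rightarrow> 'b::comm_ring_1"
  assumes "1 \<in> L" "finite V" "V \<subseteq> Y"
  shows "\<exists>e\<in>pexprs L Y. \<forall>(h :: 'a \<Rightarrow> 'b) y. is_ring_hom h \<longrightarrow> peval h y e = (\<Prod>v\<in>V. y v ^ n v)"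
  using assms(2,3)
proof (induction V rule: finite_induct)
  case empty
  then show ?case by (intro bexI[of _ "PConst 1"]) (auto simp: is_ring_homD assms)
next
  case (insert v V)
  then obtain e where e: "e \<in> pexprs L Y" "\<And>(h :: 'a \<Rightarrow> 'b) y. is_ring_hom h \<Longrightarrow> peval h y e = (\<Prod>v\<in>V. y v ^ n v)"
    by auto
  have "\<exists>f\<in>pexprs L Y. \<forall>(h :: 'a \<Rightarrow> 'b) y. is_ring_hom h \<longrightarrow> peval h y f = y v ^ j" for j
  proof (induction j)
    case 0
    then show ?case by (intro bexI[of _ "PConst 1"]) (auto simp: is_ring_homD assms)
  next
    case (Suc j)
    then obtain f where "f \<in> pexprs L Y" "\<And>(h :: 'a \<Rightarrow> 'b) y. is_ring_hom h \<Longrightarrow> peval h y f = y v ^ j" by blast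
    then show ?case using insert.prems by (intro bexI[of _ "PMul (PVar v) f"]) auto
  qed
  then obtain f where f: "f \<in> pexprs L Y" "\<And>(h :: 'a \<Rightarrow> 'b) y. is_ring_hom h \<Longrightarrow> peval h y f = y v ^ n v" by blast
  show ?case using e f insert.hyps by (intro bexI[of _ "PMul f e"]) auto
qed

lemma mpoly_pexpr:
  fixes L :: "'a::comm_ring_1 set" and f :: "('v, 'a) mpoly"
  assumes L: "is_subring L" and f: "f \<in> mpolys_over L Y"
  shows "\<exists>e\<in>pexprs L Y. \<forall>(h :: 'a \<Rightarrow> 'b::comm_ring_1) y. is_ring_hom h \<longrightarrow> peval h y e = meval h y f"
proof -
  have "\<exists>e\<in>pexprs L Y. \<forall>(h :: 'a \<Rightarrow> 'b) y. is_ring_hom h \<longrightarrow>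
      peval h y e = (\<Sum>u\<in>U. h (Poly_Mapping.lookup f u) * monomial_eval y u)"
    if "finite U" "U \<subseteq> Poly_Mapping.keys f" for U
    using that
  proof (induction U rule: finite_induct)
    case empty
    then show ?case using is_subringD[OF L] by (intro bexI[of _ "PConst 0"]) (auto simp: is_ring_homD)
  next
    case (insert u U)
    then obtain e where e: "e \<in> pexprs L Y" "\<And>(h :: 'a \<Rightarrow> 'b) y. is_ring_hom h \<Longrightarrow>
      peval h y e = (\<Sum>u\<in>U. h (Poly_Mapping.lookup f u) * monomial_eval y u)" by auto
    have "Poly_Mapping.keys u \<subseteq> Y" using mpolys_overD(2)[OF f] insert.prems by auto
    from monomial_pexpr[OF is_subringD(2)[OF L] finite_keys this]
    obtain g where g: "g \<in> pexprs L Y" "\<And>(h :: 'a \<Rightarrow> 'b) y. is_ring_hom h \<Longrightarrow>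
      peval h y g = monomial_eval y u" unfolding monomial_eval_def by blast
    show ?case using e g insert.hyps mpolys_overD(1)[OF f]
      by (intro bexI[of _ "PAdd (PMul (PConst (Poly_Mapping.lookup f u)) g) e"]) auto
  qed
  from this[OF finite_keys order_refl] show ?thesis unfolding meval_def .
qed

section \<open>Lists of expressions as coefficient lists of univariate polynomials\<close>

abbreviation Pev :: "('a \<Rightarrow> 'b::comm_ring_1) \<Rightarrow> ('v \<Rightarrow> 'b) \<Rightarrow> ('v, 'a) pexpr list \<Rightarrow> 'b Polynomial.poly" where
  "Pev h y es \<equiv> Poly (map (peval h y) es)"

fun padds :: "('v, 'a) pexpr list \<Rightarrow> ('v, 'a) pexpr list \<Rightarrow> ('v, 'a) pexpr list" where
  "padds [] fs = fs"
| "padds es [] = es"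
| "padds (e # es) (f # fs) = PAdd e f # padds es fs"

primrec pmuls :: "('v, 'a::zero) pexpr list \<Rightarrow> ('v, 'a) pexpr list \<Rightarrow> ('v, 'a) pexpr list" where
  "pmuls [] fs = []"
| "pmuls (e # es) fs = padds (map (PMul e) fs) (PConst 0 # pmuls es fs)"

text \<open>Coefficients with respect to v, lowest first. The last entries may evaluate to 0, so
  lengths only bound degrees.\<close>

primrec pcoeffs :: "'v \<Rightarrow> ('v, 'a::zero_neq_one) pexpr \<Rightarrow> ('v, 'a) pexpr list" where
  "pcoeffs v (PConst c) = [PConst c]"
| "pcoeffs v (PVar w) = (if w = v then [PConst 0, PConst 1] else [PVar w])"
| "pcoeffs v (PAdd e f) = padds (pcoeffs v e) (pcoeffs v f)"
| "pcoeffs v (PMul e f) = pmuls (pcoeffs v e) (pcoeffs v f)"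

lemma length_padds: "length (padds es fs) = max (length es) (length fs)"
  by (induction es fs rule: padds.induct) auto

lemma Pev_padds: "Pev h y (padds es fs) = Pev h y es + Pev h y fs"
  by (induction es fs rule: padds.induct) simp_all

lemma Pev_map_PMul: "Pev h y (map (PMul e) fs) = Polynomial.smult (peval h y e) (Pev h y fs)"
  by (induction fs) simp_all

lemma Pev_pmuls: "is_ring_hom h \<Longrightarrow> Pev h y (pmuls es fs) = Pev h y es * Pev h y fs"
  by (induction es) (simp_all add: Pev_padds Pev_map_PMul is_ring_homD del: map_map)

lemma peval_pcoeffs: "is_ring_hom h \<Longrightarrow> Polynomial.poly (Pev h y (pcoeffs v e)) (y v) = peval h y e"
  by (induction e) (simp_all add: Pev_padds Pev_pmuls is_ring_homD)

lemma set_padds: "set es \<subseteq> pexprs k Y \<Longrightarrow> set fs \<subseteq> pexprs k Y \<Longrightarrow> set (padds es fs) \<subseteq> pexprs k Y"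
  by (induction es fs rule: padds.induct) auto

lemma set_pmuls:
  "0 \<in> k \<Longrightarrow> set es \<subseteq> pexprs k Y \<Longrightarrow> set fs \<subseteq> pexprs k Y \<Longrightarrow> set (pmuls es fs) \<subseteq> pexprs k Y"
proof (induction es)
  case (Cons e es)
  then show ?case by (simp, intro set_padds) auto
qed simp

lemma set_pcoeffs:
  "0 \<in> k \<Longrightarrow> 1 \<in> k \<Longrightarrow> e \<in> pexprs k (insert v Y) \<Longrightarrow> set (pcoeffs v e) \<subseteq> pexprs k Y"
  by (induction e) (simp_all add: set_padds set_pmuls, blast)

text \<open>Turns a relation given by its coefficient list back into a single expression, as
  specialisations and formulas require.\<close>

definition phorner :: "('v, 'a::zero) pexpr \<Rightarrow> ('v, 'a) pexpr list \<Rightarrow> ('v, 'a) pexpr" where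
  "phorner t es = foldr (\<lambda>e acc. PAdd e (PMul t acc)) es (PConst 0)"

lemma peval_phorner: "is_ring_hom h \<Longrightarrow> peval h y (phorner t es) = Polynomial.poly (Pev h y es) (peval h y t)"
  by (induction es) (simp_all add: phorner_def is_ring_homD)

lemma phorner_pexprs: "0 \<in> k \<Longrightarrow> t \<in> pexprs k Y \<Longrightarrow> set es \<subseteq> pexprs k Y \<Longrightarrow> phorner t es \<in> pexprs k Y"
  by (induction es) (simp_all add: phorner_def)

text \<open>The separant: the derivative of \<open>phorner t es\<close> with respect to \<open>t\<close>.\<close>

primrec psep :: "('v, 'a::zero) pexpr \<Rightarrow> ('v, 'a) pexpr list \<Rightarrow> ('v, 'a) pexpr" where
  "psep t [] = PConst 0"
| "psep t (e # es) = PAdd (phorner t es) (PMul t (psep t es))"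

lemma peval_psep: "is_ring_hom h \<Longrightarrow> peval h y (psep t es) = Polynomial.poly (pderiv (Pev h y es)) (peval h y t)"
  by (induction es) (simp_all add: peval_phorner pderiv_pCons is_ring_homD)

lemma psep_pexprs: "0 \<in> k \<Longrightarrow> t \<in> pexprs k Y \<Longrightarrow> set es \<subseteq> pexprs k Y \<Longrightarrow> psep t es \<in> pexprs k Y"
  by (induction es) (simp_all add: phorner_pexprs)

lemma Pev_in:
  assumes "0 \<in> B" "\<And>e. e \<in> set es \<Longrightarrow> peval h y e \<in> B"
  shows "Polynomial.coeff (Pev h y es) i \<in> B"
  using assms by (auto simp: nth_default_def)

lemma Pev_eq_0_iff: "Pev h y es = 0 \<longleftrightarrow> (\<forall>e\<in>set es. peval h y e = 0)"
  by (induction es) auto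

lemma degree_Pev:
  assumes "es \<noteq> []" "peval h y (last es) \<noteq> 0"
  shows "Polynomial.degree (Pev h y es) = length es - 1" "lead_coeff (Pev h y es) = peval h y (last es)"
proof -
  have nd: "nth_default 0 (map (peval h y) es) (length es - 1) = peval h y (last es)"
    using assms(1) by (simp add: nth_default_def last_conv_nth)
  have "Polynomial.degree (Pev h y es) \<le> length es - 1"
    by (rule degree_le) (auto simp: nth_default_def)
  moreover have "length es - 1 \<le> Polynomial.degree (Pev h y es)"
    by (rule le_degree) (use nd assms in simp)
  ultimately show d: "Polynomial.degree (Pev h y es) = length es - 1" by simp
  show "lead_coeff (Pev h y es) = peval h y (last es)" unfolding d using nd by simp
qed

text \<open>For a subring k, the ring generated by the image of k under h and the values of the
  variables in Y.\<close>

definition pval :: "('a \<Rightarrow> 'b::comm_ring_1) \<Rightarrow> 'a set \<Rightarrow> ('v \<Rightarrow> 'b) \<Rightarrow> 'v set \<Rightarrow> 'b set" where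
  "pval h k y Y = peval h y ` pexprs k Y"

lemma is_subring_pval:
  assumes k: "is_subring k" and h: "is_ring_hom h"
  shows "is_subring (pval h k y Y)"
  unfolding is_subring_def pval_def
proof (intro conjI ballI)
  note D = is_subringD[OF k] is_ring_homD[OF h]
  show "0 \<in> peval h y ` pexprs k Y" by (rule image_eqI[of _ _ "PConst 0"]) (simp_all add: D)
  show "1 \<in> peval h y ` pexprs k Y" by (rule image_eqI[of _ _ "PConst 1"]) (simp_all add: D)
  fix a assume "a \<in> peval h y ` pexprs k Y"
  then obtain e where e: "e \<in> pexprs k Y" "a = peval h y e" by blast
  show "- a \<in> peval h y ` pexprs k Y"
    by (rule image_eqI[of _ _ "PMul (PConst (- 1)) e"]) (simp_all add: D e is_ring_hom_minus[OF h])
  fix b assume "b \<in> peval h y ` pexprs k Y"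
  then obtain f where f: "f \<in> pexprs k Y" "b = peval h y f" by blast
  show "a + b \<in> peval h y ` pexprs k Y" by (rule image_eqI[of _ _ "PAdd e f"]) (simp_all add: e f)
  show "a * b \<in> peval h y ` pexprs k Y" by (rule image_eqI[of _ _ "PMul e f"]) (simp_all add: e f)
qed

lemma pval_mono: "Y \<subseteq> Y' \<Longrightarrow> pval h k y Y \<subseteq> pval h k y Y'"
  unfolding pval_def using pexprs_mono by blast

lemma pval_subset:
  assumes "is_subring B" "h ` k \<subseteq> B" "y ` Y \<subseteq> B"
  shows "pval h k y Y \<subseteq> B"
proof -
  have "peval h y e \<in> B" if "e \<in> pexprs k Y" for e
    using that by (induction e) (use assms is_subringD[OF assms(1)] in auto)
  then show ?thesis by (auto simp: pval_def)
qed

lemma pval_var: "v \<in> Y \<Longrightarrow> y v \<in> pval h k y Y"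
  unfolding pval_def by (rule image_eqI[of _ _ "PVar v"]) simp_all

lemma pval_const: "c \<in> k \<Longrightarrow> h c \<in> pval h k y Y"
  unfolding pval_def by (rule image_eqI[of _ _ "PConst c"]) simp_all

lemma poly_over_pval:
  assumes "0 \<in> k" "is_ring_hom h" "\<And>i. Polynomial.coeff Q i \<in> pval h k y Y"
  shows "\<exists>es. set es \<subseteq> pexprs k Y \<and> Pev h y es = Q \<and> length es = length (Polynomial.coeffs Q)"
proof -
  have "\<exists>e\<in>pexprs k Y. peval h y e = Polynomial.coeff Q i" for i
    using assms(3)[of i] by (auto simp: pval_def)
  then obtain e where e: "\<And>i. e i \<in> pexprs k Y" "\<And>i. peval h y (e i) = Polynomial.coeff Q i" by metis
  show ?thesis
    by (intro exI[of _ "map e [0..<length (Polynomial.coeffs Q)]"])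
       (auto simp: e(1) poly_eq_iff nth_default_def e(2) coeffs_def coeff_eq_0 simp del: upt_Suc split: if_splits)
qed

section \<open>Specialisations\<close>

text \<open>The assignment \<open>y\<close> specialises \<open>x\<close> on the variables \<open>Y\<close> if \<open>x v \<mapsto> y v\<close> (\<open>v \<in> Y\<close>) extends
  to a ring homomorphism on the ring generated by \<open>k\<close> and \<open>x ` Y\<close>.\<close>

definition specializes :: "'a set \<Rightarrow> ('a::comm_ring_1 \<Rightarrow> 'b::comm_ring_1) \<Rightarrow> ('v \<Rightarrow> 'a) \<Rightarrow> ('v \<Rightarrow> 'b) \<Rightarrow> 'v set \<Rightarrow> bool" where
  "specializes k h x y Y \<longleftrightarrow> (\<forall>e\<in>pexprs k Y. peval (\<lambda>c. c) x e = 0 \<longrightarrow> peval h y e = 0)"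

text \<open>A minimal polynomial of t over the fraction field of the ring of values, with
  denominators cleared. Minimality is stated by list length because coefficient lists may end in
  zeros; the last entry is the initial.\<close>

definition min_relation :: "'a set \<Rightarrow> ('v \<Rightarrow> 'a::field_char_0) \<Rightarrow> 'v set \<Rightarrow> 'a \<Rightarrow> ('v, 'a) pexpr list \<Rightarrow> bool" where
  "min_relation k x Y t es \<longleftrightarrow> set es \<subseteq> pexprs k Y \<and> es \<noteq> [] \<and> peval (\<lambda>c. c) x (last es) \<noteq> 0 \<and>
     Polynomial.poly (Pev (\<lambda>c. c) x es) t = 0 \<and>
     (\<forall>fs. set fs \<subseteq> pexprs k Y \<longrightarrow> length fs < length es \<longrightarrow>
        Polynomial.poly (Pev (\<lambda>c. c) x fs) t = 0 \<longrightarrow> Pev (\<lambda>c. c) x fs = 0)"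

lemma min_relation_exists:
  assumes k: "is_subring k" and alg: "algebraic_over (pval (\<lambda>c. c) k x Y) t"
  shows "\<exists>es. min_relation k x Y t es"
proof -
  define R where "R n \<longleftrightarrow> (\<exists>es. set es \<subseteq> pexprs k Y \<and> Pev (\<lambda>c. c) x es \<noteq> 0 \<and>
    Polynomial.poly (Pev (\<lambda>c. c) x es) t = 0 \<and> length es = n)" for n
  obtain Q where "Q \<noteq> 0" "\<And>i. Polynomial.coeff Q i \<in> pval (\<lambda>c. c) k x Y" "Polynomial.poly Q t = 0"
    using alg unfolding algebraic_over_def by blast
  then have "\<exists>n. R n" unfolding R_def
    using poly_over_pval[OF is_subringD(1)[OF k] is_ring_hom_id, of Q x Y] by metis
  then have "R (Least R)" by (metis LeastI)
  then obtain es where es: "set es \<subseteq> pexprs k Y" "Pev (\<lambda>c. c) x es \<noteq> 0"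
    "Polynomial.poly (Pev (\<lambda>c. c) x es) t = 0" "length es = Least R" unfolding R_def by blast
  have min: "Pev (\<lambda>c. c) x fs = 0" if "set fs \<subseteq> pexprs k Y" "length fs < length es"
    "Polynomial.poly (Pev (\<lambda>c. c) x fs) t = 0" for fs
    using that not_less_Least[of "length fs" R] es(4) unfolding R_def by auto
  have ne: "es \<noteq> []" using es(2) by auto
  have "peval (\<lambda>c. c) x (last es) \<noteq> 0"
  proof
    assume 0: "peval (\<lambda>c. c) x (last es) = 0"
    have "Pev (\<lambda>c. c) x (butlast es @ [last es]) = Pev (\<lambda>c. c) x (butlast es)" using 0 by simp
    then have eq: "Pev (\<lambda>c. c) x es = Pev (\<lambda>c. c) x (butlast es)" using ne by simp
    have "Pev (\<lambda>c. c) x (butlast es) = 0"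
    proof (rule min)
      show "set (butlast es) \<subseteq> pexprs k Y" using es(1) by (auto dest: in_set_butlastD)
      show "length (butlast es) < length es" using ne by (cases es) auto
      show "Polynomial.poly (Pev (\<lambda>c. c) x (butlast es)) t = 0" using es(3) eq by simp
    qed
    then show False using es(2) eq by simp
  qed
  then show ?thesis unfolding min_relation_def using es min ne by blast
qed

lemma min_relation_length:
  assumes "min_relation k x Y t es"
  shows "length es \<ge> 2"
proof (rule ccontr)
  assume "\<not> 2 \<le> length es"
  then obtain e where "es = [e]" using assms unfolding min_relation_def
    by (cases es; cases "tl es") auto
  then show False using assms unfolding min_relation_def by simp
qed

text \<open>In characteristic 0 the formal derivative is a nonzero polynomial with a shorter
  coefficient list, so minimality forbids it to vanish at t.\<close>

lemma min_relation_sep: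
  fixes x :: "'v \<Rightarrow> 'a::field_char_0"
  assumes k: "is_subring k" and m: "min_relation k x Y t es"
  shows "Polynomial.poly (pderiv (Pev (\<lambda>c. c) x es)) t \<noteq> 0"
proof
  let ?P = "Pev (\<lambda>c. c) x es"
  assume 0: "Polynomial.poly (pderiv ?P) t = 0"
  have R: "is_subring (pval (\<lambda>c. c) k x Y)" by (rule is_subring_pval[OF k is_ring_hom_id])
  have es: "es \<noteq> []" "peval (\<lambda>c. c) x (last es) \<noteq> 0" "set es \<subseteq> pexprs k Y" using m by (auto simp: min_relation_def)
  have deg: "Polynomial.degree ?P = length es - 1" by (rule degree_Pev[OF es(1,2)])
  have dn: "Polynomial.degree ?P \<noteq> 0" using deg min_relation_length[OF m] by simp
  have "Polynomial.coeff ?P i \<in> pval (\<lambda>c. c) k x Y" for i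
    by (rule Pev_in[OF is_subringD(1)[OF R]]) (use es(3) in \<open>auto simp: pval_def\<close>)
  then have "Polynomial.coeff (pderiv ?P) i \<in> pval (\<lambda>c. c) k x Y" for i
    unfolding coeff_pderiv by (intro is_subringD(4)[OF R] is_subring_of_nat[OF R])
  from poly_over_pval[OF is_subringD(1)[OF k] is_ring_hom_id this]
  obtain fs where fs: "set fs \<subseteq> pexprs k Y" "Pev (\<lambda>c. c) x fs = pderiv ?P" "length fs = length (Polynomial.coeffs (pderiv ?P))"
    by blast
  have nz: "pderiv ?P \<noteq> 0" using dn by (simp add: pderiv_eq_0_iff)
  then have "length fs = Polynomial.degree ?P" using fs(3) dn by (simp add: length_coeffs_degree degree_pderiv)
  then have "length fs < length es" using deg es(1) by (cases es) auto
  then have "Pev (\<lambda>c. c) x fs = 0" using m fs(1,2) 0 unfolding min_relation_def by metis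
  then show False using fs(2) nz by simp
qed

lemma specializes_subset: "specializes k h x y Y \<Longrightarrow> Y' \<subseteq> Y \<Longrightarrow> specializes k h x y Y'"
  unfolding specializes_def using pexprs_mono by blast

lemma specializes_Pev_0:
  assumes "specializes k h x y Y" "set es \<subseteq> pexprs k Y" "Pev (\<lambda>c. c) x es = 0"
  shows "Pev h y es = 0"
  using assms unfolding specializes_def Pev_eq_0_iff by blast

text \<open>By \<open>pcoeffs\<close> an expression over the enlarged set is a polynomial in v with
  coefficients over Y, so only the relations of x v need checking.\<close>

lemma specializes_insertI:
  assumes k: "is_subring k" and h: "is_ring_hom h"
    and *: "\<And>es. set es \<subseteq> pexprs k Y \<Longrightarrow> Polynomial.poly (Pev (\<lambda>c. c) x es) (x v) = 0 \<Longrightarrow> Polynomial.poly (Pev h y es) (y v) = 0"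
  shows "specializes k h x y (insert v Y)"
  unfolding specializes_def
proof (intro ballI impI)
  fix e assume e: "e \<in> pexprs k (insert v Y)" "peval (\<lambda>c. c) x e = 0"
  have "Polynomial.poly (Pev h y (pcoeffs v e)) (y v) = 0"
    by (rule *[OF set_pcoeffs]) (use e is_subringD[OF k] in \<open>auto simp: peval_pcoeffs is_ring_hom_id\<close>)
  then show "peval h y e = 0" by (simp add: peval_pcoeffs[OF h])
qed

text \<open>A relation of a transcendental x v has all its coefficients zero at x, hence at y; the
  value y v is arbitrary.\<close>

lemma specializes_insert_transcendental:
  assumes k: "is_subring k" and h: "is_ring_hom h" and s: "specializes k h x y Y"
    and tr: "\<not> algebraic_over (pval (\<lambda>c. c) k x Y) (x v)"
  shows "specializes k h x y (insert v Y)"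
proof (rule specializes_insertI[OF k h])
  fix es assume es: "set es \<subseteq> pexprs k Y" "Polynomial.poly (Pev (\<lambda>c. c) x es) (x v) = 0"
  have "Polynomial.coeff (Pev (\<lambda>c. c) x es) i \<in> pval (\<lambda>c. c) k x Y" for i
    by (rule Pev_in[OF is_subringD(1)[OF is_subring_pval[OF k is_ring_hom_id]]])
       (use es(1) in \<open>auto simp: pval_def\<close>)
  then have "Pev (\<lambda>c. c) x es = 0" using es(2) tr unfolding algebraic_over_def by blast
  then have "Pev h y es = 0" by (rule specializes_Pev_0[OF s es(1)])
  then show "Polynomial.poly (Pev h y es) (y v) = 0" by simp
qed

text \<open>The top coefficients q g and g q of the two products cancel under every evaluation. The
  list omits them and is therefore strictly shorter than that of the dividend.\<close>

lemma Pev_pseudo_remainder: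
  assumes h: "is_ring_hom h" and d: "length fs = d + length qs"
  shows "Pev h z (padds (map (PMul q) fs) (replicate d (PConst 0) @ map (PMul (PMul (PConst (- 1)) g)) qs))
    = Polynomial.smult (peval h z q) (Pev h z (fs @ [g]))
      - Polynomial.smult (peval h z g) (Polynomial.monom 1 d * Pev h z (qs @ [q]))"
    (is "Pev h z ?gs = _")
proof -
  have "Pev h z (replicate d (PConst 0) @ rs) = Polynomial.monom 1 d * Pev h z rs" for rs
    by (simp add: Poly_append is_ring_homD[OF h])
  then have "Pev h z ?gs = Polynomial.smult (peval h z q) (Pev h z fs)
      - Polynomial.smult (peval h z g) (Polynomial.monom 1 d * Pev h z qs)"
    unfolding Pev_padds Pev_map_PMul
    by (simp add: is_ring_homD[OF h] is_ring_hom_minus[OF h] Pev_map_PMul del: map_map map_append map_replicate)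
  moreover have "Polynomial.smult (peval h z q) (Polynomial.monom (peval h z g) (length fs))
      = Polynomial.smult (peval h z g) (Polynomial.monom 1 d * Polynomial.monom (peval h z q) (length qs))"
    by (simp add: d mult_monom smult_monom mult.commute)
  ultimately show ?thesis by (simp add: Poly_snoc smult_add_right distrib_left)
qed

text \<open>Pseudo-division by the minimal relation reduces every relation of x v to a shorter one.
  Each step multiplies by the initial, whose value at y is nonzero, so vanishing at y passes back
  up.\<close>

lemma specializes_insert_algebraic:
  fixes h :: "'a::field_char_0 \<Rightarrow> 'b::field"
  assumes k: "is_subring k" and h: "is_ring_hom h" and s: "specializes k h x y Y"
    and m: "min_relation k x Y (x v) ps"
    and y: "peval h y (last ps) \<noteq> 0" "Polynomial.poly (Pev h y ps) (y v) = 0"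
  shows "specializes k h x y (insert v Y)"
proof (rule specializes_insertI[OF k h])
  note K = is_subringD[OF k]
  define qs q where "qs = butlast ps" and "q = last ps"
  have ps: "ps = qs @ [q]" using m by (simp add: qs_def q_def min_relation_def)
  fix es assume "set es \<subseteq> pexprs k Y" "Polynomial.poly (Pev (\<lambda>c. c) x es) (x v) = 0"
  then show "Polynomial.poly (Pev h y es) (y v) = 0"
  proof (induction "length es" arbitrary: es rule: less_induct)
    case less
    show ?case
    proof (cases "length es < length ps")
      case True
      then have "Pev (\<lambda>c. c) x es = 0" using m less.prems unfolding min_relation_def by blast
      then have "Pev h y es = 0" by (rule specializes_Pev_0[OF s less.prems(1)])
      then show ?thesis by simp
    next
      case False
      then have "es \<noteq> []" using ps by auto
      define fs g where "fs = butlast es" and "g = last es"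
      have es: "es = fs @ [g]" using \<open>es \<noteq> []\<close> by (simp add: fs_def g_def)
      define d where "d = length fs - length qs"
      have d: "length fs = d + length qs" using False by (simp add: d_def es ps)
      define gs where "gs = padds (map (PMul q) fs)
        (replicate d (PConst 0) @ map (PMul (PMul (PConst (- 1)) g)) qs)"
      have id1: "Pev (\<lambda>c. c) x gs = Polynomial.smult (peval (\<lambda>c. c) x q) (Pev (\<lambda>c. c) x es)
          - Polynomial.smult (peval (\<lambda>c. c) x g) (Polynomial.monom 1 d * Pev (\<lambda>c. c) x ps)"
        unfolding gs_def es ps by (rule Pev_pseudo_remainder[OF is_ring_hom_id d])
      have id2: "Pev h y gs = Polynomial.smult (peval h y q) (Pev h y es)
          - Polynomial.smult (peval h y g) (Polynomial.monom 1 d * Pev h y ps)"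
        unfolding gs_def es ps by (rule Pev_pseudo_remainder[OF h d])
      have "set gs \<subseteq> pexprs k Y"
        unfolding gs_def using less.prems(1) m K
        by (intro set_padds) (auto simp: es ps min_relation_def)
      moreover have "length gs < length es" by (simp add: gs_def length_padds es d)
      moreover have "Polynomial.poly (Pev (\<lambda>c. c) x gs) (x v) = 0"
        unfolding id1 using less.prems(2) m by (simp add: min_relation_def)
      ultimately have "Polynomial.poly (Pev h y gs) (y v) = 0" using less.hyps by blast
      then have "peval h y q * Polynomial.poly (Pev h y es) (y v) = 0"
        unfolding id2 using y(2) by simp
      then show ?thesis using y(1) by (simp add: q_def)
    qed
  qed
qed

section \<open>Jets and an orderly ranking\<close>

type_synonym jvar = "nat \<times> nat list"

definition shiftv :: "nat \<Rightarrow> jvar \<Rightarrow> jvar" where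
  "shiftv l v = (fst v, (snd v)[l := Suc (snd v ! l)])"

definition jet :: "(nat \<Rightarrow> 'a \<Rightarrow> 'a) \<Rightarrow> 'a list \<Rightarrow> jvar \<Rightarrow> 'a" where
  "jet \<delta> c v = dpow \<delta> (snd v) (c ! fst v)"

definition jvars :: "nat \<Rightarrow> nat set \<Rightarrow> jvar set" where
  "jvars m I = {v. fst v \<in> I \<and> length (snd v) = m}"

text \<open>The order comes first, exponents and index break ties. Keys of jets with m exponents all
  have length m + 2, so \<open>lenlex\<close> compares them lexicographically.\<close>

definition rkey :: "jvar \<Rightarrow> nat list" where
  "rkey v = sum_list (snd v) # snd v @ [fst v]"

definition rless :: "(jvar \<times> jvar) set" where
  "rless = inv_image (lenlex less_than) rkey"

definition below :: "nat \<Rightarrow> nat set \<Rightarrow> jvar \<Rightarrow> jvar set" where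
  "below m I u = {v \<in> jvars m I. (v, u) \<in> rless}"

lemma wf_rless: "wf rless"
  unfolding rless_def by (intro wf_inv_image wf_lenlex wf_less_than)

lemma trans_rless: "(u, v) \<in> rless \<Longrightarrow> (v, w) \<in> rless \<Longrightarrow> (u, w) \<in> rless"
  unfolding rless_def by (auto intro: lenlex_trans trans_less_than)

lemma rless_irrefl: "(v, v) \<notin> rless"
  using wf_rless by (metis wf_not_refl)

lemma rkey_inj: "rkey v = rkey w \<Longrightarrow> v = w"
  by (simp add: rkey_def prod_eq_iff)

lemma rless_total: "v \<noteq> w \<Longrightarrow> (v, w) \<in> rless \<or> (w, v) \<in> rless"
proof -
  assume "v \<noteq> w"
  then have "rkey v \<noteq> rkey w" using rkey_inj by blast
  moreover have "total (lenlex less_than)" by (rule total_lenlex) (auto simp: total_on_def)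
  ultimately show ?thesis unfolding rless_def total_on_def by simp
qed

lemma jvars_shiftv: "v \<in> jvars m I \<Longrightarrow> shiftv l v \<in> jvars m I"
  by (simp add: jvars_def shiftv_def)

lemma jvars_mono: "I \<subseteq> I' \<Longrightarrow> jvars m I \<subseteq> jvars m I'"
  by (auto simp: jvars_def)

lemma sum_list_shiftv: "l < length (snd v) \<Longrightarrow> sum_list (snd (shiftv l v)) = Suc (sum_list (snd v))"
  by (simp add: shiftv_def sum_list_update)

text \<open>A derivation raises two entries of a key by one, the order and one exponent; two
  applications of this make the ranking compatible with derivations.\<close>

lemma lenlex_Suc_update:
  assumes "length xs = length ys" "(xs, ys) \<in> lenlex less_than" "l < length xs"
  shows "(xs[l := Suc (xs ! l)], ys[l := Suc (ys ! l)]) \<in> lenlex less_than"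
  using assms
proof (induction xs ys arbitrary: l rule: list_induct2)
  case (Cons x xs y ys)
  then show ?case by (cases l) (auto simp: Cons_lenlex_iff)
qed simp

lemma rkey_shiftv:
  assumes "l < length (snd v)"
  shows "rkey (shiftv l v) = ((rkey v)[0 := Suc (rkey v ! 0)])[Suc l := Suc ((rkey v)[0 := Suc (rkey v ! 0)] ! Suc l)]"
  using assms by (simp add: rkey_def sum_list_shiftv) (simp add: shiftv_def list_update_append nth_append)

lemma rless_shiftv_mono:
  assumes "length (snd v) = m" "length (snd w) = m" "l < m" "(v, w) \<in> rless"
  shows "(shiftv l v, shiftv l w) \<in> rless"
proof -
  have len: "length (rkey v) = m + 2" "length (rkey w) = m + 2" using assms by (simp_all add: rkey_def)
  have "(rkey v, rkey w) \<in> lenlex less_than" using assms(4) by (simp add: rless_def)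
  then have 1: "((rkey v)[0 := Suc (rkey v ! 0)], (rkey w)[0 := Suc (rkey w ! 0)]) \<in> lenlex less_than"
    by (intro lenlex_Suc_update) (simp_all add: len)
  have "l < length (snd v)" "l < length (snd w)" using assms by simp_all
  from this[THEN rkey_shiftv] show ?thesis
    unfolding rless_def in_inv_image
    using lenlex_Suc_update[OF _ 1, of "Suc l"] len assms(3) by simp
qed

lemma rless_shiftv: "l < length (snd v) \<Longrightarrow> (v, shiftv l v) \<in> rless"
  unfolding rless_def in_inv_image
  by (simp add: rkey_def sum_list_shiftv Cons_lenlex_iff) (simp add: shiftv_def)

lemma rless_ord:
  assumes "length (snd v) = length (snd w)" "(v, w) \<in> rless"
  shows "sum_list (snd v) \<le> sum_list (snd w)"
  using assms by (auto simp: rless_def rkey_def Cons_lenlex_iff)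

lemma below_shiftv_closed:
  assumes "u \<in> jvars m I" "l < m" "v \<in> below m I u"
  shows "shiftv l v \<in> below m I (shiftv l u)"
  using assms rless_shiftv_mono[of v m u l] jvars_shiftv[of v m I l]
  by (auto simp: below_def jvars_def)

lemma below_subset_shiftv:
  assumes "u \<in> jvars m I" "l < m"
  shows "insert u (below m I u) \<subseteq> below m I (shiftv l u)"
  using assms rless_shiftv[of l u] trans_rless[of _ u "shiftv l u"] by (auto simp: below_def jvars_def)

lemma below_mono: "(v, u) \<in> rless \<Longrightarrow> insert v (below m I v) \<inter> jvars m I \<subseteq> below m I u"
proof
  fix w assume "(v, u) \<in> rless" "w \<in> insert v (below m I v) \<inter> jvars m I"
  then show "w \<in> below m I u" using trans_rless[of w v u] by (cases "w = v") (simp_all add: below_def)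
qed

lemma rless_finite_max:
  assumes "finite A" "A \<noteq> {}"
  shows "\<exists>w\<in>A. \<forall>v\<in>A. v = w \<or> (v, w) \<in> rless"
  using assms
proof (induction A rule: finite_ne_induct)
  case (insert a A)
  then obtain w where w: "w \<in> A" "\<forall>v\<in>A. v = w \<or> (v, w) \<in> rless" by blast
  consider "(a, w) \<in> rless" | "a = w" | "(w, a) \<in> rless" using rless_total by blast
  then show ?case
  proof cases
    case 3
    have "v = a \<or> (v, a) \<in> rless" if "v \<in> insert a A" for v
      using that w(2) 3 trans_rless[of v w a] by auto
    then show ?thesis by (intro bexI[of _ a]) auto
  qed (use w in auto)
qed simp

lemma finite_subset_max:
  assumes "finite A" "A \<subseteq> jvars m I" "A \<noteq> {}"
  shows "\<exists>w\<in>A. A \<subseteq> insert w (below m I w)"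
proof -
  obtain w where w: "w \<in> A" "\<forall>v\<in>A. v = w \<or> (v, w) \<in> rless" using rless_finite_max[OF assms(1,3)] by blast
  then have "A \<subseteq> insert w (below m I w)" using assms(2) unfolding below_def by blast
  then show ?thesis using w(1) by blast
qed

section \<open>Total derivatives\<close>

primrec pder :: "('a::comm_ring_1 \<Rightarrow> 'a) \<Rightarrow> nat \<Rightarrow> (jvar, 'a) pexpr \<Rightarrow> (jvar, 'a) pexpr" where
  "pder d l (PConst c) = PConst (d c)"
| "pder d l (PVar v) = PVar (shiftv l v)"
| "pder d l (PAdd e f) = PAdd (pder d l e) (pder d l f)"
| "pder d l (PMul e f) = PAdd (PMul (pder d l e) f) (PMul e (pder d l f))"

lemma pder_pexprs:
  assumes "\<And>c. c \<in> k \<Longrightarrow> d c \<in> k" "Y \<subseteq> Y'" "\<And>v. v \<in> Y \<Longrightarrow> shiftv l v \<in> Y'" "e \<in> pexprs k Y"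
  shows "pder d l e \<in> pexprs k Y'"
  using assms(4) by (induction e) (use assms(1-3) in \<open>auto intro: pexprs_mono\<close>)

lemma peval_pder:
  assumes D: "derivation D" and h: "\<And>c. c \<in> k \<Longrightarrow> D (h c) = h (d c)"
    and y: "\<And>v. v \<in> Y \<Longrightarrow> D (y v) = y (shiftv l v)" and e: "e \<in> pexprs k Y"
  shows "D (peval h y e) = peval h y (pder d l e)"
  using e by (induction e) (use h y in \<open>auto simp: derivationD[OF D]\<close>)

lemma map_poly_Poly: "f 0 = 0 \<Longrightarrow> map_poly f (Poly xs) = Poly (map f xs)"
  by (rule poly_eqI) (auto simp: coeff_map_poly nth_default_def)

text \<open>The derivative of a relation is linear in D t with the value of the separant as
  coefficient; this is the source of prolongations.\<close>

lemma derivation_Pev: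
  assumes D: "derivation D" and h: "\<And>c. c \<in> k \<Longrightarrow> D (h c) = h (d c)"
    and y: "\<And>v. v \<in> Y \<Longrightarrow> D (y v) = y (shiftv l v)" and es: "set es \<subseteq> pexprs k Y"
  shows "D (Polynomial.poly (Pev h y es) t) =
    Polynomial.poly (Pev h y (map (pder d l) es)) t + Polynomial.poly (pderiv (Pev h y es)) t * D t"
proof -
  have eq: "map D (map (peval h y) es) = map (peval h y) (map (pder d l) es)"
    using peval_pder[where Y = Y and k = k and d = d and h = h and y = y and D = D and l = l] D h y es by auto
  show ?thesis unfolding derivation_poly[OF D] map_poly_Poly[where f = D, OF derivation_0[OF D]] eq by (rule refl)
qed

lemma dpow_zero_jet:
  assumes "\<And>l \<xi>. l < m \<Longrightarrow> length \<xi> = m \<Longrightarrow> D l (y (i, \<xi>)) = y (shiftv l (i, \<xi>))" "length \<xi> = m"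
  shows "dpow D \<xi> (y (i, replicate m 0)) = y (i, \<xi>)"
proof -
  \<comment> \<open>\<open>\<eta> js\<close> is the part of \<xi> supported on the derivations
    already applied.\<close>
  define \<eta> where "\<eta> js = map (\<lambda>j. if j \<in> set js then \<xi> ! j else 0) [0..<m]" for js :: "nat list"
  have pw: "(D l ^^ p) (y (i, \<zeta>)) = y (i, \<zeta>[l := \<zeta> ! l + p])" if "l < m" "length \<zeta> = m" for l p \<zeta>
  proof (induction p)
    case 0
    then show ?case by simp
  next
    case (Suc p)
    then show ?case using assms(1)[of l "\<zeta>[l := \<zeta> ! l + p]"] that by (simp add: shiftv_def)
  qed
  have "foldr (\<lambda>j. D j ^^ (\<xi> ! j)) js (y (i, replicate m 0)) = y (i, \<eta> js)"
    if "distinct js" "set js \<subseteq> {..<m}" for js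
    using that
  proof (induction js)
    case Nil
    have "\<eta> [] = replicate m 0" by (rule nth_equalityI) (auto simp: \<eta>_def)
    then show ?case by simp
  next
    case (Cons j js)
    then have j: "j < m" "j \<notin> set js" by auto
    have "(\<eta> js)[j := \<eta> js ! j + \<xi> ! j] = \<eta> (j # js)"
      using j by (intro nth_equalityI) (auto simp: \<eta>_def nth_list_update)
    then show ?case using Cons pw[OF j(1), of "\<eta> js" "\<xi> ! j"] by (simp add: \<eta>_def)
  qed
  from this[of "[0..<m]"] have "dpow D \<xi> (y (i, replicate m 0)) = y (i, \<eta> [0..<m])"
    using assms(2) by (simp add: dpow_def lessThan_atLeast0)
  moreover have "\<eta> [0..<m] = \<xi>" using assms(2) by (intro nth_equalityI) (auto simp: \<eta>_def)
  ultimately show ?thesis by simp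
qed

text \<open>The extra derivation enters in the middle of the composition; commutation moves it to
  the front.\<close>

lemma dpow_shift:
  fixes D :: "nat \<Rightarrow> 'a \<Rightarrow> 'a"
  assumes comm: "\<And>i j x. i < m \<Longrightarrow> j < m \<Longrightarrow> D i (D j x) = D j (D i x)" and "length \<xi> = m" "l < m"
  shows "dpow D (\<xi>[l := Suc (\<xi> ! l)]) x = D l (dpow D \<xi> x)"
proof -
  let ?\<xi> = "\<xi>[l := Suc (\<xi> ! l)]"
  have pw: "(D j ^^ p) (D l x) = D l ((D j ^^ p) x)" if "j < m" for j p x
    by (induction p) (use comm that assms(3) in auto)
  have same: "foldr (\<lambda>j. D j ^^ (?\<xi> ! j)) js x = foldr (\<lambda>j. D j ^^ (\<xi> ! j)) js x" if "l \<notin> set js" for js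
    using that by (induction js) (auto simp: nth_list_update)
  have "foldr (\<lambda>j. D j ^^ (?\<xi> ! j)) js x = D l (foldr (\<lambda>j. D j ^^ (\<xi> ! j)) js x)"
    if "distinct js" "set js \<subseteq> {..<m}" "l \<in> set js" for js
    using that
  proof (induction js)
    case (Cons j js)
    show ?case
    proof (cases "j = l")
      case True
      then show ?thesis using Cons same[of js] assms by simp
    next
      case False
      then show ?thesis using Cons pw[of j] by simp
    qed
  qed simp
  from this[of "[0..<m]"] show ?thesis using assms by (simp add: dpow_def lessThan_atLeast0)
qed

section \<open>Leaders and characteristic sets\<close>

text \<open>A system of coherent relations: the total derivatives of the relations in \<open>Bs\<close>, each of which
  is linear in its leader with the separant of the original relation as leading coefficient.\<close>

inductive prolongation ::
    "nat \<Rightarrow> (nat \<Rightarrow> 'a::comm_ring_1 \<Rightarrow> 'a) \<Rightarrow> (jvar \<times> (jvar, 'a) pexpr list) set \<Rightarrow> jvar \<Rightarrow> (jvar, 'a) pexpr list \<Rightarrow> bool"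
  for m \<delta> Bs where
  base: "(u, es) \<in> Bs \<Longrightarrow> prolongation m \<delta> Bs u es"
| shift: "prolongation m \<delta> Bs u es \<Longrightarrow> l < m \<Longrightarrow>
    prolongation m \<delta> Bs (shiftv l u) [phorner (PVar u) (map (pder (\<delta> l) l) es), psep (PVar u) es]"

text \<open>With initial and separant nonzero the condition passes to all prolongations, since a
  prolonged relation has the old separant both as initial and as separant.\<close>

definition rel_holds :: "('a \<Rightarrow> 'b::field) \<Rightarrow> (jvar \<Rightarrow> 'b) \<Rightarrow> jvar \<Rightarrow> (jvar, 'a::zero) pexpr list \<Rightarrow> bool" where
  "rel_holds h y u es \<longleftrightarrow> peval h y (last es) \<noteq> 0 \<and> Polynomial.poly (Pev h y es) (y u) = 0 \<and>
     peval h y (psep (PVar u) es) \<noteq> 0"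

locale diff_subfield =
  fixes m :: nat and \<delta> :: "nat \<Rightarrow> 'a::field_char_0 \<Rightarrow> 'a" and k :: "'a set"
  assumes DF: "differential_field m \<delta>" and kD: "is_diff_subfield m \<delta> k"
begin

lemma k_subfield: "is_subfield k" using kD by (simp add: is_diff_subfield_def)

lemma k_subring: "is_subring k" by (rule is_subfield_imp_is_subring[OF k_subfield])

lemmas k_simps = is_subringD(1,2)[OF k_subring]

lemma k_der: "l < m \<Longrightarrow> c \<in> k \<Longrightarrow> \<delta> l c \<in> k" using kD by (simp add: is_diff_subfield_def)

lemma derivation_\<delta>: "l < m \<Longrightarrow> derivation (\<delta> l)"
  using DF by (simp add: differential_field_def derivation_def)

lemma \<delta>_commute: "i < m \<Longrightarrow> j < m \<Longrightarrow> \<delta> i (\<delta> j x) = \<delta> j (\<delta> i x)"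
  using DF by (simp add: differential_field_def)

lemma jet_shiftv: "length (snd v) = m \<Longrightarrow> l < m \<Longrightarrow> \<delta> l (jet \<delta> c v) = jet \<delta> c (shiftv l v)"
  using dpow_shift[of m \<delta> "snd v" l "c ! fst v"] \<delta>_commute by (simp add: jet_def shiftv_def)

abbreviation mrel :: "'a list \<Rightarrow> nat set \<Rightarrow> nat set \<Rightarrow> jvar \<Rightarrow> (jvar, 'a) pexpr list \<Rightarrow> bool" where
  "mrel c I0 I u es \<equiv> min_relation k (jet \<delta> c) (jvars m I0 \<union> below m I u) (jet \<delta> c u) es"

text \<open>\<open>I0\<close> indexes the parameters, all of whose jets are available;
  \<open>I\<close> indexes the unknowns, of which only lower jets are. With \<open>I0\<close> empty
  this treats the tuple of parameters itself over \<open>k\<close>.\<close>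

definition lead :: "'a list \<Rightarrow> nat set \<Rightarrow> nat set \<Rightarrow> jvar \<Rightarrow> bool" where
  "lead c I0 I u \<longleftrightarrow> u \<in> jvars m I \<and>
     algebraic_over (pval (\<lambda>x. x) k (jet \<delta> c) (jvars m I0 \<union> below m I u)) (jet \<delta> c u)"

lemma lead_iff_mrel: "lead c I0 I u \<longleftrightarrow> u \<in> jvars m I \<and> (\<exists>es. mrel c I0 I u es)"
proof
  assume "u \<in> jvars m I \<and> (\<exists>es. mrel c I0 I u es)"
  then obtain es where es: "u \<in> jvars m I" "mrel c I0 I u es" by blast
  let ?B = "pval (\<lambda>x. x) k (jet \<delta> c) (jvars m I0 \<union> below m I u)"
  have "Polynomial.coeff (Pev (\<lambda>x. x) (jet \<delta> c) es) i \<in> ?B" for i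
    by (rule Pev_in[OF is_subringD(1)[OF is_subring_pval[OF k_subring is_ring_hom_id]]])
       (use es(2) in \<open>auto simp: pval_def min_relation_def\<close>)
  moreover have "Pev (\<lambda>x. x) (jet \<delta> c) es \<noteq> 0"
    using es(2) by (auto simp: Pev_eq_0_iff min_relation_def)
  ultimately show "lead c I0 I u"
    using es unfolding lead_def algebraic_over_def min_relation_def by blast
qed (auto simp: lead_def intro: min_relation_exists[OF k_subring])

lemma relation_shift:
  assumes u: "u \<in> jvars m I" "l < m" and es: "set es \<subseteq> pexprs k (jvars m I0 \<union> below m I u)"
  shows "set [phorner (PVar u) (map (pder (\<delta> l) l) es), psep (PVar u) es]
      \<subseteq> pexprs k (jvars m I0 \<union> below m I (shiftv l u))" (is ?sub)
    and "Polynomial.poly (Pev (\<lambda>x. x) (jet \<delta> c) es) (jet \<delta> c u) = 0 \<Longrightarrow>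
      Polynomial.poly (Pev (\<lambda>x. x) (jet \<delta> c) [phorner (PVar u) (map (pder (\<delta> l) l) es), psep (PVar u) es]) (jet \<delta> c (shiftv l u)) = 0"
      (is "_ \<Longrightarrow> ?eq")
proof -
  let ?Y = "jvars m I0 \<union> below m I u" and ?Y' = "jvars m I0 \<union> below m I (shiftv l u)"
  have sub: "?Y \<subseteq> ?Y'" "u \<in> ?Y'" using below_subset_shiftv[OF u] by auto
  have sh: "shiftv l v \<in> ?Y'" if "v \<in> ?Y" for v
    using that below_shiftv_closed[OF u] jvars_shiftv by blast
  have "set (map (pder (\<delta> l) l) es) \<subseteq> pexprs k ?Y'"
  proof
    fix f assume "f \<in> set (map (pder (\<delta> l) l) es)"
    then obtain e where "e \<in> set es" "f = pder (\<delta> l) l e" by auto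
    then show "f \<in> pexprs k ?Y'" using es by (auto intro!: pder_pexprs[OF k_der[OF u(2)] sub(1) sh])
  qed
  moreover have "set es \<subseteq> pexprs k ?Y'" using es pexprs_mono[OF sub(1)] by blast
  ultimately show ?sub using sub(2) by (simp add: phorner_pexprs psep_pexprs k_simps)
  assume 0: "Polynomial.poly (Pev (\<lambda>x. x) (jet \<delta> c) es) (jet \<delta> c u) = 0"
  have y: "\<delta> l (jet \<delta> c v) = jet \<delta> c (shiftv l v)" if "v \<in> ?Y" for v
    using that u by (intro jet_shiftv) (auto simp: jvars_def below_def)
  have "0 = \<delta> l (Polynomial.poly (Pev (\<lambda>x. x) (jet \<delta> c) es) (jet \<delta> c u))"
    using 0 derivation_0[OF derivation_\<delta>[OF u(2)]] by simp
  also have "\<dots> = Polynomial.poly (Pev (\<lambda>x. x) (jet \<delta> c) (map (pder (\<delta> l) l) es)) (jet \<delta> c u)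
     + Polynomial.poly (pderiv (Pev (\<lambda>x. x) (jet \<delta> c) es)) (jet \<delta> c u) * \<delta> l (jet \<delta> c u)"
    by (rule derivation_Pev[where k = k and h = "\<lambda>x. x" and d = "\<delta> l" and y = "jet \<delta> c" and D = "\<delta> l" and Y = ?Y])
       (use derivation_\<delta>[OF u(2)] y es in auto)
  also have "\<delta> l (jet \<delta> c u) = jet \<delta> c (shiftv l u)" using u by (intro jet_shiftv) (auto simp: jvars_def)
  finally show ?eq by (simp add: peval_phorner[OF is_ring_hom_id] peval_psep[OF is_ring_hom_id] mult.commute del: map_map)
qed

text \<open>A relation of length 2 is minimal as soon as its leading coefficient is nonzero, and
  here that coefficient is the separant of a minimal relation.\<close>

lemma mrel_shift:
  assumes u: "u \<in> jvars m I" "l < m" and es: "mrel c I0 I u es"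
  shows "mrel c I0 I (shiftv l u) [phorner (PVar u) (map (pder (\<delta> l) l) es), psep (PVar u) es]"
    (is "min_relation k _ _ _ ?fs")
proof -
  have es': "set es \<subseteq> pexprs k (jvars m I0 \<union> below m I u)"
    "Polynomial.poly (Pev (\<lambda>x. x) (jet \<delta> c) es) (jet \<delta> c u) = 0" using es by (auto simp: min_relation_def)
  have sep: "peval (\<lambda>x. x) (jet \<delta> c) (psep (PVar u) es) \<noteq> 0"
    using min_relation_sep[OF k_subring es] by (simp add: peval_psep[OF is_ring_hom_id])
  have min: "Pev (\<lambda>x. x) (jet \<delta> c) gs = 0"
    if "length gs < 2" "Polynomial.poly (Pev (\<lambda>x. x) (jet \<delta> c) gs) (jet \<delta> c (shiftv l u)) = 0" for gs
  proof (cases gs)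
    case (Cons g gs')
    then show ?thesis using that by simp
  qed simp
  show ?thesis
    unfolding min_relation_def
    using relation_shift[OF u es'(1)] es'(2) sep min by auto
qed

lemma lead_shiftv: "lead c I0 I u \<Longrightarrow> l < m \<Longrightarrow> lead c I0 I (shiftv l u)"
  unfolding lead_iff_mrel using mrel_shift jvars_shiftv by blast

lemma prolongation_mrel:
  assumes "\<And>u es. (u, es) \<in> Bs \<Longrightarrow> u \<in> jvars m I \<and> mrel c I0 I u es" "prolongation m \<delta> Bs u es"
  shows "u \<in> jvars m I \<and> mrel c I0 I u es"
  using assms(2)
proof (induction rule: prolongation.induct)
  case (shift u es l)
  then show ?case using mrel_shift jvars_shiftv by blast
qed (use assms(1) in auto)

lemma prolongation_holds:
  assumes Bs: "\<And>u es. (u, es) \<in> Bs \<Longrightarrow> u \<in> jvars m I \<and> mrel c I0 I u es"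
    and c': "\<And>u es. (u, es) \<in> Bs \<Longrightarrow> rel_holds (\<lambda>x. x) (jet \<delta> c') u es"
    and "prolongation m \<delta> Bs u es"
  shows "rel_holds (\<lambda>x. x) (jet \<delta> c') u es"
  using assms(3)
proof (induction rule: prolongation.induct)
  case (shift u es l)
  have u: "u \<in> jvars m I" "mrel c I0 I u es" using prolongation_mrel[OF Bs shift.hyps(1)] by auto
  have es: "set es \<subseteq> pexprs k (jvars m I0 \<union> below m I u)" using u(2) by (auto simp: min_relation_def)
  have "Polynomial.poly (Pev (\<lambda>x. x) (jet \<delta> c') [phorner (PVar u) (map (pder (\<delta> l) l) es), psep (PVar u) es]) (jet \<delta> c' (shiftv l u)) = 0"
    by (rule relation_shift(2)[OF u(1) shift.hyps(2) es]) (use shift.IH in \<open>simp add: rel_holds_def\<close>)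
  then show ?case using shift.IH by (simp add: rel_holds_def phorner_def is_ring_hom_id)
qed (use c' in auto)

text \<open>Leaders are closed under differentiation, so for each index they form a monomial ideal.
  Minimal relations of its finitely many generators prolong to relations of all leaders.\<close>

lemma lead_basis:
  assumes "finite I"
  shows "\<exists>Bs. finite Bs \<and> (\<forall>u es. (u, es) \<in> Bs \<longrightarrow> u \<in> jvars m I \<and> mrel c I0 I u es) \<and>
    (\<forall>u. lead c I0 I u \<longrightarrow> (\<exists>es. prolongation m \<delta> Bs u es))"
proof -
  have "\<exists>G\<subseteq>{\<xi>. lead c I0 I (i, \<xi>)}. finite G \<and> (\<forall>\<xi>\<in>{\<xi>. lead c I0 I (i, \<xi>)}. \<exists>g\<in>G. list_all2 (\<le>) g \<xi>)" for i
  proof (rule shift_closed_finite_basis)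
    show "shift_closed m {\<xi>. lead c I0 I (i, \<xi>)}"
      using lead_shiftv by (fastforce simp: shift_closed_def shiftv_def)
    show "\<And>\<xi>. \<xi> \<in> {\<xi>. lead c I0 I (i, \<xi>)} \<Longrightarrow> length \<xi> = m" by (auto simp: lead_def jvars_def)
  qed
  then obtain G where G: "\<And>i. G i \<subseteq> {\<xi>. lead c I0 I (i, \<xi>)}" "\<And>i. finite (G i)"
    "\<And>i \<xi>. lead c I0 I (i, \<xi>) \<Longrightarrow> \<exists>g\<in>G i. list_all2 (\<le>) g \<xi>" by (metis mem_Collect_eq)
  have "\<forall>u. \<exists>es. lead c I0 I u \<longrightarrow> mrel c I0 I u es" using lead_iff_mrel by blast
  then obtain P where P: "\<And>u. lead c I0 I u \<Longrightarrow> mrel c I0 I u (P u)" by metis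
  define Bs where "Bs = (\<lambda>u. (u, P u)) ` (Sigma I G)"
  have "finite Bs" using assms G(2) by (simp add: Bs_def)
  moreover have B: "u \<in> jvars m I \<and> mrel c I0 I u es" if "(u, es) \<in> Bs" for u es
  proof -
    have "es = P u" "lead c I0 I u" using that G(1) by (auto simp: Bs_def)
    then show ?thesis using P lead_def by auto
  qed
  moreover have "\<exists>es. prolongation m \<delta> Bs u es" if ld: "lead c I0 I u" for u
  proof -
    define U where "U = {\<xi>. \<exists>es. prolongation m \<delta> Bs (fst u, \<xi>) es}"
    obtain g where g: "g \<in> G (fst u)" "list_all2 (\<le>) g (snd u)" using G(3)[of "fst u" "snd u"] ld by auto
    have "fst u \<in> I" using ld by (simp add: lead_def jvars_def)
    then have "((fst u, g), P (fst u, g)) \<in> Bs" using g(1) by (auto simp: Bs_def)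
    then have gU: "g \<in> U" unfolding U_def using prolongation.base by blast
    have "shift_closed m U"
      unfolding shift_closed_def U_def
    proof (intro ballI impI allI)
      fix \<xi> l assume "\<xi> \<in> {\<xi>. \<exists>es. prolongation m \<delta> Bs (fst u, \<xi>) es}" "l < m"
      then obtain es where "prolongation m \<delta> Bs (fst u, \<xi>) es" by blast
      from prolongation.shift[OF this \<open>l < m\<close>]
      show "\<xi>[l := Suc (\<xi> ! l)] \<in> {\<xi>. \<exists>es. prolongation m \<delta> Bs (fst u, \<xi>) es}"
        by (auto simp: shiftv_def)
    qed
    moreover have "length g = m"
      using list_all2_lengthD[OF g(2)] ld by (simp add: lead_def jvars_def)
    ultimately have "snd u \<in> U" using shift_closed_le[OF _ gU g(2)] by blast
    then show ?thesis by (simp add: U_def)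
  qed
  ultimately show ?thesis by blast
qed

text \<open>A relation involves finitely many jets, so beyond the jets of \<open>I0\<close> it only
  contains the highest of those in S and jets below that one.\<close>

lemma specializes_below:
  assumes s0: "specializes k h x y (jvars m I0)" and S: "S \<subseteq> jvars m I"
    and *: "\<And>w. w \<in> S \<Longrightarrow> specializes k h x y (jvars m I0 \<union> insert w (below m I w))"
  shows "specializes k h x y (jvars m I0 \<union> S)"
  unfolding specializes_def
proof (intro ballI impI)
  fix e assume e: "e \<in> pexprs k (jvars m I0 \<union> S)" "peval (\<lambda>c. c) x e = 0"
  define A where "A = pvars e \<inter> S"
  show "peval h y e = 0"
  proof (cases "A = {}")
    case True
    then have "e \<in> pexprs k (jvars m I0)" using e(1) by (auto simp: A_def pexprs_def)
    then show ?thesis using s0 e(2) by (simp add: specializes_def)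
  next
    case False
    moreover have "finite A" "A \<subseteq> jvars m I" using S by (auto simp: A_def finite_pvars)
    ultimately obtain w where w: "w \<in> A" "A \<subseteq> insert w (below m I w)" using finite_subset_max by metis
    then have "e \<in> pexprs k (jvars m I0 \<union> insert w (below m I w))" using e(1) unfolding A_def pexprs_def by blast
    then show ?thesis using *[of w] w(1) e(2) unfolding specializes_def A_def by blast
  qed
qed

lemma specializes_wf:
  assumes s0: "specializes k h x y (jvars m I0)"
    and *: "\<And>u. u \<in> jvars m I \<Longrightarrow> specializes k h x y (jvars m I0 \<union> below m I u) \<Longrightarrow>
      specializes k h x y (jvars m I0 \<union> insert u (below m I u))"
  shows "specializes k h x y (jvars m I0 \<union> jvars m I)"
proof -
  have "u \<in> jvars m I \<longrightarrow> specializes k h x y (jvars m I0 \<union> insert u (below m I u))" for u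
  proof (induction u rule: wf_induct_rule[OF wf_rless])
    case (1 u)
    have "specializes k h x y (jvars m I0 \<union> below m I u)"
      by (rule specializes_below[OF s0]) (use 1 in \<open>auto simp: below_def\<close>)
    then show ?case using * by blast
  qed
  then have "\<And>u. u \<in> jvars m I \<Longrightarrow> specializes k h x y (jvars m I0 \<union> insert u (below m I u))" by blast
  then show ?thesis by (rule specializes_below[OF s0 order_refl])
qed

lemma specializes_insert:
  fixes h :: "'a \<Rightarrow> 'b::field"
  assumes h: "is_ring_hom h" and u: "u \<in> jvars m I"
    and s: "specializes k h (jet \<delta> c) y (jvars m I0 \<union> below m I u)"
    and es: "lead c I0 I u \<Longrightarrow> \<exists>es. mrel c I0 I u es \<and> peval h y (last es) \<noteq> 0 \<and> Polynomial.poly (Pev h y es) (y u) = 0"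
  shows "specializes k h (jet \<delta> c) y (jvars m I0 \<union> insert u (below m I u))"
proof (cases "lead c I0 I u")
  case True
  then obtain es where "mrel c I0 I u es" "peval h y (last es) \<noteq> 0" "Polynomial.poly (Pev h y es) (y u) = 0"
    using es by blast
  from specializes_insert_algebraic[OF k_subring h s this] show ?thesis by simp
next
  case False
  then show ?thesis using specializes_insert_transcendental[OF k_subring h s, of u] u
    by (simp add: lead_def)
qed

text \<open>Going up the ranking, leaders are governed by their prolonged relations, and all other
  jets are free.\<close>

lemma specializes_point:
  assumes Bs: "\<And>u es. (u, es) \<in> Bs \<Longrightarrow> u \<in> jvars m I \<and> mrel c I0 I u es"
    "\<And>u. lead c I0 I u \<Longrightarrow> \<exists>es. prolongation m \<delta> Bs u es"
    and c': "\<And>u es. (u, es) \<in> Bs \<Longrightarrow> rel_holds (\<lambda>x. x) (jet \<delta> c') u es"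
    and s0: "specializes k (\<lambda>x. x) (jet \<delta> c) (jet \<delta> c') (jvars m I0)"
  shows "specializes k (\<lambda>x. x) (jet \<delta> c) (jet \<delta> c') (jvars m I0 \<union> jvars m I)"
proof (rule specializes_wf[OF s0], rule specializes_insert[OF is_ring_hom_id])
  fix u assume "lead c I0 I u"
  then obtain es where es: "prolongation m \<delta> Bs u es" using Bs(2) by blast
  then show "\<exists>es. mrel c I0 I u es \<and> peval (\<lambda>x. x) (jet \<delta> c') (last es) \<noteq> 0 \<and>
      Polynomial.poly (Pev (\<lambda>x. x) (jet \<delta> c') es) (jet \<delta> c' u) = 0"
    using prolongation_mrel[OF Bs(1) es] prolongation_holds[OF Bs(1) c' es]
    by (auto simp: rel_holds_def)
qed auto

text \<open>The relation of a leader of c remains a nonzero relation at c' because its initial does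
  not vanish there. Thus leaders can only be gained.\<close>

lemma lead_point:
  assumes Bs: "\<And>u es. (u, es) \<in> Bs \<Longrightarrow> u \<in> jvars m I \<and> mrel c I0 I u es"
    "\<And>u. lead c I0 I u \<Longrightarrow> \<exists>es. prolongation m \<delta> Bs u es"
    and c': "\<And>u es. (u, es) \<in> Bs \<Longrightarrow> rel_holds (\<lambda>x. x) (jet \<delta> c') u es"
    and u: "lead c I0 I u"
  shows "lead c' I0 I u"
proof -
  obtain es where es: "prolongation m \<delta> Bs u es" using Bs(2)[OF u] by blast
  have mr: "u \<in> jvars m I" "mrel c I0 I u es" using prolongation_mrel[OF Bs(1) es] by auto
  have rh: "rel_holds (\<lambda>x. x) (jet \<delta> c') u es" using prolongation_holds[OF Bs(1) c' es] by auto
  let ?B = "pval (\<lambda>x. x) k (jet \<delta> c') (jvars m I0 \<union> below m I u)"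
  have "Polynomial.coeff (Pev (\<lambda>x. x) (jet \<delta> c') es) i \<in> ?B" for i
    by (rule Pev_in[OF is_subringD(1)[OF is_subring_pval[OF k_subring is_ring_hom_id]]])
       (use mr(2) in \<open>auto simp: pval_def min_relation_def\<close>)
  moreover have "Pev (\<lambda>x. x) (jet \<delta> c') es \<noteq> 0"
    using rh mr(2) by (auto simp: Pev_eq_0_iff min_relation_def rel_holds_def)
  ultimately show ?thesis
    using mr(1) rh unfolding lead_def algebraic_over_def rel_holds_def by blast
qed

text \<open>A polynomial in the jets that does not vanish at \<open>c\<close> has a nonzero multiple in the base ring,
  modulo the relations of \<open>c\<close> and up to coefficients with respect to the non-leaders; the
  non-vanishing of this multiple is inherited by the polynomial under specialisation.\<close>

lemma nonvanishing_base:
  assumes "u \<in> jvars m I" "q \<in> pexprs k (jvars m I0 \<union> insert u (below m I u))" "peval (\<lambda>x. x) (jet \<delta> c) q \<noteq> 0"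
  shows "\<exists>g\<in>pexprs k (jvars m I0). peval (\<lambda>x. x) (jet \<delta> c) g \<noteq> 0 \<and>
    (\<forall>(h :: 'a \<Rightarrow> 'f::field_char_0) y. is_ring_hom h \<longrightarrow>
      specializes k h (jet \<delta> c) y (jvars m I0 \<union> insert u (below m I u)) \<longrightarrow>
      (\<forall>z\<in>insert u (below m I u). \<not> lead c I0 I z \<longrightarrow>
         \<not> algebraic_over (pval h k y (jvars m I0 \<union> below m I z)) (y z)) \<longrightarrow>
      peval h y g \<noteq> 0 \<longrightarrow> peval h y q \<noteq> 0)"
  using assms
proof (induction u arbitrary: q rule: wf_induct_rule[OF wf_rless])
  case (1 u)
  let ?Y0 = "jvars m I0" and ?x = "jet \<delta> c" and ?Z = "jvars m I0 \<union> below m I u"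
  \<comment> \<open>\<open>good\<close> is the conclusion restricted to the jets in S. It gets
    weaker as S grows, which lets the result at a lower jet be reused.\<close>
  define good where "good S h y g q \<longleftrightarrow> (is_ring_hom h \<longrightarrow> specializes k h ?x y (?Y0 \<union> S) \<longrightarrow>
      (\<forall>z\<in>S. \<not> lead c I0 I z \<longrightarrow> \<not> algebraic_over (pval h k y (?Y0 \<union> below m I z)) (y z)) \<longrightarrow>
      peval h y g \<noteq> 0 \<longrightarrow> peval h y q \<noteq> 0)" for S and h :: "'a \<Rightarrow> 'f" and y g q
  have lower: "\<exists>g\<in>pexprs k ?Y0. peval (\<lambda>x. x) ?x g \<noteq> 0 \<and> (\<forall>h y. good (below m I u) h y g q)"
    if q: "q \<in> pexprs k ?Z" "peval (\<lambda>x. x) ?x q \<noteq> 0" for q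
  proof -
    define A where "A = pvars q \<inter> below m I u"
    show ?thesis
    proof (cases "A = {}")
      case True
      then have "q \<in> pexprs k ?Y0" using q(1) by (auto simp: A_def pexprs_def)
      then show ?thesis using q(2) by (intro bexI[of _ q]) (auto simp: good_def)
    next
      case False
      moreover have "finite A" "A \<subseteq> jvars m I" by (auto simp: A_def finite_pvars below_def)
      ultimately obtain w where w: "w \<in> A" "A \<subseteq> insert w (below m I w)" using finite_subset_max by metis
      have wu: "w \<in> jvars m I" "(w, u) \<in> rless" using w(1) by (auto simp: A_def below_def)
      have qw: "q \<in> pexprs k (?Y0 \<union> insert w (below m I w))" using q(1) w(2) unfolding A_def pexprs_def by blast
      have sub: "insert w (below m I w) \<subseteq> below m I u"
        using below_mono[OF wu(2), of m I] wu(1) by (auto simp: below_def)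
      obtain g where g: "g \<in> pexprs k ?Y0" "peval (\<lambda>x. x) ?x g \<noteq> 0"
        "\<And>h y. good (insert w (below m I w)) h y g q"
        using "1.IH"[OF wu(2,1) qw q(2)] unfolding good_def by blast
      have "good (below m I u) h y g q" for h y
        unfolding good_def
      proof (intro impI)
        assume a: "is_ring_hom h" "specializes k h ?x y (?Y0 \<union> below m I u)"
          "\<forall>z\<in>below m I u. \<not> lead c I0 I z \<longrightarrow> \<not> algebraic_over (pval h k y (?Y0 \<union> below m I z)) (y z)"
          "peval h y g \<noteq> 0"
        have "specializes k h ?x y (?Y0 \<union> insert w (below m I w))"
          by (rule specializes_subset[OF a(2)]) (use sub in auto)
        then show "peval h y q \<noteq> 0" using g(3)[of h y] a sub unfolding good_def by blast
      qed
      then show ?thesis using g by blast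
    qed
  qed
  have good_mono: "good (insert u (below m I u)) h y g q"
    if "\<And>h y. good (below m I u) h y g q0"
      and "is_ring_hom h \<Longrightarrow> specializes k h ?x y (?Y0 \<union> insert u (below m I u)) \<Longrightarrow>
        (\<not> lead c I0 I u \<longrightarrow> \<not> algebraic_over (pval h k y (?Y0 \<union> below m I u)) (y u)) \<Longrightarrow>
        peval h y q0 \<noteq> 0 \<Longrightarrow> peval h y q \<noteq> 0" for h y g q0
    unfolding good_def
  proof (intro impI)
    assume a: "is_ring_hom h" "specializes k h ?x y (?Y0 \<union> insert u (below m I u))"
      "\<forall>z\<in>insert u (below m I u). \<not> lead c I0 I z \<longrightarrow> \<not> algebraic_over (pval h k y (?Y0 \<union> below m I z)) (y z)"
      "peval h y g \<noteq> 0"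
    have "specializes k h ?x y (?Y0 \<union> below m I u)" by (rule specializes_subset[OF a(2)]) auto
    then have "peval h y q0 \<noteq> 0" using that(1)[of h y] a unfolding good_def by blast
    then show "peval h y q \<noteq> 0" using that(2) a by blast
  qed
  have qY: "q \<in> pexprs k (insert u ?Z)" using "1.prems"(2) by simp
  have "\<exists>g\<in>pexprs k ?Y0. peval (\<lambda>x. x) ?x g \<noteq> 0 \<and> (\<forall>h y. good (insert u (below m I u)) h y g q)"
  proof (cases "lead c I0 I u")
    case False
    \<comment> \<open>A non-leader u stays transcendental after specialisation, so q survives as
      soon as one of its coefficients in u does.\<close>
    define es where "es = pcoeffs u q"
    have es: "set es \<subseteq> pexprs k ?Z" unfolding es_def by (rule set_pcoeffs[OF k_simps qY])
    have "Pev (\<lambda>x. x) ?x es \<noteq> 0"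
      using "1.prems"(3) peval_pcoeffs[OF is_ring_hom_id, of ?x u q] unfolding es_def by auto
    then obtain e where e: "e \<in> set es" "peval (\<lambda>x. x) ?x e \<noteq> 0" unfolding Pev_eq_0_iff by blast
    obtain g where g: "g \<in> pexprs k ?Y0" "peval (\<lambda>x. x) ?x g \<noteq> 0" "\<And>h y. good (below m I u) h y g e"
      using lower[OF _ e(2)] e(1) es by blast
    have "good (insert u (below m I u)) h y g q" for h y
    proof (rule good_mono[OF g(3)])
      assume a: "is_ring_hom h" "\<not> lead c I0 I u \<longrightarrow> \<not> algebraic_over (pval h k y ?Z) (y u)" "peval h y e \<noteq> 0"
      have "Polynomial.coeff (Pev h y es) i \<in> pval h k y ?Z" for i
        by (rule Pev_in[OF is_subringD(1)[OF is_subring_pval[OF k_subring a(1)]]]) (use es in \<open>auto simp: pval_def\<close>)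
      moreover have "Pev h y es \<noteq> 0" using a(3) e(1) unfolding Pev_eq_0_iff by blast
      ultimately have "Polynomial.poly (Pev h y es) (y u) \<noteq> 0"
        using a(2) False unfolding algebraic_over_def by blast
      then show "peval h y q \<noteq> 0" using peval_pcoeffs[OF a(1), of y u q] by (simp add: es_def)
    qed
    then show ?thesis using g by blast
  next
    case True
    \<comment> \<open>At a leader the value b of q is algebraic over the lower jets. An equation for
      b with nonzero constant term e shows e to be a multiple of q modulo the relations of c, so q
      can vanish only where e does.\<close>
    define b where "b = peval (\<lambda>x. x) ?x q"
    let ?B = "pval (\<lambda>x. x) k ?x ?Z"
    have B: "is_subring ?B" by (rule is_subring_pval[OF k_subring is_ring_hom_id])
    have "?x u \<in> der_closure ?B"
      using True algebraic_imp_der_closure[OF _ der_closure_superset] by (auto simp: lead_def)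
    then have "pval (\<lambda>x. x) k ?x (insert u ?Z) \<subseteq> der_closure ?B"
      using der_closure_superset[of ?B] pval_const[of _ k "\<lambda>x. x" ?x ?Z] pval_var[of _ ?Z ?x "\<lambda>x. x" k]
      by (intro pval_subset is_subfield_imp_is_subring[OF is_subfield_der_closure]) auto
    then have "b \<in> der_closure ?B" using qY by (auto simp: b_def pval_def)
    then have "algebraic_over ?B b" by (rule der_closure_imp_algebraic[OF B])
    then obtain Q where Q: "Q \<noteq> 0" "\<And>i. Polynomial.coeff Q i \<in> ?B" "Polynomial.poly Q b = 0"
      unfolding algebraic_over_def by blast
    \<comment> \<open>Dividing by the j-th power of the variable makes the constant term nonzero; b
      is still a root because b \<noteq> 0.\<close>
    define j where "j = (LEAST j. Polynomial.coeff Q j \<noteq> 0)"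
    have j: "Polynomial.coeff Q j \<noteq> 0" unfolding j_def using Q(1) by (metis (mono_tags, lifting) LeastI leading_coeff_neq_0)
    have jl: "Polynomial.coeff Q i = 0" if "i < j" for i using not_less_Least that unfolding j_def by blast
    define Q' where "Q' = poly_shift j Q"
    have QQ': "Q = Polynomial.monom 1 j * Q'"
      by (rule poly_eqI) (auto simp: coeff_monom_mult Q'_def coeff_poly_shift jl)
    have "b \<noteq> 0" using "1.prems"(3) by (simp add: b_def)
    then have "Polynomial.poly Q' b = 0" using Q(3) unfolding QQ' by (simp add: poly_monom)
    moreover have "Polynomial.coeff Q' i \<in> ?B" for i using Q(2) by (simp add: Q'_def coeff_poly_shift)
    then obtain es where es: "set es \<subseteq> pexprs k ?Z" "Pev (\<lambda>x. x) ?x es = Q'"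
      using poly_over_pval[OF k_simps(1) is_ring_hom_id, of Q' ?x ?Z] by blast
    have "Polynomial.coeff Q' 0 \<noteq> 0" using j by (simp add: Q'_def coeff_poly_shift)
    then obtain e es' where ees: "es = e # es'" "peval (\<lambda>x. x) ?x e \<noteq> 0"
      unfolding es(2)[symmetric] by (cases es) auto
    obtain g where g: "g \<in> pexprs k ?Y0" "peval (\<lambda>x. x) ?x g \<noteq> 0" "\<And>h y. good (below m I u) h y g e"
      using lower[OF _ ees(2)] ees(1) es(1) by auto
    have "phorner q es \<in> pexprs k (?Y0 \<union> insert u (below m I u))"
      using es(1) "1.prems"(2) pexprs_mono[of ?Z "?Y0 \<union> insert u (below m I u)"]
      by (intro phorner_pexprs k_simps) auto
    moreover have "peval (\<lambda>x. x) ?x (phorner q es) = 0"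
      using \<open>Polynomial.poly Q' b = 0\<close> by (simp add: peval_phorner[OF is_ring_hom_id] es(2) b_def)
    ultimately have rel: "peval h y (phorner q es) = 0"
      if "specializes k h ?x y (?Y0 \<union> insert u (below m I u))" for h :: "'a \<Rightarrow> 'f" and y
      using that unfolding specializes_def by blast
    have "good (insert u (below m I u)) h y g q" for h y
    proof (rule good_mono[OF g(3)])
      assume a: "is_ring_hom h" "specializes k h ?x y (?Y0 \<union> insert u (below m I u))" "peval h y e \<noteq> 0"
      show "peval h y q \<noteq> 0"
      proof
        assume "peval h y q = 0"
        then have "peval h y e = 0" using rel[OF a(2)] by (simp add: peval_phorner[OF a(1)] ees(1))
        then show False using a(3) by simp
      qed
    qed
    then show ?thesis using g by blast
  qed
  then show ?case unfolding good_def .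
qed

end

section \<open>An algebraically closed field with prescribed derivations\<close>

text \<open>Puts the rational function field, and with it its algebraic closure, into the class of
  fields for which derivations are extended.\<close>

instance fract :: ("{idom, ring_char_0}") field_char_0
proof
  have "of_nat n = Fract (of_nat n :: 'a) 1" for n
    by (induction n) (simp_all add: Zero_fract_def One_fract_def)
  then show "inj (of_nat :: nat \<Rightarrow> 'a fract)"
    by (simp add: inj_def eq_fract)
qed

text \<open>Large enough for generic solutions: every jet that is not a leader becomes a new transcendental,
  and every leader a root of its relation.\<close>

type_synonym 'a big = "((nat \<Rightarrow>\<^sub>0 nat) \<Rightarrow>\<^sub>0 'a) fract alg_closure"

definition big_poly :: "(nat, 'a::field_char_0) mpoly \<Rightarrow> 'a big" where
  "big_poly p = to_ac (Fract p 1)"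

definition big_const :: "'a::field_char_0 \<Rightarrow> 'a big" where
  "big_const c = big_poly (Poly_Mapping.single 0 c)"

definition big_var :: "nat \<Rightarrow> 'a::field_char_0 big" where
  "big_var i = big_poly (Poly_Mapping.single (Poly_Mapping.single i 1) 1)"

lemma big_poly_hom: "is_ring_hom big_poly"
proof -
  have "big_poly 0 = 0" "big_poly 1 = 1"
    by (simp_all add: big_poly_def Zero_fract_def[symmetric] One_fract_def[symmetric])
  moreover have "big_poly (p + q) = big_poly p + big_poly q" "big_poly (p * q) = big_poly p * big_poly q" for p q :: "(nat, 'a) mpoly"
    unfolding big_poly_def to_ac_add[symmetric] to_ac_mult[symmetric] by simp_all
  ultimately show ?thesis by (simp add: is_ring_hom_def)
qed

lemma big_poly_eq_0_iff: "big_poly p = 0 \<longleftrightarrow> p = 0"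
  by (simp add: big_poly_def Zero_fract_def eq_fract)

lemma big_const_hom: "is_ring_hom big_const"
  unfolding is_ring_hom_def big_const_def
  by (simp add: single_add is_ring_homD[OF big_poly_hom] mult_single[of 0 _ 0, simplified, symmetric])

lemma is_subring_image:
  assumes "is_ring_hom h" "is_subring B"
  shows "is_subring (h ` B)"
proof -
  note D = is_subringD[OF assms(2)] and H = is_ring_homD[OF assms(1)]
  show ?thesis
    unfolding is_subring_def
  proof (intro conjI ballI)
    show "0 \<in> h ` B" "1 \<in> h ` B" using D H by (metis imageI)+
    fix a assume "a \<in> h ` B"
    then obtain a' where a: "a' \<in> B" "a = h a'" by blast
    show "- a \<in> h ` B" using D(5)[OF a(1)] is_ring_hom_minus[OF assms(1), of a'] a(2) by (metis imageI)
    fix b assume "b \<in> h ` B"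
    then obtain b' where b: "b' \<in> B" "b = h b'" by blast
    show "a + b \<in> h ` B" using D(3)[OF a(1) b(1)] H(3)[of a' b'] a(2) b(2) by (metis imageI)
    show "a * b \<in> h ` B" using D(4)[OF a(1) b(1)] H(4)[of a' b'] a(2) b(2) by (metis imageI)
  qed
qed

definition big_ring :: "nat \<Rightarrow> 'a::field_char_0 big set" where
  "big_ring n = big_poly ` mpolys_over UNIV {..<n}"

lemma is_subring_UNIV: "is_subring UNIV"
  by (simp add: is_subring_def)

lemma is_subring_mpolys_over:
  fixes L :: "'b::comm_ring_1 set"
  assumes "is_subring L" shows "is_subring (mpolys_over L Y)"
proof -
  have one: "(1 :: ('a, 'b) mpoly) \<in> mpolys_over L Y"
    unfolding single_one[symmetric] by (rule mpolys_over_single) (simp_all add: is_subringD[OF assms] del: single_one)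
  have "- f \<in> mpolys_over L Y" if "f \<in> mpolys_over L Y" for f :: "('a, 'b) mpoly"
    by (rule mpolys_overI) (use mpolys_overD[OF that] is_subringD(5)[OF assms] in \<open>auto simp: keys_minus in_keys_iff\<close>)
  then show ?thesis
    unfolding is_subring_def
    by (simp add: one mpolys_over_0 is_subringD(1)[OF assms] mpolys_over_add[OF assms] mpolys_over_mult[OF assms])
qed

lemma is_subring_big_ring: "is_subring (big_ring n)"
  unfolding big_ring_def by (intro is_subring_image big_poly_hom is_subring_mpolys_over is_subring_UNIV)

lemma big_var_transcendental: "\<not> algebraic_over (big_ring n) (big_var n :: 'a::field_char_0 big)"
proof
  assume "algebraic_over (big_ring n) (big_var n :: 'a big)"
  then obtain Q :: "'a big Polynomial.poly" where Q: "Q \<noteq> 0"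
    "\<And>i. Polynomial.coeff Q i \<in> big_ring n" "Polynomial.poly Q (big_var n) = 0"
    unfolding algebraic_over_def by blast
  have "\<exists>g\<in>mpolys_over UNIV {..<n}. Polynomial.coeff Q i = big_poly g" for i
    using Q(2)[of i] by (auto simp: big_ring_def)
  then obtain g where g: "\<And>i. g i \<in> mpolys_over UNIV {..<n}" "\<And>i. Polynomial.coeff Q i = big_poly (g i)" by metis
  define d where "d = Polynomial.degree Q"
  have pow: "(big_var n :: 'a big) ^ i = big_poly (Poly_Mapping.single (Poly_Mapping.single n i) 1)" for i
  proof (induction i)
    case 0
    then show ?case by (simp add: is_ring_homD[OF big_poly_hom])
  next
    case (Suc i)
    have "Poly_Mapping.single (Poly_Mapping.single n 1) (1::'a) * Poly_Mapping.single (Poly_Mapping.single n i) 1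
        = Poly_Mapping.single (Poly_Mapping.single n (Suc i)) 1"
      by (simp add: mult_single single_add[symmetric])
    then show ?case using Suc by (simp add: big_var_def is_ring_homD(4)[OF big_poly_hom, symmetric])
  qed
  have sum: "big_poly (sum f A) = (\<Sum>i\<in>A. big_poly (f i))" for f :: "nat \<Rightarrow> (nat, 'a) mpoly" and A
    by (induction A rule: infinite_finite_induct) (simp_all add: is_ring_homD[OF big_poly_hom])
  have "big_poly (\<Sum>i\<le>d. g i * Poly_Mapping.single (Poly_Mapping.single n i) 1) = Polynomial.poly Q (big_var n)"
    unfolding poly_altdef sum d_def by (simp add: is_ring_homD(4)[OF big_poly_hom] g(2) pow)
  then have "(\<Sum>i\<le>d. g i * Poly_Mapping.single (Poly_Mapping.single n i) 1) = 0"
    using Q(3) by (simp add: big_poly_eq_0_iff)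
  then have "g d = 0" using mpolys_over_insert_unique[of g UNIV "{..<n}" n d d] g(1) by auto
  then have "lead_coeff Q = 0" using g(2)[of d] by (simp add: d_def is_ring_homD[OF big_poly_hom])
  then show False using Q(1) by simp
qed

text \<open>The variables are adjoined one after the other, each transcendental over the polynomials
  in the previous ones, so any values \<open>g i\<close> can be prescribed; the extension theorem
  covers the rest of the field.\<close>

lemma big_derivation:
  fixes d :: "'a::field_char_0 \<Rightarrow> 'a" and g :: "nat \<Rightarrow> 'a big"
  assumes d: "derivation d"
  shows "\<exists>D. derivation D \<and> (\<forall>c. D (big_const c) = big_const (d c)) \<and> (\<forall>i. D (big_var i) = g i)"
proof -
  \<comment> \<open>\<open>\<Gamma> n\<close> is the graph of the derivation on the polynomials in
    the first n variables.\<close>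
  define \<Gamma> where "\<Gamma> = rec_nat (range (\<lambda>c. (big_const c, big_const (d c)))) (\<lambda>n \<Gamma>. dual_adjoin \<Gamma> (big_var n) (g n))"
  have \<Gamma>0: "\<Gamma> 0 = range (\<lambda>c. (big_const c, big_const (d c)))" and \<Gamma>S: "\<Gamma> (Suc n) = dual_adjoin (\<Gamma> n) (big_var n) (g n)" for n
    by (simp_all add: \<Gamma>_def)
  note H = is_ring_homD[OF big_const_hom]
  have inv: "dual_ring (\<Gamma> n) \<and> functional_dual (\<Gamma> n) \<and> fst ` \<Gamma> n \<subseteq> big_ring n" for n
  proof (induction n)
    case 0
    have mem: "(big_const c, big_const (d c)) \<in> \<Gamma> 0" for c by (simp add: \<Gamma>0)
    have "dual_ring (\<Gamma> 0)"
      unfolding dual_ring_def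
    proof (intro conjI allI impI)
      show "(0, 0) \<in> \<Gamma> 0" using mem[of 0] by (simp add: H derivation_0[OF d])
      show "(1, 0) \<in> \<Gamma> 0" using mem[of 1] by (simp add: H derivation_1[OF d])
      fix a w assume "(a, w) \<in> \<Gamma> 0"
      then obtain x where x: "a = big_const x" "w = big_const (d x)" unfolding \<Gamma>0 by blast
      show "(- a, - w) \<in> \<Gamma> 0"
        using mem[of "- x"] x by (simp add: is_ring_hom_minus[OF big_const_hom] derivation_minus[OF d])
      fix b v assume "(b, v) \<in> \<Gamma> 0"
      then obtain z where z: "b = big_const z" "v = big_const (d z)" unfolding \<Gamma>0 by blast
      show "(a + b, w + v) \<in> \<Gamma> 0" using mem[of "x + z"] x z by (simp add: H derivationD[OF d])
      show "(a * b, a * v + w * b) \<in> \<Gamma> 0"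
        using mem[of "x * z"] x z by (simp add: H derivationD[OF d] add.commute)
    qed
    moreover have "functional_dual (\<Gamma> 0)"
      unfolding functional_dual_def \<Gamma>0
    proof (intro allI impI)
      fix w assume "(0, w) \<in> range (\<lambda>c. (big_const c, big_const (d c)))"
      then obtain c where c: "big_const c = 0" "w = big_const (d c)" by (metis (no_types, lifting) imageE prod.inject)
      then have "c = 0" using is_ring_hom_eq_0[OF big_const_hom zero_neq_one, of c] by simp
      then show "w = 0" using c(2) derivation_0[OF d] H(1) by simp
    qed
    moreover have "fst ` \<Gamma> 0 \<subseteq> big_ring 0"
      unfolding \<Gamma>0 big_ring_def big_const_def by (auto intro!: imageI mpolys_over_single)
    ultimately show ?case by blast
  next
    case (Suc n)
    then have IH: "dual_ring (\<Gamma> n)" "functional_dual (\<Gamma> n)" "fst ` \<Gamma> n \<subseteq> big_ring n" by auto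
    have "\<not> algebraic_over (fst ` \<Gamma> n) (big_var n)"
      using big_var_transcendental algebraic_over_mono[OF IH(3)] by blast
    then have "functional_dual (\<Gamma> (Suc n))"
      unfolding \<Gamma>S by (rule functional_dual_adjoin_transcendental[OF IH(1,2)])
    moreover have "dual_ring (\<Gamma> (Suc n))" unfolding \<Gamma>S by (rule dual_ring_adjoin[OF IH(1)])
    moreover have "fst ` \<Gamma> (Suc n) \<subseteq> big_ring (Suc n)"
    proof
      fix a assume "a \<in> fst ` \<Gamma> (Suc n)"
      then obtain w where "(a, w) \<in> dual_adjoin (\<Gamma> n) (big_var n) (g n)" unfolding \<Gamma>S by auto
      then obtain P Q where P: "(P, Q) \<in> poly_pairs (\<Gamma> n)" "a = Polynomial.poly P (big_var n)" by (rule dual_adjoinE)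
      have "mpolys_over UNIV {..<n} \<subseteq> (mpolys_over UNIV {..<Suc n} :: (nat, 'a) mpoly set)"
        by (rule mpolys_over_mono) auto
      then have "big_ring n \<subseteq> (big_ring (Suc n) :: 'a big set)" unfolding big_ring_def by (rule image_mono)
      moreover have "Polynomial.coeff P i \<in> fst ` \<Gamma> n" for i
        using P(1) by (auto simp: poly_pairs_def intro: image_eqI[of _ _ "(Polynomial.coeff P i, Polynomial.coeff Q i)"])
      ultimately have "Polynomial.coeff P i \<in> big_ring (Suc n)" for i using IH(3) by blast
      moreover have "big_var n \<in> (big_ring (Suc n) :: 'a big set)"
        unfolding big_var_def big_ring_def by (intro imageI mpolys_over_single) auto
      ultimately show "a \<in> big_ring (Suc n)" unfolding P(2) by (rule is_subring_poly[OF is_subring_big_ring])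
    qed
    ultimately show ?case by blast
  qed
  have step: "\<Gamma> n \<subseteq> \<Gamma> (Suc n)" for n unfolding \<Gamma>S by (rule dual_adjoin_superset) (use inv in blast)
  then have mono: "n \<le> n' \<Longrightarrow> \<Gamma> n \<subseteq> \<Gamma> n'" for n n' by (rule lift_Suc_mono_le)
  define \<Delta> where "\<Delta> = (\<Union>n. \<Gamma> n)"
  have "dual_ring \<Delta>"
    unfolding dual_ring_def
  proof (intro conjI allI impI)
    show "(0, 0) \<in> \<Delta>" "(1, 0) \<in> \<Delta>" using inv[of 0] dual_ringD(1,2)[of "\<Gamma> 0"] unfolding \<Delta>_def by blast+
    fix a w assume "(a, w) \<in> \<Delta>"
    then obtain n where n: "(a, w) \<in> \<Gamma> n" unfolding \<Delta>_def by blast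
    then show "(- a, - w) \<in> \<Delta>" using inv[of n] dual_ringD(5)[of "\<Gamma> n" a w] unfolding \<Delta>_def by blast
    fix b v assume "(b, v) \<in> \<Delta>"
    then obtain n' where n': "(b, v) \<in> \<Gamma> n'" unfolding \<Delta>_def by blast
    have 1: "(a, w) \<in> \<Gamma> (max n n')" using n mono[of n "max n n'"] by auto
    have 2: "(b, v) \<in> \<Gamma> (max n n')" using n' mono[of n' "max n n'"] by auto
    have 3: "dual_ring (\<Gamma> (max n n'))" using inv by blast
    show "(a + b, w + v) \<in> \<Delta>" using dual_ringD(3)[OF 3 1 2] unfolding \<Delta>_def by blast
    show "(a * b, a * v + w * b) \<in> \<Delta>" using dual_ringD(4)[OF 3 1 2] unfolding \<Delta>_def by blast
  qed
  moreover have "functional_dual \<Delta>" using inv unfolding functional_dual_def \<Delta>_def by blast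
  ultimately obtain D where D: "derivation D" "\<forall>(x, w)\<in>\<Delta>. D x = w" using derivation_extension by blast
  have "D (big_const c) = big_const (d c)" for c
  proof -
    have "(big_const c, big_const (d c)) \<in> \<Gamma> 0" by (simp add: \<Gamma>0)
    then have "(big_const c, big_const (d c)) \<in> \<Delta>" unfolding \<Delta>_def by blast
    from bspec[OF D(2) this] show ?thesis by simp
  qed
  moreover have "D (big_var i) = g i" for i
  proof -
    have "(big_var i, g i) \<in> \<Gamma> (Suc i)" unfolding \<Gamma>S by (rule dual_adjoin_mem) (use inv in blast)
    then have "(big_var i, g i) \<in> \<Delta>" unfolding \<Delta>_def by blast
    from bspec[OF D(2) this] show ?thesis by simp
  qed
  ultimately show ?thesis using D(1) by blast
qed

section \<open>Generic solutions of a characteristic set\<close>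

context diff_subfield
begin

lemma nonvanishing_down_closed:
  assumes S: "S \<subseteq> jvars m I" "\<And>w. w \<in> S \<Longrightarrow> below m I w \<subseteq> S"
    and q: "q \<in> pexprs k (jvars m I0 \<union> S)" "peval (\<lambda>x. x) (jet \<delta> c) q \<noteq> 0"
  shows "\<exists>g\<in>pexprs k (jvars m I0). peval (\<lambda>x. x) (jet \<delta> c) g \<noteq> 0 \<and>
    (\<forall>(h :: 'a \<Rightarrow> 'f::field_char_0) y. is_ring_hom h \<longrightarrow> specializes k h (jet \<delta> c) y (jvars m I0 \<union> S) \<longrightarrow>
      (\<forall>z\<in>S. \<not> lead c I0 I z \<longrightarrow> \<not> algebraic_over (pval h k y (jvars m I0 \<union> below m I z)) (y z)) \<longrightarrow>
      peval h y g \<noteq> 0 \<longrightarrow> peval h y q \<noteq> 0)"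
proof -
  define A where "A = pvars q \<inter> S"
  show ?thesis
  proof (cases "A = {}")
    case True
    then have "q \<in> pexprs k (jvars m I0)" using q(1) by (auto simp: A_def pexprs_def)
    then show ?thesis using q(2) by (intro bexI[of _ q]) auto
  next
    case False
    moreover have "finite A" "A \<subseteq> jvars m I" using S(1) by (auto simp: A_def finite_pvars)
    ultimately obtain w where w: "w \<in> A" "A \<subseteq> insert w (below m I w)" using finite_subset_max by metis
    have wS: "w \<in> S" "w \<in> jvars m I" using w(1) S(1) by (auto simp: A_def)
    have qw: "q \<in> pexprs k (jvars m I0 \<union> insert w (below m I w))" using q(1) w(2) unfolding A_def pexprs_def by blast
    have sub: "insert w (below m I w) \<subseteq> S" using S(2)[OF wS(1)] wS(1) by blast
    obtain g where g: "g \<in> pexprs k (jvars m I0)" "peval (\<lambda>x. x) (jet \<delta> c) g \<noteq> 0"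
      "\<And>(h :: 'a \<Rightarrow> 'f) y. is_ring_hom h \<Longrightarrow> specializes k h (jet \<delta> c) y (jvars m I0 \<union> insert w (below m I w)) \<Longrightarrow>
        (\<forall>z\<in>insert w (below m I w). \<not> lead c I0 I z \<longrightarrow> \<not> algebraic_over (pval h k y (jvars m I0 \<union> below m I z)) (y z)) \<Longrightarrow>
        peval h y g \<noteq> 0 \<Longrightarrow> peval h y q \<noteq> 0"
      using nonvanishing_base[OF wS(2) qw q(2), where 'f = 'f] by blast
    show ?thesis
    proof (intro bexI[OF _ g(1)] conjI g(2) allI impI)
      fix h :: "'a \<Rightarrow> 'f" and y
      assume a: "is_ring_hom h" "specializes k h (jet \<delta> c) y (jvars m I0 \<union> S)"
        "\<forall>z\<in>S. \<not> lead c I0 I z \<longrightarrow> \<not> algebraic_over (pval h k y (jvars m I0 \<union> below m I z)) (y z)"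
        "peval h y g \<noteq> 0"
      have s: "specializes k h (jet \<delta> c) y (jvars m I0 \<union> insert w (below m I w))"
        by (rule specializes_subset[OF a(2)]) (use sub in auto)
      show "peval h y q \<noteq> 0" by (rule g(3)[OF a(1) s _ a(4)]) (use a(3) sub in blast)
    qed
  qed
qed

text \<open>\<open>g\<close> is a condition on the parameters alone that keeps \<open>q\<close>
  nonzero under every specialisation in which the non-leaders stay transcendental. The target is
  fixed to \<open>'a big\<close>, where generic solutions are built.\<close>

definition keeps_nonzero :: "'a list \<Rightarrow> nat set \<Rightarrow> nat set \<Rightarrow> jvar set \<Rightarrow> (jvar, 'a) pexpr \<Rightarrow> (jvar, 'a) pexpr \<Rightarrow> bool" where
  "keeps_nonzero c I0 I S g q \<longleftrightarrow> g \<in> pexprs k (jvars m I0) \<and> peval (\<lambda>x. x) (jet \<delta> c) g \<noteq> 0 \<and>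
    (\<forall>(h :: 'a \<Rightarrow> 'a big) y. is_ring_hom h \<longrightarrow> specializes k h (jet \<delta> c) y (jvars m I0 \<union> S) \<longrightarrow>
      (\<forall>z\<in>S. \<not> lead c I0 I z \<longrightarrow> \<not> algebraic_over (pval h k y (jvars m I0 \<union> below m I z)) (y z)) \<longrightarrow>
      peval h y g \<noteq> 0 \<longrightarrow> peval h y q \<noteq> 0)"

lemma ex_keeps_nonzero:
  assumes "S \<subseteq> jvars m I" "\<And>w. w \<in> S \<Longrightarrow> below m I w \<subseteq> S"
    and "q \<in> pexprs k (jvars m I0 \<union> S)" "peval (\<lambda>x. x) (jet \<delta> c) q \<noteq> 0"
  shows "\<exists>g. keeps_nonzero c I0 I S g q"
  unfolding keeps_nonzero_def using nonvanishing_down_closed[OF assms, where 'f = "'a big"] by blast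

text \<open>Four facts have to be proved in one induction along the ranking. Roots exist only if
  initials do not vanish; initials are controlled through specialisation and transcendence of the
  lower jets; and these in turn depend on the lower roots and separants. Compatibility with the
  derivations follows afterwards from specialisation.\<close>

theorem generic_solution:
  fixes Bs :: "(jvar \<times> (jvar, 'a) pexpr list) set"
  assumes disj: "I0 \<inter> I = {}"
    and Bs: "\<And>u es. (u, es) \<in> Bs \<Longrightarrow> u \<in> jvars m I \<and> mrel c I0 I u es"
      "\<And>u. lead c I0 I u \<Longrightarrow> \<exists>es. prolongation m \<delta> Bs u es"
    and G: "\<And>u es. (u, es) \<in> Bs \<Longrightarrow> keeps_nonzero c I0 I (below m I u) (g1 u es) (last es)"
      "\<And>u es. (u, es) \<in> Bs \<Longrightarrow> keeps_nonzero c I0 I (insert u (below m I u)) (g2 u es) (psep (PVar u) es)"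
    and c': "\<And>u es. (u, es) \<in> Bs \<Longrightarrow> peval (\<lambda>x. x) (jet \<delta> c') (g1 u es) \<noteq> 0 \<and> peval (\<lambda>x. x) (jet \<delta> c') (g2 u es) \<noteq> 0"
    and s0: "specializes k (\<lambda>x. x) (jet \<delta> c) (jet \<delta> c') (jvars m I0)"
  shows "\<exists>(y :: jvar \<Rightarrow> 'a big) D.
    (\<forall>v\<in>jvars m I0. y v = big_const (jet \<delta> c' v)) \<and>
    (\<forall>(u, es)\<in>Bs. rel_holds big_const y u es) \<and>
    (\<forall>z\<in>jvars m I. \<not> lead c I0 I z \<longrightarrow> \<not> algebraic_over (pval big_const k y (jvars m I0 \<union> below m I z)) (y z)) \<and>
    (\<forall>l<m. derivation (D l) \<and> (\<forall>x. D l (big_const x) = big_const (\<delta> l x)) \<and>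
      (\<forall>v\<in>jvars m I0 \<union> jvars m I. D l (y v) = y (shiftv l v)))"
proof -
  define es where "es u = (SOME es. prolongation m \<delta> Bs u es)" for u
  have es: "prolongation m \<delta> Bs u (es u)" if "lead c I0 I u" for u
    unfolding es_def by (rule someI_ex) (rule Bs(2)[OF that])
  have es': "u \<in> jvars m I" "mrel c I0 I u (es u)" if "lead c I0 I u" for u
    using prolongation_mrel[OF Bs(1) es[OF that]] by auto
  have esY: "set (es u) \<subseteq> pexprs k (jvars m I0 \<union> below m I u)" if "lead c I0 I u" for u
    using es'(2)[OF that] by (simp add: min_relation_def)
  define base where "base f v = (if v \<in> jvars m I0 then big_const (jet \<delta> c' v) else f v)" for f :: "jvar \<Rightarrow> 'a big" and v
  \<comment> \<open>The choice at u consults only jets below u, hence recursion along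
    \<open>rless\<close>; \<open>base\<close> overlays the fixed values of the parameter
    jets.\<close>
  define F where "F f u = (if lead c I0 I u
      then (SOME t. Polynomial.poly (Pev big_const (base f) (es u)) t = 0) else big_var (to_nat u))" for f :: "jvar \<Rightarrow> 'a big" and u
  define y0 where "y0 = wfrec rless F"
  define y where "y = base y0"
  note hom = big_const_hom
  have y0: "y0 u = F (cut y0 rless u) u" for u
    unfolding y0_def by (rule wfrec[OF wf_rless])
  have yI: "y u = y0 u" if "u \<in> jvars m I" for u
    using that disj by (auto simp: y_def base_def jvars_def)
  have yI0: "y v = big_const (jet \<delta> c' v)" if "v \<in> jvars m I0" for v
    using that by (simp add: y_def base_def)
  have y_lead: "y u = (SOME t. Polynomial.poly (Pev big_const y (es u)) t = 0)" if "lead c I0 I u" for u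
  proof -
    have eq: "map (peval big_const (base (cut y0 rless u))) (es u) = map (peval big_const y) (es u)"
    proof (rule map_cong[OF refl])
      fix e assume "e \<in> set (es u)"
      then have "pvars e \<subseteq> jvars m I0 \<union> below m I u" using esY[OF that] by (auto simp: pexprs_def)
      then show "peval big_const (base (cut y0 rless u)) e = peval big_const y e"
        by (intro peval_cong) (auto simp: y_def base_def cut_apply below_def)
    qed
    have "y u = (SOME t. Polynomial.poly (Pev big_const (base (cut y0 rless u)) (es u)) t = 0)"
      using yI[OF es'(1)[OF that]] y0[of u] that by (simp add: F_def)
    then show ?thesis unfolding eq .
  qed
  have y_nonlead: "y u = big_var (to_nat u)" if "u \<in> jvars m I" "\<not> lead c I0 I u" for u
    using yI[OF that(1)] y0[of u] that(2) by (simp add: F_def)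
  have s0': "specializes k big_const (jet \<delta> c) y (jvars m I0)"
    unfolding specializes_def
  proof (intro ballI impI)
    fix e assume e: "e \<in> pexprs k (jvars m I0)" "peval (\<lambda>c. c) (jet \<delta> c) e = 0"
    have "peval big_const y e = big_const (peval (\<lambda>c. c) (jet \<delta> c') e)"
      using e(1) by (induction e) (auto simp: yI0 is_ring_homD[OF hom])
    then show "peval big_const y e = 0"
      using s0 e by (simp add: specializes_def is_ring_homD[OF hom])
  qed
  have base_eval: "peval big_const y e = big_const (peval (\<lambda>c. c) (jet \<delta> c') e)" if "e \<in> pexprs k (jvars m I0)" for e
    using that by (induction e) (auto simp: yI0 is_ring_homD[OF hom])
  have big_nz: "big_const t \<noteq> 0" if "t \<noteq> 0" for t :: 'a
    using is_ring_hom_eq_0[OF hom] that by auto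
  define transc where "transc z \<longleftrightarrow> (\<not> lead c I0 I z \<longrightarrow>
    \<not> algebraic_over (pval big_const k y (jvars m I0 \<union> below m I z)) (y z))" for z
  define nonvan where "nonvan u \<longleftrightarrow> (\<forall>fs. prolongation m \<delta> Bs u fs \<longrightarrow>
    peval big_const y (last fs) \<noteq> 0 \<and> peval big_const y (psep (PVar u) fs) \<noteq> 0)" for u
  define root where "root u \<longleftrightarrow> (lead c I0 I u \<longrightarrow> Polynomial.poly (Pev big_const y (es u)) (y u) = 0)" for u
  define spec where "spec u \<longleftrightarrow> specializes k big_const (jet \<delta> c) y (jvars m I0 \<union> insert u (below m I u))" for u
  have main: "u \<in> jvars m I \<longrightarrow> spec u \<and> transc u \<and> nonvan u \<and> root u" for u
  proof (induction u rule: wf_induct_rule[OF wf_rless])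
    case (1 u)
    show ?case
    proof
      assume u: "u \<in> jvars m I"
      have IH: "spec w" "transc w" "nonvan w" "root w" if "w \<in> below m I u" for w
        using 1 that by (auto simp: below_def)
      have sb: "specializes k big_const (jet \<delta> c) y (jvars m I0 \<union> below m I u)"
        by (rule specializes_below[OF s0']) (use IH(1) in \<open>auto simp: below_def spec_def\<close>)
      have tr: "transc u"
        unfolding transc_def
      proof (intro impI notI)
        assume nl: "\<not> lead c I0 I u" and alg: "algebraic_over (pval big_const k y (jvars m I0 \<union> below m I u)) (y u)"
        have "derivation (\<lambda>_. 0 :: 'a)" by (simp add: derivation_def)
        \<comment> \<open>This derivation sees only the variable of u. It kills the constants and
          all other variables, hence all lower jets, whose relations have nonzero separants. If y u
          were algebraic over them it would be killed too, but its derivative is 1.\<close>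
        from big_derivation[OF this, of "\<lambda>i. if i = to_nat u then 1 else 0"]
        obtain D :: "'a big \<Rightarrow> 'a big" where D: "derivation D" "\<And>c. D (big_const c) = 0" "\<And>i. D (big_var i) = (if i = to_nat u then 1 else 0)"
          unfolding is_ring_homD(1)[OF hom] by blast
        have ker: "is_subring {t. D t = 0}" by (rule is_subfield_imp_is_subring[OF derivation_kernel_subfield[OF D(1)]])
        have D0: "w \<in> below m I u \<longrightarrow> D (y w) = 0" for w
        proof (induction w rule: wf_induct_rule[OF wf_rless])
          case (1 w)
          show ?case
          proof
            assume w: "w \<in> below m I u"
            then have wI: "w \<in> jvars m I" "(w, u) \<in> rless" by (auto simp: below_def)
            show "D (y w) = 0"
            proof (cases "lead c I0 I w")
              case False
              have "w \<noteq> u" using wI(2) rless_irrefl[of u] by auto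
              then show ?thesis using y_nonlead[OF wI(1) False] D(3) by simp
            next
              case True
              have "pval big_const k y (jvars m I0 \<union> below m I w) \<subseteq> {t. D t = 0}"
                using 1 wI trans_rless[of _ w u] yI0 D(2)
                by (intro pval_subset[OF ker]) (auto simp: below_def)
              then have "D (peval big_const y e) = 0" if "e \<in> set (es w)" for e
                using that esY[OF True] by (auto simp: pval_def)
              then have "Polynomial.coeff (Pev big_const y (es w)) i \<in> {t. D t = 0}" for i
                by (intro Pev_in is_subringD(1)[OF ker]) auto
              then have "map_poly D (Pev big_const y (es w)) = 0"
                by (intro poly_eqI) (simp add: coeff_map_poly derivation_0[OF D(1)])
              then have "Polynomial.poly (pderiv (Pev big_const y (es w))) (y w) * D (y w) = D (Polynomial.poly (Pev big_const y (es w)) (y w))"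
                unfolding derivation_poly[OF D(1)] by simp
              also have "\<dots> = 0" using IH(4)[OF w] True derivation_0[OF D(1)] by (simp add: root_def)
              finally show ?thesis
                using IH(3)[OF w] es[OF True] by (auto simp: nonvan_def peval_psep[OF hom])
            qed
          qed
        qed
        have "pval big_const k y (jvars m I0 \<union> below m I u) \<subseteq> {t. D t = 0}"
          using D0 yI0 D(2) by (intro pval_subset[OF ker]) auto
        then have "D (y u) = 0" using derivation_algebraic_eq_0[OF D(1) _ alg] by blast
        then show False using y_nonlead[OF u nl] D(3) by simp
      qed
      have tr_below: "\<forall>z\<in>below m I u. \<not> lead c I0 I z \<longrightarrow> \<not> algebraic_over (pval big_const k y (jvars m I0 \<union> below m I z)) (y z)"
        using IH(2) by (auto simp: transc_def)
      have g_nz: "peval big_const y (g1 u fs) \<noteq> 0" "peval big_const y (g2 u fs) \<noteq> 0" if "(u, fs) \<in> Bs" for fs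
        using G[OF that] c'[OF that] base_eval big_nz by (auto simp: keeps_nonzero_def)
      have lc: "peval big_const y (last fs) \<noteq> 0" if "prolongation m \<delta> Bs u fs" for fs
        using that
      proof cases
        case base
        then show ?thesis using G(1)[OF base] hom sb tr_below g_nz(1)[OF base] unfolding keeps_nonzero_def by blast
      next
        case (shift w fs' l)
        have w: "w \<in> jvars m I" using prolongation_mrel[OF Bs(1) shift(3)] by auto
        then have "w \<in> below m I u" using below_subset_shiftv[OF w shift(4)] shift(1) by auto
        then show ?thesis using IH(3) shift(2,3) by (simp add: nonvan_def)
      qed
      have rt: "root u"
        unfolding root_def
      proof
        assume l: "lead c I0 I u"
        have ne: "es u \<noteq> []" using es'(2)[OF l] by (simp add: min_relation_def)
        have "Polynomial.degree (Pev big_const y (es u)) > 0"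
          using degree_Pev(1)[OF ne lc[OF es[OF l]]] min_relation_length[OF es'(2)[OF l]] by simp
        then have "\<exists>t. Polynomial.poly (Pev big_const y (es u)) t = 0" by (rule alg_closed_imp_poly_has_root)
        then show "Polynomial.poly (Pev big_const y (es u)) (y u) = 0"
          unfolding y_lead[OF l] by (rule someI_ex)
      qed
      have sp: "spec u"
        unfolding spec_def
        by (rule specializes_insert[OF hom u sb], rule exI[of _ "es u"])
           (use es[of u] es'(2)[of u] lc rt in \<open>auto simp: root_def\<close>)
      \<comment> \<open>The separant may contain u itself, so it is controlled only after u has been
        specialised, unlike the initial.\<close>
      have "peval big_const y (psep (PVar u) fs) \<noteq> 0" if "prolongation m \<delta> Bs u fs" for fs
        using that
      proof cases
        case base
        then show ?thesis using G(2)[OF base] hom sp tr_below tr g_nz(2)[OF base]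
          unfolding keeps_nonzero_def spec_def transc_def by blast
      next
        case (shift w fs' l)
        have "peval big_const y (psep (PVar u) fs) = peval big_const y (last fs)"
          unfolding shift(2) by (simp add: phorner_def is_ring_homD[OF hom])
        then show ?thesis using lc[OF that] by simp
      qed
      then show "spec u \<and> transc u \<and> nonvan u \<and> root u" using sp tr rt lc by (auto simp: nonvan_def)
    qed
  qed
  have spec_all: "specializes k big_const (jet \<delta> c) y (jvars m I0 \<union> jvars m I)"
    by (rule specializes_below[OF s0' order_refl]) (use main in \<open>auto simp: spec_def\<close>)
  \<comment> \<open>On the variable of a non-leader the derivative is prescribed to be the value of
    the shifted jet; on leaders the same has to be proved.\<close>
  have "\<exists>D. derivation D \<and> (\<forall>c. D (big_const c) = big_const (\<delta> l c)) \<and> (\<forall>i. D (big_var i) = y (shiftv l (from_nat i)))"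
    if "l < m" for l
    by (rule big_derivation[OF derivation_\<delta>[OF that]])
  then obtain D :: "nat \<Rightarrow> 'a big \<Rightarrow> 'a big" where D: "\<And>l. l < m \<Longrightarrow> derivation (D l)" "\<And>l c. l < m \<Longrightarrow> D l (big_const c) = big_const (\<delta> l c)"
    "\<And>l i. l < m \<Longrightarrow> D l (big_var i) = y (shiftv l (from_nat i))" by metis
  have D0: "D l (y v) = y (shiftv l v)" if "v \<in> jvars m I0" "l < m" for v l
    using yI0[OF that(1)] yI0[OF jvars_shiftv[OF that(1)]] D(2)[OF that(2)] jet_shiftv[of v l c'] that
    by (simp add: jvars_def)
  have DI: "u \<in> jvars m I \<longrightarrow> D l (y u) = y (shiftv l u)" if l: "l < m" for u l
  proof (induction u rule: wf_induct_rule[OF wf_rless])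
    case (1 u)
    show ?case
    proof
      assume u: "u \<in> jvars m I"
      show "D l (y u) = y (shiftv l u)"
      proof (cases "lead c I0 I u")
        case False
        then show ?thesis using y_nonlead[OF u False] D(3)[OF l] by simp
      next
        case True
        \<comment> \<open>The derivative of the relation chosen for u need not be the relation
          chosen for the derivative of u. It holds at c, however, and therefore at y.\<close>
        let ?fs = "[phorner (PVar u) (map (pder (\<delta> l) l) (es u)), psep (PVar u) (es u)]"
        let ?su = "shiftv l u"
        have eqc: "Polynomial.poly (Pev (\<lambda>x. x) (jet \<delta> c) ?fs) (jet \<delta> c ?su) = 0"
          by (rule relation_shift(2)[OF u l esY[OF True]]) (use es'(2)[OF True] in \<open>simp add: min_relation_def\<close>)
        have fsY: "set ?fs \<subseteq> pexprs k (jvars m I0 \<union> jvars m I)"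
          using relation_shift(1)[OF u l esY[OF True]]
            pexprs_mono[of "jvars m I0 \<union> below m I ?su" "jvars m I0 \<union> jvars m I"] by (auto simp: below_def)
        have "phorner (PVar ?su) ?fs \<in> pexprs k (jvars m I0 \<union> jvars m I)"
          by (rule phorner_pexprs[OF k_simps(1) _ fsY]) (use jvars_shiftv[OF u] in simp)
        moreover have "peval (\<lambda>x. x) (jet \<delta> c) (phorner (PVar ?su) ?fs) = 0"
          using eqc by (simp only: peval_phorner[OF is_ring_hom_id] peval.simps)
        ultimately have "peval big_const y (phorner (PVar ?su) ?fs) = 0"
          using spec_all unfolding specializes_def by blast
        then have rel: "Polynomial.poly (Pev big_const y (map (pder (\<delta> l) l) (es u))) (y u)
            + y ?su * Polynomial.poly (pderiv (Pev big_const y (es u))) (y u) = 0"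
          by (simp add: peval_phorner[OF hom] peval_psep[OF hom] del: map_map)
        have "0 = D l (Polynomial.poly (Pev big_const y (es u)) (y u))"
          using main u True derivation_0[OF D(1)[OF l]] by (auto simp: root_def)
        also have "\<dots> = Polynomial.poly (Pev big_const y (map (pder (\<delta> l) l) (es u))) (y u)
            + Polynomial.poly (pderiv (Pev big_const y (es u))) (y u) * D l (y u)"
          by (rule derivation_Pev[where k = k and h = big_const and d = "\<delta> l" and y = y and D = "D l"
                and Y = "jvars m I0 \<union> below m I u"])
             (use D l 1 D0 esY[OF True] in \<open>auto simp: below_def\<close>)
        finally have e: "0 = Polynomial.poly (Pev big_const y (map (pder (\<delta> l) l) (es u))) (y u)
            + Polynomial.poly (pderiv (Pev big_const y (es u))) (y u) * D l (y u)" .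
        have "B * (t - s) = (A + B * t) - (A + s * B)" for A B s t :: "'a big" by (simp add: algebra_simps)
        from this[where A = "Polynomial.poly (Pev big_const y (map (pder (\<delta> l) l) (es u))) (y u)"
            and B = "Polynomial.poly (pderiv (Pev big_const y (es u))) (y u)" and t = "D l (y u)" and s = "y ?su"]
        have "Polynomial.poly (pderiv (Pev big_const y (es u))) (y u) * (D l (y u) - y ?su) = 0"
          unfolding e[symmetric] rel by simp
        moreover have "Polynomial.poly (pderiv (Pev big_const y (es u))) (y u) \<noteq> 0"
          using main u es[OF True] by (auto simp: nonvan_def peval_psep[OF hom])
        ultimately show ?thesis by simp
      qed
    qed
  qed
  have holds: "rel_holds big_const y u fs" if fs: "(u, fs) \<in> Bs" for u fs
  proof -
    have u: "u \<in> jvars m I" "mrel c I0 I u fs" using Bs(1)[OF fs] by auto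
    have "phorner (PVar u) fs \<in> pexprs k (jvars m I0 \<union> jvars m I)"
      using u(2) pexprs_mono[of "jvars m I0 \<union> below m I u" "jvars m I0 \<union> jvars m I"] u(1)
      by (intro phorner_pexprs k_simps) (auto simp: min_relation_def below_def)
    moreover have "peval (\<lambda>x. x) (jet \<delta> c) (phorner (PVar u) fs) = 0"
      using u(2) by (simp add: peval_phorner[OF is_ring_hom_id] min_relation_def)
    ultimately have "peval big_const y (phorner (PVar u) fs) = 0"
      using spec_all unfolding specializes_def by blast
    then show ?thesis using main u(1) prolongation.base[OF fs]
      by (auto simp: rel_holds_def nonvan_def peval_phorner[OF hom])
  qed
  show ?thesis
    by (rule exI[of _ y], rule exI[of _ D])
       (use yI0 holds main D(1,2) D0 DI in \<open>auto simp: transc_def\<close>)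
qed

end

section \<open>Cardinalities of generated fields\<close>

lemma lepoll_UN:
  assumes "infinite B" "lepoll I B" "\<And>i. i \<in> I \<Longrightarrow> lepoll (A i) B"
  shows "lepoll (\<Union>i\<in>I. A i) B"
  using card_of_UNION_ordLeq_infinite[OF assms(1), of I A] assms(2,3)
  unfolding lepoll_def card_of_ordLeq by blast

lemma lepoll_Un:
  assumes "infinite B" "lepoll A B" "lepoll A' B"
  shows "lepoll (A \<union> A') B"
proof -
  have "A \<union> A' = (\<Union>b\<in>(UNIV :: bool set). if b then A else A')" by (auto split: if_splits)
  moreover have "lepoll (UNIV :: bool set) B" using assms(1) by (simp add: finite_lepoll_infinite)
  ultimately show ?thesis using lepoll_UN[OF assms(1), of "UNIV :: bool set" "\<lambda>b. if b then A else A'"] assms by simp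
qed

lemma lepoll_Times:
  assumes "infinite B" "lepoll A B" "lepoll A' B"
  shows "lepoll (A \<times> A') B"
proof -
  have "A \<times> A' = (\<Union>a\<in>A. Pair a ` A')" by auto
  moreover have "lepoll (\<Union>a\<in>A. Pair a ` A') B"
    by (rule lepoll_UN[OF assms(1,2)]) (rule lepoll_trans[OF image_lepoll assms(3)])
  ultimately show ?thesis by simp
qed

lemma countable_lepoll: "infinite B \<Longrightarrow> lepoll (UNIV :: nat set) B"
  by (simp add: infinite_le_lepoll)

text \<open>Each of countably many rounds applies countably many binary operations to pairs, which
  does not raise an infinite cardinality. Constants and unary operations can be coded as binary
  ones.\<close>

lemma operations_closure_lepoll:
  fixes f :: "nat \<Rightarrow> 'b \<Rightarrow> 'b \<Rightarrow> 'b"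
  assumes "infinite A"
  shows "\<exists>C. A \<subseteq> C \<and> (\<forall>j. \<forall>x\<in>C. \<forall>y\<in>C. f j x y \<in> C) \<and> lepoll C A"
proof -
  define G where "G = rec_nat A (\<lambda>n B. B \<union> (\<Union>j. (\<lambda>(x, y). f j x y) ` (B \<times> B)))"
  have G0: "G 0 = A" and GS: "G (Suc n) = G n \<union> (\<Union>j. (\<lambda>(x, y). f j x y) ` (G n \<times> G n))" for n
    by (simp_all add: G_def)
  have le: "lepoll (G n) A" for n
  proof (induction n)
    case 0
    then show ?case by (simp add: G0)
  next
    case (Suc n)
    have "lepoll ((\<lambda>(x, y). f j x y) ` (G n \<times> G n)) A" for j
      by (rule lepoll_trans[OF image_lepoll lepoll_Times[OF assms Suc Suc]])
    then show ?case unfolding GS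
      by (intro lepoll_Un lepoll_UN assms Suc countable_lepoll) auto
  qed
  have mono: "n \<le> n' \<Longrightarrow> G n \<subseteq> G n'" for n n'
    by (rule lift_Suc_mono_le[of G]) (auto simp: GS)
  have "f j x y \<in> (\<Union>n. G n)" if xy: "x \<in> (\<Union>n. G n)" "y \<in> (\<Union>n. G n)" for j x y
  proof -
    obtain p q where "x \<in> G p" "y \<in> G q" using xy by blast
    then have "x \<in> G (max p q)" "y \<in> G (max p q)" using mono[of p "max p q"] mono[of q "max p q"] by auto
    then have "f j x y \<in> G (Suc (max p q))" unfolding GS by blast
    then show ?thesis by blast
  qed
  moreover have "lepoll (\<Union>n. G n) A" by (intro lepoll_UN assms countable_lepoll le)
  moreover have "A \<subseteq> (\<Union>n. G n)" using G0 by blast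
  ultimately show ?thesis by (intro exI[of _ "\<Union>n. G n"] conjI allI ballI)
qed

lemma diff_subfield_hull_lepoll:
  fixes A :: "'b::field_char_0 set"
  assumes "infinite A"
  shows "lepoll (is_diff_subfield m \<delta> hull A) A" and "lepoll (is_subfield hull A) A"
proof -
  \<comment> \<open>Codes 0 to 5 are the field operations and constants, and l + 6 is the l-th
    derivation.\<close>
  define f where "f j x y = (case j of 0 \<Rightarrow> x + y | Suc 0 \<Rightarrow> x * y | Suc (Suc 0) \<Rightarrow> - x
    | Suc (Suc (Suc 0)) \<Rightarrow> inverse x | Suc (Suc (Suc (Suc 0))) \<Rightarrow> 0 | Suc (Suc (Suc (Suc (Suc 0)))) \<Rightarrow> 1
    | Suc (Suc (Suc (Suc (Suc (Suc l))))) \<Rightarrow> \<delta> l x)" for j :: nat and x y :: 'b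
  obtain C where C: "A \<subseteq> C" "\<And>j x y. x \<in> C \<Longrightarrow> y \<in> C \<Longrightarrow> f j x y \<in> C" "lepoll C A"
    using operations_closure_lepoll[OF assms, of f] by blast
  have ne: "\<exists>x. x \<in> C" using assms C(1) by (metis finite.emptyI subset_empty equals0I)
  have f: "f 0 x y = x + y" "f 1 x y = x * y" "f 2 x y = - x" "f 3 x y = inverse x" "f 4 x y = 0" "f 5 x y = 1"
    "f (l + 6) x y = \<delta> l x" for x y l
    by (simp_all add: f_def numeral_eq_Suc)
  have sub: "is_subfield C"
    unfolding is_subfield_def using C(2) f ne by metis
  moreover have "\<delta> l x \<in> C" if "x \<in> C" for l x using C(2)[OF that that, of "l + 6"] by (simp only: f)
  ultimately have "is_diff_subfield m \<delta> C" by (simp add: is_diff_subfield_def)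
  then have "is_diff_subfield m \<delta> hull A \<subseteq> C" by (rule hull_minimal[OF C(1)])
  then show "lepoll (is_diff_subfield m \<delta> hull A) A" using C(3) subset_imp_lepoll lepoll_trans by blast
  have "is_subfield hull A \<subseteq> C" by (rule hull_minimal[where S = is_subfield, OF C(1) sub])
  then show "lepoll (is_subfield hull A) A" using C(3) subset_imp_lepoll lepoll_trans by blast
qed

section \<open>Transport of a subfield to another type\<close>

definition sub_ring :: "'f::field_char_0 set \<Rightarrow> 'f ring" where
  "sub_ring B = \<lparr>carrier = B, monoid.mult = (\<lambda>x y. x * y), one = 1, ring.zero = 0, add = (\<lambda>x y. x + y)\<rparr>"

lemma field_sub_ring:
  assumes "is_subfield B"
  shows "field (sub_ring B)"
proof -
  note D = is_subfieldD[OF assms]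
  have 1: "\<exists>y\<in>B. y + x = 0 \<and> x + y = 0" if "x \<in> B" for x using D(5)[OF that] by (intro bexI[of _ "- x"]) auto
  have 2: "\<exists>y\<in>B. y * x = 1 \<and> x * y = 1" if "x \<in> B" "x \<noteq> 0" for x
    using D(6)[OF that(1)] that(2) by (intro bexI[of _ "inverse x"]) auto
  show ?thesis
    unfolding sub_ring_def
    by unfold_locales (use D 1 2 in \<open>auto simp: algebra_simps Units_def\<close>)
qed

text \<open>\<open>differentially_closed\<close> quantifies over extensions carried by the type
  \<open>'a\<close>, so a subfield of \<open>'a big\<close> of suitable cardinality is moved there
  along an injection.\<close>

locale transported_field =
  fixes B :: "'f::field_char_0 set" and \<iota> :: "'f \<Rightarrow> 'a"
  assumes B: "is_subfield B" and inj: "inj_on \<iota> B"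
begin

definition E :: "'a ring" where "E = image_ring \<iota> (sub_ring B)"

lemma field_E: "field E"
  unfolding E_def by (rule field.inj_imp_image_ring_is_field[OF field_sub_ring[OF B]])
    (use inj in \<open>simp add: sub_ring_def\<close>)

sublocale E: field E by (rule field_E)

lemma iso: "\<iota> \<in> ring_iso (sub_ring B) E"
  unfolding E_def by (rule inj_imp_image_ring_iso) (use inj in \<open>simp add: sub_ring_def\<close>)

lemma carrier_E: "carrier E = \<iota> ` B"
  unfolding E_def image_ring_carrier by (simp add: sub_ring_def)

lemma E_simps:
  "a \<in> B \<Longrightarrow> b \<in> B \<Longrightarrow> \<iota> a \<oplus>\<^bsub>E\<^esub> \<iota> b = \<iota> (a + b)"
  "a \<in> B \<Longrightarrow> b \<in> B \<Longrightarrow> \<iota> a \<otimes>\<^bsub>E\<^esub> \<iota> b = \<iota> (a * b)"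
  "\<zero>\<^bsub>E\<^esub> = \<iota> 0" "\<one>\<^bsub>E\<^esub> = \<iota> 1"
  using iso unfolding ring_iso_def ring_hom_def
  by (simp_all add: sub_ring_def E_def image_ring_zero image_ring_one)

lemma mem_E: "a \<in> B \<Longrightarrow> \<iota> a \<in> carrier E"
  by (simp add: carrier_E)

lemma B_subring: "is_subring B" by (rule is_subfield_imp_is_subring[OF B])

lemma finsum_E:
  assumes "finite S" "\<And>s. s \<in> S \<Longrightarrow> g s \<in> B"
  shows "(\<Oplus>\<^bsub>E\<^esub>s\<in>S. \<iota> (g s)) = \<iota> (sum g S)"
  using assms
proof (induction S rule: finite_induct)
  case (insert s S)
  then have "sum g S \<in> B" by (intro is_subring_sum[OF B_subring]) auto
  then show ?case using insert by (simp add: mem_E E_simps Pi_iff)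
qed (simp add: E_simps)

lemma finprod_E:
  assumes "finite S" "\<And>s. s \<in> S \<Longrightarrow> g s \<in> B"
  shows "(\<Otimes>\<^bsub>E\<^esub>s\<in>S. \<iota> (g s)) = \<iota> (prod g S)"
  using assms
proof (induction S rule: finite_induct)
  case (insert s S)
  then have "prod g S \<in> B" by (intro is_subring_prod[OF B_subring]) auto
  then show ?case using insert by (simp add: mem_E E_simps Pi_iff)
qed (simp add: E_simps)

lemma nat_pow_E: "a \<in> B \<Longrightarrow> \<iota> a [^]\<^bsub>E\<^esub> (n :: nat) = \<iota> (a ^ n)"
  by (induction n) (simp_all add: E_simps is_subring_power[OF B_subring] mult.commute)

lemma dpoly_eval_ext_E:
  assumes h: "\<And>c. h c \<in> B" and y: "\<And>v. y v \<in> B" and f: "f \<in> dpolys m UNIV n"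
    and c: "\<And>v. v \<in> {..<n} \<times> {\<xi>. length \<xi> = m} \<Longrightarrow> dpow \<epsilon> (snd v) (c ! fst v) = \<iota> (y v)"
  shows "dpoly_eval_ext E \<epsilon> (\<lambda>x. \<iota> (h x)) f c = \<iota> (meval h y f)"
proof -
  have mon: "(\<Otimes>\<^bsub>E\<^esub>v\<in>Poly_Mapping.keys u. dpow \<epsilon> (snd v) (c ! fst v) [^]\<^bsub>E\<^esub> Poly_Mapping.lookup u v) = \<iota> (monomial_eval y u)"
    if u: "u \<in> Poly_Mapping.keys f" for u
  proof -
    have pw: "dpow \<epsilon> (snd v) (c ! fst v) [^]\<^bsub>E\<^esub> Poly_Mapping.lookup u v = \<iota> (y v ^ Poly_Mapping.lookup u v)"
      if "v \<in> Poly_Mapping.keys u" for v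
    proof -
      have "v \<in> {..<n} \<times> {\<xi>. length \<xi> = m}"
        using mpolys_overD(2)[OF f[unfolded dpolys_def] u that] .
      then show ?thesis using c nat_pow_E[OF y] by simp
    qed
    have "(\<Otimes>\<^bsub>E\<^esub>v\<in>Poly_Mapping.keys u. dpow \<epsilon> (snd v) (c ! fst v) [^]\<^bsub>E\<^esub> Poly_Mapping.lookup u v)
        = (\<Otimes>\<^bsub>E\<^esub>v\<in>Poly_Mapping.keys u. \<iota> (y v ^ Poly_Mapping.lookup u v))"
      by (rule E.finprod_cong') (use pw y in \<open>auto simp: mem_E is_subring_power[OF B_subring]\<close>)
    also have "\<dots> = \<iota> (monomial_eval y u)" unfolding monomial_eval_def
      by (rule finprod_E) (auto intro: is_subring_power[OF B_subring] y)
    finally show ?thesis .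
  qed
  have monB: "monomial_eval y u \<in> B" for u
    unfolding monomial_eval_def by (intro is_subring_prod is_subring_power B_subring y)
  have "dpoly_eval_ext E \<epsilon> (\<lambda>x. \<iota> (h x)) f c
      = (\<Oplus>\<^bsub>E\<^esub>u\<in>Poly_Mapping.keys f. \<iota> (h (Poly_Mapping.lookup f u) * monomial_eval y u))"
    unfolding dpoly_eval_ext_def
    by (rule E.finsum_cong') (use mon h monB is_subringD(4)[OF B_subring] in \<open>auto simp: mem_E E_simps\<close>)
  also have "\<dots> = \<iota> (meval h y f)"
    unfolding meval_def by (rule finsum_E) (use h monB is_subringD(4)[OF B_subring] in auto)
  finally show ?thesis .
qed

text \<open>Only the restrictions of the derivations to B are transported, so commutation is
  required on B alone.\<close>

lemma differential_extension_E:
  assumes h: "is_ring_hom h" "\<And>c. h c \<in> B"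
    and D: "\<And>l. l < m \<Longrightarrow> derivation (D l)" "\<And>l x. l < m \<Longrightarrow> x \<in> B \<Longrightarrow> D l x \<in> B"
      "\<And>i j x. i < m \<Longrightarrow> j < m \<Longrightarrow> x \<in> B \<Longrightarrow> D i (D j x) = D j (D i x)"
      "\<And>l c. l < m \<Longrightarrow> D l (h c) = h (\<delta> l c)"
  shows "differential_extension m \<delta> E (\<lambda>l z. \<iota> (D l (inv_into B \<iota> z))) (\<lambda>x. \<iota> (h x))"
proof -
  have inv: "inv_into B \<iota> (\<iota> x) = x" if "x \<in> B" for x using inv_into_f_f[OF inj that] .
  note S = is_subringD[OF B_subring]
  have hom: "(\<lambda>x. \<iota> (h x)) \<in> ring_hom ring_of_type_algebra E"
    by (rule ring_hom_memI) (simp_all add: ring_of_type_algebra_def mem_E h(2) E_simps is_ring_homD[OF h(1)])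
  show ?thesis
    unfolding differential_extension_def carrier_E
    using field_E hom D
    by (auto simp: inv E_simps S derivationD h(2))
qed

end

context diff_subfield
begin

text \<open>Replaces the jets of the parameters, those with index at least n, by values in
  \<open>K\<close>. What remains is a differential polynomial over \<open>K\<close> in n
  indeterminates, the form that differential closedness accepts.\<close>

primrec psubst :: "nat \<Rightarrow> (jvar \<Rightarrow> 'a) \<Rightarrow> (jvar, 'a) pexpr \<Rightarrow> (jvar, 'a) pexpr" where
  "psubst n z (PConst c) = PConst c"
| "psubst n z (PVar v) = (if fst v < n then PVar v else PConst (z v))"
| "psubst n z (PAdd e f) = PAdd (psubst n z e) (psubst n z f)"
| "psubst n z (PMul e f) = PMul (psubst n z e) (psubst n z f)"

lemma peval_psubst:
  assumes "\<And>v. v \<in> Y \<Longrightarrow> \<not> fst v < n \<Longrightarrow> y v = h (z v)" "e \<in> pexprs UNIV Y"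
  shows "peval h y (psubst n z e) = peval h y e"
  using assms(2) by (induction e) (use assms(1) in auto)

lemma psubst_pexprs: "e \<in> pexprs k (jvars m {..<N}) \<Longrightarrow> psubst n z e \<in> pexprs UNIV ({..<n} \<times> {\<xi>. length \<xi> = m})"
  by (induction e) (auto simp: jvars_def)

lemma pexprs_UNIV: "e \<in> pexprs k Y \<Longrightarrow> e \<in> pexprs UNIV Y"
  by (simp add: pexprs_def)

lemma dpoly_eval_psubst:
  assumes e: "e \<in> pexprs k (jvars m {..<N})" and len: "length b = n" "length b' = n"
  shows "dpoly_eval \<delta> (to_mpoly (psubst n (jet \<delta> (b' @ a)) e)) b = peval (\<lambda>x. x) (jet \<delta> (b @ a)) e"
proof -
  let ?e = "psubst n (jet \<delta> (b' @ a)) e"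
  have "dpoly_eval \<delta> (to_mpoly ?e) b = meval (\<lambda>x. x) (jet \<delta> b) (to_mpoly ?e)"
    unfolding dpoly_eval_def mpoly_eval_eq_meval by (rule arg_cong2[where f = "meval (\<lambda>x. x)"]) (auto simp: jet_def)
  also have "\<dots> = peval (\<lambda>x. x) (jet \<delta> b) ?e" by (rule meval_to_mpoly[OF is_ring_hom_id])
  also have "\<dots> = peval (\<lambda>x. x) (jet \<delta> (b @ a)) ?e"
  proof (rule peval_cong)
    fix v assume "v \<in> pvars ?e"
    then have "fst v < n" using psubst_pexprs[OF e, of n "jet \<delta> (b' @ a)"] by (auto simp: pexprs_def)
    then show "jet \<delta> b v = jet \<delta> (b @ a) v" using len by (simp add: jet_def nth_append)
  qed
  also have "\<dots> = peval (\<lambda>x. x) (jet \<delta> (b @ a)) e"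
    by (rule peval_psubst[where Y = "jvars m {..<N}", OF _ pexprs_UNIV[OF e]])
       (use len in \<open>auto simp: jet_def nth_append\<close>)
  finally show ?thesis .
qed

text \<open>A solution in \<open>'a big\<close> generates, over \<open>K\<close>, a differential field extension of \<open>K\<close> of the same
  cardinality as \<open>K\<close>, so that differential closedness applies.\<close>

lemma realize_solution:
  assumes dc: "differentially_closed m \<delta>"
    and y0: "\<And>v. v \<in> jvars m {n..<n + r} \<Longrightarrow> y v = big_const (jet \<delta> (b' @ a) v)" "length b' = n"
    and D: "\<And>l. l < m \<Longrightarrow> derivation (D l)" "\<And>l x. l < m \<Longrightarrow> D l (big_const x) = big_const (\<delta> l x)"
      "\<And>l v. l < m \<Longrightarrow> v \<in> jvars m {..<n + r} \<Longrightarrow> D l (y v) = y (shiftv l v)"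
    and EQ: "finite EQ" "EQ \<subseteq> pexprs k (jvars m {..<n + r})" "\<And>e. e \<in> EQ \<Longrightarrow> peval big_const y e = 0"
    and NE: "finite NE" "NE \<subseteq> pexprs k (jvars m {..<n + r})" "\<And>e. e \<in> NE \<Longrightarrow> peval big_const y e \<noteq> 0"
  shows "\<exists>b. length b = n \<and> (\<forall>e\<in>EQ. peval (\<lambda>x. x) (jet \<delta> (b @ a)) e = 0) \<and>
    (\<forall>e\<in>NE. peval (\<lambda>x. x) (jet \<delta> (b @ a)) e \<noteq> 0)"
proof -
  define V where "V = jvars m {..<n + r}"
  define gens where "gens = range (big_const :: 'a \<Rightarrow> 'a big) \<union> y ` V"
  \<comment> \<open>The field generated by the constants and the jets is stable under the
    derivations, which commute on it though perhaps not on all of \<open>'a big\<close>, and it is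
    small enough to be transported.\<close>
  define B where "B = is_subfield hull gens"
  have Bsub: "is_subfield B" unfolding B_def by (rule is_subfield_hull)
  have gensB: "gens \<subseteq> B" unfolding B_def by (rule hull_subset)
  have hB: "big_const x \<in> B" for x using gensB by (auto simp: gens_def)
  have yB: "y v \<in> B" if "v \<in> V" for v using gensB that by (auto simp: gens_def)
  have DV: "shiftv l v \<in> V" if "v \<in> V" for l v using that jvars_shiftv by (simp add: V_def)
  have inf: "infinite (UNIV :: 'a set)" by (rule infinite_UNIV_char_0)
  have "inj (big_const :: 'a \<Rightarrow> 'a big)"
  proof (rule injI)
    fix p q :: 'a assume "big_const p = big_const q"
    then have "big_const (p - q) = 0"
      using is_ring_homD(3)[OF big_const_hom, of q "p - q"] by simp
    then show "p = q" using is_ring_hom_eq_0[OF big_const_hom zero_neq_one, of "p - q"] by simp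
  qed
  then have infg: "infinite gens" using inf by (auto simp: gens_def dest: finite_imageD)
  have "lepoll (y ` V) (UNIV :: 'a set)"
  proof -
    have "lepoll (y ` V) V" by (rule image_lepoll)
    also have "lepoll V (UNIV :: nat set)" unfolding lepoll_def by (rule exI[of _ to_nat]) (auto intro: inj_on_subset[OF inj_to_nat])
    also have "lepoll (UNIV :: nat set) (UNIV :: 'a set)" by (rule countable_lepoll[OF inf])
    finally show ?thesis .
  qed
  then have "lepoll gens (UNIV :: 'a set)" unfolding gens_def by (intro lepoll_Un inf image_lepoll)
  then have "lepoll B (UNIV :: 'a set)"
    unfolding B_def using diff_subfield_hull_lepoll(2)[OF infg] lepoll_trans by blast
  then obtain \<iota> :: "'a big \<Rightarrow> 'a" where \<iota>: "inj_on \<iota> B" unfolding lepoll_def by blast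
  interpret T: transported_field B \<iota> by unfold_locales (rule Bsub, rule \<iota>)
  have DB: "D l x \<in> B" if l: "l < m" and x: "x \<in> B" for l x
  proof -
    note DD = derivationD[OF D(1)[OF l]] derivation_0[OF D(1)[OF l]] derivation_1[OF D(1)[OF l]]
      derivation_minus[OF D(1)[OF l]] derivation_inverse[OF D(1)[OF l]]
    have "is_subfield {x \<in> B. D l x \<in> B}"
      unfolding is_subfield_def using is_subfieldD[OF Bsub] by (auto simp: DD simp del: mult_minus_left)
    moreover have "gens \<subseteq> {x \<in> B. D l x \<in> B}"
      using gensB hB yB DV D(2)[OF l] D(3)[OF l] unfolding gens_def V_def by auto
    ultimately have "B \<subseteq> {x \<in> B. D l x \<in> B}" unfolding B_def by (intro hull_minimal)
    then show ?thesis using x by blast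
  qed
  have comm: "D i (D j x) = D j (D i x)" if ij: "i < m" "j < m" and x: "x \<in> B" for i j x
  proof -
    have sh: "shiftv i (shiftv j v) = shiftv j (shiftv i v)" if "v \<in> V" for v
      using ij that by (cases "i = j") (auto simp: shiftv_def V_def jvars_def list_update_swap nth_list_update)
    \<comment> \<open>Commutation is checked on generators, where both orders of shifting agree, and
      the kernel of the commutator is a field.\<close>
    have "is_subfield {x. D i (D j x) - D j (D i x) = 0}"
      by (rule derivation_kernel_subfield[OF derivation_commutator[OF D(1)[OF ij(1)] D(1)[OF ij(2)]]])
    moreover have "gens \<subseteq> {x. D i (D j x) - D j (D i x) = 0}"
    proof -
      have "D i (D j (y v)) - D j (D i (y v)) = 0" if v: "v \<in> V" for v
      proof -
        have "D i (D j (y v)) = y (shiftv i (shiftv j v))"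
          using D(3)[OF ij(1)] D(3)[OF ij(2)] v DV[OF v] by (simp add: V_def)
        moreover have "D j (D i (y v)) = y (shiftv j (shiftv i v))"
          using D(3)[OF ij(1)] D(3)[OF ij(2)] v DV[OF v] by (simp add: V_def)
        ultimately show ?thesis using sh[OF v] by simp
      qed
      then show ?thesis
        unfolding gens_def using D(2)[OF ij(1)] D(2)[OF ij(2)] \<delta>_commute[OF ij] by auto
    qed
    ultimately have "B \<subseteq> {x. D i (D j x) - D j (D i x) = 0}" unfolding B_def by (intro hull_minimal)
    then show ?thesis using x by auto
  qed
  define \<epsilon> where "\<epsilon> = (\<lambda>l z. \<iota> (D l (inv_into B \<iota> z)))"
  have ext: "differential_extension m \<delta> T.E \<epsilon> (\<lambda>x. \<iota> (big_const x))"
    unfolding \<epsilon>_def by (rule T.differential_extension_E) (use big_const_hom hB D DB comm in auto)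
  define c where "c = map (\<lambda>i. \<iota> (y (i, replicate m 0))) [0..<n]"
  have c: "dpow \<epsilon> (snd v) (c ! fst v) = \<iota> (y v)" if "v \<in> {..<n} \<times> {\<xi>. length \<xi> = m}" for v
  proof -
    have "dpow \<epsilon> (snd v) (\<iota> (y (fst v, replicate m 0))) = \<iota> (y (fst v, snd v))"
    proof (rule dpow_zero_jet[where y = "\<lambda>v. \<iota> (y v)" and m = m])
      fix l and \<xi> :: "nat list" assume l: "l < m" "length \<xi> = m"
      have v: "(fst v, \<xi>) \<in> V" using that l by (auto simp: V_def jvars_def)
      then show "\<epsilon> l (\<iota> (y (fst v, \<xi>))) = \<iota> (y (shiftv l (fst v, \<xi>)))"
        unfolding \<epsilon>_def using D(3)[OF l(1)] yB[OF v] inv_into_f_f[OF \<iota>] by (simp add: V_def)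
    qed (use that in auto)
    then show ?thesis using that by (auto simp: c_def)
  qed
  \<comment> \<open>Off \<open>V\<close> nothing is known about \<open>y\<close>; the value 0 there
    keeps all values in \<open>B\<close>.\<close>
  define y1 where "y1 v = (if v \<in> V then y v else 0)" for v
  have y1B: "y1 v \<in> B" for v using yB is_subfieldD(1)[OF Bsub] by (simp add: y1_def)
  define z where "z = jet \<delta> (b' @ a)"
  define T where "T e = to_mpoly (psubst n z e)" for e
  have TD: "T e \<in> dpolys m UNIV n" if "e \<in> pexprs k V" for e
    unfolding T_def dpolys_def
    by (rule to_mpoly_mpolys_over[OF is_subring_UNIV psubst_pexprs]) (use that in \<open>simp add: V_def\<close>)
  have Text: "dpoly_eval_ext T.E \<epsilon> (\<lambda>x. \<iota> (big_const x)) (T e) c = \<iota> (peval big_const y e)" if e: "e \<in> pexprs k V" for e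
  proof -
    have "dpoly_eval_ext T.E \<epsilon> (\<lambda>x. \<iota> (big_const x)) (T e) c = \<iota> (meval big_const y1 (T e))"
    proof (rule T.dpoly_eval_ext_E[OF hB y1B TD[OF e]])
      fix v assume v: "v \<in> {..<n} \<times> {\<xi>::nat list. length \<xi> = m}"
      then have "v \<in> V" by (auto simp: V_def jvars_def)
      then show "dpow \<epsilon> (snd v) (c ! fst v) = \<iota> (y1 v)" using c[OF v] by (simp add: y1_def)
    qed
    also have "meval big_const y1 (T e) = peval big_const y1 (psubst n z e)"
      unfolding T_def by (rule meval_to_mpoly[OF big_const_hom])
    also have "\<dots> = peval big_const y1 e"
      by (rule peval_psubst[where Y = V, OF _ pexprs_UNIV[OF e]])
         (use y0 in \<open>auto simp: y1_def V_def z_def jvars_def\<close>)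
    also have "\<dots> = peval big_const y e"
      using e by (intro peval_cong) (auto simp: y1_def pexprs_def)
    finally show ?thesis .
  qed
  have TK: "dpoly_eval \<delta> (T e) b = peval (\<lambda>x. x) (jet \<delta> (b @ a)) e" if "e \<in> pexprs k V" "length b = n" for e b
    unfolding T_def z_def by (rule dpoly_eval_psubst) (use that y0(2) in \<open>auto simp: V_def\<close>)
  have "\<exists>b. length b = n \<and> (\<forall>f\<in>T ` EQ. dpoly_eval \<delta> f b = 0) \<and> (\<forall>g\<in>T ` NE. dpoly_eval \<delta> g b \<noteq> 0)"
  proof (rule dc[unfolded differentially_closed_def, THEN conjunct2, rule_format, OF ext])
    show "finite (T ` EQ)" "finite (T ` NE)" using EQ(1) NE(1) by auto
    show "T ` EQ \<subseteq> dpolys m UNIV n" "T ` NE \<subseteq> dpolys m UNIV n" using TD EQ(2) NE(2) by (auto simp: V_def)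
    show "length c = n" by (simp add: c_def)
    show "set c \<subseteq> carrier T.E" unfolding T.carrier_E by (auto simp: c_def V_def jvars_def intro!: imageI yB)
    fix f assume "f \<in> T ` EQ"
    then show "dpoly_eval_ext T.E \<epsilon> (\<lambda>x. \<iota> (big_const x)) f c = \<zero>\<^bsub>T.E\<^esub>"
      using Text EQ(2,3) by (auto simp: T.E_simps V_def)
  next
    fix f assume "f \<in> T ` NE"
    then obtain e where e: "e \<in> NE" "f = T e" by blast
    have eV: "e \<in> pexprs k V" using e(1) NE(2) by (auto simp: V_def)
    have "pval big_const k y V \<subseteq> B"
      by (rule pval_subset[OF is_subfield_imp_is_subring[OF Bsub]]) (use hB yB in auto)
    then have "peval big_const y e \<in> B" using eV unfolding pval_def by blast
    then have "\<iota> (peval big_const y e) \<noteq> \<iota> 0"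
      using \<iota> NE(3)[OF e(1)] is_subfieldD(1)[OF Bsub] by (auto simp: inj_on_def)
    then show "dpoly_eval_ext T.E \<epsilon> (\<lambda>x. \<iota> (big_const x)) f c \<noteq> \<zero>\<^bsub>T.E\<^esub>"
      using Text[OF eV] e(2) by (simp add: T.E_simps)
  qed
  then show ?thesis using TK EQ(2) NE(2) unfolding V_def by (metis (no_types, lifting) imageI subsetD)
qed

end

section \<open>Kolchin polynomials count non-leaders\<close>

text \<open>Shaped like \<open>kolchin_poly\<close>, with the number of jets outside
  \<open>U\<close> in place of the transcendence degree, so that the two can be identified by
  rewriting.\<close>

definition count_poly :: "nat \<Rightarrow> nat \<Rightarrow> jvar set \<Rightarrow> rat Polynomial.poly" where
  "count_poly m n U = (THE q. numerical_poly q \<and>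
     (\<forall>\<^sub>F s in sequentially. Polynomial.poly q (of_nat s) =
        of_nat (card {u \<in> jvars m {..<n}. u \<notin> U \<and> sum_list (snd u) \<le> s})))"

lemma card_nonleaders:
  "card {u \<in> jvars m {..<n}. u \<notin> U \<and> sum_list (snd u) \<le> s} = (\<Sum>i<n. hilbert_fun m {\<xi>. (i, \<xi>) \<in> U} s)"
proof -
  have "{u \<in> jvars m {..<n}. u \<notin> U \<and> sum_list (snd u) \<le> s}
      = (\<Union>i<n. Pair i ` {\<xi>. length \<xi> = m \<and> sum_list \<xi> \<le> s \<and> \<xi> \<notin> {\<xi>. (i, \<xi>) \<in> U}})"
    by (auto simp: jvars_def)
  moreover have "card (\<Union>i<n. Pair i ` {\<xi>. length \<xi> = m \<and> sum_list \<xi> \<le> s \<and> \<xi> \<notin> {\<xi>. (i, \<xi>) \<in> U}})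
      = (\<Sum>i<n. card (Pair i ` {\<xi>. length \<xi> = m \<and> sum_list \<xi> \<le> s \<and> \<xi> \<notin> {\<xi>. (i, \<xi>) \<in> U}}))"
  proof (rule card_UN_disjoint)
    show "\<forall>i\<in>{..<n}. finite (Pair i ` {\<xi>. length \<xi> = m \<and> sum_list \<xi> \<le> s \<and> \<xi> \<notin> {\<xi>. (i, \<xi>) \<in> U}})"
      by (intro ballI finite_imageI finite_subset[OF _ finite_bounded_multi_indices[of m s]]) auto
  qed auto
  moreover have "card (Pair i ` A) = card A" for i :: nat and A :: "nat list set"
    by (rule card_image) (simp add: inj_on_def)
  ultimately show ?thesis by (simp add: hilbert_fun_def)
qed

lemma finite_bounded_jvars: "finite {u \<in> jvars m {..<n}. sum_list (snd u) \<le> s}"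
proof (rule finite_subset)
  show "{u \<in> jvars m {..<n}. sum_list (snd u) \<le> s} \<subseteq> {..<n} \<times> {\<xi>. length \<xi> = m \<and> sum_list \<xi> \<le> s}"
    by (auto simp: jvars_def)
qed (simp add: finite_bounded_multi_indices)

lemma count_poly:
  assumes "\<And>i. i < n \<Longrightarrow> shift_closed m {\<xi>. (i, \<xi>) \<in> U}"
  shows "\<forall>\<^sub>F s in sequentially. Polynomial.poly (count_poly m n U) (of_nat s) =
        of_nat (card {u \<in> jvars m {..<n}. u \<notin> U \<and> sum_list (snd u) \<le> s})"
proof -
  let ?P = "\<lambda>q. numerical_poly q \<and> (\<forall>\<^sub>F s in sequentially. Polynomial.poly q (of_nat s) =
        of_nat (card {u \<in> jvars m {..<n}. u \<notin> U \<and> sum_list (snd u) \<le> s}))"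
  have "eventually_poly (\<lambda>s. \<Sum>i<n. hilbert_fun m {\<xi>. (i, \<xi>) \<in> U} s)"
    by (rule eventually_poly_sum) (use hilbert_fun_eventually_poly[OF assms] in auto)
  then obtain q :: "rat Polynomial.poly" where q: "\<forall>\<^sub>F s in sequentially. Polynomial.poly q (of_nat s) =
        of_nat (card {u \<in> jvars m {..<n}. u \<notin> U \<and> sum_list (snd u) \<le> s})"
    unfolding eventually_poly_def card_nonleaders by blast
  have "numerical_poly q"
    by (rule numerical_polyI, rule eventually_mono[OF q]) simp
  with q have "?P q" by blast
  moreover have "q' = q" if "?P q'" for q'
  proof (rule eventually_equal_polys)
    from that have "\<forall>\<^sub>F s in sequentially. Polynomial.poly q' (of_nat s) =
        of_nat (card {u \<in> jvars m {..<n}. u \<notin> U \<and> sum_list (snd u) \<le> s})" by blast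
    with q show "\<forall>\<^sub>F s in sequentially. Polynomial.poly q' (of_nat s) = Polynomial.poly q (of_nat s)"
      by eventually_elim simp
  qed
  ultimately have "?P (count_poly m n U)" unfolding count_poly_def by (rule theI)
  then show ?thesis by blast
qed

text \<open>Compares cardinalities instead of sets because under specialisation neither set of
  leaders need contain the other.\<close>

lemma count_poly_dominated:
  assumes "\<And>i. i < n \<Longrightarrow> shift_closed m {\<xi>. (i, \<xi>) \<in> U}" "\<And>i. i < n \<Longrightarrow> shift_closed m {\<xi>. (i, \<xi>) \<in> U'}"
    and "\<And>s. card {u \<in> jvars m {..<n}. u \<notin> U \<and> sum_list (snd u) \<le> s}
      \<le> card {u \<in> jvars m {..<n}. u \<notin> U' \<and> sum_list (snd u) \<le> s}"
  shows "dominated (count_poly m n U) (count_poly m n U')"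
  unfolding dominated_def
  using count_poly[where n = n and m = m and U = U, OF assms(1), simplified]
    count_poly[where n = n and m = m and U = U', OF assms(2), simplified]
  by eventually_elim (use assms(3) in auto)

lemma count_poly_antimono:
  assumes "\<And>i. i < n \<Longrightarrow> shift_closed m {\<xi>. (i, \<xi>) \<in> U}" "\<And>i. i < n \<Longrightarrow> shift_closed m {\<xi>. (i, \<xi>) \<in> U'}"
    and "U' \<subseteq> U"
  shows "dominated (count_poly m n U) (count_poly m n U')"
proof (rule count_poly_dominated[OF assms(1,2)])
  fix s
  show "card {u \<in> jvars m {..<n}. u \<notin> U \<and> sum_list (snd u) \<le> s}
      \<le> card {u \<in> jvars m {..<n}. u \<notin> U' \<and> sum_list (snd u) \<le> s}"
    by (rule card_mono[OF finite_subset[OF _ finite_bounded_jvars[of m n s]]]) (use assms(3) in auto)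
qed auto

lemma dpow_closed:
  assumes "\<And>l x. l < m \<Longrightarrow> x \<in> L \<Longrightarrow> \<delta> l x \<in> L" "x \<in> L" "length \<xi> = m"
  shows "dpow \<delta> \<xi> x \<in> L"
proof -
  have pw: "(\<delta> l ^^ p) z \<in> L" if "l < m" "z \<in> L" for l p z
    by (induction p) (use that assms(1) in auto)
  have "foldr (\<lambda>j. \<delta> j ^^ (\<xi> ! j)) js x \<in> L" if "set js \<subseteq> {..<m}" for js
    using that by (induction js) (use pw assms(2) in auto)
  from this[of "[0..<m]"] show ?thesis using assms(3) by (simp add: dpow_def lessThan_atLeast0)
qed

lemma dpow_zero: "dpow \<delta> (replicate m 0) x = x"
proof -
  have "foldr (\<lambda>j. \<delta> j ^^ (replicate m 0 ! j)) js x = x" if "set js \<subseteq> {..<m}" for js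
    using that by (induction js) auto
  from this[of "[0..<m]"] show ?thesis by (simp add: dpow_def lessThan_atLeast0)
qed

lemma mpoly_eval_cong:
  assumes "\<And>v. v \<in> Y \<Longrightarrow> x v = z v" "f \<in> mpolys_over L Y"
  shows "mpoly_eval x f = mpoly_eval z f"
  unfolding mpoly_eval_def
  by (intro sum.cong refl arg_cong2[where f = "(*)"] prod.cong) (use assms mpolys_overD(2)[OF assms(2)] in auto)

lemma is_diff_subfield_Inter: "(\<And>B. B \<in> T \<Longrightarrow> is_diff_subfield m \<delta> B) \<Longrightarrow> is_diff_subfield m \<delta> (\<Inter>T)"
  using is_subfield_Inter[of T] by (auto simp: is_diff_subfield_def)

lemma is_diff_subfield_gen_diff_field: "is_diff_subfield m \<delta> (gen_diff_field m \<delta> L S)"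
  unfolding gen_diff_field_def by (rule hull_in) (auto intro: is_diff_subfield_Inter)

lemma gen_diff_field_superset: "L \<union> S \<subseteq> gen_diff_field m \<delta> L S"
  unfolding gen_diff_field_def by (rule hull_subset)

context diff_subfield
begin

text \<open>By \<open>algebraic_over_gen_field_iff\<close> these are the jets of b that are
  algebraic over k<a> and the lower jets of b.\<close>

definition leaders :: "'a list \<Rightarrow> 'a list \<Rightarrow> jvar set" where
  "leaders b a = {u. lead (b @ a) {length b..<length b + length a} {..<length b} u}"

lemma leaders_shift_closed: "shift_closed m {\<xi>. (i, \<xi>) \<in> leaders b a}"
  unfolding shift_closed_def leaders_def using lead_shiftv by (fastforce simp: shiftv_def)

lemma pval_closed_\<delta>:
  assumes "l < m" "\<And>v. v \<in> Y \<Longrightarrow> length (snd v) = m \<and> shiftv l v \<in> Y" "x \<in> pval (\<lambda>x. x) k (jet \<delta> c) Y"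
  shows "\<delta> l x \<in> pval (\<lambda>x. x) k (jet \<delta> c) Y"
proof -
  obtain e where e: "e \<in> pexprs k Y" "x = peval (\<lambda>x. x) (jet \<delta> c) e" using assms(3) by (auto simp: pval_def)
  have "\<delta> l x = peval (\<lambda>x. x) (jet \<delta> c) (pder (\<delta> l) l e)"
    unfolding e(2)
    by (rule peval_pder[where k = k and Y = Y, OF derivation_\<delta>[OF assms(1)] _ _ e(1)])
       (use assms jet_shiftv in auto)
  moreover have "pder (\<delta> l) l e \<in> pexprs k Y"
    by (rule pder_pexprs[OF _ order_refl _ e(1)]) (use assms k_der in auto)
  ultimately show ?thesis by (simp add: pval_def)
qed

text \<open>The fractions of the ring generated by k and the jets of a form a differential field,
  hence contain k<a>. Clearing denominators then replaces the generated field by the values of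
  expressions with coefficients in k.\<close>

lemma algebraic_over_gen_field_iff:
  fixes a b :: "'a list"
  defines "c \<equiv> b @ a" and "Y0 \<equiv> jvars m {length b..<length b + length a}"
    and "L \<equiv> gen_diff_field m \<delta> k (set a)"
  shows "algebraic_over (gen_field L (jet \<delta> c ` Y)) z \<longleftrightarrow> algebraic_over (pval (\<lambda>x. x) k (jet \<delta> c) (Y0 \<union> Y)) z"
    and "pval (\<lambda>x. x) k (jet \<delta> c) (Y0 \<union> Y) \<subseteq> gen_field L (jet \<delta> c ` Y)"
proof -
  define B0 where "B0 = pval (\<lambda>x. x) k (jet \<delta> c) Y0"
  define B where "B = pval (\<lambda>x. x) k (jet \<delta> c) (Y0 \<union> Y)"
  have B0: "is_subring B0" and B: "is_subring B"
    unfolding B0_def B_def by (rule is_subring_pval[OF k_subring is_ring_hom_id])+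
  note F0 = is_subfield_fractions[OF B0]
  have Ld: "is_diff_subfield m \<delta> L" unfolding L_def by (rule is_diff_subfield_gen_diff_field)
  have B0d: "\<delta> l x \<in> B0" if "l < m" "x \<in> B0" for l x
    unfolding B0_def
    by (rule pval_closed_\<delta>[OF that(1) _ that(2)[unfolded B0_def]]) (auto simp: Y0_def jvars_def shiftv_def)
  have "is_diff_subfield m \<delta> (fractions B0)"
    unfolding is_diff_subfield_def
  proof (intro conjI F0 allI impI ballI)
    fix l x assume l: "l < m" and x: "x \<in> fractions B0"
    obtain p q where pq: "x = p / q" "p \<in> B0" "q \<in> B0" using fractionsE[OF B0 x] by metis
    have "\<delta> l x = \<delta> l p * inverse q + p * (- \<delta> l q * inverse q * inverse q)"
      unfolding pq(1) divide_inverse derivationD(2)[OF derivation_\<delta>[OF l]] derivation_inverse[OF derivation_\<delta>[OF l]] ..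
    also have "\<dots> \<in> fractions B0"
      using subset_fractions[OF B0] pq B0d[OF l]
      by (intro is_subfieldD(3-6)[OF F0]) auto
    finally show "\<delta> l x \<in> fractions B0" .
  qed
  moreover have "k \<union> set a \<subseteq> B0"
  proof (intro Un_least subsetI)
    show "x \<in> B0" if "x \<in> k" for x using pval_const[OF that, of "\<lambda>x. x"] by (simp add: B0_def)
    fix x assume "x \<in> set a"
    then obtain i where i: "i < length a" "x = a ! i" by (metis in_set_conv_nth)
    have "(length b + i, replicate m 0) \<in> Y0" using i by (simp add: Y0_def jvars_def)
    then have "jet \<delta> c (length b + i, replicate m 0) \<in> B0" unfolding B0_def by (rule pval_var)
    then show "x \<in> B0" using i by (simp add: jet_def dpow_zero c_def)
  qed
  ultimately have "L \<subseteq> fractions B0"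
    unfolding L_def gen_diff_field_def using subset_fractions[OF B0] by (intro hull_minimal) auto
  also have "fractions B0 \<subseteq> fractions B"
    using pval_mono[of Y0 "Y0 \<union> Y" "\<lambda>x. x" k "jet \<delta> c"] unfolding fractions_def B0_def B_def by blast
  finally have "L \<subseteq> fractions B" .
  moreover have "jet \<delta> c ` Y \<subseteq> B" unfolding B_def by (auto intro: pval_var)
  ultimately have 1: "gen_field L (jet \<delta> c ` Y) \<subseteq> fractions B"
    using subset_fractions[OF B] by (intro gen_field_minimal is_subfield_fractions B) auto
  have kL: "k \<subseteq> L" "set a \<subseteq> L" using gen_diff_field_superset[of k "set a" m \<delta>] by (auto simp: L_def)
  have "jet \<delta> c v \<in> L" if "v \<in> Y0" for v
    unfolding jet_def
  proof (rule dpow_closed)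
    show "\<And>l x. l < m \<Longrightarrow> x \<in> L \<Longrightarrow> \<delta> l x \<in> L" using Ld by (simp add: is_diff_subfield_def)
    show "c ! fst v \<in> L" using that kL(2) by (auto simp: c_def Y0_def jvars_def nth_append)
    show "length (snd v) = m" using that by (simp add: Y0_def jvars_def)
  qed
  then have 2: "B \<subseteq> gen_field L (jet \<delta> c ` Y)"
    unfolding B_def using gen_field_superset[of L "jet \<delta> c ` Y"] kL
    by (intro pval_subset is_subfield_imp_is_subring[OF is_subfield_gen_field]) auto
  show "pval (\<lambda>x. x) k (jet \<delta> c) (Y0 \<union> Y) \<subseteq> gen_field L (jet \<delta> c ` Y)" using 2 by (simp add: B_def)
  show "algebraic_over (gen_field L (jet \<delta> c ` Y)) z \<longleftrightarrow> algebraic_over (pval (\<lambda>x. x) k (jet \<delta> c) (Y0 \<union> Y)) z"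
    using algebraic_over_mono[OF 1] algebraic_over_fractions[OF B] algebraic_over_mono[OF 2]
    unfolding B_def by blast
qed

text \<open>The highest jet of N is transcendental over all lower ones, so independence of the rest
  extends to it.\<close>

lemma nonleaders_alg_indep:
  assumes "finite N" "N \<subseteq> jvars m {..<length b} - leaders b a"
  shows "alg_indep_family (gen_diff_field m \<delta> k (set a)) (jet \<delta> (b @ a)) N"
  using assms
proof (induction "card N" arbitrary: N)
  case 0
  then show ?case by (simp add: alg_indep_family_empty)
next
  case (Suc p)
  let ?L = "gen_diff_field m \<delta> k (set a)" and ?x = "jet \<delta> (b @ a)" and ?I = "{..<length b}"
  have "N \<noteq> {}" using Suc by auto
  moreover have "N \<subseteq> jvars m ?I" using Suc.prems by blast
  ultimately obtain u where u: "u \<in> N" "N \<subseteq> insert u (below m ?I u)"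
    using finite_subset_max[OF Suc.prems(1)] by blast
  have L: "is_subring ?L"
    using is_diff_subfield_gen_diff_field[of m \<delta> k "set a"] by (simp add: is_diff_subfield_def is_subfield_imp_is_subring)
  have "p = card (N - {u})" using Suc.hyps(2) u(1) Suc.prems(1) by simp
  then have IH: "alg_indep_family ?L ?x (N - {u})" by (rule Suc.hyps(1)) (use Suc.prems in auto)
  have "\<not> algebraic_over (gen_field ?L (?x ` below m ?I u)) (?x u)"
    unfolding algebraic_over_gen_field_iff(1) using Suc.prems(2) u(1) by (auto simp: leaders_def lead_def)
  moreover have "gen_field ?L (?x ` (N - {u})) \<subseteq> gen_field ?L (?x ` below m ?I u)"
    by (rule gen_field_mono) (use u(2) in auto)
  ultimately have "\<not> algebraic_over (gen_field ?L (?x ` (N - {u}))) (?x u)" using algebraic_over_mono by blast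
  then have "alg_indep_family ?L ?x (insert u (N - {u}))"
    by (intro alg_indep_family_insert[OF L IH]) auto
  then show ?case using u(1) by (simp add: insert_absorb)
qed

definition nonleaders :: "'a list \<Rightarrow> 'a list \<Rightarrow> nat \<Rightarrow> jvar set" where
  "nonleaders b a s = {u \<in> jvars m {..<length b}. u \<notin> leaders b a \<and> sum_list (snd u) \<le> s}"

lemma finite_nonleaders: "finite (nonleaders b a s)"
  by (rule finite_subset[OF _ finite_bounded_jvars[of m "length b" s]]) (auto simp: nonleaders_def)

text \<open>Here the ranking has to be orderly: a leader of order at most s is algebraic over lower
  jets, whose order is again at most s.\<close>

lemma jets_in_der_closure:
  "u \<in> jvars m {..<length b} \<Longrightarrow> sum_list (snd u) \<le> s \<Longrightarrow>
    jet \<delta> (b @ a) u \<in> der_closure (gen_diff_field m \<delta> k (set a) \<union> jet \<delta> (b @ a) ` nonleaders b a s)"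
proof (induction u rule: wf_induct_rule[OF wf_rless])
  case (1 u)
  let ?L = "gen_diff_field m \<delta> k (set a)" and ?x = "jet \<delta> (b @ a)" and ?I = "{..<length b}"
  let ?C = "der_closure (?L \<union> ?x ` nonleaders b a s)"
  show ?case
  proof (cases "u \<in> leaders b a")
    case False
    then have "u \<in> nonleaders b a s" using 1 by (simp add: nonleaders_def)
    then have "?x u \<in> ?L \<union> ?x ` nonleaders b a s" by simp
    then show ?thesis by (rule subsetD[OF der_closure_superset])
  next
    case True
    then have "algebraic_over (gen_field ?L (?x ` below m ?I u)) (?x u)"
      unfolding algebraic_over_gen_field_iff(1) by (simp add: leaders_def lead_def)
    moreover have "?x w \<in> ?C" if "w \<in> below m ?I u" for w
    proof (rule "1.IH")
      show "(w, u) \<in> rless" "w \<in> jvars m ?I" using that by (simp_all add: below_def)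
      have "sum_list (snd w) \<le> sum_list (snd u)"
        by (rule rless_ord) (use that "1.prems" in \<open>auto simp: below_def jvars_def\<close>)
      then show "sum_list (snd w) \<le> s" using "1.prems" by simp
    qed
    then have "?L \<union> ?x ` below m ?I u \<subseteq> ?C" using der_closure_superset[of "?L \<union> ?x ` nonleaders b a s"] by auto
    then have "gen_field ?L (?x ` below m ?I u) \<subseteq> ?C" by (rule gen_field_minimal[OF is_subfield_der_closure])
    ultimately show ?thesis by (rule algebraic_imp_der_closure)
  qed
qed

lemma kolchin_poly_eq_count_poly:
  "kolchin_poly m \<delta> (gen_diff_field m \<delta> k (set a)) b = count_poly m (length b) (leaders b a)"
proof -
  let ?L = "gen_diff_field m \<delta> k (set a)" and ?x = "jet \<delta> (b @ a)"
  have L: "is_subfield ?L"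
    using is_diff_subfield_gen_diff_field[of m \<delta> k "set a"] by (simp add: is_diff_subfield_def)
  have "trdeg ?L (gen_field ?L {dpow \<delta> \<xi> (b ! i) | \<xi> i. length \<xi> = m \<and> sum_list \<xi> \<le> s \<and> i < length b})
      = card (nonleaders b a s)" for s
  proof -
    have eq: "{dpow \<delta> \<xi> (b ! i) | \<xi> i. length \<xi> = m \<and> sum_list \<xi> \<le> s \<and> i < length b}
        = ?x ` {u \<in> jvars m {..<length b}. sum_list (snd u) \<le> s}" (is "?S = ?T")
    proof
      show "?S \<subseteq> ?T"
      proof
        fix z assume "z \<in> ?S"
        then obtain \<xi> i where "z = dpow \<delta> \<xi> (b ! i)" "length \<xi> = m" "sum_list \<xi> \<le> s" "i < length b" by blast
        then show "z \<in> ?T" by (intro image_eqI[of _ _ "(i, \<xi>)"]) (auto simp: jvars_def jet_def nth_append)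
      qed
      show "?T \<subseteq> ?S" by (auto simp: jvars_def jet_def nth_append)
    qed
    show ?thesis
      unfolding eq
    proof (rule trdeg_eq_card[OF L finite_nonleaders])
      show "alg_indep_family ?L ?x (nonleaders b a s)"
        by (rule nonleaders_alg_indep[OF finite_nonleaders]) (auto simp: nonleaders_def)
      show "?x ` nonleaders b a s \<subseteq> gen_field ?L (?x ` {u \<in> jvars m {..<length b}. sum_list (snd u) \<le> s})"
        using gen_field_superset[of ?L "?x ` {u \<in> jvars m {..<length b}. sum_list (snd u) \<le> s}"]
        by (auto simp: nonleaders_def)
      show "?x ` {u \<in> jvars m {..<length b}. sum_list (snd u) \<le> s} \<subseteq> der_closure (?L \<union> ?x ` nonleaders b a s)"
        using jets_in_der_closure by blast
    qed
  qed
  then show ?thesis unfolding kolchin_poly_def count_poly_def nonleaders_def by simp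
qed

lemma jvars_dpoly_vars: "{..<n} \<times> {\<xi>. length \<xi> = m} = jvars m {..<n}"
  by (auto simp: jvars_def)

lemma dpoly_eval_append:
  assumes "f \<in> dpolys m L (length b)"
  shows "dpoly_eval \<delta> f b = mpoly_eval (jet \<delta> (b @ a)) f"
  unfolding dpoly_eval_def
  by (rule mpoly_eval_cong[OF _ assms[unfolded dpolys_def]]) (auto simp: jet_def nth_append)

text \<open>The hypothesis makes b a specialisation of w over k<a>. A relation among the jets at w
  also holds at b, so jets that are independent at b are independent at w.\<close>

lemma kolchin_poly_specialize:
  assumes len: "length b = n" "length w = n"
    and sp: "\<And>f. f \<in> dpolys m (gen_diff_field m \<delta> k (set a)) n \<Longrightarrow> dpoly_eval \<delta> f w = 0 \<Longrightarrow> dpoly_eval \<delta> f b = 0"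
  shows "dominated (kolchin_poly m \<delta> (gen_diff_field m \<delta> k (set a)) b) (kolchin_poly m \<delta> (gen_diff_field m \<delta> k (set a)) w)"
  unfolding kolchin_poly_eq_count_poly len
proof (rule count_poly_dominated[OF leaders_shift_closed leaders_shift_closed])
  fix s
  let ?L = "gen_diff_field m \<delta> k (set a)"
  have L: "is_subring ?L"
    using is_diff_subfield_gen_diff_field[of m \<delta> k "set a"] by (simp add: is_diff_subfield_def is_subfield_imp_is_subring)
  have "alg_indep_family ?L (jet \<delta> (b @ a)) (nonleaders b a s)"
    by (rule nonleaders_alg_indep[OF finite_nonleaders]) (auto simp: nonleaders_def)
  moreover have "mpoly_eval (jet \<delta> (b @ a)) f = 0"
    if "f \<in> mpolys_over ?L (nonleaders b a s)" "mpoly_eval (jet \<delta> (w @ a)) f = 0" for f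
  proof -
    have "f \<in> dpolys m ?L n"
      unfolding dpolys_def jvars_dpoly_vars
      by (rule subsetD[OF mpolys_over_mono that(1)]) (auto simp: nonleaders_def len)
    then show ?thesis
      using sp[of f] dpoly_eval_append[of f ?L b a] dpoly_eval_append[of f ?L w a] that(2) len by simp
  qed
  ultimately have "alg_indep_family ?L (jet \<delta> (w @ a)) (nonleaders b a s)"
    unfolding alg_indep_family_def by blast
  moreover have "jet \<delta> (w @ a) ` nonleaders b a s \<subseteq> der_closure (?L \<union> jet \<delta> (w @ a) ` nonleaders w a s)"
    using jets_in_der_closure[of _ w s a] by (auto simp: nonleaders_def len)
  ultimately have "card (nonleaders b a s) \<le> card (jet \<delta> (w @ a) ` nonleaders w a s)"
    by (intro alg_indep_family_card_le[OF L]) (simp_all add: finite_nonleaders)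
  also have "\<dots> \<le> card (nonleaders w a s)" by (rule card_image_le[OF finite_nonleaders])
  finally show "card {u \<in> jvars m {..<n}. u \<notin> leaders b a \<and> sum_list (snd u) \<le> s}
      \<le> card {u \<in> jvars m {..<n}. u \<notin> leaders w a \<and> sum_list (snd u) \<le> s}"
    by (simp add: nonleaders_def len)
qed

end

section \<open>Formulas\<close>

definition jet_term :: "(nat \<Rightarrow> ('a, nat) dterm) \<Rightarrow> jvar \<Rightarrow> ('a, nat) dterm" where
  "jet_term \<tau> v = foldr (\<lambda>j. TDer j ^^ (snd v ! j)) [0..<length (snd v)] (\<tau> (fst v))"

primrec pterm :: "(nat \<Rightarrow> ('a, nat) dterm) \<Rightarrow> (jvar, 'a) pexpr \<Rightarrow> ('a, nat) dterm" where
  "pterm \<tau> (PConst c) = TParam c"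
| "pterm \<tau> (PVar v) = jet_term \<tau> v"
| "pterm \<tau> (PAdd e f) = TAdd (pterm \<tau> e) (pterm \<tau> f)"
| "pterm \<tau> (PMul e f) = TMult (pterm \<tau> e) (pterm \<tau> f)"

lemma tm_val_jet_term: "tm_val \<delta> e (jet_term \<tau> v) = dpow \<delta> (snd v) (tm_val \<delta> e (\<tau> (fst v)))"
proof -
  have pw: "tm_val \<delta> e ((TDer j ^^ p) t) = (\<delta> j ^^ p) (tm_val \<delta> e t)" for j p t
    by (induction p) auto
  have "tm_val \<delta> e (foldr (\<lambda>j. TDer j ^^ (snd v ! j)) js t) = foldr (\<lambda>j. \<delta> j ^^ (snd v ! j)) js (tm_val \<delta> e t)" for js t
    by (induction js) (simp_all add: pw)
  then show ?thesis by (simp add: jet_term_def dpow_def)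
qed

lemma tm_val_pterm:
  "tm_val \<delta> e (pterm \<tau> p) = peval (\<lambda>x. x) (\<lambda>v. dpow \<delta> (snd v) (tm_val \<delta> e (\<tau> (fst v)))) p"
  by (induction p) (simp_all add: tm_val_jet_term)

lemma jet_term_syntax:
  "tm_params (jet_term \<tau> v) = tm_params (\<tau> (fst v))" "tm_vars (jet_term \<tau> v) = tm_vars (\<tau> (fst v))"
  "tm_ders (jet_term \<tau> v) \<subseteq> tm_ders (\<tau> (fst v)) \<union> {..<length (snd v)}"
proof -
  have pw: "tm_params ((TDer j ^^ p) t) = tm_params t" "tm_vars ((TDer j ^^ p) t) = tm_vars t"
    "tm_ders ((TDer j ^^ p) t) \<subseteq> insert j (tm_ders t)" for j p and t :: "('a, nat) dterm"
    by (induction p) auto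
  have "tm_params (foldr (\<lambda>j. TDer j ^^ (snd v ! j)) js t) = tm_params t \<and>
    tm_vars (foldr (\<lambda>j. TDer j ^^ (snd v ! j)) js t) = tm_vars t \<and>
    tm_ders (foldr (\<lambda>j. TDer j ^^ (snd v ! j)) js t) \<subseteq> tm_ders t \<union> set js" for js and t :: "('a, nat) dterm"
  proof (induction js)
    case (Cons j js)
    then show ?case using pw(3)[where j = j and p = "snd v ! j" and t = "foldr (\<lambda>j. TDer j ^^ (snd v ! j)) js t"] pw(1,2) by auto
  qed simp
  from this[of "[0..<length (snd v)]" "\<tau> (fst v)"]
  show "tm_params (jet_term \<tau> v) = tm_params (\<tau> (fst v))" "tm_vars (jet_term \<tau> v) = tm_vars (\<tau> (fst v))"
    "tm_ders (jet_term \<tau> v) \<subseteq> tm_ders (\<tau> (fst v)) \<union> {..<length (snd v)}"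
    by (auto simp: jet_term_def lessThan_atLeast0)
qed

lemma pterm_syntax:
  assumes "p \<in> pexprs A (jvars m {..<N})" "A \<subseteq> A'"
    and "\<And>i. i < N \<Longrightarrow> tm_params (\<tau> i) \<subseteq> A' \<and> tm_ders (\<tau> i) = {} \<and> tm_vars (\<tau> i) \<subseteq> S"
  shows "tm_params (pterm \<tau> p) \<subseteq> A' \<and> tm_ders (pterm \<tau> p) \<subseteq> {..<m} \<and> tm_vars (pterm \<tau> p) \<subseteq> S"
  using assms(1)
proof (induction p)
  case (PVar v)
  then have "fst v < N" "length (snd v) = m" by (auto simp: jvars_def)
  then show ?case using assms(3)[of "fst v"] jet_term_syntax[of \<tau> v] by auto
qed (use assms(2) in auto)

lemma pterm_eq_formula:
  assumes "p \<in> pexprs A (jvars m {..<N})" "A \<subseteq> A'"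
    and "\<And>i. i < N \<Longrightarrow> tm_params (\<tau> i) \<subseteq> A' \<and> tm_ders (\<tau> i) = {} \<and> tm_vars (\<tau> i) \<subseteq> {..<n}"
  shows "FEq (pterm \<tau> p) TZero \<in> formulas m A' n"
  using pterm_syntax[OF assms] by (auto simp: formulas_def)

lemma formulas_FNot: "\<phi> \<in> formulas m A n \<Longrightarrow> FNot \<phi> \<in> formulas m A n"
  by (simp add: formulas_def)

lemma formulas_FAnd: "\<phi> \<in> formulas m A n \<Longrightarrow> \<psi> \<in> formulas m A n \<Longrightarrow> FAnd \<phi> \<psi> \<in> formulas m A n"
  by (simp add: formulas_def)

lemma conj_formula:
  assumes "finite \<Phi>" "\<Phi> \<subseteq> formulas m A n"
  shows "\<exists>\<phi>\<in>formulas m A n. \<forall>e. sat \<delta> e \<phi> \<longleftrightarrow> (\<forall>\<psi>\<in>\<Phi>. sat \<delta> e \<psi>)"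
  using assms
proof (induction \<Phi> rule: finite_induct)
  case empty
  then show ?case by (intro bexI[of _ "FEq TZero TZero"]) (auto simp: formulas_def)
next
  case (insert \<psi> \<Phi>)
  then obtain \<phi> where "\<phi> \<in> formulas m A n" "\<And>e. sat \<delta> e \<phi> \<longleftrightarrow> (\<forall>\<psi>\<in>\<Phi>. sat \<delta> e \<psi>)" by auto
  then show ?case using insert.prems by (intro bexI[of _ "FAnd \<psi> \<phi>"]) (auto intro: formulas_FAnd)
qed

section \<open>Formulas for charts and closure properties of definable sets\<close>

definition in_chart :: "(nat \<Rightarrow> 'a::comm_ring_1 \<Rightarrow> 'a) \<Rightarrow> (jvar, 'a) pexpr set \<Rightarrow> (jvar, 'a) pexpr set \<Rightarrow> 'a list \<Rightarrow> bool" where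
  "in_chart \<delta> EQ NE c \<longleftrightarrow> (\<forall>e\<in>EQ. peval (\<lambda>x. x) (jet \<delta> c) e = 0) \<and> (\<forall>e\<in>NE. peval (\<lambda>x. x) (jet \<delta> c) e \<noteq> 0)"

lemma chart_formula:
  assumes "finite EQ" "finite NE" "EQ \<union> NE \<subseteq> pexprs A (jvars m {..<N})" "A \<subseteq> A'"
    and "\<And>i. i < N \<Longrightarrow> tm_params (\<tau> i) \<subseteq> A' \<and> tm_ders (\<tau> i) = {} \<and> tm_vars (\<tau> i) \<subseteq> {..<n}"
  shows "\<exists>\<phi>\<in>formulas m A' n. \<forall>e c. (\<forall>i<N. tm_val \<delta> e (\<tau> i) = c ! i) \<longrightarrow> (sat \<delta> e \<phi> \<longleftrightarrow> in_chart \<delta> EQ NE c)"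
proof -
  have "finite ((\<lambda>p. FEq (pterm \<tau> p) TZero) ` EQ \<union> (\<lambda>p. FNot (FEq (pterm \<tau> p) TZero)) ` NE)"
    using assms(1,2) by simp
  moreover have "(\<lambda>p. FEq (pterm \<tau> p) TZero) ` EQ \<union> (\<lambda>p. FNot (FEq (pterm \<tau> p) TZero)) ` NE \<subseteq> formulas m A' n"
  proof -
    have f: "FEq (pterm \<tau> p) TZero \<in> formulas m A' n" if "p \<in> EQ \<union> NE" for p
      using pterm_eq_formula[where \<tau> = \<tau> and N = N and A = A, OF _ assms(4,5)] that assms(3) by blast
    have "(\<lambda>p. FEq (pterm \<tau> p) TZero) ` EQ \<subseteq> formulas m A' n"
      by (rule image_subsetI, rule f) simp
    moreover have "(\<lambda>p. FNot (FEq (pterm \<tau> p) TZero)) ` NE \<subseteq> formulas m A' n"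
      by (rule image_subsetI, rule formulas_FNot, rule f) simp
    ultimately show ?thesis by (rule Un_least)
  qed
  ultimately obtain \<phi> where \<phi>: "\<phi> \<in> formulas m A' n" "\<And>e. sat \<delta> e \<phi> \<longleftrightarrow>
    (\<forall>\<psi>\<in>(\<lambda>p. FEq (pterm \<tau> p) TZero) ` EQ \<union> (\<lambda>p. FNot (FEq (pterm \<tau> p) TZero)) ` NE. sat \<delta> e \<psi>)"
    by (rule bexE[OF conj_formula[where \<delta> = \<delta>]]) (rule that, assumption, erule spec)
  have "sat \<delta> e \<phi> \<longleftrightarrow> in_chart \<delta> EQ NE c" if c: "\<forall>i<N. tm_val \<delta> e (\<tau> i) = c ! i" for e c
  proof -
    have "tm_val \<delta> e (pterm \<tau> p) = peval (\<lambda>x. x) (jet \<delta> c) p" if "p \<in> EQ \<union> NE" for p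
      unfolding tm_val_pterm
    proof (rule peval_cong)
      fix v assume "v \<in> pvars p"
      then have "fst v < N" using that assms(3) by (auto simp: pexprs_def jvars_def)
      then show "dpow \<delta> (snd v) (tm_val \<delta> e (\<tau> (fst v))) = jet \<delta> c v" using c by (simp add: jet_def)
    qed
    then show ?thesis unfolding \<phi>(2) in_chart_def ball_Un ball_simps by simp
  qed
  then show ?thesis using \<phi>(1) by blast
qed

lemma sat_FEx_block:
  "sat \<delta> e (foldr FEx [r..<r + n] \<phi>) \<longleftrightarrow>
     (\<exists>b. length b = n \<and> sat \<delta> (\<lambda>i. if r \<le> i \<and> i < r + n then b ! (i - r) else e i) \<phi>)"
proof (induction n arbitrary: \<phi>)
  case 0
  have "(\<lambda>i. if r \<le> i \<and> i < r + 0 then [] ! (i - r) else e i) = e" by (auto simp: fun_eq_iff)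
  then show ?case by simp
next
  case (Suc n)
  have eq: "(\<lambda>i. if r \<le> i \<and> i < r + n then b ! (i - r) else e i)(r + n := x)
      = (\<lambda>i. if r \<le> i \<and> i < r + Suc n then (b @ [x]) ! (i - r) else e i)" if "length b = n" for b x
    using that by (auto simp: nth_append fun_eq_iff)
  have "sat \<delta> e (foldr FEx [r..<r + Suc n] \<phi>) \<longleftrightarrow>
      (\<exists>b. length b = n \<and> (\<exists>x. sat \<delta> ((\<lambda>i. if r \<le> i \<and> i < r + n then b ! (i - r) else e i)(r + n := x)) \<phi>))"
    using Suc[of "FEx (r + n) \<phi>"] by simp
  also have "\<dots> \<longleftrightarrow> (\<exists>b. length b = n \<and> (\<exists>x. sat \<delta> (\<lambda>i. if r \<le> i \<and> i < r + Suc n then (b @ [x]) ! (i - r) else e i) \<phi>))"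
    using eq by (metis (no_types, lifting))
  also have "\<dots> \<longleftrightarrow> (\<exists>b. length b = Suc n \<and> sat \<delta> (\<lambda>i. if r \<le> i \<and> i < r + Suc n then b ! (i - r) else e i) \<phi>)"
    (is "?l \<longleftrightarrow> ?r")
  proof
    assume ?r
    then obtain b where b: "length b = Suc n" "sat \<delta> (\<lambda>i. if r \<le> i \<and> i < r + Suc n then b ! (i - r) else e i) \<phi>" by blast
    then have "butlast b @ [last b] = b" by (metis append_butlast_last_id length_0_conv nat.distinct(1))
    then show ?l using b by (intro exI[of _ "butlast b"] conjI exI[of _ "last b"]) (simp, simp only: \<open>butlast b @ [last b] = b\<close>)
  next
    assume ?l
    then obtain b x where "length b = n" "sat \<delta> (\<lambda>i. if r \<le> i \<and> i < r + Suc n then (b @ [x]) ! (i - r) else e i) \<phi>"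
      by blast
    then show ?r by (intro exI[of _ "b @ [x]"] conjI) (simp, simp only:)
  qed
  finally show ?case .
qed

lemma FEx_block_formulas:
  "\<phi> \<in> formulas m A (r + n) \<Longrightarrow> foldr FEx [r..<r + n] \<phi> \<in> formulas m A r"
proof -
  have "fm_params (foldr FEx js \<phi>) = fm_params \<phi>" "fm_ders (foldr FEx js \<phi>) = fm_ders \<phi>"
    "fm_free (foldr FEx js \<phi>) = fm_free \<phi> - set js" for js
    by (induction js) auto
  then show "\<phi> \<in> formulas m A (r + n) \<Longrightarrow> foldr FEx [r..<r + n] \<phi> \<in> formulas m A r"
    by (auto simp: formulas_def)
qed

lemma definableI:
  assumes "\<phi> \<in> formulas m UNIV r" "\<And>a. length a = r \<Longrightarrow> P a \<longleftrightarrow> sat \<delta> (\<lambda>i. a ! i) \<phi>"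
  shows "definable m \<delta> r {a. length a = r \<and> P a}"
  unfolding definable_def using assms by (intro bexI[of _ \<phi>]) auto

lemma definable_cong:
  assumes "definable m \<delta> r {a. length a = r \<and> P a}" "\<And>a. length a = r \<Longrightarrow> P a \<longleftrightarrow> Q a"
  shows "definable m \<delta> r {a. length a = r \<and> Q a}"
proof -
  have "{a. length a = r \<and> Q a} = {a. length a = r \<and> P a}" using assms(2) by auto
  then show ?thesis using assms(1) by simp
qed

lemma definable_formula:
  assumes "definable m \<delta> r {a. length a = r \<and> P a}"
  obtains \<phi> where "\<phi> \<in> formulas m UNIV r" "\<And>a. length a = r \<Longrightarrow> P a \<longleftrightarrow> sat \<delta> (\<lambda>i. a ! i) \<phi>"
proof -
  obtain \<phi> where \<phi>: "\<phi> \<in> formulas m UNIV r" "{a. length a = r \<and> P a} = {a. length a = r \<and> sat \<delta> (\<lambda>i. a ! i) \<phi>}"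
    using assms unfolding definable_def by blast
  then have "P a \<longleftrightarrow> sat \<delta> (\<lambda>i. a ! i) \<phi>" if "length a = r" for a
    using that by (auto simp: set_eq_iff)
  then show thesis using that \<phi>(1) by blast
qed

lemma definable_not:
  assumes "definable m \<delta> r {a. length a = r \<and> P a}"
  shows "definable m \<delta> r {a. length a = r \<and> \<not> P a}"
proof -
  obtain \<phi> where "\<phi> \<in> formulas m UNIV r" "\<And>a. length a = r \<Longrightarrow> P a \<longleftrightarrow> sat \<delta> (\<lambda>i. a ! i) \<phi>"
    using definable_formula[OF assms] by blast
  then show ?thesis by (intro definableI[of "FNot \<phi>"] formulas_FNot) auto
qed

lemma definable_and:
  assumes "definable m \<delta> r {a. length a = r \<and> P a}" "definable m \<delta> r {a. length a = r \<and> Q a}"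
  shows "definable m \<delta> r {a. length a = r \<and> P a \<and> Q a}"
proof -
  obtain \<phi> where "\<phi> \<in> formulas m UNIV r" "\<And>a. length a = r \<Longrightarrow> P a \<longleftrightarrow> sat \<delta> (\<lambda>i. a ! i) \<phi>"
    using definable_formula[OF assms(1)] by blast
  moreover obtain \<psi> where "\<psi> \<in> formulas m UNIV r" "\<And>a. length a = r \<Longrightarrow> Q a \<longleftrightarrow> sat \<delta> (\<lambda>i. a ! i) \<psi>"
    using definable_formula[OF assms(2)] by blast
  ultimately show ?thesis by (intro definableI[of "FAnd \<phi> \<psi>"] formulas_FAnd) auto
qed

lemma definable_finite_all:
  assumes "finite C" "\<And>c. c \<in> C \<Longrightarrow> definable m \<delta> r {a. length a = r \<and> P c a}"
  shows "definable m \<delta> r {a. length a = r \<and> (\<forall>c\<in>C. P c a)}"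
  using assms
proof (induction C rule: finite_induct)
  case empty
  then show ?case by (intro definableI[of "FEq TZero TZero"]) (auto simp: formulas_def)
next
  case (insert c C)
  then show ?case using definable_and[of m \<delta> r "P c" "\<lambda>a. \<forall>c\<in>C. P c a"] by simp
qed

lemma definable_finite_ex:
  assumes "finite C" "\<And>c. c \<in> C \<Longrightarrow> definable m \<delta> r {a. length a = r \<and> P c a}"
  shows "definable m \<delta> r {a. length a = r \<and> (\<exists>c\<in>C. P c a)}"
  using definable_not[OF definable_finite_all[OF assms(1), of m \<delta> r "\<lambda>c a. \<not> P c a"]] definable_not[OF assms(2)]
  by simp

lemma chart_projection_definable:
  assumes "finite EQ" "finite NE" "EQ \<union> NE \<subseteq> pexprs A (jvars m {..<n + r})"
  shows "definable m \<delta> r {a. length a = r \<and> (\<exists>b. length b = n \<and> in_chart \<delta> EQ NE (b @ a))}"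
proof -
  \<comment> \<open>In a chart b precedes a, but the quantified block has to follow the free
    variables: a is placed at 0, ..., r - 1 and b from r on.\<close>
  define \<tau> where "\<tau> i = (if i < n then TVar (r + i) else TVar (i - n) :: ('a, nat) dterm)" for i
  have \<tau>: "tm_params (\<tau> i) \<subseteq> UNIV \<and> tm_ders (\<tau> i) = {} \<and> tm_vars (\<tau> i) \<subseteq> {..<r + n}" if "i < n + r" for i
    using that by (auto simp: \<tau>_def)
  obtain \<phi> where \<phi>: "\<phi> \<in> formulas m UNIV (r + n)"
    "\<And>e c. (\<forall>i<n + r. tm_val \<delta> e (\<tau> i) = c ! i) \<Longrightarrow> (sat \<delta> e \<phi> \<longleftrightarrow> in_chart \<delta> EQ NE c)"
    using chart_formula[OF assms subset_UNIV, of \<tau> "r + n" \<delta>] \<tau> by blast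
  show ?thesis
  proof (rule definableI[OF FEx_block_formulas[OF \<phi>(1)]])
    fix a :: "'a list" assume a: "length a = r"
    have "sat \<delta> (\<lambda>i. if r \<le> i \<and> i < r + n then b ! (i - r) else a ! i) \<phi> \<longleftrightarrow> in_chart \<delta> EQ NE (b @ a)"
      if "length b = n" for b
      by (rule \<phi>(2)) (use that a in \<open>auto simp: \<tau>_def nth_append\<close>)
    then show "(\<exists>b. length b = n \<and> in_chart \<delta> EQ NE (b @ a)) \<longleftrightarrow> sat \<delta> (\<lambda>i. a ! i) (foldr FEx [r..<r + n] \<phi>)"
      unfolding sat_FEx_block by auto
  qed
qed

section \<open>Charts\<close>

context diff_subfield
begin

lemma infinite_k: "infinite k"
proof -
  have "range (of_nat :: nat \<Rightarrow> 'a) \<subseteq> k" using is_subring_of_nat[OF k_subring] by blast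
  moreover have "infinite (range (of_nat :: nat \<Rightarrow> 'a))"
    by (simp add: finite_image_iff inj_of_nat)
  ultimately show ?thesis using finite_subset by blast
qed

lemma small_params: "lesspoll k (UNIV :: 'a set) \<Longrightarrow> finite S \<Longrightarrow> lesspoll (k \<union> S) (UNIV :: 'a set)"
proof -
  assume k: "lesspoll k (UNIV :: 'a set)" and "finite S"
  have "lepoll (k \<union> S) k"
    by (intro lepoll_Un infinite_k lepoll_refl) (simp add: \<open>finite S\<close> finite_lepoll_infinite infinite_k)
  then show ?thesis using k by (rule lesspoll_trans1)
qed

lemma small_gen_diff_field:
  assumes "lesspoll k (UNIV :: 'a set)" "finite S"
  shows "lesspoll (gen_diff_field m \<delta> k S) (UNIV :: 'a set)"
  unfolding gen_diff_field_def
  by (rule lesspoll_trans1[OF diff_subfield_hull_lepoll(1) small_params[OF assms]]) (simp add: infinite_k)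

text \<open>The inclusion of leaders bounds the polynomials of all points of the chart by that of
  (b, a); the last clause makes this bound attained in every fibre that meets the chart.\<close>

definition chart_spec :: "'a list \<Rightarrow> 'a list \<Rightarrow> (jvar, 'a) pexpr set \<Rightarrow> (jvar, 'a) pexpr set \<Rightarrow> bool" where
  "chart_spec b a EQ NE \<longleftrightarrow> in_chart \<delta> EQ NE (b @ a) \<and>
    (\<forall>b' a'. length b' = length b \<longrightarrow> length a' = length a \<longrightarrow> in_chart \<delta> EQ NE (b' @ a') \<longrightarrow>
       leaders b a \<subseteq> leaders b' a' \<and>
       specializes k (\<lambda>x. x) (jet \<delta> (b @ a)) (jet \<delta> (b' @ a')) (jvars m {..<length b + length a}) \<and>
       (\<exists>b''. length b'' = length b \<and> in_chart \<delta> EQ NE (b'' @ a') \<and> leaders b'' a' = leaders b a))"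

lemma relations_in_chart:
  assumes "\<And>u es. (u, es) \<in> Bs \<Longrightarrow> u \<in> jvars m I \<and> mrel c I0 I u es"
  shows "(u, es) \<in> Bs \<Longrightarrow> peval (\<lambda>x. x) (jet \<delta> c) (phorner (PVar u) es) = 0 \<and>
    peval (\<lambda>x. x) (jet \<delta> c) (last es) \<noteq> 0 \<and> peval (\<lambda>x. x) (jet \<delta> c) (psep (PVar u) es) \<noteq> 0"
    and "(u, es) \<in> Bs \<Longrightarrow> {phorner (PVar u) es, last es, psep (PVar u) es} \<subseteq> pexprs k (jvars m (I0 \<union> I))"
proof -
  assume ues: "(u, es) \<in> Bs"
  note m = assms[OF ues]
  show "peval (\<lambda>x. x) (jet \<delta> c) (phorner (PVar u) es) = 0 \<and>
    peval (\<lambda>x. x) (jet \<delta> c) (last es) \<noteq> 0 \<and> peval (\<lambda>x. x) (jet \<delta> c) (psep (PVar u) es) \<noteq> 0"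
    using m min_relation_sep[OF k_subring, of "jet \<delta> c" _ _ es]
    by (auto simp: peval_phorner[OF is_ring_hom_id] peval_psep[OF is_ring_hom_id] min_relation_def)
  have "jvars m I0 \<union> below m I u \<subseteq> jvars m (I0 \<union> I)" by (auto simp: jvars_def below_def)
  then have es: "set es \<subseteq> pexprs k (jvars m (I0 \<union> I))" "es \<noteq> []"
    using m pexprs_mono unfolding min_relation_def by blast+
  have "u \<in> jvars m (I0 \<union> I)" using m by (auto simp: jvars_def)
  then show "{phorner (PVar u) es, last es, psep (PVar u) es} \<subseteq> pexprs k (jvars m (I0 \<union> I))"
    using es by (auto intro: phorner_pexprs psep_pexprs k_simps)
qed

text \<open>Two characteristic sets enter: \<open>Ba\<close> for the parameters over k and
  \<open>Bb\<close> for b over k<a>. The first makes a' a specialisation of a, which the generic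
  solution over a' presupposes.\<close>

lemma chart_exists:
  assumes dc: "differentially_closed m \<delta>" and sat: "saturated m \<delta>" and small: "lesspoll k (UNIV :: 'a set)"
    and len: "length b = n" "length a = r"
  shows "\<exists>EQ NE. finite EQ \<and> finite NE \<and> EQ \<union> NE \<subseteq> pexprs k (jvars m {..<n + r}) \<and> chart_spec b a EQ NE"
proof -
  define c where "c = b @ a"
  define J0 J1 where "J0 = {..<n}" and "J1 = {n..<n + r}"
  have JJ: "jvars m J1 \<union> jvars m J0 = jvars m {..<n + r}" "J1 \<union> J0 = {..<n + r}" "J1 \<inter> J0 = {}"
    by (auto simp: J0_def J1_def jvars_def)
  have e: "jvars m {} = {}" by (simp add: jvars_def)
  obtain Ba where Ba: "finite Ba" "\<And>u es. (u, es) \<in> Ba \<Longrightarrow> u \<in> jvars m J1 \<and> mrel c {} J1 u es"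
    "\<And>u. lead c {} J1 u \<Longrightarrow> \<exists>es. prolongation m \<delta> Ba u es"
    using lead_basis[of J1 c "{}"] unfolding J1_def by blast
  obtain Bb where Bb: "finite Bb" "\<And>u es. (u, es) \<in> Bb \<Longrightarrow> u \<in> jvars m J0 \<and> mrel c J1 J0 u es"
    "\<And>u. lead c J1 J0 u \<Longrightarrow> \<exists>es. prolongation m \<delta> Bb u es"
    using lead_basis[of J0 c J1] unfolding J0_def by blast
  \<comment> \<open>The initial lives strictly below u, whereas the separant may contain u; hence
    the two different sets of jets.\<close>
  have "\<exists>g1 g2. keeps_nonzero c J1 J0 (below m J0 u) g1 (last es) \<and>
      keeps_nonzero c J1 J0 (insert u (below m J0 u)) g2 (psep (PVar u) es)" if ues: "(u, es) \<in> Bb" for u es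
  proof -
    have u: "u \<in> jvars m J0" "mrel c J1 J0 u es" using Bb(2)[OF ues] by auto
    have es: "set es \<subseteq> pexprs k (jvars m J1 \<union> below m J0 u)" "es \<noteq> []" using u(2) by (auto simp: min_relation_def)
    have dn: "below m J0 w \<subseteq> below m J0 u" if "w \<in> below m J0 u" for w
      using that trans_rless[of _ w u] by (auto simp: below_def)
    have "\<exists>g1. keeps_nonzero c J1 J0 (below m J0 u) g1 (last es)"
      by (rule ex_keeps_nonzero) (use dn es u(2) in \<open>auto simp: below_def min_relation_def\<close>)
    moreover have "\<exists>g2. keeps_nonzero c J1 J0 (insert u (below m J0 u)) g2 (psep (PVar u) es)"
    proof (rule ex_keeps_nonzero)
      show "insert u (below m J0 u) \<subseteq> jvars m J0" using u(1) by (auto simp: below_def)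
      show "\<And>w. w \<in> insert u (below m J0 u) \<Longrightarrow> below m J0 w \<subseteq> insert u (below m J0 u)" using dn by auto
      show "psep (PVar u) es \<in> pexprs k (jvars m J1 \<union> insert u (below m J0 u))"
        using es(1) pexprs_mono[of "jvars m J1 \<union> below m J0 u" "jvars m J1 \<union> insert u (below m J0 u)"]
        by (intro psep_pexprs k_simps) auto
      show "peval (\<lambda>x. x) (jet \<delta> c) (psep (PVar u) es) \<noteq> 0" using relations_in_chart(1)[where Bs = Bb, OF Bb(2) ues] by blast
    qed
    ultimately show ?thesis by blast
  qed
  then obtain g1 g2 where g: "\<And>u es. (u, es) \<in> Bb \<Longrightarrow> keeps_nonzero c J1 J0 (below m J0 u) (g1 u es) (last es)"
    "\<And>u es. (u, es) \<in> Bb \<Longrightarrow> keeps_nonzero c J1 J0 (insert u (below m J0 u)) (g2 u es) (psep (PVar u) es)"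
    by metis
  define EQ where "EQ = (\<lambda>(u, es). phorner (PVar u) es) ` (Ba \<union> Bb)"
  define NE where "NE = (\<lambda>(u, es). last es) ` (Ba \<union> Bb) \<union> (\<lambda>(u, es). psep (PVar u) es) ` (Ba \<union> Bb) \<union>
    (\<lambda>(u, es). g1 u es) ` Bb \<union> (\<lambda>(u, es). g2 u es) ` Bb"
  have fin: "finite EQ" "finite NE" using Ba(1) Bb(1) by (auto simp: EQ_def NE_def)
  have ra: "{phorner (PVar u) es, last es, psep (PVar u) es} \<subseteq> pexprs k (jvars m {..<n + r})"
    if "(u, es) \<in> Ba \<union> Bb" for u es
  proof -
    have "jvars m ({} \<union> J1) \<subseteq> jvars m {..<n + r}" by (rule jvars_mono) (auto simp: J1_def)
    note J1 = subsetI[OF pexprs_mono[OF this]]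
    from that show ?thesis
    proof
      assume "(u, es) \<in> Ba"
      from relations_in_chart(2)[where u = u and es = es and Bs = Ba, OF Ba(2) this] J1 show ?thesis by (rule order_trans)
    next
      assume "(u, es) \<in> Bb"
      from relations_in_chart(2)[where u = u and es = es and Bs = Bb, OF Bb(2) this] show ?thesis by (simp only: JJ(2))
    qed
  qed
  have gY: "g1 u es \<in> pexprs k (jvars m {..<n + r})" "g2 u es \<in> pexprs k (jvars m {..<n + r})"
    "peval (\<lambda>x. x) (jet \<delta> c) (g1 u es) \<noteq> 0" "peval (\<lambda>x. x) (jet \<delta> c) (g2 u es) \<noteq> 0" if "(u, es) \<in> Bb" for u es
  proof -
    have "jvars m J1 \<subseteq> jvars m {..<n + r}" by (rule jvars_mono) (auto simp: J1_def)
    then show "g1 u es \<in> pexprs k (jvars m {..<n + r})" "g2 u es \<in> pexprs k (jvars m {..<n + r})"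
      using g[OF that] pexprs_mono unfolding keeps_nonzero_def by blast+
    show "peval (\<lambda>x. x) (jet \<delta> c) (g1 u es) \<noteq> 0" "peval (\<lambda>x. x) (jet \<delta> c) (g2 u es) \<noteq> 0"
      using g[OF that] unfolding keeps_nonzero_def by blast+
  qed
  have sub: "EQ \<union> NE \<subseteq> pexprs k (jvars m {..<n + r})"
    unfolding EQ_def NE_def using ra gY(1,2) by auto
  have chart_c: "in_chart \<delta> EQ NE c"
    unfolding in_chart_def EQ_def NE_def
    using relations_in_chart(1)[where Bs = Ba, OF Ba(2)] relations_in_chart(1)[where Bs = Bb, OF Bb(2)] gY(3,4) by auto
  have holds: "rel_holds (\<lambda>x. x) (jet \<delta> c') u es" if "in_chart \<delta> EQ NE c'" "(u, es) \<in> Ba \<union> Bb" for c' u es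
  proof -
    have "phorner (PVar u) es \<in> EQ" "last es \<in> NE" "psep (PVar u) es \<in> NE"
      using that(2) unfolding EQ_def NE_def by force+
    then show ?thesis using that(1) unfolding in_chart_def rel_holds_def
      by (auto simp: peval_phorner[OF is_ring_hom_id])
  qed
  have g_nz: "peval (\<lambda>x. x) (jet \<delta> c') (g1 u es) \<noteq> 0 \<and> peval (\<lambda>x. x) (jet \<delta> c') (g2 u es) \<noteq> 0"
    if "in_chart \<delta> EQ NE c'" "(u, es) \<in> Bb" for c' u es
  proof -
    have "g1 u es \<in> NE" "g2 u es \<in> NE" using that(2) unfolding NE_def by force+
    then show ?thesis using that(1) unfolding in_chart_def by blast
  qed
  \<comment> \<open>Specialisation is obtained in two stages: the parameters over k, starting from
    no jets at all, and then the unknowns over the parameters.\<close>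
  have spec1: "specializes k (\<lambda>x. x) (jet \<delta> c) (jet \<delta> c') (jvars m J1)" if ch: "in_chart \<delta> EQ NE c'" for c'
  proof -
    have "peval (\<lambda>x. x) (jet \<delta> c) f = peval (\<lambda>x. x) (jet \<delta> c') f" if "f \<in> pexprs k {}" for f
      using that by (induction f) auto
    then have "specializes k (\<lambda>x. x) (jet \<delta> c) (jet \<delta> c') (jvars m {})"
      unfolding specializes_def e by auto
    from specializes_point[OF Ba(2,3) holds[OF ch] this] show ?thesis by (simp add: e)
  qed
  have spec2: "specializes k (\<lambda>x. x) (jet \<delta> c) (jet \<delta> c') (jvars m {..<n + r})" if ch: "in_chart \<delta> EQ NE c'" for c'
    using specializes_point[OF Bb(2,3) holds[OF ch] spec1[OF ch]] JJ(1) by simp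
  have lead_c: "leaders b a = {u. lead c J1 J0 u}"
    by (simp add: leaders_def len c_def J0_def J1_def)
  have leads: "leaders b a \<subseteq> leaders b' a'" if ch: "in_chart \<delta> EQ NE (b' @ a')" "length b' = n" "length a' = r" for b' a'
  proof
    fix z assume "z \<in> leaders b a"
    then have "lead c J1 J0 z" by (simp add: lead_c)
    moreover have "rel_holds (\<lambda>x. x) (jet \<delta> (b' @ a')) u es" if "(u, es) \<in> Bb" for u es
      by (rule holds[OF ch(1)]) (simp add: that)
    ultimately have "lead (b' @ a') J1 J0 z" by - (rule lead_point[where Bs = Bb and c = c, OF Bb(2,3)])
    then show "z \<in> leaders b' a'" by (simp add: leaders_def J0_def J1_def ch(2,3))
  qed
  have real: "\<exists>b''. length b'' = n \<and> in_chart \<delta> EQ NE (b'' @ a') \<and> leaders b'' a' = leaders b a"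
    if ch: "in_chart \<delta> EQ NE (b' @ a')" "length b' = n" "length a' = r" for b' a'
  proof -
    obtain y :: "jvar \<Rightarrow> 'a big" and D where y:
      "\<And>v. v \<in> jvars m J1 \<Longrightarrow> y v = big_const (jet \<delta> (b' @ a') v)"
      "\<And>u es. (u, es) \<in> Bb \<Longrightarrow> rel_holds big_const y u es"
      "\<And>z. z \<in> jvars m J0 \<Longrightarrow> \<not> lead c J1 J0 z \<Longrightarrow> \<not> algebraic_over (pval big_const k y (jvars m J1 \<union> below m J0 z)) (y z)"
      "\<And>l. l < m \<Longrightarrow> derivation (D l)" "\<And>l x. l < m \<Longrightarrow> D l (big_const x) = big_const (\<delta> l x)"
      "\<And>l v. l < m \<Longrightarrow> v \<in> jvars m J1 \<union> jvars m J0 \<Longrightarrow> D l (y v) = y (shiftv l v)"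
      using generic_solution[OF JJ(3) Bb(2,3) g g_nz[OF ch(1)] spec1[OF ch(1)]] by blast
    have y_base: "peval big_const y f = big_const (peval (\<lambda>x. x) (jet \<delta> (b' @ a')) f)" if "f \<in> pexprs k (jvars m J1)" for f
      using that by (induction f) (auto simp: y(1) is_ring_homD[OF big_const_hom])
    have big_0: "big_const t = 0 \<longleftrightarrow> t = 0" for t :: 'a by (rule is_ring_hom_eq_0[OF big_const_hom zero_neq_one])
    have yEQ: "peval big_const y f = 0" if "f \<in> EQ" for f
    proof -
      obtain u es where f: "f = phorner (PVar u) es" "(u, es) \<in> Ba \<or> (u, es) \<in> Bb" using \<open>f \<in> EQ\<close> unfolding EQ_def by auto
      from f(2) show ?thesis
      proof
        assume "(u, es) \<in> Ba"
        then have "f \<in> pexprs k (jvars m J1)" using relations_in_chart(2)[where u = u and es = es and Bs = Ba, OF Ba(2)] f(1) by simp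
        then show ?thesis using y_base ch(1) \<open>f \<in> EQ\<close> by (simp add: in_chart_def big_0)
      next
        assume "(u, es) \<in> Bb"
        then show ?thesis using y(2) f(1) by (simp add: rel_holds_def peval_phorner[OF big_const_hom])
      qed
    qed
    have yNE: "peval big_const y f \<noteq> 0" if "f \<in> NE" for f
    proof -
      consider u es where "(u, es) \<in> Ba" "f \<in> {last es, psep (PVar u) es}"
        | u es where "(u, es) \<in> Bb" "f \<in> {last es, psep (PVar u) es}"
        | u es where "(u, es) \<in> Bb" "f \<in> {g1 u es, g2 u es}"
        using \<open>f \<in> NE\<close> unfolding NE_def by auto
      then show ?thesis
      proof cases
        case 1
        then have "f \<in> pexprs k (jvars m J1)" using relations_in_chart(2)[where u = u and es = es and Bs = Ba, OF Ba(2)] by auto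
        then show ?thesis using y_base ch(1) \<open>f \<in> NE\<close> by (simp add: in_chart_def big_0)
      next
        case 2
        then show ?thesis using y(2)[of u es] by (auto simp: rel_holds_def)
      next
        case 3
        then have "f \<in> pexprs k (jvars m J1)" using g[OF 3(1)] by (auto simp: keeps_nonzero_def)
        then show ?thesis using y_base ch(1) \<open>f \<in> NE\<close> by (simp add: in_chart_def big_0)
      qed
    qed
    \<comment> \<open>The type that describes the desired point uses only these parameters, few
      enough for saturation.\<close>
    define A where "A = k \<union> set a'"
    have Asmall: "lesspoll A (UNIV :: 'a set)" unfolding A_def by (rule small_params[OF small]) simp
    define \<tau> where "\<tau> i = (if i < n then TVar i else TParam (a' ! (i - n)) :: ('a, nat) dterm)" for i
    have \<tau>: "tm_params (\<tau> i) \<subseteq> A \<and> tm_ders (\<tau> i) = {} \<and> tm_vars (\<tau> i) \<subseteq> {..<n}" if "i < n + r" for i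
      using that ch(3) by (auto simp: \<tau>_def A_def)
    have kA: "k \<subseteq> A" by (simp add: A_def)
    have \<tau>_val: "\<forall>i<n + r. tm_val \<delta> (\<lambda>i. b'' ! i) (\<tau> i) = (b'' @ a') ! i" if "length b'' = n" for b''
      using that by (auto simp: \<tau>_def nth_append)
    note chart = chart_formula[OF _ _ _ kA, of _ _ m "n + r" \<tau> n \<delta>, OF _ _ _ \<tau>]
    obtain \<phi> where \<phi>1: "\<phi> \<in> formulas m A n" "\<forall>e c. (\<forall>i<n + r. tm_val \<delta> e (\<tau> i) = c ! i) \<longrightarrow> (sat \<delta> e \<phi> \<longleftrightarrow> in_chart \<delta> EQ NE c)"
      by (rule bexE[OF chart[OF fin sub]])
    have \<phi>: "\<phi> \<in> formulas m A n"
      "\<And>b''. length b'' = n \<Longrightarrow> sat \<delta> (\<lambda>i. b'' ! i) \<phi> \<longleftrightarrow> in_chart \<delta> EQ NE (b'' @ a')"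
      by (rule \<phi>1(1)) (rule \<phi>1(2)[rule_format, OF \<tau>_val[rule_format]])
    \<comment> \<open>These are the potential relations that would turn a non-leader z of (b, a)
      into a leader. The type forbids all of them.\<close>
    define Z where "Z = {(z, fs). z \<in> jvars m J0 \<and> \<not> lead c J1 J0 z \<and> fs \<noteq> [] \<and> set fs \<subseteq> pexprs k (jvars m J1 \<union> below m J0 z)}"
    have Zsub: "phorner (PVar z) fs \<in> pexprs k (jvars m {..<n + r})" "last fs \<in> pexprs k (jvars m {..<n + r})" if "(z, fs) \<in> Z" for z fs
    proof -
      have "jvars m J1 \<union> below m J0 z \<subseteq> jvars m {..<n + r}" unfolding JJ(1)[symmetric] by (auto simp: below_def)
      then have "set fs \<subseteq> pexprs k (jvars m {..<n + r})" using that pexprs_mono unfolding Z_def by blast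
      moreover have "z \<in> jvars m {..<n + r}" using that JJ(1) by (auto simp: Z_def)
      ultimately show "phorner (PVar z) fs \<in> pexprs k (jvars m {..<n + r})" "last fs \<in> pexprs k (jvars m {..<n + r})"
        using that by (auto simp: Z_def intro: phorner_pexprs k_simps)
    qed
    have "\<exists>\<psi>\<in>formulas m A n. \<forall>b''. length b'' = n \<longrightarrow>
        (sat \<delta> (\<lambda>i. b'' ! i) \<psi> \<longleftrightarrow> \<not> in_chart \<delta> {phorner (PVar z) fs} {last fs} (b'' @ a'))" if "(z, fs) \<in> Z" for z fs
    proof -
      have "{phorner (PVar z) fs} \<union> {last fs} \<subseteq> pexprs k (jvars m {..<n + r})" using Zsub[OF that] by simp
      from bexE[OF chart[OF _ _ this]]
      obtain \<psi> where \<psi>: "\<psi> \<in> formulas m A n" "\<forall>e c. (\<forall>i<n + r. tm_val \<delta> e (\<tau> i) = c ! i) \<longrightarrow>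
        (sat \<delta> e \<psi> \<longleftrightarrow> in_chart \<delta> {phorner (PVar z) fs} {last fs} c)" by (metis finite.emptyI finite.insertI)
      have "sat \<delta> (\<lambda>i. b'' ! i) \<psi> \<longleftrightarrow> in_chart \<delta> {phorner (PVar z) fs} {last fs} (b'' @ a')" if "length b'' = n" for b''
        by (rule \<psi>(2)[rule_format]) (use \<tau>_val[OF that] in blast)
      then show ?thesis by (intro bexI[of _ "FNot \<psi>"] formulas_FNot \<psi>(1)) simp
    qed
    then obtain \<psi> where \<psi>: "\<And>z fs. (z, fs) \<in> Z \<Longrightarrow> \<psi> z fs \<in> formulas m A n"
      "\<And>z fs b''. (z, fs) \<in> Z \<Longrightarrow> length b'' = n \<Longrightarrow>
        (sat \<delta> (\<lambda>i. b'' ! i) (\<psi> z fs) \<longleftrightarrow> \<not> in_chart \<delta> {phorner (PVar z) fs} {last fs} (b'' @ a'))" by metis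
    define \<Gamma> where "\<Gamma> = insert \<phi> ((\<lambda>(z, fs). \<psi> z fs) ` Z)"
    have "\<exists>b''. length b'' = n \<and> (\<forall>\<theta>\<in>\<Gamma>. sat \<delta> (\<lambda>i. b'' ! i) \<theta>)"
    proof (rule sat[unfolded saturated_def, rule_format, OF Asmall])
      show "\<Gamma> \<subseteq> formulas m A n" using \<phi>(1) \<psi>(1) by (auto simp: \<Gamma>_def)
      fix \<Gamma>0 assume \<Gamma>0: "\<Gamma>0 \<subseteq> \<Gamma>" "finite \<Gamma>0"
      obtain Z0 where Z0: "Z0 \<subseteq> Z" "finite Z0" "\<Gamma>0 - {\<phi>} = (\<lambda>(z, fs). \<psi> z fs) ` Z0"
        using finite_subset_image[of "\<Gamma>0 - {\<phi>}" "\<lambda>(z, fs). \<psi> z fs" Z] \<Gamma>0 by (auto simp: \<Gamma>_def)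
      \<comment> \<open>A potential relation is ruled out if its initial vanishes or its value is
        nonzero. The generic solution decides which: an initial that vanishes at y is required to
        vanish; otherwise the value is nonzero because z is transcendental at y.\<close>
      define EQ' where "EQ' = EQ \<union> {last fs | z fs. (z, fs) \<in> Z0 \<and> peval big_const y (last fs) = 0}"
      define NE' where "NE' = NE \<union> {phorner (PVar z) fs | z fs. (z, fs) \<in> Z0 \<and> peval big_const y (last fs) \<noteq> 0}"
      have "{last fs | z fs. (z, fs) \<in> Z0 \<and> peval big_const y (last fs) = 0} \<subseteq> (\<lambda>(z, fs). last fs) ` Z0"
        "{phorner (PVar z) fs | z fs. (z, fs) \<in> Z0 \<and> peval big_const y (last fs) \<noteq> 0} \<subseteq> (\<lambda>(z, fs). phorner (PVar z) fs) ` Z0"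
        by force+
      then have fin': "finite EQ'" "finite NE'"
        unfolding EQ'_def NE'_def using fin Z0(2) by (auto intro: finite_subset)
      have sub': "EQ' \<subseteq> pexprs k (jvars m {..<n + r})" "NE' \<subseteq> pexprs k (jvars m {..<n + r})"
        unfolding EQ'_def NE'_def using sub Zsub Z0(1) by auto
      have y': "peval big_const y f = 0" if "f \<in> EQ'" for f using that yEQ by (auto simp: EQ'_def)
      have ny': "peval big_const y f \<noteq> 0" if f: "f \<in> NE'" for f
      proof (cases "f \<in> NE")
        case False
        then obtain z fs where zf: "f = phorner (PVar z) fs" "(z, fs) \<in> Z" "peval big_const y (last fs) \<noteq> 0"
          using f Z0(1) by (auto simp: NE'_def)
        have z: "z \<in> jvars m J0" "\<not> lead c J1 J0 z" "fs \<noteq> []" "set fs \<subseteq> pexprs k (jvars m J1 \<union> below m J0 z)"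
          using zf(2) by (auto simp: Z_def)
        have "Polynomial.coeff (Pev big_const y fs) i \<in> pval big_const k y (jvars m J1 \<union> below m J0 z)" for i
          by (rule Pev_in[OF is_subringD(1)[OF is_subring_pval[OF k_subring big_const_hom]]])
             (use z(4) in \<open>auto simp: pval_def\<close>)
        moreover have "Pev big_const y fs \<noteq> 0" unfolding Pev_eq_0_iff using z(3) zf(3) last_in_set by blast
        ultimately have "Polynomial.poly (Pev big_const y fs) (y z) \<noteq> 0"
          using y(3)[OF z(1,2)] unfolding algebraic_over_def by blast
        then show ?thesis by (simp add: zf(1) peval_phorner[OF big_const_hom])
      qed (use yNE in auto)
      have y6: "D l (y v) = y (shiftv l v)" if "l < m" "v \<in> jvars m {..<n + r}" for l v
        by (rule y(6)) (use that JJ(1) in simp_all)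
      obtain b'' where b'': "length b'' = n" "\<forall>e\<in>EQ'. peval (\<lambda>x. x) (jet \<delta> (b'' @ a')) e = 0"
        "\<forall>e\<in>NE'. peval (\<lambda>x. x) (jet \<delta> (b'' @ a')) e \<noteq> 0"
        using realize_solution[where D = D and y = y and n = n and r = r and b' = b' and a = a', OF dc _ ch(2) y(4,5) y6 fin'(1) sub'(1) y' fin'(2) sub'(2) ny']
          y(1) by (auto simp: J1_def)
      have "in_chart \<delta> EQ NE (b'' @ a')" using b''(2,3) by (auto simp: in_chart_def EQ'_def NE'_def)
      then have "sat \<delta> (\<lambda>i. b'' ! i) \<phi>" using \<phi>(2) b''(1) by simp
      moreover have "sat \<delta> (\<lambda>i. b'' ! i) (\<psi> z fs)" if zf: "(z, fs) \<in> Z0" for z fs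
      proof -
        have "\<not> in_chart \<delta> {phorner (PVar z) fs} {last fs} (b'' @ a')"
        proof (cases "peval big_const y (last fs) = 0")
          case True
          then have "last fs \<in> EQ'" using zf unfolding EQ'_def by blast
          then show ?thesis using b''(2) by (simp add: in_chart_def)
        next
          case False
          then have "phorner (PVar z) fs \<in> NE'" using zf unfolding NE'_def by blast
          then show ?thesis using b''(3) by (simp add: in_chart_def)
        qed
        then show ?thesis using \<psi>(2)[OF subsetD[OF Z0(1) zf] b''(1)] by simp
      qed
      moreover have "\<Gamma>0 \<subseteq> insert \<phi> ((\<lambda>(z, fs). \<psi> z fs) ` Z0)" using Z0(3) by blast
      ultimately have "\<forall>\<theta>\<in>\<Gamma>0. sat \<delta> (\<lambda>i. b'' ! i) \<theta>" using Z0(3) by force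
      then show "\<exists>b''. length b'' = n \<and> (\<forall>\<theta>\<in>\<Gamma>0. sat \<delta> (\<lambda>i. b'' ! i) \<theta>)" using b''(1) by blast
    qed
    then obtain b'' where b'': "length b'' = n" "\<And>\<theta>. \<theta> \<in> \<Gamma> \<Longrightarrow> sat \<delta> (\<lambda>i. b'' ! i) \<theta>" by blast
    have chb: "in_chart \<delta> EQ NE (b'' @ a')" using b''(2)[of \<phi>] \<phi>(2) b''(1) by (simp add: \<Gamma>_def)
    have "leaders b'' a' \<subseteq> leaders b a"
    proof
      fix z assume "z \<in> leaders b'' a'"
      then have z: "lead (b'' @ a') J1 J0 z" using b''(1) ch(3) by (simp add: leaders_def J0_def J1_def)
      then obtain fs where fs: "z \<in> jvars m J0" "mrel (b'' @ a') J1 J0 z fs" unfolding lead_iff_mrel by blast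
      show "z \<in> leaders b a"
      proof (rule ccontr)
        assume "z \<notin> leaders b a"
        then have "(z, fs) \<in> Z" using fs by (auto simp: Z_def lead_c min_relation_def)
        then have "\<psi> z fs \<in> \<Gamma>" by (force simp: \<Gamma>_def)
        from b''(2)[OF this] have "\<not> in_chart \<delta> {phorner (PVar z) fs} {last fs} (b'' @ a')"
          using \<psi>(2)[OF \<open>(z, fs) \<in> Z\<close> b''(1)] by simp
        then show False using fs(2)
          by (auto simp: in_chart_def peval_phorner[OF is_ring_hom_id] min_relation_def)
      qed
    qed
    then show ?thesis using leads[OF chb b''(1) ch(3)] b''(1) chb by blast
  qed
  have "chart_spec b a EQ NE"
    unfolding chart_spec_def len using chart_c leads spec2 real by (simp add: c_def)
  then show ?thesis using fin sub by blast
qed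

end

section \<open>Irreducible components and generic points\<close>

lemma dpolys_eq_mpolys_over: "dpolys m L n = mpolys_over L (jvars m {..<n})"
proof -
  have "{..<n} \<times> {\<xi>. length \<xi> = m} = jvars m {..<n}" by (auto simp: jvars_def)
  then show ?thesis by (simp add: dpolys_def)
qed

lemma dpoly_eval_eq_meval: "dpoly_eval \<delta> f b = meval (\<lambda>x. x) (jet \<delta> b) f"
proof -
  have "(\<lambda>(i, \<xi>). dpow \<delta> \<xi> (b ! i)) = jet \<delta> b" by (auto simp: jet_def fun_eq_iff)
  then show ?thesis by (simp add: dpoly_eval_def mpoly_eval_eq_meval)
qed

lemma dpoly_pexpr:
  fixes L :: "'a::field_char_0 set"
  assumes "is_subring L" "f \<in> dpolys m L n"
  shows "\<exists>e\<in>pexprs L (jvars m {..<n}). \<forall>b. peval (\<lambda>x. x) (jet \<delta> b) e = dpoly_eval \<delta> f b"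
proof -
  have "f \<in> mpolys_over L (jvars m {..<n})" using assms(2) by (simp add: dpolys_eq_mpolys_over)
  from bexE[OF mpoly_pexpr[OF assms(1) this, where ?'b = 'a]]
  obtain e where e: "e \<in> pexprs L (jvars m {..<n})"
    "\<forall>(h :: 'a \<Rightarrow> 'a) y. is_ring_hom h \<longrightarrow> peval h y e = meval h y f" by blast
  then show ?thesis by (intro bexI[of _ e]) (simp_all add: dpoly_eval_eq_meval is_ring_hom_id)
qed

lemma dpolys_mult: "is_subring L \<Longrightarrow> f \<in> dpolys m L n \<Longrightarrow> g \<in> dpolys m L n \<Longrightarrow> f * g \<in> dpolys m L n"
  unfolding dpolys_def by (rule mpolys_over_mult)

lemma dpoly_eval_mult:
  fixes f g :: "'a::field_char_0 dpoly"
  shows "dpoly_eval \<delta> (f * g) b = dpoly_eval \<delta> f b * dpoly_eval \<delta> g b"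
  by (simp add: dpoly_eval_eq_meval meval_mult is_ring_hom_id)

lemma diff_variety_Int:
  assumes "diff_variety m \<delta> L n V" "diff_variety m \<delta> L n W"
  shows "diff_variety m \<delta> L n (V \<inter> W)"
proof -
  obtain S T where "S \<subseteq> dpolys m L n" "V = {b. length b = n \<and> (\<forall>f\<in>S. dpoly_eval \<delta> f b = 0)}"
    "T \<subseteq> dpolys m L n" "W = {b. length b = n \<and> (\<forall>f\<in>T. dpoly_eval \<delta> f b = 0)}"
    using assms unfolding diff_variety_def by blast
  then show ?thesis unfolding diff_variety_def by (intro exI[of _ "S \<union> T"]) auto
qed

lemma irreducible_variety_cover:
  assumes "irreducible_variety m \<delta> L n W" "diff_variety m \<delta> L n V1" "diff_variety m \<delta> L n V2"
    and "W \<subseteq> V1 \<union> V2"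
  shows "W \<subseteq> V1 \<or> W \<subseteq> V2"
proof -
  have W: "diff_variety m \<delta> L n W" using assms(1) by (simp add: irreducible_variety_def)
  have "W = W \<inter> V1 \<or> W = W \<inter> V2"
    using assms(1) diff_variety_Int[OF W assms(2)] diff_variety_Int[OF W assms(3)] assms(4)
    unfolding irreducible_variety_def by (metis Int_Un_distrib inf.absorb1)
  then show ?thesis by blast
qed

text \<open>Primality of the vanishing ideal: otherwise the zero sets of f and g would cover
  W.\<close>

lemma irreducible_variety_mult:
  assumes L: "is_subring L" and W: "irreducible_variety m \<delta> L n W"
    and fg: "f \<in> dpolys m L n" "g \<in> dpolys m L n" "v \<in> W" "dpoly_eval \<delta> f v \<noteq> 0" "w \<in> W" "dpoly_eval \<delta> g w \<noteq> 0"
  shows "\<exists>u\<in>W. dpoly_eval \<delta> (f * g) u \<noteq> 0"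
proof (rule ccontr)
  assume "\<not> (\<exists>u\<in>W. dpoly_eval \<delta> (f * g) u \<noteq> 0)"
  then have z: "dpoly_eval \<delta> f u = 0 \<or> dpoly_eval \<delta> g u = 0" if "u \<in> W" for u
    using that by (simp add: dpoly_eval_mult)
  have V: "diff_variety m \<delta> L n {b. length b = n \<and> dpoly_eval \<delta> h b = 0}" if "h \<in> dpolys m L n" for h
    unfolding diff_variety_def by (intro exI[of _ "{h}"]) (simp add: that)
  have "\<forall>u\<in>W. length u = n" using W by (auto simp: irreducible_variety_def diff_variety_def)
  then have "W \<subseteq> {b. length b = n \<and> dpoly_eval \<delta> f b = 0} \<union> {b. length b = n \<and> dpoly_eval \<delta> g b = 0}"
    using z by blast
  from irreducible_variety_cover[OF W V[OF fg(1)] V[OF fg(2)] this] show False using fg(3-6) by blast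
qed

text \<open>By primality the product of the members of T does not vanish identically on W, and any
  point where it is nonzero serves.\<close>

lemma irreducible_variety_avoid:
  assumes L: "is_subring L" and W: "irreducible_variety m \<delta> L n W"
    and "finite T" "T \<subseteq> dpolys m L n" "\<And>f. f \<in> T \<Longrightarrow> \<exists>v\<in>W. dpoly_eval \<delta> f v \<noteq> 0"
  shows "\<exists>v\<in>W. \<forall>f\<in>T. dpoly_eval \<delta> f v \<noteq> 0"
proof -
  have "\<exists>g\<in>dpolys m L n. (\<exists>v\<in>W. dpoly_eval \<delta> g v \<noteq> 0) \<and> (\<forall>v. dpoly_eval \<delta> g v \<noteq> 0 \<longrightarrow> (\<forall>f\<in>T. dpoly_eval \<delta> f v \<noteq> 0))"
    using assms(3-5)
  proof (induction T rule: finite_induct)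
    case empty
    have "PConst 1 \<in> pexprs L (jvars m {..<n})" using is_subringD[OF L] by simp
    from to_mpoly_mpolys_over[OF L this] have "to_mpoly (PConst 1) \<in> dpolys m L n"
      by (simp only: dpolys_eq_mpolys_over)
    moreover have "dpoly_eval \<delta> (to_mpoly (PConst 1)) v = 1" for v
      by (simp only: dpoly_eval_eq_meval meval_to_mpoly[OF is_ring_hom_id] peval.simps)
    moreover have "W \<noteq> {}" using W by (simp add: irreducible_variety_def)
    ultimately show ?case by (metis all_not_in_conv ball_empty zero_neq_one)
  next
    case (insert f T)
    then obtain g v where g: "g \<in> dpolys m L n" "v \<in> W" "dpoly_eval \<delta> g v \<noteq> 0"
      "\<And>v. dpoly_eval \<delta> g v \<noteq> 0 \<Longrightarrow> \<forall>f\<in>T. dpoly_eval \<delta> f v \<noteq> 0" by auto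
    obtain w where w: "w \<in> W" "dpoly_eval \<delta> f w \<noteq> 0" using insert.prems(2)[of f] by auto
    have f: "f \<in> dpolys m L n" using insert.prems(1) by simp
    show ?case
    proof (intro bexI[of _ "f * g"] conjI allI impI)
      show "\<exists>v\<in>W. dpoly_eval \<delta> (f * g) v \<noteq> 0" by (rule irreducible_variety_mult[OF L W f g(1) w g(2,3)])
      show "\<forall>h\<in>insert f T. dpoly_eval \<delta> h u \<noteq> 0" if "dpoly_eval \<delta> (f * g) u \<noteq> 0" for u
        using that g(4)[of u] by (simp add: dpoly_eval_mult)
    qed (rule dpolys_mult[OF L f g(1)])
  qed
  then show ?thesis by blast
qed

lemma generic_point_mem:
  assumes "diff_variety m \<delta> L n W" "generic_point m \<delta> L n W b"
  shows "b \<in> W"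
  using assms unfolding diff_variety_def generic_point_def by blast

text \<open>The type states for each f whether it vanishes on W. A finite part of it contains
  finitely many inequations, and a single point of W satisfies them all.\<close>

lemma generic_point_exists:
  fixes L :: "'a::field_char_0 set"
  assumes sat: "saturated m \<delta>" and L: "is_subring L" "lesspoll L (UNIV :: 'a set)"
    and W: "irreducible_variety m \<delta> L n W"
  shows "\<exists>b. generic_point m \<delta> L n W b"
proof -
  have "\<exists>\<phi>\<in>formulas m L n. \<forall>b. sat \<delta> (\<lambda>i. b ! i) \<phi> \<longleftrightarrow> dpoly_eval \<delta> f b = 0" if "f \<in> dpolys m L n" for f
  proof -
    obtain e where e: "e \<in> pexprs L (jvars m {..<n})" "\<And>b. peval (\<lambda>x. x) (jet \<delta> b) e = dpoly_eval \<delta> f b"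
      using dpoly_pexpr[OF L(1) \<open>f \<in> dpolys m L n\<close>, of \<delta>] by blast
    have "FEq (pterm TVar e) TZero \<in> formulas m L n"
      by (rule pterm_eq_formula[OF e(1) order_refl]) simp
    moreover have "sat \<delta> (\<lambda>i. b ! i) (FEq (pterm TVar e) TZero) \<longleftrightarrow> dpoly_eval \<delta> f b = 0" for b
    proof -
      have "(\<lambda>v. dpow \<delta> (snd v) (b ! fst v)) = jet \<delta> b" by (simp add: jet_def fun_eq_iff)
      then show ?thesis using e(2)[of b] by (simp add: tm_val_pterm)
    qed
    ultimately show ?thesis by blast
  qed
  then obtain \<phi> where \<phi>: "\<And>f. f \<in> dpolys m L n \<Longrightarrow> \<phi> f \<in> formulas m L n"
    "\<And>f b. f \<in> dpolys m L n \<Longrightarrow> sat \<delta> (\<lambda>i. b ! i) (\<phi> f) \<longleftrightarrow> dpoly_eval \<delta> f b = 0" by metis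
  define \<psi> where "\<psi> f = (if \<forall>v\<in>W. dpoly_eval \<delta> f v = 0 then \<phi> f else FNot (\<phi> f))" for f
  have \<psi>: "sat \<delta> (\<lambda>i. b ! i) (\<psi> f) \<longleftrightarrow> (dpoly_eval \<delta> f b = 0 \<longleftrightarrow> (\<forall>v\<in>W. dpoly_eval \<delta> f v = 0))"
    if "f \<in> dpolys m L n" for f b
    using \<phi>(2)[OF that, of b] unfolding \<psi>_def by (cases "\<forall>v\<in>W. dpoly_eval \<delta> f v = 0") auto
  have len: "length v = n" if "v \<in> W" for v
    using W that by (auto simp: irreducible_variety_def diff_variety_def)
  have "\<exists>b. length b = n \<and> (\<forall>\<theta>\<in>\<psi> ` dpolys m L n. sat \<delta> (\<lambda>i. b ! i) \<theta>)"
  proof (rule sat[unfolded saturated_def, rule_format, OF L(2)])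
    show "\<psi> ` dpolys m L n \<subseteq> formulas m L n" using \<phi>(1) by (auto simp: \<psi>_def formulas_FNot)
    fix \<Gamma> assume "\<Gamma> \<subseteq> \<psi> ` dpolys m L n" "finite \<Gamma>"
    then obtain T where T: "T \<subseteq> dpolys m L n" "finite T" "\<Gamma> = \<psi> ` T"
      using finite_subset_image[of \<Gamma> \<psi> "dpolys m L n"] by blast
    have "\<exists>v\<in>W. \<forall>f\<in>{f \<in> T. \<exists>v\<in>W. dpoly_eval \<delta> f v \<noteq> 0}. dpoly_eval \<delta> f v \<noteq> 0"
      by (rule irreducible_variety_avoid[OF L(1) W]) (use T in auto)
    then obtain v where "v \<in> W" "\<And>f w. f \<in> T \<Longrightarrow> w \<in> W \<Longrightarrow> dpoly_eval \<delta> f w \<noteq> 0 \<Longrightarrow> dpoly_eval \<delta> f v \<noteq> 0" by blast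
    then have "\<forall>f\<in>T. dpoly_eval \<delta> f v = 0 \<longleftrightarrow> (\<forall>w\<in>W. dpoly_eval \<delta> f w = 0)" by blast
    then have "\<forall>\<theta>\<in>\<Gamma>. sat \<delta> (\<lambda>i. v ! i) \<theta>" using \<psi> T(1,3) by blast
    then show "\<exists>b. length b = n \<and> (\<forall>\<theta>\<in>\<Gamma>. sat \<delta> (\<lambda>i. b ! i) \<theta>)" using len[OF \<open>v \<in> W\<close>] by blast
  qed
  then show ?thesis unfolding generic_point_def using \<psi> by blast
qed

section \<open>Kolchin closures and irreducible components\<close>

definition kolchin_closure :: "nat \<Rightarrow> (nat \<Rightarrow> 'a::field_char_0 \<Rightarrow> 'a) \<Rightarrow> 'a set \<Rightarrow> nat \<Rightarrow> 'a list set \<Rightarrow> 'a list set" where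
  "kolchin_closure m \<delta> L n A =
     {c. length c = n \<and> (\<forall>f\<in>dpolys m L n. (\<forall>v\<in>A. dpoly_eval \<delta> f v = 0) \<longrightarrow> dpoly_eval \<delta> f c = 0)}"

lemma kolchin_closure_variety: "diff_variety m \<delta> L n (kolchin_closure m \<delta> L n A)"
  unfolding diff_variety_def kolchin_closure_def
  by (intro exI[of _ "{f \<in> dpolys m L n. \<forall>v\<in>A. dpoly_eval \<delta> f v = 0}"]) auto

lemma kolchin_closure_superset: "(\<And>v. v \<in> A \<Longrightarrow> length v = n) \<Longrightarrow> A \<subseteq> kolchin_closure m \<delta> L n A"
  by (auto simp: kolchin_closure_def)

lemma kolchin_closure_least: "diff_variety m \<delta> L n V \<Longrightarrow> A \<subseteq> V \<Longrightarrow> kolchin_closure m \<delta> L n A \<subseteq> V"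
  unfolding diff_variety_def kolchin_closure_def by blast

lemma irreducible_kolchin_closure:
  assumes "A \<noteq> {}" "\<And>v. v \<in> A \<Longrightarrow> length v = n"
    and "\<And>V1 V2. diff_variety m \<delta> L n V1 \<Longrightarrow> diff_variety m \<delta> L n V2 \<Longrightarrow> A \<subseteq> V1 \<union> V2 \<Longrightarrow> A \<subseteq> V1 \<or> A \<subseteq> V2"
  shows "irreducible_variety m \<delta> L n (kolchin_closure m \<delta> L n A)"
  unfolding irreducible_variety_def
proof (intro conjI allI impI)
  show "diff_variety m \<delta> L n (kolchin_closure m \<delta> L n A)" by (rule kolchin_closure_variety)
  have sup: "A \<subseteq> kolchin_closure m \<delta> L n A" by (rule kolchin_closure_superset[OF assms(2)])
  then show "kolchin_closure m \<delta> L n A \<noteq> {}" using assms(1) by blast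
  fix V1 V2 assume V: "diff_variety m \<delta> L n V1" "diff_variety m \<delta> L n V2" "kolchin_closure m \<delta> L n A = V1 \<union> V2"
  then have "A \<subseteq> V1 \<or> A \<subseteq> V2" using assms(3)[OF V(1,2)] sup by simp
  then show "kolchin_closure m \<delta> L n A = V1 \<or> kolchin_closure m \<delta> L n A = V2"
    using kolchin_closure_least[OF V(1), of A] kolchin_closure_least[OF V(2), of A] V(3) by auto
qed

text \<open>Zorn's lemma: a chain is bounded by the Kolchin closure of its union. This closure is
  irreducible because, when two varieties cover a chain of irreducible sets, one of the two contains
  them all.\<close>

lemma irreducible_component_exists:
  assumes V: "diff_variety m \<delta> L n V" and b: "b \<in> V"
  shows "\<exists>W. irreducible_component m \<delta> L n V W \<and> b \<in> W"
proof -
  have len: "length v = n" if "v \<in> V" for v using V that by (auto simp: diff_variety_def)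
  define \<A> where "\<A> = {W. irreducible_variety m \<delta> L n W \<and> W \<subseteq> V \<and> b \<in> W}"
  have "\<exists>M\<in>\<A>. \<forall>W\<in>\<A>. M \<subseteq> W \<longrightarrow> W = M"
  proof (rule subset_Zorn)
    fix \<C> assume chain: "subset.chain \<A> \<C>"
    \<comment> \<open>Adding b covers the empty chain, whose bound is the closure of the point
      b.\<close>
    define A where "A = insert b (\<Union>\<C>)"
    have C: "\<C> \<subseteq> \<A>" "\<And>P Q. P \<in> \<C> \<Longrightarrow> Q \<in> \<C> \<Longrightarrow> P \<subseteq> Q \<or> Q \<subseteq> P"
      using chain by (auto simp: subset.chain_def)
    have AV: "A \<subseteq> V" using C(1) b by (auto simp: A_def \<A>_def)
    have "A \<subseteq> V1 \<or> A \<subseteq> V2"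
      if V12: "diff_variety m \<delta> L n V1" "diff_variety m \<delta> L n V2" "A \<subseteq> V1 \<union> V2" for V1 V2
    proof -
      have cov: "P \<subseteq> V1 \<or> P \<subseteq> V2" if "P \<in> \<C>" for P
        by (rule irreducible_variety_cover[OF _ V12(1,2)]) (use that C(1) V12(3) in \<open>auto simp: A_def \<A>_def\<close>)
      have bP: "b \<in> P" if "P \<in> \<C>" for P using that C(1) by (auto simp: \<A>_def)
      show ?thesis
      proof (cases "\<C> = {}")
        case True
        then show ?thesis using V12(3) by (auto simp: A_def)
      next
        case False
        have "(\<forall>P\<in>\<C>. P \<subseteq> V1) \<or> (\<forall>P\<in>\<C>. P \<subseteq> V2)"
        proof (rule disjCI)
          assume "\<not> (\<forall>P\<in>\<C>. P \<subseteq> V2)"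
          then obtain P where P: "P \<in> \<C>" "\<not> P \<subseteq> V2" by blast
          show "\<forall>Q\<in>\<C>. Q \<subseteq> V1"
          proof
            fix Q assume Q: "Q \<in> \<C>"
            from C(2)[OF P(1) Q] show "Q \<subseteq> V1" using cov[OF Q] cov[OF P(1)] P(2) by blast
          qed
        qed
        then show ?thesis using False bP unfolding A_def by blast
      qed
    qed
    then have "irreducible_variety m \<delta> L n (kolchin_closure m \<delta> L n A)"
      by (intro irreducible_kolchin_closure) (use AV len in \<open>auto simp: A_def\<close>)
    moreover have "kolchin_closure m \<delta> L n A \<subseteq> V" by (rule kolchin_closure_least[OF V AV])
    moreover have sup: "A \<subseteq> kolchin_closure m \<delta> L n A" by (rule kolchin_closure_superset) (use AV len in auto)
    ultimately have "kolchin_closure m \<delta> L n A \<in> \<A>" by (auto simp: \<A>_def A_def)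
    then show "\<exists>U\<in>\<A>. \<forall>P\<in>\<C>. P \<subseteq> U" using sup unfolding A_def by blast
  qed
  then obtain M where M: "M \<in> \<A>" "\<And>W. W \<in> \<A> \<Longrightarrow> M \<subseteq> W \<Longrightarrow> W = M" by blast
  then have "W = M" if "irreducible_variety m \<delta> L n W" "M \<subseteq> W" "W \<subseteq> V" for W
    using that by (auto simp: \<A>_def)
  then show ?thesis using M(1) by (intro exI[of _ M]) (auto simp: irreducible_component_def \<A>_def)
qed

section \<open>Kolchin polynomials in a definable family\<close>

context diff_subfield
begin

lemma gen_diff_field_subring: "is_subring (gen_diff_field m \<delta> k S)"
  using is_diff_subfield_gen_diff_field[of m \<delta> k S] by (simp add: is_diff_subfield_def is_subfield_imp_is_subring)

text \<open>The maximum over components is a maximum over points: generic points of components lie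
  in V, and b0 is a specialisation of the generic point of a component through it, whose polynomial
  therefore dominates q.\<close>

lemma kolchin_poly_varietyI:
  assumes sat: "saturated m \<delta>" and small: "lesspoll k (UNIV :: 'a set)"
    and V: "diff_variety m \<delta> (gen_diff_field m \<delta> k (set a)) n V"
    and b0: "b0 \<in> V" "kolchin_poly m \<delta> (gen_diff_field m \<delta> k (set a)) b0 = q"
    and max: "\<And>b. b \<in> V \<Longrightarrow> dominated (kolchin_poly m \<delta> (gen_diff_field m \<delta> k (set a)) b) q"
  shows "kolchin_poly_variety m \<delta> (gen_diff_field m \<delta> k (set a)) n V = q"
proof -
  let ?L = "gen_diff_field m \<delta> k (set a)"
  let ?A = "kolchin_poly_irreducible m \<delta> ?L n ` {W. irreducible_component m \<delta> ?L n V W}"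
  have comp: "\<exists>w. generic_point m \<delta> ?L n W w \<and> w \<in> V \<and> kolchin_poly_irreducible m \<delta> ?L n W = kolchin_poly m \<delta> ?L w"
    if "irreducible_component m \<delta> ?L n V W" for W
  proof -
    have W: "irreducible_variety m \<delta> ?L n W" "W \<subseteq> V" using that by (auto simp: irreducible_component_def)
    have "generic_point m \<delta> ?L n W (SOME b. generic_point m \<delta> ?L n W b)"
      by (rule someI_ex[OF generic_point_exists[OF sat gen_diff_field_subring small_gen_diff_field[OF small] W(1)]]) simp
    then show ?thesis using generic_point_mem[of m \<delta> ?L n W] W
      unfolding kolchin_poly_irreducible_def irreducible_variety_def by blast
  qed
  have dom: "dominated q' q" if q': "q' \<in> ?A" for q'
  proof -
    obtain W where W: "irreducible_component m \<delta> ?L n V W" "q' = kolchin_poly_irreducible m \<delta> ?L n W" using q' by blast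
    from comp[OF W(1)] obtain w where "w \<in> V" "q' = kolchin_poly m \<delta> ?L w" using W(2) by auto
    then show ?thesis using max by simp
  qed
  obtain W0 where W0: "irreducible_component m \<delta> ?L n V W0" "b0 \<in> W0"
    using irreducible_component_exists[OF V b0(1)] by blast
  obtain w where w: "generic_point m \<delta> ?L n W0 w" "kolchin_poly_irreducible m \<delta> ?L n W0 = kolchin_poly m \<delta> ?L w"
    using comp[OF W0(1)] by blast
  have "length b0 = n" using V b0(1) by (auto simp: diff_variety_def)
  then have "dominated q (kolchin_poly m \<delta> ?L w)"
    unfolding b0(2)[symmetric]
    by (rule kolchin_poly_specialize) (use w(1) W0(2) in \<open>auto simp: generic_point_def\<close>)
  then have "kolchin_poly m \<delta> ?L w = q" using dominated_antisym dom W0(1) w(2) by (metis imageI mem_Collect_eq)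
  then have "q \<in> ?A" using W0(1) w(2) by (metis imageI mem_Collect_eq)
  show ?thesis unfolding kolchin_poly_variety_def
  proof (rule the_equality)
    show "q \<in> ?A \<and> (\<forall>q'\<in>?A. dominated q' q)" using \<open>q \<in> ?A\<close> dom by blast
    show "q' = q" if "q' \<in> ?A \<and> (\<forall>q''\<in>?A. dominated q'' q')" for q'
      using that \<open>q \<in> ?A\<close> dom dominated_antisym by blast
  qed
qed

lemma psubst_pexprs_gen:
  assumes "e \<in> pexprs k (jvars m {..<n + r})" "length b = n" "length a = r"
  shows "psubst n (jet \<delta> (b @ a)) e \<in> pexprs (gen_diff_field m \<delta> k (set a)) (jvars m {..<n})"
  using assms(1)
proof (induction e)
  case (PVar v)
  let ?L = "gen_diff_field m \<delta> k (set a)"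
  have "jet \<delta> (b @ a) v \<in> ?L" if "\<not> fst v < n"
    unfolding jet_def
  proof (rule dpow_closed)
    show "\<delta> l x \<in> ?L" if "l < m" "x \<in> ?L" for l x
      using is_diff_subfield_gen_diff_field[of m \<delta> k "set a"] that by (simp add: is_diff_subfield_def)
    show "(b @ a) ! fst v \<in> ?L"
      using gen_diff_field_superset[of k "set a" m \<delta>] PVar that assms(2,3) by (auto simp: nth_append jvars_def)
    show "length (snd v) = m" using PVar by (simp add: jvars_def)
  qed
  then show ?case using PVar by (auto simp: jvars_def)
qed (use gen_diff_field_superset[of k "set a" m \<delta>] in auto)

lemma family_member_variety:
  assumes F: "F \<subseteq> dpolys m k (n + r)" and a: "length a = r"
  shows "diff_variety m \<delta> (gen_diff_field m \<delta> k (set a)) n (family_member \<delta> n F a)"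
proof -
  let ?L = "gen_diff_field m \<delta> k (set a)"
  have "\<exists>g\<in>dpolys m ?L n. \<forall>b. length b = n \<longrightarrow> dpoly_eval \<delta> g b = dpoly_eval \<delta> f (b @ a)" if f: "f \<in> F" for f
  proof -
    obtain e where e: "e \<in> pexprs k (jvars m {..<n + r})" "\<And>c. peval (\<lambda>x. x) (jet \<delta> c) e = dpoly_eval \<delta> f c"
      using dpoly_pexpr[OF k_subring subsetD[OF F f], of \<delta>] by blast
    let ?b = "replicate n (0::'a)"
    have "to_mpoly (psubst n (jet \<delta> (?b @ a)) e) \<in> dpolys m ?L n"
      unfolding dpolys_eq_mpolys_over
      by (rule to_mpoly_mpolys_over[OF gen_diff_field_subring psubst_pexprs_gen[OF e(1) _ a]]) simp
    moreover have "dpoly_eval \<delta> (to_mpoly (psubst n (jet \<delta> (?b @ a)) e)) b = dpoly_eval \<delta> f (b @ a)" if "length b = n" for b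
      using dpoly_eval_psubst[OF e(1) that, of ?b a] e(2) by simp
    ultimately show ?thesis by blast
  qed
  then obtain g where g: "\<And>f. f \<in> F \<Longrightarrow> g f \<in> dpolys m ?L n"
    "\<And>f b. f \<in> F \<Longrightarrow> length b = n \<Longrightarrow> dpoly_eval \<delta> (g f) b = dpoly_eval \<delta> f (b @ a)" by metis
  show ?thesis unfolding diff_variety_def
    by (rule exI[of _ "g ` F"]) (use g in \<open>auto simp: family_member_def\<close>)
qed

text \<open>Compactness: if no finite number of charts sufficed, saturation would provide a point
  outside all charts, but every point lies in its own.\<close>

lemma finite_chart_cover:
  assumes sat: "saturated m \<delta>" and small: "lesspoll k (UNIV :: 'a set)"
    and chart: "\<And>c. length c = N \<Longrightarrow> finite (EQ c) \<and> finite (NE c) \<and> EQ c \<union> NE c \<subseteq> pexprs k (jvars m {..<N}) \<and> in_chart \<delta> (EQ c) (NE c) c"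
  obtains C where "finite C" "\<And>c. c \<in> C \<Longrightarrow> length c = N" "\<And>c'. length c' = N \<Longrightarrow> \<exists>c\<in>C. in_chart \<delta> (EQ c) (NE c) c'"
proof -
  have "\<exists>\<phi>\<in>formulas m k N. \<forall>c'. sat \<delta> (\<lambda>i. c' ! i) \<phi> \<longleftrightarrow> \<not> in_chart \<delta> (EQ c) (NE c) c'" if c: "length c = N" for c
  proof -
    have "\<exists>\<phi>\<in>formulas m k N. \<forall>e c'. (\<forall>i<N. tm_val \<delta> e (TVar i) = c' ! i) \<longrightarrow> (sat \<delta> e \<phi> \<longleftrightarrow> in_chart \<delta> (EQ c) (NE c) c')"
      by (rule chart_formula[where A = k]) (use chart[OF c] in auto)
    then obtain \<phi> where "\<phi> \<in> formulas m k N" "\<forall>c'. sat \<delta> (\<lambda>i. c' ! i) \<phi> \<longleftrightarrow> in_chart \<delta> (EQ c) (NE c) c'" by force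
    then show ?thesis by (intro bexI[of _ "FNot \<phi>"] formulas_FNot) simp_all
  qed
  then obtain \<phi> where \<phi>: "\<And>c. length c = N \<Longrightarrow> \<phi> c \<in> formulas m k N"
    "\<And>c c'. length c = N \<Longrightarrow> sat \<delta> (\<lambda>i. c' ! i) (\<phi> c) \<longleftrightarrow> \<not> in_chart \<delta> (EQ c) (NE c) c'" by metis
  have "\<exists>C. finite C \<and> (\<forall>c\<in>C. length c = N) \<and> (\<forall>c'. length c' = N \<longrightarrow> (\<exists>c\<in>C. in_chart \<delta> (EQ c) (NE c) c'))"
  proof (rule ccontr)
    assume neg: "\<not> ?thesis"
    have "\<exists>b. length b = N \<and> (\<forall>\<theta>\<in>\<phi> ` {c. length c = N}. sat \<delta> (\<lambda>i. b ! i) \<theta>)"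
    proof (rule sat[unfolded saturated_def, rule_format, OF small])
      show "\<phi> ` {c. length c = N} \<subseteq> formulas m k N" using \<phi>(1) by auto
      fix \<Gamma> assume \<Gamma>: "\<Gamma> \<subseteq> \<phi> ` {c. length c = N}" "finite \<Gamma>"
      obtain C where C: "C \<subseteq> {c. length c = N}" "finite C" "\<Gamma> = \<phi> ` C"
        using finite_subset_image[OF \<Gamma>(2,1)] by (elim exE conjE)
      have "finite C \<and> (\<forall>c\<in>C. length c = N)" using C(1,2) by auto
      moreover have "\<not> (finite C \<and> (\<forall>c\<in>C. length c = N) \<and> (\<forall>c'. length c' = N \<longrightarrow> (\<exists>c\<in>C. in_chart \<delta> (EQ c) (NE c) c')))"
        using neg by (rule contrapos_nn) (rule exI)
      ultimately have "\<not> (\<forall>c'. length c' = N \<longrightarrow> (\<exists>c\<in>C. in_chart \<delta> (EQ c) (NE c) c'))" by satx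
      then obtain c' where c': "length c' = N" "\<forall>c\<in>C. \<not> in_chart \<delta> (EQ c) (NE c) c'" by auto
      have "sat \<delta> (\<lambda>i. c' ! i) (\<phi> c)" if "c \<in> C" for c
        using \<phi>(2)[of c c'] c'(2) C(1) that by auto
      then show "\<exists>b. length b = N \<and> (\<forall>\<theta>\<in>\<Gamma>. sat \<delta> (\<lambda>i. b ! i) \<theta>)" using c'(1) C(3) by auto
    qed
    then obtain b where "length b = N" "sat \<delta> (\<lambda>i. b ! i) (\<phi> b)" by auto
    then show False using \<phi>(2)[of b b] chart[of b] by simp
  qed
  then show thesis using that by blast
qed

text \<open>A point off the family gets the chart on which one violated equation stays nonzero. So
  compactness applies to the whole affine space, even if F is infinite.\<close>

lemma family_chart_exists:
  assumes dc: "differentially_closed m \<delta>" and sat: "saturated m \<delta>" and small: "lesspoll k (UNIV :: 'a set)"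
    and F: "F \<subseteq> dpolys m k (n + r)" and c: "length c = n + r"
  shows "\<exists>EQ NE. (finite EQ \<and> finite NE \<and> EQ \<union> NE \<subseteq> pexprs k (jvars m {..<n + r}) \<and> in_chart \<delta> EQ NE c) \<and>
    ((\<forall>f\<in>F. dpoly_eval \<delta> f c = 0) \<longrightarrow> chart_spec (take n c) (drop n c) EQ NE) \<and>
    ((\<exists>f\<in>F. dpoly_eval \<delta> f c \<noteq> 0) \<longrightarrow> (\<forall>c'. in_chart \<delta> EQ NE c' \<longrightarrow> (\<exists>f\<in>F. dpoly_eval \<delta> f c' \<noteq> 0)))"
proof (cases "\<forall>f\<in>F. dpoly_eval \<delta> f c = 0")
  case True
  obtain EQ NE where E: "finite EQ" "finite NE" "EQ \<union> NE \<subseteq> pexprs k (jvars m {..<n + r})"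
    "chart_spec (take n c) (drop n c) EQ NE"
    using chart_exists[OF dc sat small, of "take n c" n "drop n c" r] c by auto
  moreover have "in_chart \<delta> EQ NE c" using E(4) by (simp add: chart_spec_def)
  ultimately show ?thesis using True by (intro exI[of _ EQ] exI[of _ NE]) simp
next
  case False
  then obtain f where f: "f \<in> F" "dpoly_eval \<delta> f c \<noteq> 0" by blast
  obtain e where e: "e \<in> pexprs k (jvars m {..<n + r})" "\<And>c. peval (\<lambda>x. x) (jet \<delta> c) e = dpoly_eval \<delta> f c"
    using dpoly_pexpr[OF k_subring subsetD[OF F f(1)], of \<delta>] by blast
  show ?thesis
    by (rule exI[of _ "{}"], rule exI[of _ "{e}"]) (use f e False in \<open>auto simp: in_chart_def\<close>)
qed

text \<open>Each chart over a contributes a point of the fibre with its polynomial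
  (\<open>up\<close>), and each point of the fibre is bounded by some chart over a
  (\<open>down\<close>).\<close>

lemma family_kolchin_poly_charts:
  assumes dc: "differentially_closed m \<delta>" and sat: "saturated m \<delta>" and small: "lesspoll k (UNIV :: 'a set)"
    and F: "F \<subseteq> dpolys m k (n + r)"
  obtains C :: "'a list set" and P \<omega> where "finite C" "\<And>c. c \<in> C \<Longrightarrow> definable m \<delta> r {a. length a = r \<and> P c a}"
    "\<And>a. length a = r \<Longrightarrow> family_member \<delta> n F a \<noteq> {} \<longleftrightarrow> (\<exists>c\<in>C. P c a)"
    "\<And>a c. length a = r \<Longrightarrow> c \<in> C \<Longrightarrow> P c a \<Longrightarrow> (\<And>c'. c' \<in> C \<Longrightarrow> P c' a \<Longrightarrow> dominated (\<omega> c') (\<omega> c)) \<Longrightarrow>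
       family_kolchin_poly m \<delta> k n F a = \<omega> c"
proof -
  define Z where "Z c \<longleftrightarrow> (\<forall>f\<in>F. dpoly_eval \<delta> f c = 0)" for c
  define K where "K c EQ NE \<longleftrightarrow>
    (finite EQ \<and> finite NE \<and> EQ \<union> NE \<subseteq> pexprs k (jvars m {..<n + r}) \<and> in_chart \<delta> EQ NE c) \<and>
    (Z c \<longrightarrow> chart_spec (take n c) (drop n c) EQ NE) \<and>
    (\<not> Z c \<longrightarrow> (\<forall>c'. in_chart \<delta> EQ NE c' \<longrightarrow> \<not> Z c'))" for c EQ NE
  define E where "E c = (SOME E. K c (fst E) (snd E))" for c
  define EQ NE where "EQ c = fst (E c)" and "NE c = snd (E c)" for c
  have K: "K c (EQ c) (NE c)" if c: "length c = n + r" for c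
  proof -
    obtain EQ' NE' where "K c EQ' NE'"
      using family_chart_exists[OF dc sat small F c] unfolding K_def Z_def by auto
    then have "K c (fst (EQ', NE')) (snd (EQ', NE'))" by simp
    then show ?thesis unfolding EQ_def NE_def E_def by (rule someI)
  qed
  have ch: "finite (EQ c) \<and> finite (NE c) \<and> EQ c \<union> NE c \<subseteq> pexprs k (jvars m {..<n + r}) \<and> in_chart \<delta> (EQ c) (NE c) c"
    "Z c \<Longrightarrow> chart_spec (take n c) (drop n c) (EQ c) (NE c)"
    "\<And>c'. \<not> Z c \<Longrightarrow> in_chart \<delta> (EQ c) (NE c) c' \<Longrightarrow> \<not> Z c'" if "length c = n + r" for c
    using K[OF that] unfolding K_def by auto
  obtain C where C: "finite C" "\<And>c. c \<in> C \<Longrightarrow> length c = n + r" "\<And>c'. length c' = n + r \<Longrightarrow> \<exists>c\<in>C. in_chart \<delta> (EQ c) (NE c) c'"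
    using finite_chart_cover[OF sat small ch(1)] by blast
  define P where "P c a \<longleftrightarrow> (\<exists>b. length b = n \<and> in_chart \<delta> (EQ c) (NE c) (b @ a))" for c a
  define U where "U c = leaders (take n c) (drop n c)" for c
  have fam: "b \<in> family_member \<delta> n F a \<longleftrightarrow> length b = n \<and> Z (b @ a)" for b a by (simp add: family_member_def Z_def)
  have kp: "kolchin_poly m \<delta> (gen_diff_field m \<delta> k (set a)) b = count_poly m n (leaders b a)" if "length b = n" for b a
    using kolchin_poly_eq_count_poly[of a b] that by simp
  \<comment> \<open>Specialisation preserves the equations in F, so a chart around a point of the
    family stays inside the family.\<close>
  have Zspec: "Z c'" if "Z c" "length c = n + r" "length c' = n + r" "specializes k (\<lambda>x. x) (jet \<delta> c) (jet \<delta> c') (jvars m {..<n + r})" for c c'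
    unfolding Z_def
  proof
    fix f assume f: "f \<in> F"
    obtain e where e: "e \<in> pexprs k (jvars m {..<n + r})" "\<And>c. peval (\<lambda>x. x) (jet \<delta> c) e = dpoly_eval \<delta> f c"
      using dpoly_pexpr[OF k_subring subsetD[OF F f], of \<delta>] by blast
    have "dpoly_eval \<delta> f c = 0" using that(1) f by (simp add: Z_def)
    then show "dpoly_eval \<delta> f c' = 0" using that(4) e unfolding specializes_def by metis
  qed
  have up: "\<exists>b'\<in>family_member \<delta> n F a. leaders b' a = U c" if c: "c \<in> C" "Z c" and a: "length a = r" "P c a" for c a
  proof -
    have spec: "chart_spec (take n c) (drop n c) (EQ c) (NE c)" and len: "length (take n c) = n" "length (drop n c) = r"
      using ch(2) C(2) c by auto
    obtain b where b: "length b = n" "in_chart \<delta> (EQ c) (NE c) (b @ a)" using a(2) by (auto simp: P_def)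
    obtain b' where b': "length b' = n" "in_chart \<delta> (EQ c) (NE c) (b' @ a)" "leaders b' a = U c"
      using spec b a(1) unfolding chart_spec_def len U_def by blast
    have "specializes k (\<lambda>x. x) (jet \<delta> c) (jet \<delta> (b' @ a)) (jvars m {..<n + r})"
      using spec b' a(1) unfolding chart_spec_def len append_take_drop_id by blast
    then have "Z (b' @ a)" using Zspec c C(2) b'(1) a(1) by simp
    then show ?thesis using b' fam by blast
  qed
  have down: "\<exists>c\<in>C. Z c \<and> P c a \<and> U c \<subseteq> leaders b a" if b: "b \<in> family_member \<delta> n F a" and a: "length a = r" for b a
  proof -
    have b': "length b = n" "Z (b @ a)" using b fam by auto
    obtain c where c: "c \<in> C" "in_chart \<delta> (EQ c) (NE c) (b @ a)" using C(3)[of "b @ a"] b'(1) a by auto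
    have len: "length c = n + r" by (rule C(2)[OF c(1)])
    have "Z c" using ch(3)[OF len _ c(2)] b'(2) by blast
    moreover have "U c \<subseteq> leaders b a"
      using ch(2)[OF len \<open>Z c\<close>] c(2) b'(1) a len unfolding chart_spec_def U_def by simp
    ultimately show ?thesis using c b'(1) unfolding P_def by blast
  qed
  show thesis
  proof (rule that[of "{c \<in> C. Z c}" P "\<lambda>c. count_poly m n (U c)"])
    show "finite {c \<in> C. Z c}" using C(1) by simp
    show "definable m \<delta> r {a. length a = r \<and> P c a}" if "c \<in> {c \<in> C. Z c}" for c
      unfolding P_def by (rule chart_projection_definable[where A = k]) (use ch(1)[of c] C(2) that in auto)
    show "family_member \<delta> n F a \<noteq> {} \<longleftrightarrow> (\<exists>c\<in>{c \<in> C. Z c}. P c a)" if "length a = r" for a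
      using up[OF _ _ that] down[OF _ that] by blast
    fix a c assume a: "length a = r" and c: "c \<in> {c \<in> C. Z c}" "P c a"
      and max: "\<And>c'. c' \<in> {c \<in> C. Z c} \<Longrightarrow> P c' a \<Longrightarrow> dominated (count_poly m n (U c')) (count_poly m n (U c))"
    obtain b0 where b0: "b0 \<in> family_member \<delta> n F a" "leaders b0 a = U c" using up[OF _ _ a c(2)] c(1) by blast
    show "family_kolchin_poly m \<delta> k n F a = count_poly m n (U c)"
      unfolding family_kolchin_poly_def
    proof (rule kolchin_poly_varietyI[OF sat small family_member_variety[OF F a] b0(1)])
      show "kolchin_poly m \<delta> (gen_diff_field m \<delta> k (set a)) b0 = count_poly m n (U c)" using b0 kp fam by simp
      fix b assume b: "b \<in> family_member \<delta> n F a"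
      obtain c' where c': "c' \<in> C" "Z c'" "P c' a" "U c' \<subseteq> leaders b a" using down[OF b a] by blast
      have "dominated (count_poly m n (leaders b a)) (count_poly m n (U c'))"
        using c'(4) unfolding U_def by (intro count_poly_antimono leaders_shift_closed)
      then show "dominated (kolchin_poly m \<delta> (gen_diff_field m \<delta> k (set a)) b) (count_poly m n (U c))"
        using max[of c'] c' dominated_trans kp b fam by auto
    qed
  qed
qed

end

text \<open>An empty fibre has no components and so no Kolchin polynomial; such parameters are left
  out of both sets. Non-emptiness is itself decided by the charts.\<close>

theorem theorem3p5:
  fixes \<delta> :: "nat \<Rightarrow> 'a::field_char_0 \<Rightarrow> 'a"
    and m n r :: nat
    and k :: "'a set"
    and F :: "'a dpoly set"
    and p :: "rat Polynomial.poly"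
  assumes "differentially_closed m \<delta>"
    and "saturated m \<delta>"
    and "is_diff_subfield m \<delta> k"
    and "k \<prec> (UNIV :: 'a set)"
    and "F \<subseteq> dpolys m k (n + r)"
    and "numerical_poly p"
  shows "definable m \<delta> r
           {a. length a = r \<and> family_member \<delta> n F a \<noteq> {} \<and>
               dominated p (family_kolchin_poly m \<delta> k n F a)} \<and>
         definable m \<delta> r
           {a. length a = r \<and> family_member \<delta> n F a \<noteq> {} \<and>
               family_kolchin_poly m \<delta> k n F a = p}"
proof -
  interpret diff_subfield m \<delta> k
    by unfold_locales (use assms(1,3) in \<open>simp_all add: differentially_closed_def\<close>)
  obtain C :: "'a list set" and P \<omega> where C: "finite C" "\<And>c. c \<in> C \<Longrightarrow> definable m \<delta> r {a. length a = r \<and> P c a}"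
    and ne: "\<And>a. length a = r \<Longrightarrow> family_member \<delta> n F a \<noteq> {} \<longleftrightarrow> (\<exists>c\<in>C. P c a)"
    and fkp: "\<And>a c. length a = r \<Longrightarrow> c \<in> C \<Longrightarrow> P c a \<Longrightarrow> (\<And>c'. c' \<in> C \<Longrightarrow> P c' a \<Longrightarrow> dominated (\<omega> c') (\<omega> c)) \<Longrightarrow>
       family_kolchin_poly m \<delta> k n F a = \<omega> c"
    by (rule family_kolchin_poly_charts[OF assms(1,2,4,5)]) blast
  have max: "\<exists>c\<in>C. P c a \<and> family_kolchin_poly m \<delta> k n F a = \<omega> c \<and> (\<forall>c'\<in>C. P c' a \<longrightarrow> dominated (\<omega> c') (\<omega> c))"
    if a: "length a = r" and c0: "c0 \<in> C" "P c0 a" for a c0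
  proof -
    have "\<exists>q\<in>\<omega> ` {c \<in> C. P c a}. \<forall>q'\<in>\<omega> ` {c \<in> C. P c a}. dominated q' q"
      by (rule finite_dominated_max) (use C(1) c0 in auto)
    then obtain c where "c \<in> C" "P c a" "\<And>c'. c' \<in> C \<Longrightarrow> P c' a \<Longrightarrow> dominated (\<omega> c') (\<omega> c)" by auto
    then show ?thesis using fkp[OF a] by blast
  qed
  have def: "definable m \<delta> r {a. length a = r \<and> (\<exists>c\<in>{c \<in> C. Q c}. P c a)}" for Q
    by (rule definable_finite_ex) (use C in auto)
  \<comment> \<open>Any chart over a whose polynomial dominates p will do, since the maximum
    dominates that polynomial.\<close>
  have ge: "family_member \<delta> n F a \<noteq> {} \<and> dominated p (family_kolchin_poly m \<delta> k n F a) \<longleftrightarrow>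
      (\<exists>c\<in>{c \<in> C. dominated p (\<omega> c)}. P c a)" if "length a = r" for a
    using ne[OF that] max[OF that] dominated_trans by fastforce
  \<comment> \<open>To be the maximum, p has to be attained by a chart over a and to dominate all
    the others over a.\<close>
  have eq: "family_member \<delta> n F a \<noteq> {} \<and> family_kolchin_poly m \<delta> k n F a = p \<longleftrightarrow>
      (\<exists>c\<in>{c \<in> C. \<omega> c = p}. P c a) \<and> \<not> (\<exists>c\<in>{c \<in> C. \<not> dominated (\<omega> c) p}. P c a)" if "length a = r" for a
  proof
    assume "family_member \<delta> n F a \<noteq> {} \<and> family_kolchin_poly m \<delta> k n F a = p"
    then show "(\<exists>c\<in>{c \<in> C. \<omega> c = p}. P c a) \<and> \<not> (\<exists>c\<in>{c \<in> C. \<not> dominated (\<omega> c) p}. P c a)"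
      using ne[OF that] max[OF that] by fastforce
  next
    assume r: "(\<exists>c\<in>{c \<in> C. \<omega> c = p}. P c a) \<and> \<not> (\<exists>c\<in>{c \<in> C. \<not> dominated (\<omega> c) p}. P c a)"
    then obtain c where c: "c \<in> C" "\<omega> c = p" "P c a" by blast
    have "family_kolchin_poly m \<delta> k n F a = \<omega> c"
      by (rule fkp[OF that c(1,3)]) (use r c(2) in auto)
    then show "family_member \<delta> n F a \<noteq> {} \<and> family_kolchin_poly m \<delta> k n F a = p"
      using ne[OF that] c by auto
  qed
  show ?thesis
  proof
    show "definable m \<delta> r {a. length a = r \<and> family_member \<delta> n F a \<noteq> {} \<and>
               dominated p (family_kolchin_poly m \<delta> k n F a)}"
      by (rule definable_cong[OF def[of "\<lambda>c. dominated p (\<omega> c)"]]) (simp only: ge)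
    show "definable m \<delta> r {a. length a = r \<and> family_member \<delta> n F a \<noteq> {} \<and>
               family_kolchin_poly m \<delta> k n F a = p}"
      by (rule definable_cong[OF definable_and[OF def[of "\<lambda>c. \<omega> c = p"]
            definable_not[OF def[of "\<lambda>c. \<not> dominated (\<omega> c) p"]]]]) (simp only: eq)
  qed
qed

end
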